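(* Let $G$ be an abelian group, let $k$ be a commutative $G$-ring, and let $\delta,\varepsilon\in k$ both be invertible. Let $G\mathcal{RB}_n(\delta,\varepsilon)$ be the $G$-rook-Brauer algebra over $k$. Then there is an isomorphism of graded $k$-modules $$\mathrm{Tor}_{\star}^{G\mathcal{RB}_n(\delta,\varepsilon)}(\mathbf{1},\mathbf{1})\cong H_{\star}(G^n\rtimes\Sigma_n,k),$$ where the symmetric group $\Sigma_n$ acts on $G^n$ by permuting the factors, and the map $$\mathrm{Tor}_{q}^{G\mathcal{RB}_{n-1}(\delta,\varepsilon)}(\mathbf{1},\mathbf{1})\rightarrow \mathrm{Tor}_{q}^{G\mathcal{RB}_n(\delta,\varepsilon)}(\mathbf{1},\mathbf{1})$$ induced by the inclusion $G\mathcal{RB}_{n-1}(\delta,\varepsilon)\to G\mathcal{RB}_n(\delta,\varepsilon)$ is an isomorphism for $n\geqslant 2q+2$.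
   Context: A commutative $G$-ring is a unital commutative ring $k$ together with a group homomorphism $G\to\mathrm{Aut}(k)$ to the group of ring automorphisms; the action of $g\in G$ on $\lambda\in k$ is written $g\lambda$. A $G$-rook-Brauer $n$-diagram is a graph on two columns (left and right) of $n$ nodes in which each node is connected to at most one other node by an edge (left-to-left, right-to-right and left-to-right edges are all allowed, and nodes may be unconnected), and each edge is labelled by an element of $G$. The $G$-rook-Brauer algebra $G\mathcal{RB}_n(\delta,\varepsilon)$ consists of formal $k$-linear combinations of $G$-rook-Brauer $n$-diagrams. The product $x\cdot y$ of two diagrams is the $k$-bilinear extension of: identify the right-hand nodes of $x$ with the left-hand nodes of $y$ and forget the middle nodes; label each edge formed by concatenation with the product of the group elements along it; replace each closed loop formed in the middle by a factor $g\delta\in k$, where $g\in G$ is the product of all the labels on the loop; and replace each contractible component lying entirely in the middle (an isolated middle node, or an open path containing no node of the outer columns) by a factor $\varepsilon$. A path starting at an outer node and ending at a middle node is discarded without a factor, leaving the outer node unconnected. The inclusion $G\mathcal{RB}_{n-1}(\delta,\varepsilon)\to G\mathcal{RB}_n(\delta,\varepsilon)$ sends an $(n-1)$-diagram to the $n$-diagram obtained by adding an extra node at the end of each column and joining these two nodes by a horizontal edge labelled $1\in G$. The trivial module $\mathbf{1}$ is a copy of $k$ (as a left and as a right module) on which diagrams with no missing edges, no left-to-left connections and no right-to-right connections act as $1$ and all other diagrams act as $0$. Group homology $H_\star(-,k)$ is taken with trivial action on $k$. *)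

theory Defs
  imports "HOL-Algebra.Algebra" "HOL-Library.FSet"
begin

section \<open>Modules\<close>

text \<open>
  Modules over a not necessarily commutative ring \<open>A\<close> are records of type \<^typ>\<open>('a, 'm) module\<close>; only
  the fields \<open>carrier\<close>, \<open>add\<close>, \<open>zero\<close> and \<open>smult\<close> matter, the inherited ring fields \<open>mult\<close> and
  \<open>one\<close> are left undefined.  The same record serves for left and for right modules: for a right
  module \<open>M\<close>, the term \<open>smult M a m\<close> stands for the product of \<open>m\<close> by \<open>a\<close> on the right.
  A \<open>k\<close>-algebra is a record of type \<^typ>\<open>('k, 'a) module\<close> in which all fields are used.
\<close>

definition fin_fun :: "('r, 'x) ring_scheme \<Rightarrow> 's set \<Rightarrow> ('s \<Rightarrow> 'r) set" where
  "fin_fun R S = {f. (\<forall>s\<in>S. f s \<in> carrier R) \<and> (\<forall>s. s \<notin> S \<longrightarrow> f s = \<zero>\<^bsub>R\<^esub>) \<and> finite {s. f s \<noteq> \<zero>\<^bsub>R\<^esub>}}"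

definition single :: "('r, 'x) ring_scheme \<Rightarrow> 's \<Rightarrow> 'r \<Rightarrow> 's \<Rightarrow> 'r" where
  "single R s r = (\<lambda>t. if t = s then r else \<zero>\<^bsub>R\<^esub>)"

definition free_mod :: "('r, 'x) ring_scheme \<Rightarrow> 's set \<Rightarrow> ('r, 's \<Rightarrow> 'r) module" where
  "free_mod R S =
     \<lparr>carrier = fin_fun R S, monoid.mult = undefined, monoid.one = undefined,
      ring.zero = (\<lambda>_. \<zero>\<^bsub>R\<^esub>), ring.add = (\<lambda>f h s. f s \<oplus>\<^bsub>R\<^esub> h s), smult = (\<lambda>r f s. r \<otimes>\<^bsub>R\<^esub> f s)\<rparr>"

text \<open>
  The map \<open>\<Sum>\<^sub>s f(s) s \<mapsto> \<Sum>\<^sub>s \<phi>(f(s)) u(s)\<close> of free modules induced by a ring homomorphism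
  \<open>\<phi> : R \<rightarrow> R'\<close> and a map \<open>u\<close> of bases.
\<close>

definition push ::
  "('r, 'x) ring_scheme \<Rightarrow> ('q, 'y) ring_scheme \<Rightarrow> ('r \<Rightarrow> 'q) \<Rightarrow> ('s \<Rightarrow> 't) \<Rightarrow> ('s \<Rightarrow> 'r) \<Rightarrow> 't \<Rightarrow> 'q" where
  "push R R' \<phi> u f = (\<lambda>t. \<Oplus>\<^bsub>R'\<^esub>s\<in>{s. f s \<noteq> \<zero>\<^bsub>R\<^esub> \<and> u s = t}. \<phi> (f s))"

definition mod_span ::
  "('k, 'x) ring_scheme \<Rightarrow> ('k, 'm, 'y) module_scheme \<Rightarrow> 'm set \<Rightarrow> 'm set" where
  "mod_span k M Z = \<Inter>{H. submodule H k M \<and> Z \<subseteq> H}"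

definition quot_mod :: "('k, 'm, 'y) module_scheme \<Rightarrow> 'm set \<Rightarrow> ('k, 'm set) module" where
  "quot_mod M B =
     \<lparr>carrier = a_rcosets\<^bsub>M\<^esub> B, monoid.mult = undefined, monoid.one = undefined,
      ring.zero = B, ring.add = set_add M, smult = (\<lambda>r Z. \<Union>x\<in>Z. B +>\<^bsub>M\<^esub> (r \<odot>\<^bsub>M\<^esub> x))\<rparr>"

text \<open>The map into \<open>N / B\<close> induced on cosets by a map \<open>f\<close> into \<open>N\<close>.\<close>

definition quot_map :: "('k, 'n, 'y) module_scheme \<Rightarrow> 'n set \<Rightarrow> ('m \<Rightarrow> 'n) \<Rightarrow> 'm set \<Rightarrow> 'n set" where
  "quot_map N B f Z = (\<Union>x\<in>Z. B +>\<^bsub>N\<^esub> f x)"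

definition mod_iso ::
  "('k, 'x) ring_scheme \<Rightarrow> ('k, 'm, 'y) module_scheme \<Rightarrow> ('k, 'n, 'z) module_scheme \<Rightarrow> ('m \<Rightarrow> 'n) set" where
  "mod_iso k M N = {f. bij_betw f (carrier M) (carrier N) \<and>
     (\<forall>x\<in>carrier M. \<forall>y\<in>carrier M. f (x \<oplus>\<^bsub>M\<^esub> y) = f x \<oplus>\<^bsub>N\<^esub> f y) \<and>
     (\<forall>r\<in>carrier k. \<forall>x\<in>carrier M. f (r \<odot>\<^bsub>M\<^esub> x) = r \<odot>\<^bsub>N\<^esub> f x)}"


section \<open>Tensor products over a \<open>k\<close>-algebra\<close>

text \<open>
  For a right \<open>A\<close>-module \<open>M\<close> and a left \<open>A\<close>-module \<open>N\<close>, the tensor product is the free \<open>k\<close>-module on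
  \<open>M \<times> N\<close> modulo the \<open>k\<close>-submodule generated by the usual relations.  Here \<open>k\<close> acts on \<open>M\<close>
  through the unit map \<open>k \<rightarrow> A\<close>.
\<close>

definition tensor_rels ::
  "('k, 'x) ring_scheme \<Rightarrow> ('k, 'a) module \<Rightarrow> ('a, 'm) module \<Rightarrow> ('a, 'n) module \<Rightarrow> ('m \<times> 'n \<Rightarrow> 'k) set" where
  "tensor_rels k A M N =
    (let F = free_mod k (carrier M \<times> carrier N); \<iota> = (\<lambda>m n. single k (m, n) \<one>\<^bsub>k\<^esub>) in
      {\<iota> (m \<oplus>\<^bsub>M\<^esub> m') n \<ominus>\<^bsub>F\<^esub> (\<iota> m n \<oplus>\<^bsub>F\<^esub> \<iota> m' n) | m m' n.
         m \<in> carrier M \<and> m' \<in> carrier M \<and> n \<in> carrier N} \<union>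
      {\<iota> m (n \<oplus>\<^bsub>N\<^esub> n') \<ominus>\<^bsub>F\<^esub> (\<iota> m n \<oplus>\<^bsub>F\<^esub> \<iota> m n') | m n n'.
         m \<in> carrier M \<and> n \<in> carrier N \<and> n' \<in> carrier N} \<union>
      {\<iota> (a \<odot>\<^bsub>M\<^esub> m) n \<ominus>\<^bsub>F\<^esub> \<iota> m (a \<odot>\<^bsub>N\<^esub> n) | a m n.
         a \<in> carrier A \<and> m \<in> carrier M \<and> n \<in> carrier N} \<union>
      {\<iota> ((r \<odot>\<^bsub>A\<^esub> \<one>\<^bsub>A\<^esub>) \<odot>\<^bsub>M\<^esub> m) n \<ominus>\<^bsub>F\<^esub> r \<odot>\<^bsub>F\<^esub> \<iota> m n | r m n.
         r \<in> carrier k \<and> m \<in> carrier M \<and> n \<in> carrier N})"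

definition tensor_sub ::
  "('k, 'x) ring_scheme \<Rightarrow> ('k, 'a) module \<Rightarrow> ('a, 'm) module \<Rightarrow> ('a, 'n) module \<Rightarrow> ('m \<times> 'n \<Rightarrow> 'k) set" where
  "tensor_sub k A M N = mod_span k (free_mod k (carrier M \<times> carrier N)) (tensor_rels k A M N)"

definition tensor ::
  "('k, 'x) ring_scheme \<Rightarrow> ('k, 'a) module \<Rightarrow> ('a, 'm) module \<Rightarrow> ('a, 'n) module
     \<Rightarrow> ('k, ('m \<times> 'n \<Rightarrow> 'k) set) module" where
  "tensor k A M N = quot_mod (free_mod k (carrier M \<times> carrier N)) (tensor_sub k A M N)"

text \<open>
  The map \<open>h \<otimes> f\<close> into the tensor product over \<open>A\<close> of \<open>M\<close> and \<open>N\<close>; its source may be a tensor product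
  over another algebra.
\<close>

definition tensor_map ::
  "('k, 'x) ring_scheme \<Rightarrow> ('k, 'a) module \<Rightarrow> ('a, 'm) module \<Rightarrow> ('a, 'n) module
     \<Rightarrow> ('p \<Rightarrow> 'm) \<Rightarrow> ('q \<Rightarrow> 'n) \<Rightarrow> ('p \<times> 'q \<Rightarrow> 'k) set \<Rightarrow> ('m \<times> 'n \<Rightarrow> 'k) set" where
  "tensor_map k A M N h f =
     quot_map (free_mod k (carrier M \<times> carrier N)) (tensor_sub k A M N)
       (push k k id (map_prod h f))"


section \<open>The canonical free resolution\<close>

text \<open>
  Every left \<open>A\<close>-module \<open>N\<close> has the free resolution \<open>\<dots> \<rightarrow> F\<^sub>1 \<rightarrow> F\<^sub>0 \<rightarrow> N\<close> in which \<open>F\<^sub>0\<close> is free on the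
  underlying set of \<open>N\<close>, and \<open>F\<^sub>q\<^sub>+\<^sub>1\<close> is free on the underlying set of the kernel of the map
  leaving \<open>F\<^sub>q\<close>.  To have all basis elements in one type, a basis element of \<open>F\<^sub>q\<^sub>+\<^sub>1\<close>, i.e. a
  finitely supported function on the basis of \<open>F\<^sub>q\<close>, is encoded by the finite graph of its restriction to
  its support.
\<close>

datatype ('a, 'n) cell = Gen (the_gen: 'n) | Cyc "(('a, 'n) cell \<times> 'a) fset"

definition cell_of :: "('k, 'a) module \<Rightarrow> (('a, 'n) cell \<Rightarrow> 'a) \<Rightarrow> ('a, 'n) cell" where
  "cell_of A c = Cyc (Abs_fset {(s, c s) | s. c s \<noteq> \<zero>\<^bsub>A\<^esub>})"

fun chain_of :: "('k, 'a) module \<Rightarrow> ('a, 'n) cell \<Rightarrow> ('a, 'n) cell \<Rightarrow> 'a" where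
  "chain_of A (Gen n) = (\<lambda>_. \<zero>\<^bsub>A\<^esub>)"
| "chain_of A (Cyc Z) =
     (\<lambda>s. if \<exists>a. (s, a) |\<in>| Z then (THE a. (s, a) |\<in>| Z) else \<zero>\<^bsub>A\<^esub>)"

lemma chain_of_cell_of:
  assumes "finite {s. c s \<noteq> \<zero>\<^bsub>A\<^esub>}"
  shows "chain_of A (cell_of A c) = c"
proof -
  have "{(s, c s) | s. c s \<noteq> \<zero>\<^bsub>A\<^esub>} = (\<lambda>s. (s, c s)) ` {s. c s \<noteq> \<zero>\<^bsub>A\<^esub>}"
    by auto
  then have "finite {(s, c s) | s. c s \<noteq> \<zero>\<^bsub>A\<^esub>}"
    using assms by simp
  then show ?thesis
    by (auto simp: cell_of_def Abs_fset_inverse fun_eq_iff)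
qed

definition aug ::
  "('k, 'a) module \<Rightarrow> ('a, 'n) module \<Rightarrow> (('a, 'n) cell \<Rightarrow> 'a) \<Rightarrow> 'n" where
  "aug A N f = (\<Oplus>\<^bsub>N\<^esub>s\<in>{s. f s \<noteq> \<zero>\<^bsub>A\<^esub>}. f s \<odot>\<^bsub>N\<^esub> the_gen s)"

definition bdry :: "('k, 'a) module \<Rightarrow> (('a, 'n) cell \<Rightarrow> 'a) \<Rightarrow> ('a, 'n) cell \<Rightarrow> 'a" where
  "bdry A f = (\<lambda>t. \<Oplus>\<^bsub>A\<^esub>s\<in>{s. f s \<noteq> \<zero>\<^bsub>A\<^esub>}. f s \<otimes>\<^bsub>A\<^esub> chain_of A s t)"

fun cells :: "('k, 'a) module \<Rightarrow> ('a, 'n) module \<Rightarrow> nat \<Rightarrow> ('a, 'n) cell set" where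
  "cells A N 0 = Gen ` carrier N"
| "cells A N (Suc 0) = cell_of A ` {c \<in> fin_fun A (cells A N 0). aug A N c = \<zero>\<^bsub>N\<^esub>}"
| "cells A N (Suc (Suc q)) =
     cell_of A ` {c \<in> fin_fun A (cells A N (Suc q)). bdry A c = (\<lambda>_. \<zero>\<^bsub>A\<^esub>)}"

definition res :: "('k, 'a) module \<Rightarrow> ('a, 'n) module \<Rightarrow> nat \<Rightarrow> ('a, ('a, 'n) cell \<Rightarrow> 'a) module" where
  "res A N q = free_mod A (cells A N q)"

text \<open>
  Along a ring homomorphism \<open>\<phi> : A \<rightarrow> B\<close>, a \<open>\<phi>\<close>-semilinear map \<open>j : N \<rightarrow> N'\<close> induces a chain map
  \<open>push A B \<phi> (cell_map A B \<phi> j q)\<close> from the resolution of \<open>N\<close> to that of \<open>N'\<close> lifting \<open>j\<close>.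
\<close>

primrec cell_map ::
  "('k, 'a) module \<Rightarrow> ('k, 'b) module \<Rightarrow> ('a \<Rightarrow> 'b) \<Rightarrow> ('n \<Rightarrow> 'l) \<Rightarrow> nat \<Rightarrow> ('a, 'n) cell \<Rightarrow> ('b, 'l) cell" where
  "cell_map A B \<phi> j 0 = (\<lambda>s. Gen (j (the_gen s)))"
| "cell_map A B \<phi> j (Suc q) = (\<lambda>s. cell_of B (push A B \<phi> (cell_map A B \<phi> j q) (chain_of A s)))"


section \<open>Homology and Tor\<close>

text \<open>
  A chain complex is given by modules \<open>C q\<close> and maps \<open>d q\<close> from \<open>C (Suc q)\<close> to \<open>C q\<close>.
\<close>

definition cycles :: "(nat \<Rightarrow> ('k, 'c) module) \<Rightarrow> (nat \<Rightarrow> 'c \<Rightarrow> 'c) \<Rightarrow> nat \<Rightarrow> 'c set" where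
  "cycles C d q =
     (case q of 0 \<Rightarrow> carrier (C 0) | Suc p \<Rightarrow> {c \<in> carrier (C (Suc p)). d p c = \<zero>\<^bsub>C p\<^esub>})"

definition boundaries :: "(nat \<Rightarrow> ('k, 'c) module) \<Rightarrow> (nat \<Rightarrow> 'c \<Rightarrow> 'c) \<Rightarrow> nat \<Rightarrow> 'c set" where
  "boundaries C d q = d q ` carrier (C (Suc q))"

definition homology :: "(nat \<Rightarrow> ('k, 'c) module) \<Rightarrow> (nat \<Rightarrow> 'c \<Rightarrow> 'c) \<Rightarrow> nat \<Rightarrow> ('k, 'c set) module" where
  "homology C d q = quot_mod ((C q)\<lparr>carrier := cycles C d q\<rparr>) (boundaries C d q)"

definition tor_cx ::
  "('k, 'x) ring_scheme \<Rightarrow> ('k, 'a) module \<Rightarrow> ('a, 'm) module \<Rightarrow> ('a, 'n) module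
     \<Rightarrow> nat \<Rightarrow> ('k, ('m \<times> (('a, 'n) cell \<Rightarrow> 'a) \<Rightarrow> 'k) set) module" where
  "tor_cx k A M N q = tensor k A M (res A N q)"

definition tor_d ::
  "('k, 'x) ring_scheme \<Rightarrow> ('k, 'a) module \<Rightarrow> ('a, 'm) module \<Rightarrow> ('a, 'n) module
     \<Rightarrow> nat \<Rightarrow> ('m \<times> (('a, 'n) cell \<Rightarrow> 'a) \<Rightarrow> 'k) set \<Rightarrow> ('m \<times> (('a, 'n) cell \<Rightarrow> 'a) \<Rightarrow> 'k) set" where
  "tor_d k A M N q = tensor_map k A M (res A N q) id (bdry A)"

definition Tor ::
  "('k, 'x) ring_scheme \<Rightarrow> ('k, 'a) module \<Rightarrow> ('a, 'm) module \<Rightarrow> ('a, 'n) module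
     \<Rightarrow> nat \<Rightarrow> ('k, ('m \<times> (('a, 'n) cell \<Rightarrow> 'a) \<Rightarrow> 'k) set set) module" where
  "Tor k A M N q = homology (tor_cx k A M N) (tor_d k A M N) q"

text \<open>
  The map from the Tor of a right module and a left module \<open>N\<close> over \<open>A\<close> to \<open>Tor k B M' N'\<close> induced by a
  homomorphism \<open>\<phi> : A \<rightarrow> B\<close> of \<open>k\<close>-algebras and \<open>\<phi>\<close>-semilinear maps \<open>h\<close> (of right modules) and
  \<open>j\<close> (of left modules).
\<close>

definition Tor_map ::
  "('k, 'x) ring_scheme \<Rightarrow> ('k, 'a) module \<Rightarrow> ('k, 'b) module \<Rightarrow> ('b, 'm) module \<Rightarrow> ('b, 'n) module
     \<Rightarrow> ('a \<Rightarrow> 'b) \<Rightarrow> ('p \<Rightarrow> 'm) \<Rightarrow> ('l \<Rightarrow> 'n) \<Rightarrow> nat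
     \<Rightarrow> ('p \<times> (('a, 'l) cell \<Rightarrow> 'a) \<Rightarrow> 'k) set set \<Rightarrow> ('m \<times> (('b, 'n) cell \<Rightarrow> 'b) \<Rightarrow> 'k) set set" where
  "Tor_map k A B M' N' \<phi> h j q =
     quot_map (tor_cx k B M' N' q) (boundaries (tor_cx k B M' N') (tor_d k B M' N') q)
       (tensor_map k B M' (res B N' q) h (push A B \<phi> (cell_map A B \<phi> j q)))"


section \<open>Algebras with a distinguished basis, and group homology\<close>

text \<open>
  The free \<open>k\<close>-module on \<open>S\<close> with the \<open>k\<close>-bilinear product under which basis elements \<open>x\<close> and \<open>y\<close> multiply
  to \<open>coef x y\<close> times the basis element \<open>prd x y\<close>, and with unit \<open>e\<close>.
\<close>

definition basis_alg ::
  "('k, 'x) ring_scheme \<Rightarrow> 's set \<Rightarrow> ('s \<Rightarrow> 's \<Rightarrow> 's) \<Rightarrow> ('s \<Rightarrow> 's \<Rightarrow> 'k) \<Rightarrow> 's \<Rightarrow> ('k, 's \<Rightarrow> 'k) module" where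
  "basis_alg k S prd coef e = (free_mod k S)
     \<lparr>monoid.mult := (\<lambda>f h z. \<Oplus>\<^bsub>k\<^esub>p\<in>{p. f (fst p) \<noteq> \<zero>\<^bsub>k\<^esub> \<and> h (snd p) \<noteq> \<zero>\<^bsub>k\<^esub> \<and> prd (fst p) (snd p) = z}.
                 f (fst p) \<otimes>\<^bsub>k\<^esub> h (snd p) \<otimes>\<^bsub>k\<^esub> coef (fst p) (snd p)),
      monoid.one := single k e \<one>\<^bsub>k\<^esub>\<rparr>"

text \<open>
  The copy of \<open>k\<close> on which the basis elements in \<open>T\<close> act as \<open>1\<close> and all others act as \<open>0\<close>, both as a
  left and as a right module.
\<close>

definition triv_mod :: "('k, 'x) ring_scheme \<Rightarrow> 's set \<Rightarrow> ('s \<Rightarrow> 'k, 'k) module" where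
  "triv_mod k T =
     \<lparr>carrier = carrier k, monoid.mult = undefined, monoid.one = undefined, ring.zero = \<zero>\<^bsub>k\<^esub>, ring.add = ring.add k,
      smult = (\<lambda>f c. (\<Oplus>\<^bsub>k\<^esub>x\<in>{x \<in> T. f x \<noteq> \<zero>\<^bsub>k\<^esub>}. f x) \<otimes>\<^bsub>k\<^esub> c)\<rparr>"

definition group_alg ::
  "('k, 'x) ring_scheme \<Rightarrow> ('w, 'y) monoid_scheme \<Rightarrow> ('k, 'w \<Rightarrow> 'k) module" where
  "group_alg k W = basis_alg k (carrier W) (monoid.mult W) (\<lambda>_ _. \<one>\<^bsub>k\<^esub>) \<one>\<^bsub>W\<^esub>"

definition group_homology ::
  "('k, 'x) ring_scheme \<Rightarrow> ('w, 'y) monoid_scheme \<Rightarrow> nat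
     \<Rightarrow> ('k, ('k \<times> (('w \<Rightarrow> 'k, 'k) cell \<Rightarrow> 'w \<Rightarrow> 'k) \<Rightarrow> 'k) set set) module" where
  "group_homology k W q =
     Tor k (group_alg k W) (triv_mod k (carrier W)) (triv_mod k (carrier W)) q"

definition semidirect ::
  "('n, 'x) monoid_scheme \<Rightarrow> ('h, 'y) monoid_scheme \<Rightarrow> ('h \<Rightarrow> 'n \<Rightarrow> 'n) \<Rightarrow> ('n \<times> 'h) monoid" where
  "semidirect N H \<alpha> =
     \<lparr>carrier = carrier N \<times> carrier H,
      monoid.mult = (\<lambda>(a, s) (b, t). (a \<otimes>\<^bsub>N\<^esub> \<alpha> s b, s \<otimes>\<^bsub>H\<^esub> t)),
      monoid.one = (\<one>\<^bsub>N\<^esub>, \<one>\<^bsub>H\<^esub>)\<rparr>"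

definition perm_factors :: "nat \<Rightarrow> (nat \<Rightarrow> nat) \<Rightarrow> (nat \<Rightarrow> 'g) \<Rightarrow> nat \<Rightarrow> 'g" where
  "perm_factors n \<sigma> a = (\<lambda>i\<in>{1..n}. a (inv_into UNIV \<sigma> i))"

definition power_semidirect_sym ::
  "('g, 'x) monoid_scheme \<Rightarrow> nat \<Rightarrow> ((nat \<Rightarrow> 'g) \<times> (nat \<Rightarrow> nat)) monoid" where
  "power_semidirect_sym G n =
     semidirect (product_group {1..n} (\<lambda>_. G)) (sym_group n) (perm_factors n)"


section \<open>\<open>G\<close>-rook-Brauer algebras\<close>

definition comm_G_ring ::
  "('g, 'x) monoid_scheme \<Rightarrow> ('k, 'y) ring_scheme \<Rightarrow> ('g \<Rightarrow> 'k \<Rightarrow> 'k) \<Rightarrow> bool" where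
  "comm_G_ring G k act \<longleftrightarrow> cring k \<and> (\<forall>g\<in>carrier G. act g \<in> ring_iso k k) \<and>
     (\<forall>g\<in>carrier G. \<forall>h\<in>carrier G. \<forall>r\<in>carrier k. act (g \<otimes>\<^bsub>G\<^esub> h) r = act g (act h r))"

datatype node = Lft nat | Rgt nat

definition nodes :: "nat \<Rightarrow> node set" where
  "nodes n = Lft ` {1..n} \<union> Rgt ` {1..n}"

text \<open>
  A diagram is the set of its labelled edges, a labelled edge being an unordered pair of nodes together
  with its label.
\<close>

type_synonym 'g diagram = "(node set \<times> 'g) set"

definition diagrams :: "('g, 'x) monoid_scheme \<Rightarrow> nat \<Rightarrow> 'g diagram set" where
  "diagrams G n = {x.
     (\<forall>p\<in>x. fst p \<subseteq> nodes n \<and> card (fst p) = 2 \<and> snd p \<in> carrier G) \<and>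
     (\<forall>p\<in>x. \<forall>p'\<in>x. p \<noteq> p' \<longrightarrow> fst p \<inter> fst p' = {})}"

text \<open>
  Nodes of the graph obtained by gluing the right column of \<open>x\<close> to the left column of \<open>y\<close>.
\<close>

datatype gnode = Outer node | Mid nat

definition gnodes :: "nat \<Rightarrow> gnode set" where
  "gnodes n = Outer ` nodes n \<union> Mid ` {1..n}"

fun glue_fst :: "node \<Rightarrow> gnode" where
  "glue_fst (Lft i) = Outer (Lft i)"
| "glue_fst (Rgt i) = Mid i"

fun glue_snd :: "node \<Rightarrow> gnode" where
  "glue_snd (Lft i) = Mid i"
| "glue_snd (Rgt i) = Outer (Rgt i)"

definition adjacent :: "'g diagram \<Rightarrow> 'g diagram \<Rightarrow> (gnode \<times> gnode) set" where
  "adjacent x y = {(u, v). (\<exists>p\<in>x. {u, v} = glue_fst ` fst p) \<or> (\<exists>p\<in>y. {u, v} = glue_snd ` fst p)}"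

definition components :: "nat \<Rightarrow> 'g diagram \<Rightarrow> 'g diagram \<Rightarrow> gnode set set" where
  "components n x y = gnodes n // (adjacent x y)\<^sup>*"

text \<open>
  Every connected component of the glued graph is a path or a cycle.  As \<open>G\<close> is abelian, the product of
  the labels along it is just the product of the labels of all its edges.
\<close>

definition comp_label ::
  "('g, 'x) monoid_scheme \<Rightarrow> 'g diagram \<Rightarrow> 'g diagram \<Rightarrow> gnode set \<Rightarrow> 'g" where
  "comp_label G x y C =
     (\<Otimes>\<^bsub>G\<^esub>p\<in>{p \<in> x. glue_fst ` fst p \<subseteq> C}. snd p) \<otimes>\<^bsub>G\<^esub> (\<Otimes>\<^bsub>G\<^esub>p\<in>{p \<in> y. glue_snd ` fst p \<subseteq> C}. snd p)"

definition concat_diagram ::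
  "('g, 'x) monoid_scheme \<Rightarrow> nat \<Rightarrow> 'g diagram \<Rightarrow> 'g diagram \<Rightarrow> 'g diagram" where
  "concat_diagram G n x y =
     {({v. Outer v \<in> C}, comp_label G x y C) | C. C \<in> components n x y \<and> card {v. Outer v \<in> C} = 2}"

text \<open>
  A component in the middle is a closed loop iff each of its nodes lies on an edge of both diagrams.
\<close>

definition is_loop :: "'g diagram \<Rightarrow> 'g diagram \<Rightarrow> gnode set \<Rightarrow> bool" where
  "is_loop x y C \<longleftrightarrow> (\<forall>v\<in>C. (\<exists>p\<in>x. v \<in> glue_fst ` fst p) \<and> (\<exists>p\<in>y. v \<in> glue_snd ` fst p))"

definition middle_factor ::
  "('g, 'x) monoid_scheme \<Rightarrow> ('k, 'y) ring_scheme \<Rightarrow> ('g \<Rightarrow> 'k \<Rightarrow> 'k) \<Rightarrow> 'k \<Rightarrow> 'k \<Rightarrow> nat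
     \<Rightarrow> 'g diagram \<Rightarrow> 'g diagram \<Rightarrow> 'k" where
  "middle_factor G k act \<delta> \<epsilon> n x y =
     (\<Otimes>\<^bsub>k\<^esub>C\<in>{C \<in> components n x y. C \<subseteq> range Mid}.
        if is_loop x y C then act (comp_label G x y C) \<delta> else \<epsilon>)"

definition id_diagram :: "('g, 'x) monoid_scheme \<Rightarrow> nat \<Rightarrow> 'g diagram" where
  "id_diagram G n = {({Lft i, Rgt i}, \<one>\<^bsub>G\<^esub>) | i. i \<in> {1..n}}"

definition GRB ::
  "('g, 'x) monoid_scheme \<Rightarrow> ('k, 'y) ring_scheme \<Rightarrow> ('g \<Rightarrow> 'k \<Rightarrow> 'k) \<Rightarrow> 'k \<Rightarrow> 'k \<Rightarrow> nat
     \<Rightarrow> ('k, 'g diagram \<Rightarrow> 'k) module" where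
  "GRB G k act \<delta> \<epsilon> n =
     basis_alg k (diagrams G n) (concat_diagram G n) (middle_factor G k act \<delta> \<epsilon> n) (id_diagram G n)"

text \<open>
  The inclusion of the algebra on \<open>n - 1\<close> nodes into that on \<open>n\<close> nodes, for \<open>n \<ge> 1\<close>.
\<close>

definition add_strand :: "('g, 'x) monoid_scheme \<Rightarrow> nat \<Rightarrow> 'g diagram \<Rightarrow> 'g diagram" where
  "add_strand G n x = insert ({Lft n, Rgt n}, \<one>\<^bsub>G\<^esub>) x"

definition GRB_incl ::
  "('g, 'x) monoid_scheme \<Rightarrow> ('k, 'y) ring_scheme \<Rightarrow> nat \<Rightarrow> ('g diagram \<Rightarrow> 'k) \<Rightarrow> 'g diagram \<Rightarrow> 'k" where
  "GRB_incl G k n = push k k id (add_strand G n)"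

definition perm_diagrams :: "('g, 'x) monoid_scheme \<Rightarrow> nat \<Rightarrow> 'g diagram set" where
  "perm_diagrams G n = {x \<in> diagrams G n.
     (\<forall>v\<in>nodes n. \<exists>p\<in>x. v \<in> fst p) \<and>
     (\<forall>p\<in>x. \<not> fst p \<subseteq> range Lft \<and> \<not> fst p \<subseteq> range Rgt)}"

definition GRB_triv ::
  "('g, 'x) monoid_scheme \<Rightarrow> ('k, 'y) ring_scheme \<Rightarrow> nat \<Rightarrow> ('g diagram \<Rightarrow> 'k, 'k) module" where
  "GRB_triv G k n = triv_mod k (perm_diagrams G n)"

definition GRB_Tor ::
  "('g, 'x) monoid_scheme \<Rightarrow> ('k, 'y) ring_scheme \<Rightarrow> ('g \<Rightarrow> 'k \<Rightarrow> 'k) \<Rightarrow> 'k \<Rightarrow> 'k \<Rightarrow> nat \<Rightarrow> nat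
     \<Rightarrow> ('k, ('k \<times> (('g diagram \<Rightarrow> 'k, 'k) cell \<Rightarrow> 'g diagram \<Rightarrow> 'k) \<Rightarrow> 'k) set set) module" where
  "GRB_Tor G k act \<delta> \<epsilon> n q = Tor k (GRB G k act \<delta> \<epsilon> n) (GRB_triv G k n) (GRB_triv G k n) q"

definition GRB_Tor_incl ::
  "('g, 'x) monoid_scheme \<Rightarrow> ('k, 'y) ring_scheme \<Rightarrow> ('g \<Rightarrow> 'k \<Rightarrow> 'k) \<Rightarrow> 'k \<Rightarrow> 'k \<Rightarrow> nat \<Rightarrow> nat
     \<Rightarrow> ('k \<times> (('g diagram \<Rightarrow> 'k, 'k) cell \<Rightarrow> 'g diagram \<Rightarrow> 'k) \<Rightarrow> 'k) set set
     \<Rightarrow> ('k \<times> (('g diagram \<Rightarrow> 'k, 'k) cell \<Rightarrow> 'g diagram \<Rightarrow> 'k) \<Rightarrow> 'k) set set" where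
  "GRB_Tor_incl G k act \<delta> \<epsilon> n q =
     Tor_map k (GRB G k act \<delta> \<epsilon> (n - 1)) (GRB G k act \<delta> \<epsilon> n) (GRB_triv G k n) (GRB_triv G k n)
       (GRB_incl G k n) id id q"

end

theory Submission
  imports Defs
begin

text \<open>
In the diagram algebra \<open>A\<close> the non-permutation diagrams span an ideal \<open>I\<close> whose quotient is the group algebra of
\<open>G\<^sup>n \<rtimes> \<Sigma>\<^sub>n\<close>. If \<open>I \<otimes> P\<close> is acyclic for a free resolution \<open>P\<close> of the trivial module, then \<open>\<one> \<otimes> P\<close>
computes the homology of that group. Now \<open>I\<close> is the sum of the right ideals spanned by the diagrams which contain given
left-to-left edges \<open>M\<close> and leave given left nodes \<open>S\<close> isolated, where \<open>S\<close> and \<open>M\<close> are not both empty.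
Intersections of such right ideals are zero or of the same kind, and as \<open>\<delta>\<close> and \<open>\<epsilon>\<close> are units, each of
them is generated by an idempotent. So each is acyclic after tensoring with \<open>P\<close>, and so is \<open>I\<close> by
Mayer--Vietoris. Stability is that of the wreath products: they act on the highly connected complex of \<open>G\<close>-labelled
injective words, with smaller wreath products as stabilisers.
\<close>

text \<open>\<open>Tor\<close> is defined by a huge canonical resolution whose cells depend on the
  algebra, so the algebras on \<open>n - 1\<close> and \<open>n\<close> nodes and the group algebra
  share no complex. All are compared with one small model: the orbit complex of the bar resolution
  of the group of permutations of \<open>{1..n} \<times> G\<close> that commute with right
  multiplication by \<open>G\<close>. The comparison is made for any algebra with a basis
  \<open>D\<close> closed under products up to scalars, in which \<open>T\<close> is a copy of that
  group and \<open>D - T\<close> spans an ideal; the group algebra is the case \<open>D = T\<close>.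
  Cells are determined by their boundaries, so the comparison commutes strictly with the inclusion,
  and stability becomes a statement about bar complexes of nested groups. The idempotents join each
  edge to its mirror image with the inverse label; hence their loops have label
  \<open>\<one>\<close>, and \<open>act \<one> \<delta>\<close> is the only translate of \<delta>
  that is inverted. The slope 2 of the range comes from the first differential of the spectral
  sequence: it alternates between stabilisation and zero, so each degree costs two columns.\<close>

text \<open>
Coefficients have to live in a type class. An element of \<open>coef\<close> consists of one element of every commutative ring on
the type \<open>'k\<close> and of an integer, which ensures \<open>0 \<noteq> 1\<close>; a given ring \<open>k\<close> is the ideal generated by the idempotent \<open>emb k \<one>\<close>.
\<close>

typedef 'k coef = "{f :: 'k ring => 'k. \<forall>R. if cring R then f R \<in> carrier R else f R = undefined} \<times> (UNIV :: int set)"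
proof -
  have "(\<lambda>R::'k ring. if cring R then \<zero>\<^bsub>R\<^esub> else undefined, 0) \<in> {f :: 'k ring => 'k. \<forall>R. if cring R then f R \<in> carrier R else f R = undefined} \<times> (UNIV :: int set)"
    by (auto simp: cring.cring_simprules)
  thus ?thesis ..
qed

setup_lifting type_definition_coef

instantiation coef :: (type) comm_ring_1
begin
lift_definition zero_coef :: "'a coef" is "(\<lambda>R. if cring R then \<zero>\<^bsub>R\<^esub> else undefined, 0)" by (auto simp: cring.cring_simprules)
lift_definition one_coef :: "'a coef" is "(\<lambda>R. if cring R then \<one>\<^bsub>R\<^esub> else undefined, 1)" by (auto simp: cring.cring_simprules)
lift_definition plus_coef :: "'a coef => 'a coef => 'a coef" is
  "\<lambda>(f, i) (g, j). (\<lambda>R. if cring R then f R \<oplus>\<^bsub>R\<^esub> g R else undefined, i + j)"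
  by (auto simp: cring.cring_simprules split: if_splits)
lift_definition times_coef :: "'a coef => 'a coef => 'a coef" is
  "\<lambda>(f, i) (g, j). (\<lambda>R. if cring R then f R \<otimes>\<^bsub>R\<^esub> g R else undefined, i * j)"
  by (auto simp: cring.cring_simprules split: if_splits)
lift_definition uminus_coef :: "'a coef => 'a coef" is "\<lambda>(f, i). (\<lambda>R. if cring R then \<ominus>\<^bsub>R\<^esub> f R else undefined, - i)"
  by (auto simp: cring.cring_simprules split: if_splits)
definition minus_coef :: "'a coef => 'a coef => 'a coef" where "minus_coef a b = a + - b"
instance
proof
  fix a b c :: "'a coef"
  show "a - b = a + - b" by (rule minus_coef_def)
  show "1 * a = a" by transfer (auto simp: fun_eq_iff monoid.l_one[OF ring.is_monoid[OF cring.axioms(1)]])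
  show "(0::'a coef) \<noteq> 1" by transfer auto
qed (transfer, auto simp: fun_eq_iff ring_distribs cring.cring_simprules mult_ac)+
end

text \<open>A component is indexed by a bare ring record, so \<open>k\<close> is compared with the
  index after truncation. All other components and the integer are 0, which makes
  \<open>emb k\<close> additive and multiplicative but not unital.\<close>

lift_definition emb :: "('k, 'x) ring_scheme => 'k => 'k coef" is
  "\<lambda>k x. (\<lambda>R. if cring R then if R = ring.truncate k \<and> x \<in> carrier k then x else \<zero>\<^bsub>R\<^esub> else undefined, 0)"
  by (auto simp: ring.defs cring.cring_simprules split: if_splits)

lift_definition unemb :: "('k, 'x) ring_scheme => 'k coef => 'k" is "\<lambda>k v. fst v (ring.truncate k)" .

lemma cring_truncate:
  assumes "cring k" shows "cring (ring.truncate k)"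
proof -
  interpret cring k by fact
  show ?thesis unfolding ring.defs by (rule cringI)
      (auto intro!: abelian_groupI comm_monoidI simp: a_ac m_ac l_distr r_distr r_neg
        intro: bexI[of _ "\<ominus>\<^bsub>k\<^esub> _"])
qed

lemma cring_zero:
  assumes "cring R"
  shows "\<zero>\<^bsub>R\<^esub> \<oplus>\<^bsub>R\<^esub> \<zero>\<^bsub>R\<^esub> = \<zero>\<^bsub>R\<^esub>" "x \<in> carrier R ==> \<zero>\<^bsub>R\<^esub> \<otimes>\<^bsub>R\<^esub> x = \<zero>\<^bsub>R\<^esub>"
    "\<zero>\<^bsub>R\<^esub> \<in> carrier R"
proof -
  interpret cring R by fact
  show "\<zero>\<^bsub>R\<^esub> \<oplus>\<^bsub>R\<^esub> \<zero>\<^bsub>R\<^esub> = \<zero>\<^bsub>R\<^esub>" "x \<in> carrier R ==> \<zero>\<^bsub>R\<^esub> \<otimes>\<^bsub>R\<^esub> x = \<zero>\<^bsub>R\<^esub>"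
    "\<zero>\<^bsub>R\<^esub> \<in> carrier R" by simp_all
qed

context cring
begin

lemma emb_zero [simp]: "emb R \<zero> = 0" by (transfer fixing: R) (auto simp: fun_eq_iff ring.defs)

lemma emb_add: "x \<in> carrier R ==> y \<in> carrier R ==> emb R (x \<oplus> y) = emb R x + emb R y"
  by (transfer fixing: R) (auto simp: fun_eq_iff ring.defs cring_zero split_beta)

lemma emb_mult: "x \<in> carrier R ==> y \<in> carrier R ==> emb R (x \<otimes> y) = emb R x * emb R y"
  by (transfer fixing: R) (auto simp: fun_eq_iff ring.defs cring_zero split_beta)

lemma emb_uminus: "x \<in> carrier R ==> emb R (\<ominus> x) = - emb R x" using emb_add[of "\<ominus> x" x] by (simp add: l_neg eq_neg_iff_add_eq_0)

lemma emb_minus: "x \<in> carrier R ==> y \<in> carrier R ==> emb R (x \<ominus> y) = emb R x - emb R y"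
  by (simp add: emb_add emb_uminus minus_eq)

lemma unemb_emb [simp]: "x \<in> carrier R ==> unemb R (emb R x) = x" using cring_truncate[OF is_cring] by (transfer fixing: R) auto

lemma unemb_closed [simp]: "unemb R v \<in> carrier R"
proof -
  have "unemb R v \<in> carrier (ring.truncate R)" using cring_truncate[OF is_cring] by (transfer fixing: R) auto
  thus ?thesis by (simp add: ring.defs)
qed

lemma emb_inj: "x \<in> carrier R ==> y \<in> carrier R ==> emb R x = emb R y \<longleftrightarrow> x = y" by (metis unemb_emb)

lemma emb_eq_0: "x \<in> carrier R ==> emb R x = 0 \<longleftrightarrow> x = \<zero>" using emb_inj[of x \<zero>] by simp

text \<open>\<open>unemb\<close> reads one component, so returning with \<open>emb\<close> is the
  projection onto that factor, i.e. multiplication by its idempotent.\<close>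

lemma emb_unemb: "emb R (unemb R v) = emb R \<one> * v" using cring_truncate[OF is_cring] unemb_closed[of v] l_one[OF unemb_closed[of v]]
  by (transfer fixing: R) (auto simp: fun_eq_iff cring_zero split_beta, simp_all add: ring.defs)

lemma emb_one_mult [simp]: "x \<in> carrier R ==> emb R \<one> * emb R x = emb R x" using emb_mult[of \<one> x] by simp

lemma unemb_zero [simp]: "unemb R 0 = \<zero>" using unemb_emb[of \<zero>] by simp

lemma emb_finsum: "f \<in> A \<rightarrow> carrier R ==> emb R (\<Oplus>x\<in>A. f x) = (\<Sum>x\<in>A. emb R (f x))"
proof (induction A rule: infinite_finite_induct)
  case (insert x F)
  hence "emb R (\<Oplus>x\<in>insert x F. f x) = emb R (f x \<oplus> (\<Oplus>x\<in>F. f x))" by (subst finsum_insert) auto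
  thus ?case using insert by (subst (asm) emb_add) (auto intro!: finsum_closed)
qed (auto simp: finsum_infinite)

end

section \<open>Finitely supported chains, linear extension and push-forward\<close>

type_synonym ('s, 'u) chain = "'s \<Rightarrow>\<^sub>0 'u"

abbreviation sg :: "'s => 'u::zero => 's \<Rightarrow>\<^sub>0 'u" where "sg \<equiv> Poly_Mapping.single"

abbreviation keys :: "('s \<Rightarrow>\<^sub>0 'u::zero) => 's set" where "keys \<equiv> Poly_Mapping.keys"

abbreviation lkp :: "('s \<Rightarrow>\<^sub>0 'u::zero) => 's => 'u" where "lkp \<equiv> Poly_Mapping.lookup"

definition scale :: "'u::comm_ring_1 => ('s, 'u) chain => ('s, 'u) chain" where "scale c f = Poly_Mapping.map ((*) c) f"

lemma lookup_scale [simp]: "lkp (scale c f) s = c * lkp f s" unfolding scale_def by transfer (auto simp: when_def)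

lemma scale_simps [simp]: "scale c 0 = 0" "scale 0 f = 0" "scale 1 f = f" "scale c (- f) = - scale c f" "scale (- c) f = - scale c f"
  "scale c (scale d f) = scale (c * d) f" "scale c (sg s d) = sg s (c * d)" by (auto intro!: poly_mapping_eqI simp: lookup_single when_def mult.assoc)

lemma scale_distrib: "scale c (f + g) = scale c f + scale c g" "scale c (f - g) = scale c f - scale c g"
  "scale (c + d) f = scale c f + scale d f" "scale (c - d) f = scale c f - scale d f" by (auto intro!: poly_mapping_eqI simp: lookup_add lookup_minus algebra_simps)

lemma scale_sum: "scale c (sum f A) = (\<Sum>x\<in>A. scale c (f x))" by (induction A rule: infinite_finite_induct) (auto simp: scale_distrib)

lemma keys_scale: "keys (scale c f) \<subseteq> keys f" by (auto simp: in_keys_iff)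

definition lin :: "('s => ('t, 'u::comm_ring_1) chain) => ('s, 'u) chain => ('t, 'u) chain" where
  "lin \<phi> f = (\<Sum>s\<in>Poly_Mapping.keys f. scale (lkp f s) (\<phi> s))"

lemma lin_superset:
  assumes "finite A" "keys f \<subseteq> A" shows "lin \<phi> f = (\<Sum>s\<in>A. scale (lkp f s) (\<phi> s))"
  unfolding lin_def using assms by (intro sum.mono_neutral_left) (auto simp: in_keys_iff)

lemma lin_0 [simp]: "lin \<phi> 0 = 0" by (simp add: lin_def)

lemma lin_single [simp]: "lin \<phi> (sg s c) = scale c (\<phi> s)" by (simp add: lin_def)

lemma lin_add: "lin \<phi> (f + g) = lin \<phi> f + lin \<phi> g"
proof -
  have A: "finite (keys f \<union> keys g)" by simp
  show ?thesis using keys_add[of f g] by (simp add: lin_superset[OF A] lookup_add scale_distrib sum.distrib)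
qed

lemma lin_scale: "lin \<phi> (scale c f) = scale c (lin \<phi> f)" by (subst lin_superset[of "keys f"]) (auto simp: keys_scale lin_def scale_sum)

lemma lin_uminus: "lin \<phi> (- f) = - lin \<phi> f" using lin_scale[of \<phi> "- 1" f] by simp

lemma lin_diff: "lin \<phi> (f - g) = lin \<phi> f - lin \<phi> g" using lin_add[of \<phi> f "- g"] by (simp add: lin_uminus)

lemma lin_sum: "lin \<phi> (sum f A) = (\<Sum>x\<in>A. lin \<phi> (f x))" by (induction A rule: infinite_finite_induct) (auto simp: lin_add)

lemmas lin_simps = lin_add lin_diff lin_uminus lin_scale

lemma lin_cong: "(!!s. s \<in> keys f ==> \<phi> s = \<psi> s) ==> lin \<phi> f = lin \<psi> f" by (simp add: lin_def)

lemma lin_lin: "lin \<psi> (lin \<phi> f) = lin (\<lambda>s. lin \<psi> (\<phi> s)) f" by (simp add: lin_def[of \<phi>] lin_sum lin_scale) (simp add: lin_def)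

lemma lin_fun: "lin (\<lambda>s. \<phi> s + \<psi> s) f = lin \<phi> f + lin \<psi> f" "lin (\<lambda>s. \<phi> s - \<psi> s) f = lin \<phi> f - lin \<psi> f"
  "lin (\<lambda>s. - \<phi> s) f = - lin \<phi> f" "lin (\<lambda>s. scale c (\<phi> s)) f = scale c (lin \<phi> f)" "lin (\<lambda>s. 0) f = 0"
  by (auto simp: lin_def scale_distrib sum.distrib sum_subtractf sum_negf scale_sum mult.commute)

lemma lin_scaled: "lin (\<lambda>s. sg s c) f = scale c f"
proof (rule poly_mapping_eqI)
  fix t
  have "lkp (lin (\<lambda>s. sg s c) f) t = (\<Sum>s\<in>keys f. if s = t then lkp f t * c else 0)"
    unfolding lin_def lookup_sum by (intro sum.cong) (auto simp: lookup_single when_def)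
  thus "lkp (lin (\<lambda>s. sg s c) f) t = lkp (scale c f) t" by (auto simp: in_keys_iff mult.commute)
qed

lemma lin_ident [simp]: "lin (\<lambda>s. sg s 1) f = f" by (simp add: lin_scaled)

lemma keys_lin: "keys (lin \<phi> f) \<subseteq> (\<Union>s\<in>keys f. keys (\<phi> s))"
proof -
  have "keys (lin \<phi> f) \<subseteq> (\<Union>s\<in>keys f. keys (scale (lkp f s) (\<phi> s)))" unfolding lin_def by (rule keys_sum)
  thus ?thesis using keys_scale by fastforce
qed

definition fspan :: "'s set => ('s, 'u::comm_ring_1) chain set" where "fspan S = {f. keys f \<subseteq> S}"

lemma fspan_0 [simp]: "0 \<in> fspan S" by (simp add: fspan_def)

lemma fspan_single [intro, simp]: "s \<in> S ==> sg s c \<in> fspan S" by (simp add: fspan_def)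

lemma fspan_add [intro, simp]: "f \<in> fspan S ==> g \<in> fspan S ==> f + g \<in> fspan S"
  using keys_add[of f g] by (auto simp: fspan_def)

lemma fspan_uminus [intro, simp]: "f \<in> fspan S ==> - f \<in> fspan S" by (auto simp: fspan_def in_keys_iff)

lemma fspan_diff [intro, simp]: "f \<in> fspan S ==> g \<in> fspan S ==> f - g \<in> fspan S" using fspan_add[of f S "- g"] by auto

lemma fspan_scale [intro, simp]: "f \<in> fspan S ==> scale c f \<in> fspan S" using keys_scale[of c f] by (auto simp: fspan_def)

lemma fspan_sum [intro]: "(!!x. x \<in> A ==> f x \<in> fspan S) ==> sum f A \<in> fspan S"
  by (induction A rule: infinite_finite_induct) auto

lemma fspan_lin [intro]: "f \<in> fspan S ==> (!!s. s \<in> S ==> \<phi> s \<in> fspan T) ==> lin \<phi> f \<in> fspan T"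
  using keys_lin[of \<phi> f] by (fastforce simp: fspan_def)

lemma fspan_mono: "f \<in> fspan S ==> S \<subseteq> T ==> f \<in> fspan T" by (auto simp: fspan_def)

lemma fspan_keys: "f \<in> fspan S ==> s \<in> keys f ==> s \<in> S" by (auto simp: fspan_def)

lemma lin_cong': "f \<in> fspan S ==> (!!s. s \<in> S ==> \<phi> s = \<psi> s) ==> lin \<phi> f = lin \<psi> f"
  by (rule lin_cong) (auto dest: fspan_keys)

lemma chain_induct [consumes 1, case_names single zero add]:
  assumes "f \<in> fspan S" and "!!s c. s \<in> S ==> P (sg s c)" and "P 0" and "!!f g. P f ==> P g ==> P (f + g)"
  shows "P f"
proof -
  have "P (\<Sum>s\<in>A. sg s (lkp f s))" if "A \<subseteq> S" for A using that by (induction A rule: infinite_finite_induct) (auto intro: assms)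
  moreover have "(\<Sum>s\<in>keys f. sg s (lkp f s)) = f" using lin_ident[of f] by (simp add: lin_def del: lin_ident)
  ultimately show ?thesis using assms(1) by (metis fspan_def mem_Collect_eq)
qed

definition pm :: "('s => 't) => ('s, 'u::comm_ring_1) chain => ('t, 'u) chain" where "pm g f = lin (\<lambda>s. sg (g s) 1) f"

lemma pm_simps [simp]: "pm g 0 = 0" "pm g (f + f') = pm g f + pm g f'" "pm g (f - f') = pm g f - pm g f'" "pm g (- f) = - pm g f"
  "pm g (scale c f) = scale c (pm g f)" "pm g (sg s c) = sg (g s) c" by (simp_all add: pm_def lin_simps)

lemma pm_pm: "pm g (pm h f) = pm (\<lambda>x. g (h x)) f" by (simp add: pm_def lin_lin)

lemma pm_lin: "pm g (lin \<phi> f) = lin (\<lambda>s. pm g (\<phi> s)) f" by (simp add: pm_def lin_lin)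

lemma lin_pm: "lin \<phi> (pm g f) = lin (\<lambda>s. \<phi> (g s)) f" by (simp add: pm_def lin_lin)

lemma pm_cong: "(!!s. s \<in> keys f ==> g s = h s) ==> pm g f = pm h f" unfolding pm_def by (rule lin_cong) simp

lemma pm_cong': "f \<in> fspan S ==> (!!s. s \<in> S ==> g s = h s) ==> pm g f = pm h f"
  by (rule pm_cong) (auto dest: fspan_keys)

lemma pm_id: "(!!s. s \<in> keys f ==> g s = s) ==> pm g f = f" using pm_cong[of f g "\<lambda>x. x"] by (simp add: pm_def)

lemma fspan_pm: "f \<in> fspan S ==> (!!s. s \<in> S ==> g s \<in> T) ==> pm g f \<in> fspan T"
  unfolding pm_def by (rule fspan_lin) auto

lemma keys_pm: "keys (pm g f) \<subseteq> g ` keys f" unfolding pm_def using keys_lin[of "\<lambda>s. sg (g s) 1" f] by auto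

lemma pm_sum: "pm g (sum f A) = (\<Sum>x\<in>A. pm g (f x))" by (simp add: pm_def lin_sum)

lemma lookup_pm_inj:
  assumes "inj g" shows "lkp (pm g f) (g s) = lkp f s"
proof -
  have "lkp (pm g f) (g s) = (\<Sum>t\<in>keys f. if t = s then lkp f s else 0)" unfolding pm_def lin_def lookup_sum
    using assms by (intro sum.cong) (auto simp: lookup_single when_def inj_eq)
  thus ?thesis by (auto simp: in_keys_iff)
qed

lemma map_key_pm: "inj g ==> Poly_Mapping.map_key g (pm g f) = f" by (rule poly_mapping_eqI) (simp add: map_key.rep_eq lookup_pm_inj)

lemma map_key_scale: "inj g ==> Poly_Mapping.map_key g (scale c f) = scale c (Poly_Mapping.map_key g f)"
  by (rule poly_mapping_eqI) (simp add: map_key.rep_eq)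

lemma map_key_diff: "inj g ==> Poly_Mapping.map_key g (f - f' :: (_, 'u::comm_ring_1) chain) = Poly_Mapping.map_key g f - Poly_Mapping.map_key g f'"
  by (rule poly_mapping_eqI) (simp add: map_key.rep_eq lookup_minus)

lemma map_key_eq_0: "inj g ==> (!!s. g s \<notin> keys f) ==> Poly_Mapping.map_key g f = 0"
  by (rule poly_mapping_eqI) (simp add: map_key.rep_eq in_keys_iff)

subsection \<open>Lists and injective words\<close>

text \<open>Alternating sum of the words with one letter deleted. The degree is the length and the
  empty word is a generator, so this is an augmented complex and exactness makes sense in degree 0
  too.\<close>

primrec bd :: "'a list => ('a list, 'u::comm_ring_1) chain" where "bd [] = 0"
| "bd (x # xs) = sg xs 1 - pm (Cons x) (bd xs)"

lemma lin_bd_Cons: "lin bd (pm (Cons x) f) = f - pm (Cons x) (lin bd f)" by (simp add: lin_pm lin_fun pm_lin)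

lemma bd_bd: "lin bd (bd xs) = 0" by (induction xs) (simp_all add: lin_diff lin_bd_Cons)

lemma bd_map: "bd (map g xs) = pm (map g) (bd xs)" by (induction xs) (simp_all add: pm_pm)

lemma lin_bd_map: "lin bd (pm (map g) f) = pm (map g) (lin bd f)" by (simp add: lin_pm pm_lin bd_map)

lemma keys_bd: "l \<in> keys (bd xs :: (_, 'u::comm_ring_1) chain) ==> \<exists>i < length xs. l = take i xs @ drop (Suc i) xs"
proof (induction xs arbitrary: l)
  case (Cons x xs)
  have "keys (bd (x # xs) :: (_, 'u) chain) \<subseteq> keys (sg xs (1::'u)) \<union> keys (pm (Cons x) (bd xs :: (_, 'u) chain))"
    using keys_diff by (metis bd.simps(2))
  then consider "l = xs" | l' where "l = x # l'" "l' \<in> keys (bd xs :: (_, 'u) chain)" using Cons.prems keys_pm[of "Cons x" "bd xs :: (_, 'u) chain"] by auto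
  thus ?case
  proof cases
    case 1
    thus ?thesis by (auto intro!: exI[of _ 0])
  next
    case 2
    then obtain i where "i < length xs" "l' = take i xs @ drop (Suc i) xs" using Cons.IH by blast
    thus ?thesis using 2 by (auto intro!: exI[of _ "Suc i"])
  qed
qed auto

lemma keys_bd_length: "l \<in> keys (bd xs :: (_, 'u::comm_ring_1) chain) ==> Suc (length l) = length xs" by (auto dest!: keys_bd)

lemma keys_bd_set: "l \<in> keys (bd xs :: (_, 'u::comm_ring_1) chain) ==> set l \<subseteq> set xs" by (auto dest!: keys_bd in_set_takeD in_set_dropD)

lemma keys_bd_distinct:
  assumes "l \<in> keys (bd xs :: (_, 'u::comm_ring_1) chain)" "distinct (map f xs)" shows "distinct (map f l)"
proof -
  obtain i where "l = take i xs @ drop (Suc i) xs" using keys_bd[OF assms(1)] by blast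
  hence "map f l = take i (map f xs) @ drop (Suc i) (map f xs)" by (simp add: take_map drop_map)
  thus ?thesis using assms(2) set_take_disj_set_drop_if_distinct[of "map f xs" i "Suc i"] by simp
qed

text \<open>A deletion hits either the prefix or the suffix; in the second case its position is
  shifted by the length of the prefix, whence the sign.\<close>

lemma bd_append: "bd (p @ v) = pm (\<lambda>u. u @ v) (bd p) + scale ((- 1) ^ length p) (pm (\<lambda>w. p @ w) (bd v))" by (induction p) (simp_all add: pm_pm pm_id)

definition words :: "nat set => 'g set => nat => (nat \<times> 'g) list set" where
  "words I K p = {x. set x \<subseteq> I \<times> K \<and> distinct (map fst x) \<and> length x = p}"

abbreviation "lt G I \<equiv> I \<times> carrier G"

abbreviation "gw G I \<equiv> words I (carrier G)"

lemma words_bd: "x \<in> words I K (Suc p) ==> bd x \<in> fspan (words I K p)" using keys_bd_length keys_bd_set keys_bd_distinct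
  by (fastforce simp: words_def fspan_def)

lemma words_lin_bd: "c \<in> fspan (words I K (Suc p)) ==> lin bd c \<in> fspan (words I K p)" by (rule fspan_lin) (auto intro: words_bd)

text \<open>The filtration behind \<open>words_acyclic\<close>: letters over \<open>a\<close> occur
  only at positions before \<open>j\<close>. At stage 0 a word avoids \<open>a\<close> and can be
  coned off by a letter over \<open>a\<close>.\<close>

definition no_late :: "nat => nat => (nat \<times> 'g) list => bool" where
  "no_late a j l \<longleftrightarrow> (\<forall>i<length l. j \<le> i \<longrightarrow> fst (l ! i) \<noteq> a)"

lemma scale_sign_eq_0: "scale ((- 1) ^ n) f = 0 \<longleftrightarrow> f = 0"
proof
  assume "scale ((- 1) ^ n) f = 0"
  hence "scale ((- 1) ^ n) (scale ((- 1) ^ n) f) = 0" by (simp only: scale_simps(1))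
  thus "f = 0" by (simp flip: power_mult_distrib)
qed simp

lemma no_late_0: "no_late a 0 l \<longleftrightarrow> a \<notin> fst ` set l" by (force simp: no_late_def in_set_conv_nth image_iff)

text \<open>Only deletions behind the prefix contribute to the part that starts with
  \<open>p\<close>. If a deletion inside the prefix of a word produced \<open>p\<close> again, the
  word would carry a second letter over \<open>a\<close>, or one at a position after
  \<open>j\<close>; the first is excluded by injectivity, the second by the filtration. A deletion
  behind position \<open>j\<close> leaves the prefix as it was.\<close>

lemma prefix_part_bd:
  fixes c :: "((nat \<times> 'g) list, 'u::comm_ring_1) chain"
  assumes "c \<in> fspan {l \<in> words I K n. no_late a (Suc j) l}" and p: "length p = Suc j" "fst (p ! j) = a"
  shows "Poly_Mapping.map_key ((@) p) (lin bd c) = scale ((- 1) ^ Suc j) (lin bd (Poly_Mapping.map_key ((@) p) c))" using assms(1)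
proof (induction rule: chain_induct)
  case (single l r)
  have inj: "inj ((@) p)" by (auto intro: injI)
  show ?case
  proof (cases "\<exists>v. l = p @ v")
    case True
    then obtain v where v: "l = p @ v" ..
    have "Poly_Mapping.map_key ((@) p) (pm (\<lambda>u. u @ v) (bd p :: (_, 'u) chain)) = 0"
    proof (rule map_key_eq_0[OF inj], rule notI)
      fix w assume "p @ w \<in> keys (pm (\<lambda>u. u @ v) (bd p :: (_, 'u) chain))"
      then obtain u where u: "u \<in> keys (bd p :: (_, 'u) chain)" "p @ w = u @ v" using keys_pm by fastforce
      from u(1) have "length u = j" using p keys_bd_length by fastforce
      with u(2) p have "v \<noteq> []" "p ! j = v ! 0"
        by (metis append.right_neutral append_eq_append_conv length_append less_add_Suc1 less_not_refl add_Suc_shift add_Suc_right)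
          (metis \<open>length u = j\<close> lessI nth_append nth_append_length_plus p(1) u(2) add.right_neutral)
      hence "fst (p ! j) \<in> fst ` set v" "fst (p ! j) \<in> fst ` set p"
        using p by (metis image_eqI length_greater_0_conv nth_mem, metis image_eqI lessI nth_mem)
      thus False using single v by (auto simp: words_def)
    qed
    thus ?thesis using inj p by (simp add: v bd_append map_key_diff map_key_scale map_key_pm mult.commute)
  next
    case False
    have "p @ w \<notin> keys (bd l :: (_, 'u) chain)" for w
    proof
      assume "p @ w \<in> keys (bd l :: (_, 'u) chain)"
      then obtain i where i: "i < length l" "p @ w = take i l @ drop (Suc i) l" using keys_bd by blast
      show False
      proof (cases "i \<le> j")
        case True
        have "Suc j < length l"
        proof -
          have "length (p @ w) = length l - 1" unfolding i(2) using i(1) by auto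
          thus ?thesis using p by simp
        qed
        moreover have "p ! j = l ! Suc j"
        proof -
          have "(take i l @ drop (Suc i) l) ! j = l ! Suc j" using True i(1) \<open>Suc j < length l\<close> by (auto simp: nth_append)
          thus ?thesis using p unfolding i(2)[symmetric] by (simp add: nth_append)
        qed
        ultimately show False using single p by (auto simp: no_late_def)
      next
        case False
        hence "take (Suc j) l = p"
        proof -
          have "take (Suc j) (take i l @ drop (Suc i) l) = take (Suc j) l" using False i(1) by (simp add: min_def)
          thus ?thesis using p unfolding i(2)[symmetric] by simp
        qed
        thus False using \<open>\<nexists>v. l = p @ v\<close> by (metis append_take_drop_id)
      qed
    qed
    hence "Poly_Mapping.map_key ((@) p) (bd l :: (_, 'u) chain) = 0" by (intro map_key_eq_0[OF inj])
    moreover have "Poly_Mapping.map_key ((@) p) (sg l r) = 0" using False by (intro map_key_eq_0[OF inj]) auto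
    ultimately show ?thesis using inj by (simp add: map_key_scale)
  qed
next
  case (add f g)
  moreover have "inj ((@) p)" by (auto intro: injI)
  ultimately show ?case by (simp add: lin_add map_key_plus scale_distrib)
next
  case zero
  have "inj ((@) p)" by (auto intro: injI)
  thus ?case by simp
qed

lemma lookup_pm_notin: "s \<notin> range g ==> lkp (pm g f) s = 0" using keys_pm[of g f] by (auto simp: in_keys_iff)

text \<open>Induction on the size of \<open>I\<close> and, for a fixed \<open>a\<close> in
  \<open>I\<close>, descent along \<open>no_late a\<close>. In the top layer a letter over
  \<open>a\<close> sits at position \<open>j\<close>. The words with a given prefix up to that
  letter form a complex of injective words on the remaining indices; there the cycle bounds by
  induction, since degree and number of indices both drop by \<open>Suc j\<close>.\<close>

lemma words_acyclic:
  fixes c :: "((nat \<times> 'g) list, 'u::comm_ring_1) chain"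
  assumes "finite I" "p < card I" "g0 \<in> K" "c \<in> fspan (words I K p)" "lin bd c = 0" shows "\<exists>y \<in> fspan (words I K (Suc p)). lin bd y = c"
  using assms
proof (induction "card I" arbitrary: I p c rule: less_induct)
  case less
  then obtain a where a: "a \<in> I" by fastforce
  have "\<exists>y \<in> fspan (words I K (Suc p)). lin bd y = c"
    if "c \<in> fspan {l \<in> words I K p. no_late a j l}" "lin bd c = 0" for j and c :: "((nat \<times> 'g) list, 'u) chain" using that
  proof (induction j arbitrary: c)
    case 0
    \<comment> \<open>No word in \<open>c\<close> uses a letter over \<open>a\<close>, so prefixing
      \<open>(a, g0)\<close> is a contraction.\<close>
    have "pm (Cons (a, g0)) c \<in> fspan (words I K (Suc p))" using 0(1) a less.prems(3) by (rule_tac fspan_pm[OF 0(1)]) (auto simp: words_def no_late_0)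
    moreover have "lin bd (pm (Cons (a, g0)) c) = c" using 0 by (simp add: lin_bd_Cons)
    ultimately show ?case by blast
  next
    case (Suc j)
    \<comment> \<open>The prefixes that end in a letter over \<open>a\<close> at position
      \<open>j\<close>, and for each of them the chain of suffixes.\<close>
    define P where "P = take (Suc j) ` {l \<in> keys c. j < length l \<and> fst (l ! j) = a}"
    define part where "part q = Poly_Mapping.map_key ((@) q) c" for q
    have inj: "inj ((@) q)" for q :: "(nat \<times> 'g) list" by (auto intro: injI)
    have finP: "finite P" by (simp add: P_def)
    have P: "length q = Suc j" "fst (q ! j) = a" if "q \<in> P" for q using that by (auto simp: P_def)
    have keysW: "l \<in> words I K p" if "l \<in> keys c" for l using that Suc.prems by (auto dest: fspan_keys)
    have Pw: "set q \<subseteq> I \<times> K" "distinct (map fst q)" "Suc j \<le> p" if "q \<in> P" for q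
      using that keysW by (auto simp: P_def words_def take_map[symmetric] dest: in_set_takeD)
    have fsub: "card (fst ` set q) = Suc j" "fst ` set q \<subseteq> I" if "q \<in> P" for q using Pw[OF that] P[OF that] distinct_card[of "map fst q"] by auto
    have part: "part q \<in> fspan (words (I - fst ` set q) K (p - Suc j))" if "q \<in> P" for q
    proof -
      have "w \<in> words (I - fst ` set q) K (p - Suc j)" if w: "w \<in> keys (part q)" for w
      proof -
        have "q @ w \<in> words I K p" using w inj keysW[of "q @ w"] by (auto simp: part_def in_keys_iff map_key.rep_eq)
        hence *: "set w \<subseteq> I \<times> K" "fst ` set q \<inter> fst ` set w = {}" "distinct (map fst w)" "length w = p - Suc j"
          using P[OF \<open>q \<in> P\<close>] by (auto simp: words_def)
        have "x \<in> (I - fst ` set q) \<times> K" if "x \<in> set w" for x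
        proof -
          have "x \<in> I \<times> K" "fst x \<notin> fst ` set q" using * that by blast+
          thus ?thesis by (simp add: mem_Times_iff)
        qed
        thus ?thesis using * by (auto simp: words_def)
      qed
      thus ?thesis by (auto simp: fspan_def)
    qed
    have bdpart: "lin bd (part q) = 0" if "q \<in> P" for q
    proof -
      have "Poly_Mapping.map_key ((@) q) (lin bd c) = 0" using inj Suc.prems(2) by simp
      thus ?thesis using prefix_part_bd[OF Suc.prems(1) P[OF that]] by (simp add: part_def scale_sign_eq_0)
    qed
    have "\<exists>y. y \<in> fspan (words (I - fst ` set q) K (Suc (p - Suc j))) \<and> lin bd y = part q" if "q \<in> P" for q
    proof -
      have "card (I - fst ` set q) = card I - Suc j" using fsub[OF that] by (simp add: card_Diff_subset)
      moreover have "p - Suc j < card I - Suc j" "card I - Suc j < card I" using less.prems(2) Pw(3)[OF that] by linarith+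
      ultimately show ?thesis using less.hyps[of "I - fst ` set q" "p - Suc j" "part q"] less.prems(1,3) part[OF that] bdpart[OF that] by auto
    qed
    then obtain y where y: "!!q. q \<in> P ==> y q \<in> fspan (words (I - fst ` set q) K (Suc (p - Suc j)))"
      "!!q. q \<in> P ==> lin bd (y q) = part q" by metis
    \<comment> \<open>The sign cancels the one that \<open>bd_append\<close> gives for a prefix of
      length \<open>Suc j\<close>.\<close>
    define Y where "Y = (\<Sum>q\<in>P. scale ((- 1) ^ Suc j) (pm ((@) q) (y q)))"
    have Y: "Y \<in> fspan (words I K (Suc p))" unfolding Y_def
    proof (intro fspan_sum fspan_scale)
      fix q assume q: "q \<in> P"
      show "pm ((@) q) (y q) \<in> fspan (words I K (Suc p))" using y(1)[OF q] by (rule fspan_pm) (use P[OF q] Pw[OF q] in \<open>force simp: words_def\<close>)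
    qed
    have bdq: "lin bd (pm ((@) q) z) = lin (\<lambda>v. pm (\<lambda>u. u @ v) (bd q)) z + scale ((- 1) ^ length q) (pm ((@) q) (lin bd z))" for q :: "(nat \<times> 'g) list" and z :: "(_, 'u) chain"
      by (simp add: lin_pm pm_lin bd_append lin_fun)
    have bdY: "lin bd Y = (\<Sum>q\<in>P. scale ((- 1) ^ Suc j) (lin (\<lambda>v. pm (\<lambda>u. u @ v) (bd q)) (y q))) + (\<Sum>q\<in>P. pm ((@) q) (part q))"
      unfolding Y_def lin_sum sum.distrib[symmetric] by (rule sum.cong) (auto simp: lin_uminus lin_scale bdq y P scale_distrib simp flip: power_mult_distrib)
    \<comment> \<open>The fillings cancel all words with a letter over \<open>a\<close> at position
      \<open>j\<close>. The other faces of \<open>Y\<close> delete a letter of a prefix, which moves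
      the letter over \<open>a\<close> to an earlier position or removes it.\<close>
    have "c - lin bd Y \<in> fspan {l \<in> words I K p. no_late a j l}"
    proof -
      have "c - (\<Sum>q\<in>P. pm ((@) q) (part q)) \<in> fspan {l. no_late a j l}"
      proof -
        have "lkp (c - (\<Sum>q\<in>P. pm ((@) q) (part q))) l = 0" if l: "\<not> no_late a j l" for l
        proof (cases "lkp c l = 0")
          case True
          have "lkp (pm ((@) q) (part q)) l = 0" for q
          proof (cases "l \<in> range ((@) q)")
            case True
            thus ?thesis using \<open>lkp c l = 0\<close> inj by (auto simp: lookup_pm_inj part_def map_key.rep_eq)
          qed (rule lookup_pm_notin)
          thus ?thesis using True by (simp add: lookup_minus lookup_sum)
        next
          case False
          hence lk: "l \<in> keys c" by (simp add: in_keys_iff)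
          hence "no_late a (Suc j) l" using Suc.prems(1) by (auto dest: fspan_keys)
          hence j: "j < length l" "fst (l ! j) = a" using l by (metis no_late_def le_antisym not_less_eq_eq)+
          define q0 where "q0 = take (Suc j) l"
          have q0: "q0 \<in> P" using j lk by (auto simp: P_def q0_def)
          have ldec: "l = q0 @ drop (Suc j) l" by (simp add: q0_def)
          have "lkp (pm ((@) q) (part q)) l = (if q = q0 then lkp c l else 0)" if q: "q \<in> P" for q
          proof (cases "q = q0")
            case True
            have "lkp (pm ((@) q) (part q)) (q @ drop (Suc j) l) = lkp c (q @ drop (Suc j) l)" using inj by (simp add: lookup_pm_inj part_def map_key.rep_eq)
            thus ?thesis using True ldec by simp
          next
            case False
            have "l \<notin> range ((@) q)" using False P[OF q] by (auto simp: q0_def)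
            thus ?thesis using False by (simp add: lookup_pm_notin)
          qed
          thus ?thesis using finP q0 by (simp add: lookup_minus lookup_sum)
        qed
        thus ?thesis by (auto simp: fspan_def in_keys_iff)
      qed
      moreover have "(\<Sum>q\<in>P. scale ((- 1) ^ Suc j) (lin (\<lambda>v. pm (\<lambda>u. u @ v) (bd q)) (y q))) \<in> fspan {l. no_late a j l}"
      proof (intro fspan_sum fspan_scale)
        fix q assume q: "q \<in> P"
        show "lin (\<lambda>v. pm (\<lambda>u. u @ v) (bd q)) (y q) \<in> fspan {l. no_late a j l}"
        proof (rule fspan_lin[OF y(1)[OF q]], rule fspan_pm[of _ "{u. length u = j}"])
          show "bd q \<in> fspan {u. length u = j}" using P[OF q] keys_bd_length by (fastforce simp: fspan_def)
          fix v u :: "(nat \<times> 'g) list"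
          assume v: "v \<in> words (I - fst ` set q) K (Suc (p - Suc j))" and u: "u \<in> {u. length u = j}"
          have "a \<in> fst ` set q" using P[OF q] by (metis image_eqI lessI nth_mem)
          have "fst x \<noteq> a" if "x \<in> set v" for x
          proof -
            have "x \<in> (I - fst ` set q) \<times> K" using v that by (auto simp: words_def)
            thus ?thesis using \<open>a \<in> fst ` set q\<close> by (metis DiffD2 mem_Times_iff)
          qed
          thus "u @ v \<in> {l. no_late a j l}" using u by (auto simp: no_late_def nth_append)
        qed
      qed
      ultimately have "c - lin bd Y \<in> fspan {l. no_late a j l}" using fspan_diff unfolding bdY by (metis (no_types, lifting) add.commute diff_diff_eq)
      moreover have "c - lin bd Y \<in> fspan (words I K p)" using words_lin_bd[OF Y] Suc.prems(1) by (auto intro!: fspan_diff elim: fspan_mono)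
      ultimately show ?thesis by (auto simp: fspan_def)
    qed
    moreover have "lin bd (c - lin bd Y) = 0" using Suc.prems(2) by (simp add: lin_diff lin_lin bd_bd lin_fun)
    ultimately obtain y' where "y' \<in> fspan (words I K (Suc p))" "lin bd y' = c - lin bd Y" using Suc.IH by blast
    thus ?case using Y by (intro bexI[of _ "y' + Y"]) (auto simp: lin_add)
  qed
  moreover have "c \<in> fspan {l \<in> words I K p. no_late a p l}" using less.prems(4) by (auto simp: fspan_def no_late_def words_def)
  ultimately show ?case using less.prems(5) by blast
qed

section \<open>Wreath products as permutations commuting with right multiplication\<close>

definition wp :: "('g, 'x) monoid_scheme => nat set => (nat \<times> 'g => nat \<times> 'g) set" where
  "wp G I = {f. bij f \<and> f ` lt G I = lt G I \<and> (\<forall>x. x \<notin> lt G I \<longrightarrow> f x = x) \<and>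
     (\<forall>i\<in>I. \<forall>g\<in>carrier G. \<forall>h\<in>carrier G. f (i, g \<otimes>\<^bsub>G\<^esub> h) = (fst (f (i, g)), snd (f (i, g)) \<otimes>\<^bsub>G\<^esub> h))}"

abbreviation finv :: "('a => 'a) => 'a => 'a" where "finv w \<equiv> inv_into UNIV w"

lemma finv_f: "bij w ==> finv w (w x) = x" "bij w ==> w (finv w x) = x" by (simp_all add: bij_is_inj bij_is_surj surj_f_inv_f)

lemma finv_comp: "bij v ==> bij w ==> finv (v \<circ> w) = finv w \<circ> finv v" by (rule o_inv_distrib)

lemma finv_finv_comp: "bij v ==> bij w ==> finv (v \<circ> w) \<circ> (v \<circ> u) = finv w \<circ> u"
  by (simp add: finv_comp fun_eq_iff finv_f)

lemma wp_bij: "f \<in> wp G I ==> bij f" by (simp add: wp_def)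

lemma wp_in: "f \<in> wp G I ==> x \<in> lt G I ==> f x \<in> lt G I" by (auto simp: wp_def)

lemma wp_out: "f \<in> wp G I ==> x \<notin> lt G I ==> f x = x" unfolding wp_def by blast

lemma wp_surj:
  assumes "f \<in> wp G I" "x \<in> lt G I"
  obtains y where "y \<in> lt G I" "x = f y"
proof -
  have "f ` lt G I = lt G I" using assms by (simp add: wp_def)
  thus ?thesis using assms(2) that by (metis imageE)
qed

lemma wp_equivar:
  "f \<in> wp G I ==> i \<in> I ==> g \<in> carrier G ==> h \<in> carrier G ==> f (i, g) = (j, g') ==> f (i, g \<otimes>\<^bsub>G\<^esub> h) = (j, g' \<otimes>\<^bsub>G\<^esub> h)"
  by (simp add: wp_def)

lemma wp_id: "id \<in> wp G I" by (simp add: wp_def)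

lemma wpI:
  assumes "bij f" "!!x. x \<in> lt G I ==> f x \<in> lt G I" "!!x. x \<in> lt G I ==> \<exists>y \<in> lt G I. f y = x"
    "!!x. x \<notin> lt G I ==> f x = x"
    "!!i g h j g'. i \<in> I ==> g \<in> carrier G ==> h \<in> carrier G ==> f (i, g) = (j, g') ==> f (i, g \<otimes>\<^bsub>G\<^esub> h) = (j, g' \<otimes>\<^bsub>G\<^esub> h)"
  shows "f \<in> wp G I"
proof -
  have "f ` lt G I = lt G I" using assms(2,3) by (intro equalityI subsetI) (blast, metis image_eqI)
  thus ?thesis using assms(1,4,5) by (simp add: wp_def)
qed

lemma word_tl:
  assumes "a # x \<in> words I K p" shows "x \<in> words (I - {fst a}) K (p - 1)"
proof -
  have "fst b \<noteq> fst a" if "b \<in> set x" for b using assms that by (auto simp: words_def image_iff)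
  hence "b \<in> (I - {fst a}) \<times> K" if "b \<in> set x" for b using assms that by (auto simp: words_def mem_Times_iff)
  thus ?thesis using assms by (auto simp: words_def)
qed

context group
begin

lemma wp_comp: "v \<in> wp G I ==> w \<in> wp G I ==> v \<circ> w \<in> wp G I"
proof (rule wpI)
  assume v: "v \<in> wp G I" and w: "w \<in> wp G I"
  show "bij (v \<circ> w)" using v w by (simp add: wp_bij bij_comp)
  show "(v \<circ> w) x \<in> lt G I" if "x \<in> lt G I" for x using wp_in[OF v wp_in[OF w that]] by simp
  show "\<exists>y \<in> lt G I. (v \<circ> w) y = x" if "x \<in> lt G I" for x
  proof -
    obtain y where y: "y \<in> lt G I" "x = v y" by (rule wp_surj[OF v \<open>x \<in> lt G I\<close>])
    obtain z where "z \<in> lt G I" "y = w z" by (rule wp_surj[OF w y(1)])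
    thus ?thesis using y by auto
  qed
  show "(v \<circ> w) x = x" if "x \<notin> lt G I" for x using v w that by (simp add: wp_out)
  show "(v \<circ> w) (i, g \<otimes> h) = (j, g' \<otimes> h)"
    if "i \<in> I" "g \<in> carrier G" "h \<in> carrier G" "(v \<circ> w) (i, g) = (j, g')" for i g h j g'
  proof -
    obtain m k where mk: "w (i, g) = (m, k)" by fastforce
    hence "m \<in> I" "k \<in> carrier G" using wp_in[OF w, of "(i, g)"] that by auto
    thus ?thesis using that mk wp_equivar[OF w, of i g h m k] wp_equivar[OF v, of m k h j g'] by simp
  qed
qed

lemma wp_inv: "w \<in> wp G I ==> finv w \<in> wp G I"
proof (rule wpI)
  assume w: "w \<in> wp G I"
  note b = wp_bij[OF w]
  show "bij (finv w)" using b by (rule bij_imp_bij_inv)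
  have *: "finv w x \<in> lt G I" if "x \<in> lt G I" for x
  proof -
    obtain y where "y \<in> lt G I" "x = w y" by (rule wp_surj[OF w \<open>x \<in> lt G I\<close>])
    thus ?thesis using b by (simp add: finv_f)
  qed
  thus "x \<in> lt G I ==> finv w x \<in> lt G I" for x .
  show "\<exists>y \<in> lt G I. finv w y = x" if "x \<in> lt G I" for x using wp_in[OF w that] b by (metis finv_f(1))
  show "finv w x = x" if "x \<notin> lt G I" for x using wp_out[OF w that] b by (metis finv_f(1))
  show "finv w (i, g \<otimes> h) = (j, g' \<otimes> h)" if "i \<in> I" "g \<in> carrier G" "h \<in> carrier G" "finv w (i, g) = (j, g')" for i g h j g'
  proof -
    have "w (j, g') = (i, g)" "j \<in> I" "g' \<in> carrier G" using that *[of "(i, g)"] finv_f(2)[OF b, of "(i, g)"] by auto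
    hence "w (j, g' \<otimes> h) = (i, g \<otimes> h)" using wp_equivar[OF w, of j g' h i g] that by simp
    thus ?thesis using b by (metis finv_f(1))
  qed
qed

text \<open>Elements are the identity off \<open>I \<times> G\<close>. Hence enlarging the index set
  is a literal inclusion of groups, and the stabilisation map on bar chains is an inclusion as
  well.\<close>

lemma wp_mono: "I \<subseteq> J ==> wp G I \<subseteq> wp G J"
proof
  fix f assume I: "I \<subseteq> J" and f: "f \<in> wp G I"
  have in_iff: "f x \<in> lt G I \<longleftrightarrow> x \<in> lt G I" for x using wp_in[OF f] wp_out[OF f] by metis
  show "f \<in> wp G J"
  proof (rule wpI)
    show "f x \<in> lt G J" if "x \<in> lt G J" for x using I that wp_in[OF f, of x] wp_out[OF f, of x] by (cases "x \<in> lt G I") auto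
    show "\<exists>y \<in> lt G J. f y = x" if "x \<in> lt G J" for x
    proof (cases "x \<in> lt G I")
      case True
      then obtain y where "y \<in> lt G I" "x = f y" using wp_surj[OF f] by blast
      thus ?thesis using I by blast
    next
      case False
      thus ?thesis using that wp_out[OF f] by blast
    qed
    show "f x = x" if "x \<notin> lt G J" for x using I that by (intro wp_out[OF f]) auto
    show "f (i, g \<otimes> h) = (j, g' \<otimes> h)" if "i \<in> J" "g \<in> carrier G" "h \<in> carrier G" "f (i, g) = (j, g')" for i g h j g'
    proof (cases "i \<in> I")
      case True
      thus ?thesis using wp_equivar[OF f] that by simp
    next
      case False
      thus ?thesis using wp_out[OF f, of "(i, g)"] wp_out[OF f, of "(i, g \<otimes> h)"] that by auto
    qed
  qed (rule wp_bij[OF f])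
qed

text \<open>By equivariance one fixed point over \<open>a\<close> forces the whole fibre over
  \<open>a\<close> to be fixed; bijectivity then keeps the other fibres away from it.\<close>

lemma wp_fix:
  assumes f: "f \<in> wp G I" and fa: "f (a, g) = (a, g)" and g: "g \<in> carrier G" shows "f \<in> wp G (I - {a})"
proof (cases "a \<in> I")
  case True
  have fa': "f (a, h) = (a, h)" if "h \<in> carrier G" for h using wp_equivar[OF f True g _ fa, of "inv g \<otimes> h"] g that by (simp add: m_assoc[symmetric])
  have ne: "fst (f x) \<noteq> a" if "x \<in> (I - {a}) \<times> carrier G" for x
  proof
    assume "fst (f x) = a"
    then obtain h where h: "f x = (a, h)" by (metis prod.collapse)
    hence "h \<in> carrier G" using wp_in[OF f, of x] that by auto
    hence "f (a, h) = f x" using fa' h by simp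
    thus False using wp_bij[OF f] that by (auto simp: bij_def inj_eq)
  qed
  show ?thesis
  proof (rule wpI)
    show "f x \<in> (I - {a}) \<times> carrier G" if "x \<in> (I - {a}) \<times> carrier G" for x
      using ne[OF that] wp_in[OF f, of x] that by (simp add: mem_Times_iff)
    show "\<exists>y \<in> (I - {a}) \<times> carrier G. f y = x" if x: "x \<in> (I - {a}) \<times> carrier G" for x
    proof -
      obtain y where y: "y \<in> lt G I" "x = f y" using wp_surj[OF f, of x] x by blast
      hence "fst y \<noteq> a" using x fa' by (metis DiffD2 insertI1 mem_Times_iff prod.collapse)
      hence "y \<in> (I - {a}) \<times> carrier G" using y by (simp add: mem_Times_iff)
      thus ?thesis using y by blast
    qed
    show "f x = x" if "x \<notin> (I - {a}) \<times> carrier G" for x using that fa' wp_out[OF f, of x] by (cases x) auto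
    show "f (i, g \<otimes> h) = (j, g' \<otimes> h)" if "i \<in> I - {a}" "g \<in> carrier G" "h \<in> carrier G" "f (i, g) = (j, g')" for i g h j g'
      using wp_equivar[OF f] that by simp
  qed (rule wp_bij[OF f])
qed (use f in simp)

lemma wp_fix_word:
  assumes "f \<in> wp G I" "map f x = x" "x \<in> gw G I p" shows "f \<in> wp G (I - fst ` set x)"
proof -
  have *: "f \<in> wp G (I - fst ` set x)" if "set x \<subseteq> lt G I" "map f x = x" for x using that
  proof (induction x)
    case Nil
    thus ?case using assms by simp
  next
    case (Cons l x)
    thus ?case using wp_fix[of f "I - fst ` set x" "fst l" "snd l"] by (auto simp: Diff_insert[symmetric] insert_commute)
  qed
  show ?thesis using *[of x] assms by (simp add: words_def)
qed

text \<open>If two images lie in one fibre, a right multiplication carries one to the other, and by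
  equivariance and injectivity it does the same with the arguments.\<close>

lemma wp_fst_inj:
  assumes f: "f \<in> wp G I" and x: "x \<in> lt G I" "y \<in> lt G I" and eq: "fst (f x) = fst (f y)" shows "fst x = fst y"
proof -
  obtain i g where x': "x = (i, g)" by fastforce
  obtain j h where y': "y = (j, h)" by fastforce
  obtain m k where fx: "f x = (m, k)" by fastforce
  obtain l where fy: "f y = (m, l)" using eq fx by (metis fst_conv prod.collapse)
  have mem: "k \<in> carrier G" "l \<in> carrier G" using wp_in[OF f x(1)] wp_in[OF f x(2)] fx fy by auto
  hence "f (i, g \<otimes> (inv k \<otimes> l)) = (m, k \<otimes> (inv k \<otimes> l))" using wp_equivar[OF f] x x' fx by simp
  hence "f (i, g \<otimes> (inv k \<otimes> l)) = f y" using fy mem by (simp add: m_assoc[symmetric])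
  thus ?thesis using wp_bij[OF f] x' y' by (auto simp: bij_def inj_eq)
qed

lemma wp_word: "f \<in> wp G I ==> x \<in> gw G I p ==> map f x \<in> gw G I p"
proof -
  assume f: "f \<in> wp G I" and x: "x \<in> gw G I p"
  have i: "inj_on fst (set x)" and d: "distinct x" and sx: "set x \<subseteq> lt G I" using x by (auto simp: words_def distinct_map)
  have "inj_on (fst \<circ> f) (set x)"
  proof (rule inj_onI)
    fix y z assume "y \<in> set x" "z \<in> set x" "(fst \<circ> f) y = (fst \<circ> f) z"
    hence "fst y = fst z" using wp_fst_inj[OF f, of y z] sx by auto
    thus "y = z" using i \<open>y \<in> set x\<close> \<open>z \<in> set x\<close> by (simp add: inj_on_eq_iff)
  qed
  hence "distinct (map fst (map f x))" using d by (simp add: distinct_map)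
  moreover have "f ` set x \<subseteq> lt G I" using wp_in[OF f] sx by blast
  ultimately show ?thesis using x by (simp add: words_def del: distinct_map map_map)
qed

lemma inv_cancel [simp]: "a \<in> carrier G ==> y \<in> carrier G ==> inv a \<otimes> (a \<otimes> y) = y"
  "a \<in> carrier G ==> y \<in> carrier G ==> a \<otimes> (inv a \<otimes> y) = y" by (simp_all add: m_assoc[symmetric])

text \<open>The equivariant element that takes the letter \<open>a\<close> to the letter
  \<open>b\<close>, whether they lie in different fibres or in the same one. Exchanging the
  arguments gives the inverse.\<close>

definition lswap :: "nat \<times> 'a => nat \<times> 'a => nat \<times> 'a => nat \<times> 'a" where
  "lswap a b x = (if snd x \<notin> carrier G then x
     else if fst x = fst a then (fst b, snd b \<otimes> (inv (snd a) \<otimes> snd x))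
     else if fst x = fst b then (fst a, snd a \<otimes> (inv (snd b) \<otimes> snd x)) else x)"

lemma lswap_lswap: "snd a \<in> carrier G ==> snd b \<in> carrier G ==> lswap b a (lswap a b x) = x" by (cases x) (auto simp: lswap_def)

lemma lswap_wp:
  assumes a: "a \<in> lt G I" and b: "b \<in> lt G I" shows "lswap a b \<in> wp G I"
proof (rule wpI)
  have ab: "snd a \<in> carrier G" "snd b \<in> carrier G" "fst a \<in> I" "fst b \<in> I" using a b by auto
  show "bij (lswap a b)" by (rule o_bij[of "lswap b a"]) (auto simp: fun_eq_iff lswap_lswap ab)
  have *: "lswap a b x \<in> lt G I" if "x \<in> lt G I" "snd a \<in> carrier G" "snd b \<in> carrier G" "fst a \<in> I" "fst b \<in> I" for x a b
    using that by (auto simp: lswap_def mem_Times_iff)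
  thus "lswap a b x \<in> lt G I" if "x \<in> lt G I" for x using that ab by blast
  show "\<exists>y \<in> lt G I. lswap a b y = x" if "x \<in> lt G I" for x using *[of x b a] that ab lswap_lswap[of b a x] by metis
  show "lswap a b x = x" if "x \<notin> lt G I" for x using that ab by (cases x) (auto simp: lswap_def)
  show "lswap a b (i, g \<otimes> h) = (j, g' \<otimes> h)" if "i \<in> I" "g \<in> carrier G" "h \<in> carrier G" "lswap a b (i, g) = (j, g')" for i g h j g'
    using that ab by (auto simp: lswap_def m_assoc split: if_splits)
qed

text \<open>Move the head of \<open>y\<close> to that of \<open>x\<close>, match the tails by an
  element supported off the fibre of this head, and move back.\<close>

lemma wp_transitive: "x \<in> gw G I p ==> y \<in> gw G I p ==> \<exists>f \<in> wp G I. map f x = y"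
proof (induction x arbitrary: y I p)
  case Nil
  thus ?case using wp_id by (auto simp: words_def)
next
  case (Cons a x)
  obtain b y' where y: "y = b # y'" using Cons.prems by (cases y) (auto simp: words_def)
  have ab: "a \<in> lt G I" "b \<in> lt G I" using Cons.prems y by (auto simp: words_def)
  let ?s = "lswap b a" and ?s' = "lswap a b"
  have s: "?s \<in> wp G I" "?s' \<in> wp G I" using lswap_wp ab by blast+
  have sb: "?s b = a" "?s' a = b" using ab by (cases a; cases b; auto simp: lswap_def)+
  have "map ?s (b # y') \<in> gw G I p" using wp_word[OF s(1)] Cons.prems(2) y by blast
  hence 1: "map ?s y' \<in> gw G (I - {fst a}) (p - 1)" using sb word_tl by fastforce
  have 2: "x \<in> gw G (I - {fst a}) (p - 1)" using Cons.prems(1) word_tl by blast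
  obtain f where f: "f \<in> wp G (I - {fst a})" "map f x = map ?s y'" using Cons.IH[OF 2 1] by blast
  have "f a = a" using f(1) by (rule wp_out) (cases a, auto)
  moreover have "map (?s' \<circ> f) x = y'" using f(2) ab by (simp add: map_map[symmetric] del: map_map) (simp add: lswap_lswap comp_def mem_Times_iff)
  ultimately have "map (?s' \<circ> f) (a # x) = y" using y sb by simp
  moreover have "?s' \<circ> f \<in> wp G I" using wp_comp[OF s(2)] f(1) wp_mono[of "I - {fst a}" I] by blast
  ultimately show ?case by blast
qed

end

section \<open>The bar complex of the wreath product with coefficients in words\<close>

fun nf :: "'a list \<times> ('a => 'a) list => 'a list \<times> ('a => 'a) list" where "nf (x, []) = (x, [])"
| "nf (x, w # ws) = (map (finv w) x, map (\<lambda>v. finv w \<circ> v) ws)"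

abbreviation "lact w \<equiv> map ((\<circ>) w)"

definition blists :: "('a => 'a) list set" where "blists = {L. \<forall>w \<in> set L. bij w}"

definition uv :: "'b \<times> 'a list => ('b \<times> 'a list, 'u::comm_ring_1) chain" where "uv y = pm (Pair (fst y)) (bd (snd y))"

text \<open>A pair \<open>(x, ws)\<close> stands for the orbit of a word and a homogeneous tuple
  under the diagonal action: \<open>nf\<close> moves the first group element to the identity and
  drops it. The differential puts the identity back, applies the homogeneous differential
  \<open>uv\<close> and normalises again. It is 0 on \<open>ws = []\<close>, as the empty tuple is
  not part of the complex.\<close>

definition tv :: "'a list \<times> ('a => 'a) list => ('a list \<times> ('a => 'a) list, 'u::comm_ring_1) chain" where
  "tv y = (if snd y = [] then 0 else pm nf (uv (fst y, id # snd y)))"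

definition th :: "'a list \<times> 'b => ('a list \<times> 'b, 'u::comm_ring_1) chain" where "th y = pm (\<lambda>x. (x, snd y)) (bd (fst y))"

lemma nf_act:
  assumes "bij f" "L \<noteq> []" "L \<in> blists" shows "nf (map f x, lact f L) = nf (x, L)"
  using assms by (cases L) (auto simp: blists_def finv_comp finv_f comp_assoc fun_eq_iff)

lemma nf_id: "nf (x, id # ws) = (x, ws)" by (auto simp: inv_id intro: map_idI)

lemma blists_bd: "L \<in> blists ==> l \<in> keys (bd L :: (_, 'u::comm_ring_1) chain) ==> l \<in> blists"
  using keys_bd_set unfolding blists_def by fastforce

lemma keys_bd_nonempty: "2 \<le> length L ==> l \<in> keys (bd L :: (_, 'u::comm_ring_1) chain) ==> l \<noteq> []"
  by (auto dest!: keys_bd_length)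

text \<open>The homogeneous differential is equivariant, so it may be taken on any representative of
  the orbit. Two entries are required because \<open>nf\<close> has to find an entry to normalise
  after one has been deleted.\<close>

lemma tv_nf:
  assumes L: "L \<in> blists" "2 \<le> length L" shows "tv (nf (x, L)) = pm nf (uv (x, L))"
proof -
  obtain w ws where ws: "L = w # ws" "ws \<noteq> []" using L(2) by (cases L) (auto simp: neq_Nil_conv Suc_le_length_iff)
  have w: "bij w" using L ws by (simp add: blists_def)
  define f where "f = finv w"
  have f: "bij f" using w by (simp add: f_def bij_imp_bij_inv)
  have fw: "f \<circ> w = id" using w by (simp add: f_def fun_eq_iff finv_f)
  have "tv (nf (x, L)) = pm nf (uv (map f x, lact f L))" using fw by (simp add: tv_def ws f_def)
  also have "... = pm (\<lambda>l. nf (map f x, lact f l)) (bd L)" unfolding uv_def by (simp add: bd_map pm_pm)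
  also have "... = pm (\<lambda>l. nf (x, l)) (bd L)" by (rule pm_cong) (use L f nf_act blists_bd keys_bd_nonempty in blast)
  finally show ?thesis by (simp add: uv_def pm_pm)
qed

lemma lin_tv_nf: "f \<in> fspan {y. snd y \<in> blists \<and> 2 \<le> length (snd y)} ==> lin tv (pm nf f) = pm nf (lin uv f)"
  unfolding lin_pm pm_lin by (rule lin_cong') (auto simp: tv_nf)

lemma fspan_uv:
  assumes "snd y \<in> blists" shows "(uv y :: (_, 'u::comm_ring_1) chain) \<in> fspan {z. snd z \<in> blists \<and> length (snd z) = length (snd y) - 1}"
  unfolding uv_def
proof (rule fspan_pm)
  show "(bd (snd y) :: (_, 'u) chain) \<in> fspan (keys (bd (snd y) :: (_, 'u) chain))" by (simp add: fspan_def)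
  fix l assume l: "l \<in> keys (bd (snd y) :: (_, 'u) chain)"
  show "(fst y, l) \<in> {z. snd z \<in> blists \<and> length (snd z) = length (snd y) - 1}" using keys_bd_length[OF l] blists_bd[OF assms l] by simp
qed

lemma lin_uv_uv: "lin uv (uv y) = 0" by (simp add: uv_def lin_pm pm_lin[symmetric] bd_bd)

lemma tv_tv:
  assumes "snd y \<in> blists" shows "lin tv (tv y) = 0"
proof (cases "snd y = []")
  case False
  let ?y = "(fst y, id # snd y)"
  have b: "snd ?y \<in> blists" using assms by (simp add: blists_def)
  show ?thesis
  proof (cases "length (snd y) = 1")
    case True
    have "lin tv (pm nf (uv ?y)) = lin (\<lambda>y. tv (nf y)) (uv ?y)" by (simp add: lin_pm)
    also have "... = lin (\<lambda>_. 0) (uv ?y)"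
    proof (rule lin_cong')
      show "uv ?y \<in> fspan {y. length (snd y) = 1}" using fspan_uv[OF b] True by (rule_tac fspan_mono) auto
      fix z :: "'a list \<times> ('a => 'a) list"
      assume "z \<in> {y. length (snd y) = 1}"
      thus "tv (nf z) = 0" by (cases z) (auto simp: tv_def length_Suc_conv)
    qed
    finally show ?thesis using False by (simp add: tv_def lin_fun)
  next
    case F: False
    with False have "2 \<le> length (snd y)" by (cases "length (snd y)") auto
    hence "uv ?y \<in> fspan {y. snd y \<in> blists \<and> 2 \<le> length (snd y)}" using fspan_uv[OF b] by (rule_tac fspan_mono) auto
    thus ?thesis using False lin_tv_nf[of "uv ?y"] by (simp add: tv_def lin_uv_uv)
  qed
qed (simp add: tv_def)

lemma lin_swap: "lin (\<lambda>x. pm (\<lambda>y. F x y) g) f = lin (\<lambda>y. pm (\<lambda>x. F x y) f) g" unfolding pm_def lin_def scale_sum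
  by (subst sum.swap) (auto intro!: sum.cong simp: mult.commute)

lemma th_th: "lin th (th y) = 0" by (simp add: th_def lin_pm pm_lin[symmetric] bd_bd)

lemma th_nf: "L \<noteq> [] ==> th (nf (x, L)) = pm (\<lambda>x. nf (x, L)) (bd x)" by (cases L) (simp_all add: th_def bd_map pm_pm)

text \<open>The two differentials delete entries of different lists, so they commute rather than
  anticommute; the double complex is used without inserting signs.\<close>

lemma tv_th: "lin tv (th y) = (lin th (tv y) :: (_, 'u::comm_ring_1) chain)"
proof (cases "snd y = []")
  case True
  thus ?thesis by (simp add: tv_def th_def lin_pm lin_fun)
next
  case False
  have "(lin tv (th y) :: (_, 'u) chain) = lin (\<lambda>x. pm (\<lambda>l. nf (x, l)) (bd (id # snd y))) (bd (fst y))"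
    using False by (simp add: th_def tv_def lin_pm uv_def pm_pm)
  also have "... = lin (\<lambda>l. pm (\<lambda>x. nf (x, l)) (bd (fst y))) (bd (id # snd y))" by (rule lin_swap)
  also have "... = lin (\<lambda>l. th (nf (fst y, l))) (bd (id # snd y))"
  proof (rule lin_cong)
    fix l assume "l \<in> keys (bd (id # snd y) :: (_, 'u) chain)"
    hence "l \<noteq> []" using False keys_bd_nonempty[of "id # snd y" l] by (cases "snd y") auto
    thus "pm (\<lambda>x. nf (x, l)) (bd (fst y)) = th (nf (fst y, l))" by (simp add: th_nf)
  qed
  also have "... = lin th (tv y)" using False by (simp add: tv_def uv_def lin_pm del: bd.simps)
  finally show ?thesis .
qed

subsection \<open>The prism homotopy\<close>

text \<open>The usual triangulation of a prism: the alternating sum of the tuples that follow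
  \<open>f\<close> up to some entry and \<open>g\<close> from the same entry on.\<close>

fun prism :: "('a => 'b) => ('a => 'b) => 'a list => ('b list, 'u::comm_ring_1) chain" where
  "prism f g [] = 0"
| "prism f g (w # ws) = sg (f w # g w # map g ws) 1 - pm (Cons (f w)) (prism f g ws)"

lemma bd_prism: "lin bd (prism f g l) = sg (map g l) 1 - sg (map f l) 1 - lin (prism f g) (bd l)"
  by (induction l) (simp_all add: lin_diff lin_bd_Cons lin_pm lin_fun pm_lin[symmetric] bd_map pm_pm flip: pm_def)

lemma keys_prism:
  "m \<in> keys (prism f g l :: (_, 'u::comm_ring_1) chain) ==> length m = Suc (length l) \<and> set m \<subseteq> f ` set l \<union> g ` set l"
proof (induction l arbitrary: m)
  case (Cons w ws)
  have "keys (prism f g (w # ws) :: (_, 'u) chain) \<subseteq> keys (sg (f w # g w # map g ws) (1::'u)) \<union> keys (pm (Cons (f w)) (prism f g ws :: (_, 'u) chain))"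
    using keys_diff by (metis prism.simps(2))
  then consider "m = f w # g w # map g ws" | m' where "m = f w # m'" "m' \<in> keys (prism f g ws :: (_, 'u) chain)"
    using Cons.prems keys_pm[of "Cons (f w)" "prism f g ws :: (_, 'u) chain"] by auto
  thus ?case by cases (use Cons.IH in auto)
qed simp

lemma prism_map: "prism f g (map h l) = prism (\<lambda>x. f (h x)) (\<lambda>x. g (h x)) l" by (induction l) (simp_all add: comp_def)

lemma map_prism: "pm (map h) (prism f g l) = prism (\<lambda>x. h (f x)) (\<lambda>x. h (g x)) l"
  by (induction l) (simp_all add: comp_def pm_pm, simp add: pm_pm[symmetric] flip: pm_pm)

lemma prism_cong: "(!!x. x \<in> set l ==> f x = f' x \<and> g x = g' x) ==> prism f g l = prism f' g' l"
  by (induction l) (auto cong: map_cong)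

lemma lin_uv_Pair: "lin uv (pm (Pair x) f) = pm (Pair x) (lin bd f)" by (simp add: lin_pm uv_def pm_lin)

lemma tv_prism:
  assumes "l \<noteq> []" "!!w. w \<in> set l ==> bij (f w) \<and> bij (g w)" shows "lin tv (pm nf (pm (Pair x) (prism f g l))) =
    sg (nf (x, map g l)) 1 - sg (nf (x, map f l)) 1 - (pm nf (pm (Pair x) (lin (prism f g) (bd l))) :: (_, 'u::comm_ring_1) chain)"
proof -
  have "pm (Pair x) (prism f g l :: (_, 'u) chain) \<in> fspan {y. snd y \<in> blists \<and> 2 \<le> length (snd y)}"
  proof (rule fspan_pm[of _ "keys (prism f g l :: (_, 'u) chain)"])
    fix m assume "m \<in> keys (prism f g l :: (_, 'u) chain)"
    hence "length m = Suc (length l)" "set m \<subseteq> f ` set l \<union> g ` set l" using keys_prism by blast+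
    thus "(x, m) \<in> {y. snd y \<in> blists \<and> 2 \<le> length (snd y)}" using assms by (cases l) (auto simp: blists_def)
  qed (simp add: fspan_def)
  from lin_tv_nf[OF this] show ?thesis by (simp add: lin_uv_Pair bd_prism)
qed

lemma fspan_subset: "S \<subseteq> T ==> fspan S \<subseteq> fspan T" by (auto simp: fspan_def)

lemma words_Nil: "[] \<in> words I K 0" by (simp add: words_def)

text \<open>The sum of the coefficients, obtained by pushing forward to a point.\<close>

definition eps :: "('a, 'u::comm_ring_1) chain => 'u" where "eps f = lkp (pm (\<lambda>_. ()) f) ()"

lemma eps_simps [simp]: "eps (sg s c) = c" "eps 0 = 0" "eps (f + g) = eps f + eps g" "eps (f - g) = eps f - eps g" "eps (pm h f) = eps f"
  by (simp_all add: eps_def lookup_add lookup_minus pm_pm)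

lemma eps_bd: "eps (bd x) = (if odd (length x) then 1 else 0)" by (induction x) auto

text \<open>The inclusion attached to a word \<open>x\<close>: a bar chain becomes one with
  coefficient \<open>x\<close>. It is applied to chains of a group that fixes \<open>x\<close>,
  whose word component is empty.\<close>

definition jm :: "'a list => ('a list \<times> 'b, 'u::comm_ring_1) chain => ('a list \<times> 'b, 'u) chain" where
  "jm x = pm (\<lambda>y. (x, snd y))"

lemma th_jm: "lin th (jm x c) = lin (\<lambda>y. jm y c) (bd x)"
proof -
  have "lin th (jm x c) = lin (\<lambda>y. pm (\<lambda>x. (x, snd y)) (bd x)) c" by (simp add: jm_def lin_pm th_def)
  thus ?thesis unfolding jm_def lin_swap[of "\<lambda>x y. (x, snd y)"] .
qed

definition wl :: "('g, 'x) monoid_scheme => nat set => nat => (nat \<times> 'g => nat \<times> 'g) list set" where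
  "wl G I q = {ws. set ws \<subseteq> wp G I \<and> length ws = q}"

text \<open>Bidegree \<open>(p, q)\<close> of the double complex. For \<open>p = 0\<close> only the
  empty word occurs, so \<open>XX G I 0\<close> is the bar complex of \<open>wp G I\<close>.\<close>

definition XX :: "('g, 'x) monoid_scheme => nat set => nat => nat =>
    ((nat \<times> 'g) list \<times> (nat \<times> 'g => nat \<times> 'g) list, 'u::comm_ring_1) chain set" where
  "XX G I p q = fspan (gw G I p \<times> wl G I q)"

lemma XX_closed [simp, intro]: "0 \<in> XX G I p q" "x \<in> XX G I p q ==> y \<in> XX G I p q ==> x + y \<in> XX G I p q"
  "x \<in> XX G I p q ==> y \<in> XX G I p q ==> x - y \<in> XX G I p q" "x \<in> XX G I p q ==> - x \<in> XX G I p q"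
  "x \<in> XX G I p q ==> scale c x \<in> XX G I p q" by (auto simp: XX_def)

lemma wl_blists: "L \<in> wl G I q ==> L \<in> blists" using wp_bij by (auto simp: wl_def blists_def)

lemma wl_bd: "L \<in> wl G I (Suc q) ==> bd L \<in> fspan (wl G I q)" using keys_bd_length keys_bd_set by (fastforce simp: wl_def fspan_def)

lemma XX_th: "z \<in> XX G I (Suc p) q ==> lin th z \<in> XX G I p q" unfolding XX_def
  by (rule fspan_lin, assumption) (auto simp: th_def intro!: fspan_pm words_bd)

lemma tv_0: "z \<in> XX G I p 0 ==> lin tv z = 0" unfolding XX_def using lin_cong'[of z _ tv "\<lambda>_. 0"] by (force simp: wl_def tv_def lin_fun)

context group
begin

lemma nf_in: "x \<in> gw G I p ==> L \<in> wl G I (Suc q) ==> nf (x, L) \<in> gw G I p \<times> wl G I q"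
  by (cases L) (auto simp: wl_def intro!: wp_word wp_comp wp_inv)

lemma XX_tv:
  assumes "z \<in> XX G I p (Suc q)" shows "lin tv z \<in> XX G I p q"
proof -
  have *: "tv (x, ws) \<in> XX G I p q" if "x \<in> gw G I p" "ws \<in> wl G I (Suc q)" for x ws
  proof -
    have "id # ws \<in> wl G I (Suc (Suc q))" using that wp_id by (auto simp: wl_def)
    from wl_bd[OF this] show ?thesis using that nf_in unfolding XX_def by (auto simp: tv_def uv_def pm_pm intro!: fspan_pm simp del: bd.simps)
  qed
  show ?thesis unfolding XX_def by (rule fspan_lin[OF assms[unfolded XX_def]]) (use * in \<open>auto simp: XX_def\<close>)
qed

lemma wl_mono: "I \<subseteq> J ==> wl G I q \<subseteq> wl G J q" using wp_mono[of I J] by (auto simp: wl_def)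

lemma XX_mono:
  assumes "I \<subseteq> J" shows "XX G I p q \<subseteq> XX G J p q" unfolding XX_def
proof (rule fspan_subset, rule Sigma_mono)
  show "gw G I p \<subseteq> gw G J p" using assms by (force simp: words_def)
qed (rule wl_mono[OF assms])

lemma jm_in: "c \<in> XX G I' 0 q ==> I' \<subseteq> I ==> x \<in> gw G I p ==> jm x c \<in> XX G I p q"
  unfolding XX_def jm_def using wl_mono[of I' I q] by (auto intro!: fspan_pm)

lemma wp_fixes_word: "f \<in> wp G I ==> fst ` set x \<inter> I = {} ==> map f x = x" by (rule map_idI) (auto intro!: wp_out)

lemma nf_fixed:
  assumes "L \<in> wl G I' (Suc q)" "fst ` set x \<inter> I' = {}" shows "nf (x, L) = (x, snd (nf ([], L)))"
proof -
  obtain w ws where L: "L = w # ws" "w \<in> wp G I'" using assms(1) by (cases L) (auto simp: wl_def)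
  show ?thesis using wp_fixes_word[OF wp_inv[OF L(2)] assms(2)] by (simp only: L nf.simps snd_conv)
qed

text \<open>A word off \<open>I'\<close> is fixed by \<open>wp G I'\<close>, so normalising never
  changes it.\<close>

lemma tv_jm:
  assumes "c \<in> XX G I' 0 q" "fst ` set x \<inter> I' = {}" shows "lin tv (jm x c) = jm x (lin tv c)" unfolding jm_def lin_pm pm_lin
proof (rule lin_cong'[OF assms(1)[unfolded XX_def]])
  fix y assume y: "y \<in> gw G I' 0 \<times> wl G I' q"
  show "tv (x, snd y) = pm (\<lambda>y. (x, snd y)) (tv y)"
  proof (cases "snd y = []")
    case False
    have L: "id # snd y \<in> wl G I' (Suc q)" using y wp_id by (auto simp: wl_def)
    obtain q' where q': "q = Suc q'" using y False by (cases q) (auto simp: wl_def)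
    have y1: "fst y = []" using y by (auto simp: words_def)
    have "tv (x, snd y) = pm (\<lambda>l. nf (x, l)) (bd (id # snd y))" using False by (simp add: tv_def uv_def pm_pm del: bd.simps)
    also have "... = pm (\<lambda>l. (x, snd (nf ([], l)))) (bd (id # snd y))" by (rule pm_cong'[OF wl_bd[OF L]]) (use q' assms(2) nf_fixed in blast)
    also have "... = pm (\<lambda>y. (x, snd y)) (tv y)" using False y1 by (simp add: tv_def uv_def pm_pm del: bd.simps)
    finally show ?thesis .
  qed (simp add: tv_def)
qed

lemma wp_commute:
  assumes f: "f \<in> wp G A" and w: "w \<in> wp G B" and AB: "A \<inter> B = {}" shows "f \<circ> w = w \<circ> f"
proof
  fix x
  consider "x \<in> A \<times> carrier G" | "x \<in> B \<times> carrier G" | "x \<notin> A \<times> carrier G" "x \<notin> B \<times> carrier G" by blast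
  thus "(f \<circ> w) x = (w \<circ> f) x"
  proof cases
    case 1
    hence "x \<notin> B \<times> carrier G" "f x \<notin> B \<times> carrier G" using AB wp_in[OF f 1] by auto
    thus ?thesis using wp_out[OF w] by simp
  next
    case 2
    hence "x \<notin> A \<times> carrier G" "w x \<notin> A \<times> carrier G" using AB wp_in[OF w 2] by auto
    thus ?thesis using wp_out[OF f] by simp
  next
    case 3
    thus ?thesis using wp_out[OF f] wp_out[OF w] by simp
  qed
qed

lemma pm_nf_inv:
  assumes w: "w \<in> wp G I" "map w x = x" and m: "!!m. m \<in> keys f ==> m \<noteq> [] \<and> m \<in> blists"
  shows "pm nf (pm (Pair x) (pm (lact w) f)) = pm nf (pm (Pair x) f)" unfolding pm_pm
proof (rule pm_cong)
  fix l assume "l \<in> keys f"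
  hence "nf (map w x, lact w l) = nf (x, l)" using m wp_bij[OF w(1)] by (intro nf_act) auto
  thus "nf (x, lact w l) = nf (x, l)" using w by simp
qed

end

section \<open>Shapiro's lemma for the stabiliser of a word\<close>

locale shapiro = group G for G :: "('g, 'x) monoid_scheme" (structure) +
  fixes I :: "nat set" and p :: nat and x0 :: "(nat \<times> 'g) list"
  assumes x0: "x0 \<in> gw G I p"
begin

definition "I' = I - fst ` set x0"

lemma I': "I' \<subseteq> I" "fst ` set x0 \<inter> I' = {}" by (auto simp: I'_def)

text \<open>A transporter from \<open>x0\<close> to \<open>x\<close>. For \<open>x0\<close> itself
  it is prescribed as \<open>id\<close>, which makes the retraction below the identity on the
  stabiliser.\<close>

definition tr :: "(nat \<times> 'g) list => nat \<times> 'g => nat \<times> 'g" where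
  "tr x = (if x = x0 then id else SOME f. f \<in> wp G I \<and> map f x0 = x)"

lemma tr: "x \<in> gw G I p ==> tr x \<in> wp G I \<and> map (tr x) x0 = x"
  using someI_ex[of "\<lambda>f. f \<in> wp G I \<and> map f x0 = x"] wp_transitive[OF x0, of x] wp_id by (auto simp: tr_def)

text \<open>A retraction of the group onto the stabiliser of \<open>x0\<close>: the preimage of
  \<open>x0\<close> under \<open>w\<close> is reached from \<open>x0\<close> by a transporter, and
  following it by \<open>w\<close> returns to \<open>x0\<close>. It is equivariant under left
  multiplication by the stabiliser.\<close>

definition re :: "(nat \<times> 'g => nat \<times> 'g) => nat \<times> 'g => nat \<times> 'g" where
  "re w = w \<circ> tr (map (finv w) x0)"

lemma in_I': "f \<in> wp G I ==> map f x0 = x0 ==> f \<in> wp G I'" unfolding I'_def by (rule wp_fix_word[OF _ _ x0])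

lemma I'_fixes: "f \<in> wp G I' ==> map f x0 = x0" using wp_fixes_word[OF _ I'(2)] .

lemma I'_I: "f \<in> wp G I' ==> f \<in> wp G I" using wp_mono[OF I'(1)] by blast

lemma map_finv: "bij f ==> map f x = y ==> map (finv f) y = x" by (auto simp: finv_f comp_def)

lemma re_in: "w \<in> wp G I ==> re w \<in> wp G I'"
proof (rule in_I')
  assume w: "w \<in> wp G I"
  note t = tr[OF wp_word[OF wp_inv[OF w] x0]]
  show "re w \<in> wp G I" using w t by (auto simp: re_def intro: wp_comp)
  show "map (re w) x0 = x0"
  proof -
    have "map (re w) x0 = map w (map (tr (map (finv w) x0)) x0)" by (simp add: re_def)
    also have "... = map w (map (finv w) x0)" using t by (simp only:)
    also have "... = x0" using wp_bij[OF w] by (simp add: finv_f comp_def)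
    finally show ?thesis .
  qed
qed

lemma re_equivar: "w' \<in> wp G I' ==> w \<in> wp G I ==> re (w' \<circ> w) = w' \<circ> re w"
proof -
  assume w': "w' \<in> wp G I'" and w: "w \<in> wp G I"
  have "map (finv (w' \<circ> w)) x0 = map (finv w) (map (finv w') x0)" using wp_bij[OF w'] wp_bij[OF w] by (simp add: finv_comp)
  also have "map (finv w') x0 = x0" using map_finv[OF wp_bij[OF w'] I'_fixes[OF w']] .
  finally have "map (finv (w' \<circ> w)) x0 = map (finv w) x0" .
  thus ?thesis unfolding re_def by (simp only: comp_assoc)
qed

lemma re_id: "w \<in> wp G I' ==> re w = w"
proof -
  assume w: "w \<in> wp G I'"
  have "map (finv w) x0 = x0" using map_finv[OF wp_bij[OF w] I'_fixes[OF w]] .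
  thus ?thesis unfolding re_def tr_def by (simp only: simp_thms if_True comp_id)
qed

definition nrm :: "(nat \<times> 'g) list => (nat \<times> 'g => nat \<times> 'g) list => (nat \<times> 'g => nat \<times> 'g) list" where
  "nrm x L = map ((\<circ>) (finv (tr x))) L"

text \<open>The word is moved to \<open>x0\<close> by its transporter, and then the tuple is
  retracted entrywise to the stabiliser.\<close>

definition rho where "rho y = nf ([], map re (nrm (fst y) (id # snd y)))"

definition hh where "hh y = pm nf (pm (Pair x0) (prism re id (nrm (fst y) (id # snd y))))"

lemma nrm_in: "x \<in> gw G I p ==> L \<in> wl G I q ==> nrm x L \<in> wl G I q"
  using tr[of x] by (auto simp: wl_def nrm_def intro!: wp_comp wp_inv)

lemma map_re_in: "L \<in> wl G I q ==> map re L \<in> wl G I' q" by (auto simp: wl_def intro: re_in)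

text \<open>Passing to another representative of the orbit multiplies the transported tuple by an
  element of the stabiliser. This makes \<open>rho\<close> and \<open>hh\<close> independent of the
  representative.\<close>

lemma nrm_nf:
  assumes x: "x \<in> gw G I p" and L: "L \<in> wl G I (Suc q)"
  obtains w' where "w' \<in> wp G I'" "nrm (fst (nf (x, L))) (id # snd (nf (x, L))) = lact w' (nrm x L)"
proof -
  obtain w ws where ws: "L = w # ws" "w \<in> wp G I" using L by (cases L) (auto simp: wl_def)
  define y where "y = map (finv w) x"
  have y: "y \<in> gw G I p" using x ws by (simp add: y_def wp_word wp_inv)
  note tx = tr[OF x] and ty = tr[OF y]
  \<comment> \<open>The round trip from \<open>x0\<close> to \<open>x\<close>, along the inverse of
    \<open>w\<close> to \<open>y\<close>, and back to \<open>x0\<close>.\<close>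
  define w' where "w' = finv (tr y) \<circ> finv w \<circ> tr x"
  have "w' \<in> wp G I" using tx ty ws by (simp add: w'_def wp_comp wp_inv)
  moreover have "map w' x0 = x0"
  proof -
    have "map w' x0 = map (finv (tr y)) (map (finv w) (map (tr x) x0))" by (simp add: w'_def comp_assoc)
    also have "... = map (finv (tr y)) y" using tx by (simp only: y_def)
    also have "... = x0" using map_finv[OF wp_bij[OF conjunct1[OF ty]] conjunct2[OF ty]] .
    finally show ?thesis .
  qed
  ultimately have 1: "w' \<in> wp G I'" by (rule in_I')
  have 2: "w' \<circ> (finv (tr x) \<circ> u) = finv (tr y) \<circ> (finv w \<circ> u)" for u
    using finv_f[OF wp_bij[OF conjunct1[OF tx]]] by (simp add: w'_def fun_eq_iff)
  have 3: "finv w \<circ> w = id" using finv_f[OF wp_bij[OF ws(2)]] by (simp add: fun_eq_iff)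
  show thesis by (rule that[OF 1]) (simp add: ws nrm_def y_def[symmetric] 2 3)
qed

lemma rho_nf:
  assumes x: "x \<in> gw G I p" and L: "L \<in> wl G I (Suc q)" shows "rho (nf (x, L)) = nf ([], map re (nrm x L))"
proof -
  obtain w' where w': "w' \<in> wp G I'" "nrm (fst (nf (x, L))) (id # snd (nf (x, L))) = lact w' (nrm x L)" using nrm_nf[OF x L] .
  have n: "nrm x L \<in> wl G I (Suc q)" by (rule nrm_in[OF x L])
  have "map re (lact w' (nrm x L)) = lact w' (map re (nrm x L))" using n w' by (auto simp: wl_def intro!: re_equivar)
  moreover have "nf (map w' [], lact w' (map re (nrm x L))) = nf ([], map re (nrm x L))"
    using n wl_blists[OF map_re_in[OF n]] by (intro nf_act wp_bij[OF w'(1)]) (auto simp: wl_def)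
  ultimately show ?thesis unfolding rho_def w'(2) by (simp only: list.map(1))
qed

lemma hh_nf:
  assumes x: "x \<in> gw G I p" and L: "L \<in> wl G I (Suc q)" shows "hh (nf (x, L)) = (pm nf (pm (Pair x0) (prism re id (nrm x L))) :: (_, 'u::comm_ring_1) chain)"
proof -
  obtain w' where w': "w' \<in> wp G I'" "nrm (fst (nf (x, L))) (id # snd (nf (x, L))) = lact w' (nrm x L)" using nrm_nf[OF x L] .
  have n: "nrm x L \<in> wl G I (Suc q)" by (rule nrm_in[OF x L])
  have "(prism re id (lact w' (nrm x L)) :: (_, 'u) chain) = prism (\<lambda>u. re (w' \<circ> u)) (\<lambda>u. w' \<circ> u) (nrm x L)" by (simp add: prism_map)
  also have "... = prism (\<lambda>u. w' \<circ> re u) (\<lambda>u. w' \<circ> id u) (nrm x L)"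
    by (rule prism_cong) (use n w' in \<open>auto simp: wl_def intro!: re_equivar\<close>)
  also have "... = pm (lact w') (prism re id (nrm x L))" by (simp add: map_prism)
  finally have "hh (nf (x, L)) = (pm nf (pm (Pair x0) (pm (lact w') (prism re id (nrm x L)))) :: (_, 'u) chain)" by (simp add: hh_def w'(2))
  also have "... = pm nf (pm (Pair x0) (prism re id (nrm x L)))"
  proof (rule pm_nf_inv[OF w'(1) I'_fixes[OF w'(1)]])
    fix m assume "m \<in> keys (prism re id (nrm x L) :: (_, 'u) chain)"
    hence m: "length m = Suc (length (nrm x L))" "set m \<subseteq> re ` set (nrm x L) \<union> id ` set (nrm x L)" using keys_prism by blast+
    hence "set m \<subseteq> wp G I" using n re_in I'_I by (fastforce simp: wl_def)
    thus "m \<noteq> [] \<and> m \<in> blists" using m(1) wp_bij unfolding blists_def by fastforce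
  qed
  finally show ?thesis .
qed

lemma tv_rho:
  assumes z: "z \<in> XX G I p q" shows "lin tv (pm rho z) = pm rho (lin tv z)" unfolding lin_pm pm_lin
proof (rule lin_cong'[OF z[unfolded XX_def]])
  fix y assume "y \<in> gw G I p \<times> wl G I q"
  then obtain x ws where y: "y = (x, ws)" "x \<in> gw G I p" "ws \<in> wl G I q" by auto
  show "tv (rho y) = pm rho (tv y)"
  proof (cases q)
    case 0
    thus ?thesis using y by (simp add: wl_def rho_def nrm_def tv_def)
  next
    case (Suc q')
    have L: "id # ws \<in> wl G I (Suc q)" using y wp_id by (auto simp: wl_def)
    let ?M = "map re (nrm x (id # ws))"
    have M: "?M \<in> wl G I' (Suc q)" using map_re_in nrm_in L y by blast
    have "tv (rho y) = pm nf (uv ([], ?M))" unfolding rho_def y fst_conv snd_conv using M Suc wl_blists[OF M] by (intro tv_nf) (auto simp: wl_def)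
    also have "... = pm (\<lambda>l. nf ([], map re (nrm x l))) (bd (id # ws))" unfolding uv_def nrm_def by (simp only: fst_conv snd_conv bd_map pm_pm)
    also have "... = pm (\<lambda>l. rho (nf (x, l))) (bd (id # ws))" by (rule pm_cong'[OF wl_bd[OF L]]) (use Suc y rho_nf in auto)
    also have "... = pm rho (tv y)" using y Suc by (auto simp: tv_def uv_def pm_pm wl_def simp del: bd.simps)
    finally show ?thesis .
  qed
qed

lemma rho_in: "y \<in> gw G I p \<times> wl G I q ==> rho y \<in> gw G I' 0 \<times> wl G I' q"
proof -
  assume y: "y \<in> gw G I p \<times> wl G I q"
  hence "id # snd y \<in> wl G I (Suc q)" using wp_id by (auto simp: wl_def)
  hence "map re (nrm (fst y) (id # snd y)) \<in> wl G I' (Suc q)" using y by (intro map_re_in nrm_in) auto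
  from nf_in[OF words_Nil this] show ?thesis unfolding rho_def .
qed

lemma rho_jm: "c \<in> XX G I' 0 q ==> pm rho (jm x0 c) = c"
proof -
  assume c: "c \<in> XX G I' 0 q"
  have "rho (x0, snd y) = y" if "y \<in> gw G I' 0 \<times> wl G I' q" for y
  proof -
    have "nrm x0 (id # snd y) = id # snd y" by (simp add: nrm_def tr_def inv_id map_idI)
    moreover have "map re (id # snd y) = id # snd y" by (rule map_idI) (use that re_id wp_id in \<open>auto simp: wl_def\<close>)
    ultimately show ?thesis using that unfolding rho_def by (cases y) (simp add: words_def nf_id del: nf.simps list.map)
  qed
  thus ?thesis unfolding jm_def pm_pm using c by (intro pm_id) (auto simp: XX_def dest!: fspan_keys)
qed

text \<open>The prism between \<open>re\<close> and the identity is a homotopy on homogeneous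
  tuples. It is equivariant under the stabiliser and therefore descends to orbits.\<close>

lemma homotopy:
  assumes z: "z \<in> XX G I p q" shows "z = jm x0 (pm rho z) + lin tv (lin hh z) + lin hh (lin tv z :: (_, 'u::comm_ring_1) chain)"
proof -
  have "lin tv (lin hh z) = lin (\<lambda>y. sg y 1 - sg (x0, snd (rho y)) 1 - lin hh (tv y)) z" unfolding lin_lin
  proof (rule lin_cong'[OF z[unfolded XX_def]])
    fix y assume "y \<in> gw G I p \<times> wl G I q"
    then obtain x ws where y: "y = (x, ws)" "x \<in> gw G I p" "ws \<in> wl G I q" by auto
    have L: "id # ws \<in> wl G I (Suc q)" using y wp_id by (auto simp: wl_def)
    define M where "M = nrm x (id # ws)"
    have M: "M \<in> wl G I (Suc q)" unfolding M_def using nrm_in L y by blast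
    have t: "tr x \<in> wp G I" "map (tr x) x0 = x" using tr y by auto
    have "lin tv (hh y) = sg (nf (x0, map id M)) 1 - sg (nf (x0, map re M)) 1 - (pm nf (pm (Pair x0) (lin (prism re id) (bd M))) :: (_, 'u) chain)"
      unfolding hh_def y fst_conv snd_conv M_def[symmetric]
    proof (rule tv_prism)
      show "M \<noteq> []" using M by (auto simp: wl_def)
      fix w assume "w \<in> set M"
      hence "w \<in> wp G I" using M by (auto simp: wl_def)
      thus "bij (re w) \<and> bij (id w)" using wp_bij[of w] wp_bij[OF re_in[of w]] by simp
    qed
    moreover have "nf (x0, map id M) = y"
    proof -
      have "nf (x0, M) = nf (map (tr x) x0, lact (tr x) M)"
        by (rule nf_act[symmetric, OF wp_bij[OF t(1)] _ wl_blists[OF M]]) (use M in \<open>auto simp: wl_def\<close>)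
      also have "lact (tr x) M = id # ws" using wp_bij[OF t(1)] by (auto simp: M_def nrm_def fun_eq_iff finv_f intro!: map_idI)
      finally show ?thesis using t y by (simp add: nf_id del: nf.simps)
    qed
    moreover have "nf (x0, map re M) = (x0, snd (rho y))" unfolding rho_def y fst_conv snd_conv M_def[symmetric] by (rule nf_fixed[OF map_re_in[OF M] I'(2)])
    moreover have "pm nf (pm (Pair x0) (lin (prism re id) (bd M))) = (lin hh (tv y) :: (_, 'u) chain)"
    proof (cases q)
      case 0
      thus ?thesis using y by (simp add: M_def nrm_def wl_def tv_def)
    next
      case (Suc q')
      have "(pm nf (pm (Pair x0) (lin (prism re id) (bd M))) :: (_, 'u) chain) = lin (\<lambda>l. pm nf (pm (Pair x0) (prism re id (nrm x l)))) (bd (id # ws))"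
        unfolding M_def nrm_def by (simp only: bd_map lin_pm pm_lin)
      also have "... = lin (\<lambda>l. hh (nf (x, l))) (bd (id # ws))" by (rule lin_cong'[OF wl_bd[OF L]]) (simp only: Suc hh_nf[OF y(2)])
      also have "... = lin hh (tv y)" using y Suc by (auto simp: tv_def uv_def lin_pm wl_def simp del: bd.simps)
      finally show ?thesis .
    qed
    ultimately show "lin tv (hh y) = (sg y 1 - sg (x0, snd (rho y)) 1 - lin hh (tv y) :: (_, 'u) chain)" by simp
  qed
  also have "... = z - jm x0 (pm rho z) - lin hh (lin tv z)" by (simp add: lin_fun lin_lin jm_def pm_pm) (simp add: pm_def)
  finally show ?thesis by simp
qed

lemma hh_in: "z \<in> XX G I p q ==> lin hh z \<in> XX G I p (Suc q)"
proof -
  have "hh y \<in> fspan (gw G I p \<times> wl G I (Suc q))" if y: "y \<in> gw G I p \<times> wl G I q" for y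
  proof -
    have "id # snd y \<in> wl G I (Suc q)" using y wp_id by (auto simp: wl_def)
    hence n: "nrm (fst y) (id # snd y) \<in> wl G I (Suc q)" using y by (intro nrm_in) auto
    have "prism re id (nrm (fst y) (id # snd y)) \<in> fspan (wl G I (Suc (Suc q)))" using n keys_prism re_in I'_I unfolding fspan_def by (fastforce simp: wl_def)
    thus ?thesis unfolding hh_def pm_pm by (rule fspan_pm) (use nf_in x0 in blast)
  qed
  thus "z \<in> XX G I p q ==> lin hh z \<in> XX G I p (Suc q)" unfolding XX_def using fspan_lin by blast
qed

text \<open>\<open>rho\<close> is a chain map that recovers \<open>c\<close> from
  \<open>jm x0 c\<close>, so it carries a filling over the big group to one over the
  stabiliser.\<close>

lemma shapiro_inj:
  assumes "c \<in> XX G I' 0 q" "y \<in> XX G I p (Suc q)" "jm x0 c = lin tv y" shows "\<exists>b \<in> XX G I' 0 (Suc q). c = lin tv b"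
proof -
  have "c = lin tv (pm rho y)" using assms rho_jm tv_rho by metis
  moreover have "pm rho y \<in> XX G I' 0 (Suc q)" using assms(2) unfolding XX_def by (rule fspan_pm) (rule rho_in)
  ultimately show ?thesis by blast
qed

lemma shapiro_surj:
  assumes "z \<in> XX G I p q" "lin tv z = 0" shows "\<exists>c \<in> XX G I' 0 q. lin tv c = 0 \<and> (\<exists>b \<in> XX G I p (Suc q). z = jm x0 c + lin tv b)"
proof (intro bexI conjI)
  show "z = jm x0 (pm rho z) + lin tv (lin hh z)" using homotopy[OF assms(1)] assms(2) by simp
  show "lin tv (pm rho z) = 0" using tv_rho[OF assms(1)] assms(2) by simp
  show "pm rho z \<in> XX G I' 0 q" using assms(1) unfolding XX_def by (rule fspan_pm) (rule rho_in)
qed (rule hh_in[OF assms(1)])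

end

context group
begin

text \<open>Some \<open>f\<close> supported off \<open>J\<close> takes \<open>x\<close> to
  \<open>y\<close>, and it commutes with \<open>wp G J\<close>. Left composition with
  \<open>f\<close> is therefore homotopic to the identity compatibly with the group action, while
  the orbit of \<open>y\<close> with the tuple moved by \<open>f\<close> is the orbit of
  \<open>x\<close> with the original tuple.\<close>

lemma face_homotopy:
  assumes x: "x \<in> gw G I p" "y \<in> gw G I p" and J: "J \<subseteq> I" "fst ` set x \<inter> J = {}" "fst ` set y \<inter> J = {}"
    and c: "c \<in> XX G J 0 q" "lin tv c = (0 :: (_, 'u::comm_ring_1) chain)" shows "\<exists>b \<in> XX G I p (Suc q). jm y c = jm x c + lin tv b"
proof -
  have w: "x \<in> gw G (I - J) p" "y \<in> gw G (I - J) p"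
  proof -
    have "z \<in> gw G (I - J) p" if "z \<in> gw G I p" "fst ` set z \<inter> J = {}" for z
    proof -
      have "l \<in> (I - J) \<times> carrier G" if "l \<in> set z" for l
        using that \<open>z \<in> _\<close> \<open>fst ` set z \<inter> J = {}\<close> by (auto simp: words_def mem_Times_iff)
      thus ?thesis using that by (auto simp: words_def)
    qed
    thus "x \<in> gw G (I - J) p" "y \<in> gw G (I - J) p" using x J by blast+
  qed
  obtain f where f: "f \<in> wp G (I - J)" "map f x = y" using wp_transitive[OF w] by blast
  have fI: "f \<in> wp G I" using f(1) wp_mono[of "I - J" I] by blast
  have fA: "id ` A \<union> ((\<circ>) f) ` A \<subseteq> wp G I" if "A \<subseteq> wp G I" for A using that wp_comp[OF fI] by auto
  define P where "P l = (prism id ((\<circ>) f) l :: (_, 'u) chain)" for l :: "(nat \<times> 'a => nat \<times> 'a) list"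
  define k where "k z = pm nf (pm (Pair y) (P (id # snd z)))" for z :: "(nat \<times> 'a) list \<times> (nat \<times> 'a => nat \<times> 'a) list"
  \<comment> \<open>The normalising element lies in \<open>wp G J\<close>, hence commutes with
    \<open>f\<close> and fixes \<open>y\<close>; so the prism may be formed on any
    representative.\<close>
  have k_nf: "k (nf ([], L)) = pm nf (pm (Pair y) (P L))" if L: "L \<in> wl G J (Suc q')" for L q'
  proof -
    obtain w ws where ws: "L = w # ws" "w \<in> wp G J" using L by (cases L) (auto simp: wl_def)
    let ?v = "finv w"
    have v: "?v \<in> wp G J" using ws wp_inv by blast
    have vI: "?v \<in> wp G I" using v wp_mono[OF J(1)] by blast
    have fv: "f \<circ> ?v = ?v \<circ> f" by (rule wp_commute[OF f(1) v]) auto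
    have 3: "?v \<circ> w = id" using finv_f[OF wp_bij[OF ws(2)]] by (simp add: fun_eq_iff)
    have "P (lact ?v L) = pm (lact ?v) (P L)" unfolding P_def prism_map map_prism by (rule prism_cong) (simp add: comp_assoc[symmetric] fv)
    moreover have "id # snd (nf ([], L)) = lact ?v L" by (simp add: ws(1) 3)
    ultimately have "k (nf ([], L)) = pm nf (pm (Pair y) (pm (lact ?v) (P L)))" by (simp add: k_def)
    also have "... = pm nf (pm (Pair y) (P L))"
    proof (rule pm_nf_inv[OF vI wp_fixes_word[OF v J(3)]])
      fix m assume "m \<in> keys (P L)"
      hence m: "length m = Suc (length L)" "set m \<subseteq> id ` set L \<union> ((\<circ>) f) ` set L" using keys_prism unfolding P_def by blast+
      have "set L \<subseteq> wp G I" using L wp_mono[OF J(1)] by (auto simp: wl_def)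
      hence "set m \<subseteq> wp G I" using m(2) fA by (meson order_trans)
      thus "m \<noteq> [] \<and> m \<in> blists" using m(1) wp_bij unfolding blists_def by fastforce
    qed
    finally show ?thesis .
  qed
  have k: "lin tv (lin k c) = lin (\<lambda>z. sg (x, snd z) 1 - sg (y, snd z) 1 - lin k (tv z)) c" unfolding lin_lin
  proof (rule lin_cong'[OF c(1)[unfolded XX_def]])
    fix z assume z: "z \<in> gw G J 0 \<times> wl G J q"
    have L: "id # snd z \<in> wl G J (Suc q)" using z wp_id by (auto simp: wl_def)
    have "lin tv (k z) = sg (nf (y, lact f (id # snd z))) 1 - sg (nf (y, map id (id # snd z))) 1
        - (pm nf (pm (Pair y) (lin (prism id ((\<circ>) f)) (bd (id # snd z)))) :: (_, 'u) chain)" unfolding k_def P_def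
    proof (rule tv_prism)
      fix w assume "w \<in> set (id # snd z)"
      hence "bij w" using wl_blists[OF L] unfolding blists_def by blast
      thus "bij (id w) \<and> bij (f \<circ> w)" using wp_bij[OF fI] by (auto intro: bij_comp)
    qed simp
    moreover have "nf (y, lact f (id # snd z)) = (x, snd z)"
    proof -
      have "nf (map f x, lact f (id # snd z)) = nf (x, id # snd z)" by (rule nf_act[OF wp_bij[OF fI] _ wl_blists[OF L]]) simp
      thus ?thesis unfolding f(2) nf_id .
    qed
    moreover have "nf (y, map id (id # snd z)) = (y, snd z)" by (simp only: list.map_id nf_id)
    moreover have "pm nf (pm (Pair y) (lin (prism id ((\<circ>) f)) (bd (id # snd z)))) = lin k (tv z)"
    proof (cases q)
      case 0
      hence "snd z = []" using z by (auto simp: wl_def)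
      thus ?thesis by (simp add: tv_def)
    next
      case (Suc q')
      have z1: "fst z = []" "snd z \<noteq> []" using z Suc by (auto simp: words_def wl_def)
      have "pm nf (pm (Pair y) (lin (prism id ((\<circ>) f)) (bd (id # snd z)))) = lin (\<lambda>l. pm nf (pm (Pair y) (P l))) (bd (id # snd z))"
        unfolding P_def by (simp only: lin_pm pm_lin)
      also have "... = lin (\<lambda>l. k (nf ([], l))) (bd (id # snd z))" by (rule lin_cong'[OF wl_bd[OF L]]) (simp only: Suc k_nf)
      also have "... = lin k (tv z)" using z1 by (simp add: tv_def uv_def lin_pm del: bd.simps)
      finally show ?thesis .
    qed
    ultimately show "lin tv (k z) = sg (x, snd z) 1 - sg (y, snd z) 1 - lin k (tv z)" by simp
  qed
  have "lin tv (lin k c) = jm x c - jm y c - lin k (lin tv c)" unfolding k by (simp add: lin_fun lin_lin jm_def) (simp add: pm_def)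
  hence "jm y c = jm x c + lin tv (- lin k c)" using c(2) by (simp add: lin_uminus)
  moreover have "lin k c \<in> XX G I p (Suc q)" unfolding XX_def
  proof (rule fspan_lin[OF c(1)[unfolded XX_def]])
    fix z assume z: "z \<in> gw G J 0 \<times> wl G J q"
    have L: "id # snd z \<in> wl G J (Suc q)" using z wp_id by (auto simp: wl_def)
    have "P (id # snd z) \<in> fspan (wl G I (Suc (Suc q)))" unfolding fspan_def
    proof (clarify)
      fix m assume "m \<in> keys (P (id # snd z))"
      hence m: "length m = Suc (length (id # snd z))" "set m \<subseteq> id ` set (id # snd z) \<union> ((\<circ>) f) ` set (id # snd z)"
        using keys_prism unfolding P_def by blast+
      have "set (id # snd z) \<subseteq> wp G I" using L wp_mono[OF J(1)] by (auto simp: wl_def)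
      hence "set m \<subseteq> wp G I" using m(2) fA by (meson order_trans)
      thus "m \<in> wl G I (Suc (Suc q))" using m(1) L by (auto simp: wl_def)
    qed
    thus "k z \<in> fspan (gw G I p \<times> wl G I (Suc q))" unfolding k_def pm_pm by (rule fspan_pm) (use nf_in x in blast)
  qed
  ultimately show ?thesis by blast
qed

lemma faces_homotopy:
  assumes x: "x \<in> gw G I p" and J: "J \<subseteq> I" "fst ` set x \<inter> J = {}" and c: "c \<in> XX G J 0 q" "lin tv c = (0 :: (_, 'u::comm_ring_1) chain)"
    and f: "f \<in> fspan {y \<in> gw G I p. fst ` set y \<inter> J = {}}"
  shows "\<exists>b \<in> XX G I p (Suc q). lin (\<lambda>y. jm y c) f = scale (eps f) (jm x c) + lin tv b" using f
proof (induction rule: chain_induct)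
  case (single y r)
  then obtain b where "b \<in> XX G I p (Suc q)" "jm y c = jm x c + lin tv b" using face_homotopy[OF x _ J _ c] by blast
  thus ?case by (intro bexI[of _ "scale r b"]) (auto simp: scale_distrib lin_scale)
next
  case zero
  show ?case by (intro bexI[of _ 0]) auto
next
  case (add f g)
  then obtain b b' where "b \<in> XX G I p (Suc q)" "lin (\<lambda>y. jm y c) f = scale (eps f) (jm x c) + lin tv b"
    "b' \<in> XX G I p (Suc q)" "lin (\<lambda>y. jm y c) g = scale (eps g) (jm x c) + lin tv b'" by blast
  thus ?case by (intro bexI[of _ "b + b'"]) (auto simp: scale_distrib lin_add)
qed

text \<open>All faces of \<open>x1\<close> induce homologous inclusions, so only their alternating
  count matters: \<open>Suc p\<close> faces give 1 for even \<open>p\<close> and 0 for odd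
  \<open>p\<close>. This is the first differential of the spectral sequence, alternately
  stabilisation and zero.\<close>

lemma d1:
  assumes x: "x \<in> gw G I p" and x1: "x1 \<in> gw G I (Suc p)" and J: "J \<subseteq> I" "fst ` set x \<inter> J = {}" "fst ` set x1 \<inter> J = {}"
    and c: "c \<in> XX G J 0 q" "lin tv c = (0 :: (_, 'u::comm_ring_1) chain)"
  shows "\<exists>b \<in> XX G I p (Suc q). lin th (jm x1 c) = (if even p then jm x c else 0) + lin tv b"
proof -
  have "(bd x1 :: (_, 'u) chain) \<in> fspan {y \<in> gw G I p. fst ` set y \<inter> J = {}}"
  proof -
    have "fst ` set y \<inter> J = {}" if "y \<in> keys (bd x1 :: (_, 'u) chain)" for y using keys_bd_set[OF that] J(3) by blast
    thus ?thesis using words_bd[OF x1] by (auto simp: fspan_def)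
  qed
  from faces_homotopy[OF x J(1,2) c this] show ?thesis using x1 by (auto simp: th_jm eps_bd words_def)
qed

text \<open>The horizontal differential leaves the tuple alone. Splitting a chain by its tuple
  component reduces the claim to \<open>words_acyclic\<close>.\<close>

lemma columns_exact:
  assumes "finite I" "p < card I" and c: "c \<in> XX G I p q" "lin th c = (0 :: (_, 'u::comm_ring_1) chain)" shows "\<exists>y \<in> XX G I (Suc p) q. lin th y = c"
proof -
  define part where "part ws = Poly_Mapping.map_key (\<lambda>x. (x, ws)) c" for ws
  define S where "S = snd ` keys c"
  have inj: "inj (\<lambda>x. (x, ws))" for ws :: "(nat \<times> 'a => nat \<times> 'a) list" by (auto intro: injI)
  have keysc: "keys c \<subseteq> gw G I p \<times> wl G I q" using c by (simp add: XX_def fspan_def)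
  have dec: "c = (\<Sum>ws\<in>S. pm (\<lambda>x. (x, ws)) (part ws))"
  proof (rule poly_mapping_eqI)
    fix y :: "(nat \<times> 'a) list \<times> (nat \<times> 'a => nat \<times> 'a) list"
    obtain x ws where y: "y = (x, ws)" by fastforce
    have "lkp (pm (\<lambda>x. (x, ws')) (part ws')) y = (if ws' = ws then lkp c y else 0)" for ws'
    proof (cases "ws' = ws")
      case True
      thus ?thesis using lookup_pm_inj[OF inj, of ws "part ws" x] by (simp add: y part_def map_key.rep_eq[OF inj])
    next
      case False
      thus ?thesis by (auto simp: y intro: lookup_pm_notin)
    qed
    moreover have "lkp c y = 0" if "ws \<notin> S"
    proof -
      have "y \<notin> keys c" using that by (force simp: S_def y)
      thus ?thesis by (simp add: in_keys_iff)
    qed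
    moreover have "finite S" by (simp add: S_def)
    ultimately show "lkp c y = lkp (\<Sum>ws\<in>S. pm (\<lambda>x. (x, ws)) (part ws)) y" by (simp add: lookup_sum)
  qed
  have part: "part ws \<in> fspan (gw G I p)" for ws using keysc by (auto simp: fspan_def part_def in_keys_iff map_key.rep_eq[OF inj])
  have th_pm: "lin th (pm (\<lambda>x. (x, ws)) f) = pm (\<lambda>x. (x, ws)) (lin bd f)" for ws :: "(nat \<times> 'a => nat \<times> 'a) list" and f :: "(_, 'u) chain"
    by (simp add: lin_pm pm_lin th_def)
  have "lin bd (part ws) = 0" for ws
  proof (rule poly_mapping_eqI)
    fix x
    have "lkp (lin th c) (x, ws) = (\<Sum>ws'\<in>S. if ws' = ws then lkp (lin bd (part ws)) x else 0)"
      unfolding arg_cong[OF dec, of "lin th"] lin_sum th_pm lookup_sum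
    proof (rule sum.cong[OF refl])
      fix ws'
      show "lkp (pm (\<lambda>x. (x, ws')) (lin bd (part ws'))) (x, ws) = (if ws' = ws then lkp (lin bd (part ws)) x else 0)"
      proof (cases "ws' = ws")
        case True
        thus ?thesis using lookup_pm_inj[OF inj, of ws] by simp
      qed (auto intro: lookup_pm_notin)
    qed
    moreover have "part ws = 0" if "ws \<notin> S" using that unfolding part_def by (intro map_key_eq_0[OF inj]) (force simp: S_def)
    ultimately show "lkp (lin bd (part ws)) x = lkp 0 x" using c(2) by (cases "ws \<in> S") (auto simp: S_def)
  qed
  hence "\<exists>y. y \<in> fspan (gw G I (Suc p)) \<and> lin bd y = part ws" for ws using words_acyclic[OF assms(1,2) one_closed part] by blast
  then obtain y where y: "!!ws. y ws \<in> fspan (gw G I (Suc p))" "!!ws. lin bd (y ws) = part ws" by metis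
  show ?thesis
  proof (intro bexI)
    show "lin th (\<Sum>ws\<in>S. pm (\<lambda>x. (x, ws)) (y ws)) = c" unfolding lin_sum th_pm y(2) using dec by simp
    show "(\<Sum>ws\<in>S. pm (\<lambda>x. (x, ws)) (y ws)) \<in> XX G I (Suc p) q" unfolding XX_def
    proof (rule fspan_sum, rule fspan_pm[OF y(1)])
      fix ws x assume "ws \<in> S" "x \<in> gw G I (Suc p)"
      thus "(x, ws) \<in> gw G I (Suc p) \<times> wl G I q" using keysc by (auto simp: S_def)
    qed
  qed
qed

lemma words_extend:
  assumes "x \<in> gw G I p" "a \<in> I - fst ` set x" shows "x @ [(a, \<one>)] \<in> gw G I (Suc p)" using assms by (auto simp: words_def image_iff)

lemma words_exist:
  assumes "finite I" "p \<le> card I" shows "\<exists>x. x \<in> gw G I p" using assms(2)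
proof (induction p)
  case 0
  show ?case using words_Nil by blast
next
  case (Suc p)
  then obtain x where x: "x \<in> gw G I p" by auto
  hence "card (fst ` set x) < card I" using Suc.prems card_image_le[of "set x" fst] card_length[of x] by (force simp: words_def)
  hence "I - fst ` set x \<noteq> {}" by (metis Diff_eq_empty_iff card_mono finite_imageI List.finite_set leD)
  thus ?case using words_extend[OF x] by blast
qed

lemma card_compl_word:
  assumes "finite I" "x \<in> gw G I p" shows "card (I - fst ` set x) = card I - p"
proof -
  have "card (fst ` set x) = p" using assms distinct_card[of "map fst x"] by (simp add: words_def)
  moreover have "fst ` set x \<subseteq> I" using assms by (auto simp: words_def)
  ultimately show ?thesis by (simp add: card_Diff_subset)
qed

lemma jm_Nil: "c \<in> XX G I 0 q ==> jm [] c = c" unfolding jm_def by (rule pm_id) (auto simp: XX_def words_def dest!: fspan_keys)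

lemma word_shapiro: "x \<in> gw G I p ==> shapiro G I p x" by (simp add: shapiro_def shapiro_axioms_def is_group)

lemma word_shapiro_inj:
  assumes "x \<in> gw G I p" "c \<in> XX G (I - fst ` set x) 0 q" "y \<in> XX G I p (Suc q)" "jm x c = lin tv y"
  shows "\<exists>b \<in> XX G (I - fst ` set x) 0 (Suc q). c = lin tv b"
  using shapiro.shapiro_inj[OF word_shapiro[OF assms(1)]] assms shapiro.I'_def[OF word_shapiro[OF assms(1)]] by metis

lemma word_shapiro_surj:
  assumes "x \<in> gw G I p" "z \<in> XX G I p q" "lin tv z = 0"
  obtains c b where "c \<in> XX G (I - fst ` set x) 0 q" "lin tv c = 0" "b \<in> XX G I p (Suc q)" "z = jm x c + lin tv b"
  using shapiro.shapiro_surj[OF word_shapiro[OF assms(1)] assms(2,3)] shapiro.I'_def[OF word_shapiro[OF assms(1)]] by metis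

section \<open>The spectral sequence argument for the wreath products\<close>

definition stab_inj :: "'u::comm_ring_1 itself => nat set => nat => nat => bool" where
  "stab_inj TYPE('u) I a q \<longleftrightarrow> (\<forall>c \<in> XX G (I - {a}) 0 q. \<forall>y \<in> XX G I 0 (Suc q). c = lin tv y \<longrightarrow>
     (\<exists>b \<in> XX G (I - {a}) 0 (Suc q). c = (lin tv b :: (_, 'u) chain)))"

definition stab_surj :: "'u::comm_ring_1 itself => nat set => nat => nat => bool" where
  "stab_surj TYPE('u) I a q \<longleftrightarrow> (\<forall>z \<in> XX G I 0 q. lin tv z = 0 \<longrightarrow>
     (\<exists>c \<in> XX G (I - {a}) 0 q. lin tv c = 0 \<and> (\<exists>b \<in> XX G I 0 (Suc q). z = c + (lin tv b :: (_, 'u) chain))))"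

lemma th_tv: "lin th (lin tv z) = (lin tv (lin th z) :: (_, 'u::comm_ring_1) chain)" by (simp add: lin_lin tv_th)

lemma tv_tv': "z \<in> XX G I p q ==> lin tv (lin tv z) = (0 :: (_, 'u::comm_ring_1) chain)"
proof -
  assume z: "z \<in> XX G I p q"
  have "lin (\<lambda>y. lin tv (tv y)) z = (lin (\<lambda>_. 0) z :: (_, 'u) chain)" by (rule lin_cong'[OF z[unfolded XX_def]]) (auto intro!: tv_tv wl_blists)
  thus ?thesis by (simp add: lin_lin lin_fun)
qed

lemma th_th': "lin th (lin th z) = (0 :: (_, 'u::comm_ring_1) chain)" by (simp add: lin_lin th_th lin_fun)

lemma th_0: "z \<in> XX G I 0 q ==> lin th z = (0 :: (_, 'u::comm_ring_1) chain)"
proof -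
  assume z: "z \<in> XX G I 0 q"
  have "lin th z = (lin (\<lambda>_. 0) z :: (_, 'u) chain)" by (rule lin_cong'[OF z[unfolded XX_def]]) (auto simp: words_def th_def)
  thus ?thesis by (simp add: lin_fun)
qed

text \<open>Vanishing of the second page at \<open>(p, q)\<close>, written with elements, where the
  first page is vertical homology: the hypotheses say that the class of \<open>y\<close> is a cycle
  for the first differential, the conclusion that it is a boundary.\<close>

definition e2 :: "'u::comm_ring_1 itself => nat set => nat => nat => bool" where
  "e2 TYPE('u) I p q \<longleftrightarrow> (\<forall>y \<in> XX G I p q. \<forall>u \<in> XX G I (p - 1) (Suc q). lin tv y = 0 \<longrightarrow> lin th y = lin tv u \<longrightarrow>
     (\<exists>z \<in> XX G I (Suc p) q. lin tv z = 0 \<and> (\<exists>b \<in> XX G I p (Suc q). y = lin th z + (lin tv b :: (_, 'u) chain))))"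

lemma word_extension:
  assumes fin: "finite I" and p: "p < card I"
  obtains x a where "x \<in> gw G I p" "a \<in> I - fst ` set x" "card (I - fst ` set x) = card I - p" "x @ [(a, \<one>)] \<in> gw G I (Suc p)"
proof -
  obtain x where x: "x \<in> gw G I p" using words_exist[OF fin, of p] p by auto
  have c: "card (I - fst ` set x) = card I - p" by (rule card_compl_word[OF fin x])
  then obtain a where "a \<in> I - fst ` set x" using p by (metis card.empty diff_is_0_eq not_less ex_in_conv)
  thus thesis using that[OF x _ c] words_extend[OF x] by blast
qed

text \<open>Up to a boundary, \<open>y\<close> comes from a cycle \<open>c\<close> of the stabiliser
  of a word of length \<open>Suc p\<close>. As \<open>p\<close> is even, the outgoing first
  differential is stabilisation into the wreath product on \<open>card I - p\<close> letters; its
  injectivity makes \<open>c\<close>, and then \<open>y\<close>, a vertical boundary.\<close>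

lemma e2_odd:
  assumes fin: "finite I" and p: "Suc p \<le> card I" "even p"
    and stab: "!!J a. finite J ==> card J = card I - p ==> a \<in> J ==> stab_inj TYPE('u::comm_ring_1) J a q"
  shows "e2 TYPE('u) I (Suc p) q" unfolding e2_def
proof (intro ballI impI)
  fix y u :: "(_, 'u) chain"
  assume y: "y \<in> XX G I (Suc p) q" "lin tv y = 0" and u: "u \<in> XX G I (Suc p - 1) (Suc q)" "lin th y = lin tv u"
  obtain x a where x: "x \<in> gw G I p" and a: "a \<in> I - fst ` set x" and c1: "card (I - fst ` set x) = card I - p"
    and x': "x @ [(a, \<one>)] \<in> gw G I (Suc p)" using word_extension[OF fin, of p] p(1) by auto
  let ?I1 = "I - fst ` set x" and ?x = "x @ [(a, \<one>)]"
  have I2: "I - fst ` set ?x = ?I1 - {a}" by auto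
  obtain c b where c: "c \<in> XX G (?I1 - {a}) 0 q" "lin tv c = 0" "b \<in> XX G I (Suc p) (Suc q)" "y = jm ?x c + lin tv b"
    using word_shapiro_surj[OF x' y] unfolding I2 by blast
  obtain b1 where b1: "b1 \<in> XX G I p (Suc q)" "lin th (jm ?x c) = jm x c + lin tv b1" using d1[OF x x' _ _ _ c(1,2)] p(2) by auto
  have "jm x c = lin tv (u - lin th b - b1)" using u(2) b1(2) unfolding c(4) by (simp add: lin_add lin_diff th_tv algebra_simps)
  moreover have "u - lin th b - b1 \<in> XX G I p (Suc q)" using u(1) b1(1) XX_th[OF c(3)] by simp
  ultimately obtain b2 where b2: "b2 \<in> XX G ?I1 0 (Suc q)" "c = lin tv b2" using word_shapiro_inj[OF x, of c] c(1) XX_mono[of "?I1 - {a}" ?I1] by blast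
  have "stab_inj TYPE('u) ?I1 a q" using stab c1 fin a by simp
  then obtain b3 where b3: "b3 \<in> XX G (?I1 - {a}) 0 (Suc q)" "c = lin tv b3" using c(1) b2 unfolding stab_inj_def by blast
  have disj: "fst ` set ?x \<inter> (?I1 - {a}) = {}" by auto
  have "y = lin th 0 + lin tv (jm ?x b3 + b)" using tv_jm[OF b3(1) disj] c(4) b3(2) by (simp add: lin_add)
  moreover have "jm ?x b3 + b \<in> XX G I (Suc p) (Suc q)" using jm_in[OF b3(1) _ x'] c(3) by auto
  ultimately show "\<exists>z \<in> XX G I (Suc (Suc p)) q. lin tv z = 0 \<and> (\<exists>b \<in> XX G I (Suc p) (Suc q). y = lin th z + lin tv b)"
    by (intro bexI[of _ 0] conjI bexI[of _ "jm ?x b3 + b"]) auto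
qed

text \<open>For even \<open>p\<close> the incoming first differential is stabilisation into the
  wreath product on \<open>card I - p\<close> letters, and its surjectivity accounts for every class
  at \<open>p\<close>.\<close>

lemma e2_even:
  assumes fin: "finite I" and p: "p < card I" "even p"
    and stab: "!!J a. finite J ==> card J = card I - p ==> a \<in> J ==> stab_surj TYPE('u::comm_ring_1) J a q"
  shows "e2 TYPE('u) I p q" unfolding e2_def
proof (intro ballI impI)
  fix y :: "(_, 'u) chain"
  assume y: "y \<in> XX G I p q" "lin tv y = 0"
  obtain x a where x: "x \<in> gw G I p" and a: "a \<in> I - fst ` set x" and c1: "card (I - fst ` set x) = card I - p"
    and x': "x @ [(a, \<one>)] \<in> gw G I (Suc p)" using word_extension[OF fin, of p] p(1) by auto
  let ?I1 = "I - fst ` set x" and ?x = "x @ [(a, \<one>)]"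
  obtain c b where c: "c \<in> XX G ?I1 0 q" "lin tv c = 0" "b \<in> XX G I p (Suc q)" "y = jm x c + lin tv b" using word_shapiro_surj[OF x y] by blast
  have "stab_surj TYPE('u) ?I1 a q" using stab c1 fin a by simp
  then obtain c' b' where c': "c' \<in> XX G (?I1 - {a}) 0 q" "lin tv c' = 0" "b' \<in> XX G ?I1 0 (Suc q)" "c = c' + lin tv b'"
    using c(1,2) unfolding stab_surj_def by blast
  obtain b1 where b1: "b1 \<in> XX G I p (Suc q)" "lin th (jm ?x c') = jm x c' + lin tv b1" using d1[OF x x' _ _ _ c'(1,2)] p(2) by auto
  have jb: "lin tv (jm x b') = jm x (lin tv b')" by (rule tv_jm[OF c'(3)]) auto
  have "y = lin th (jm ?x c') + lin tv (jm x b' + b - b1)" unfolding b1(2) lin_add lin_diff jb c(4) c'(4) by (simp add: jm_def)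
  moreover have "jm ?x c' \<in> XX G I (Suc p) q" using jm_in[OF c'(1) _ x'] by auto
  moreover have "lin tv (jm ?x c') = 0" using tv_jm[OF c'(1), of ?x] c'(2) by (auto simp: jm_def)
  moreover have "jm x b' + b - b1 \<in> XX G I p (Suc q)" using jm_in[OF c'(3) _ x] c(3) b1(1) by auto
  ultimately show "\<exists>z \<in> XX G I (Suc p) q. lin tv z = 0 \<and> (\<exists>b \<in> XX G I p (Suc q). y = lin th z + lin tv b)" by blast
qed

text \<open>Disposes of the higher differentials. Exactness gives a chain \<open>y\<close> at
  \<open>(p + 1, q - 1)\<close> whose horizontal image is the vertical boundary of \<open>x\<close>,
  and by induction \<open>y\<close> may be replaced by a vertical cycle. The second page vanishes
  there, so this cycle is a horizontal image plus the vertical boundary of some \<open>b\<close>;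
  then \<open>x\<close> is corrected by the horizontal image of \<open>b\<close>, which does not
  affect its own horizontal image.\<close>

lemma chase:
  fixes x :: "(_, 'u::comm_ring_1) chain"
  assumes "finite I" "p + q \<le> card I" "1 \<le> p" and e2: "!!i. 1 \<le> i ==> i \<le> q ==> e2 TYPE('u) I (p + i) (q - i)"
    and x: "x \<in> XX G I p q" "lin th (lin tv x) = 0" shows "\<exists>x' \<in> XX G I p q. lin tv x' = 0 \<and> lin th x' = lin th x" using assms
proof (induction q arbitrary: p x)
  case 0
  thus ?case using tv_0 by blast
next
  case (Suc q)
  have vx: "lin tv x \<in> XX G I p q" using Suc.prems by (intro XX_tv)
  obtain y where y: "y \<in> XX G I (Suc p) q" "lin th y = lin tv x" using columns_exact[OF Suc.prems(1) _ vx Suc.prems(6)] Suc.prems(2) by auto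
  have "lin th (lin tv y) = lin tv (lin tv x)" by (simp add: th_tv y)
  also have "... = 0" by (rule tv_tv'[OF Suc.prems(5)])
  finally have "\<exists>x' \<in> XX G I (Suc p) q. lin tv x' = 0 \<and> lin th x' = lin th y"
    using Suc.IH[of "Suc p" y] Suc.prems(1,2) Suc.prems(4)[of "Suc _"] y(1) by simp
  then obtain y' where y': "y' \<in> XX G I (Suc p) q" "lin tv y' = 0" "lin th y' = lin tv x" using y by auto
  have "e2 TYPE('u) I (Suc p) q" using Suc.prems(4)[of 1] by simp
  then obtain z b where z: "z \<in> XX G I (Suc (Suc p)) q" "b \<in> XX G I (Suc p) (Suc q)" "y' = lin th z + lin tv b"
    using y' Suc.prems(5) unfolding e2_def by (metis diff_Suc_1)
  have "lin tv (x - lin th b) = 0" using y'(3) unfolding z(3) by (simp add: lin_diff lin_add th_th' th_tv)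
  moreover have "lin th (x - lin th b) = lin th x" by (simp add: lin_diff th_th')
  moreover have "x - lin th b \<in> XX G I p (Suc q)" using Suc.prems(5) XX_th[OF z(2)] by simp
  ultimately show ?case by blast
qed

text \<open>The second page is used at \<open>(p + i, q - i)\<close> with \<open>p\<close> equal to
  1 or 2. The groups that govern these entries have at least \<open>card I - 2 * i\<close> letters,
  which is what the induction hypothesis in degree \<open>q - i\<close> asks for. Surjectivity is
  read off at \<open>(1, q)\<close> and injectivity at \<open>(2, q)\<close>.\<close>

theorem wreath_stability:
  assumes "finite I" "a \<in> I" "2 * q + 2 \<le> card I" shows "stab_inj TYPE('u::comm_ring_1) I a q \<and> stab_surj TYPE('u) I a q" using assms
proof (induction q arbitrary: I a rule: less_induct)
  case (less q)
  have x1: "[(a, \<one>)] \<in> gw G I 1" using less.prems(2) by (simp add: words_def)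
  have I1: "I - fst ` set [(a, \<one>)] = I - {a}" by simp
  have e2: "e2 TYPE('u) I (p + i) (q - i)" if p: "p = 1 \<or> p = 2" and i: "1 \<le> i" "i \<le> q" for p i
  proof (cases "even (p + i)")
    case True
    show ?thesis
    proof (rule e2_even[OF less.prems(1) _ True])
      show "p + i < card I" using p i less.prems(3) by auto
      fix J :: "nat set" and a assume J: "finite J" "card J = card I - (p + i)" "a \<in> J"
      \<comment> \<open>Parity excludes \<open>p = 2\<close>, \<open>i = 1\<close>, the one case in
        which this bound would fail.\<close>
      have "p + i \<le> 2 * i" using p i True by (cases "i = 1") auto
      hence "2 * (q - i) + 2 \<le> card J" using J p i less.prems(3) by auto
      thus "stab_surj TYPE('u) J a (q - i)" using less.IH[of "q - i" J a] J i by simp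
    qed
  next
    case False
    then obtain m where m: "p + i = Suc m" "even m" by (cases "p + i") auto
    have "e2 TYPE('u) I (Suc m) (q - i)"
    proof (rule e2_odd[OF less.prems(1) _ m(2)])
      show "Suc m \<le> card I" using m p i less.prems(3) by auto
      fix J :: "nat set" and a assume J: "finite J" "card J = card I - m" "a \<in> J"
      have "2 * (q - i) + 2 \<le> card J" using J m p i less.prems(3) by auto
      thus "stab_inj TYPE('u) J a (q - i)" using less.IH[of "q - i" J a] J i by simp
    qed
    thus ?thesis using m by simp
  qed
  have "stab_surj TYPE('u) I a q" unfolding stab_surj_def
  proof (intro ballI impI)
    fix z :: "(_, 'u) chain"
    assume z: "z \<in> XX G I 0 q" "lin tv z = 0"
    have "lin th z = 0" using z(1) by (rule th_0)
    then obtain x where x: "x \<in> XX G I 1 q" "lin th x = z" using columns_exact[OF less.prems(1) _ z(1)] less.prems(3) by auto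
    obtain x' where x': "x' \<in> XX G I 1 q" "lin tv x' = 0" "lin th x' = z"
      using chase[OF less.prems(1), of 1 q x] e2[of 1] less.prems(3) x z by (auto simp: th_tv)
    obtain c b where c: "c \<in> XX G (I - {a}) 0 q" "lin tv c = 0" "b \<in> XX G I 1 (Suc q)" "x' = jm [(a, \<one>)] c + lin tv b"
      using word_shapiro_surj[OF x1 x'(1,2)] unfolding I1 by blast
    obtain b1 where b1: "b1 \<in> XX G I 0 (Suc q)" "lin th (jm [(a, \<one>)] c) = jm [] c + lin tv b1"
      using d1[OF words_Nil x1[unfolded One_nat_def] _ _ _ c(1,2)] by auto
    have "z = c + lin tv (b1 + lin th b)" using x'(3) jm_Nil[OF c(1)] unfolding c(4) by (simp add: lin_add th_tv b1(2) add.assoc)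
    moreover have "b1 + lin th b \<in> XX G I 0 (Suc q)" using b1(1) XX_th[of b G I 0] c(3) by simp
    ultimately show "\<exists>c \<in> XX G (I - {a}) 0 q. lin tv c = 0 \<and> (\<exists>b \<in> XX G I 0 (Suc q). z = c + lin tv b)" using c(1,2) by blast
  qed
  moreover have "stab_inj TYPE('u) I a q" unfolding stab_inj_def
  proof (intro ballI impI)
    fix c y :: "(_, 'u) chain"
    assume c: "c \<in> XX G (I - {a}) 0 q" and y: "y \<in> XX G I 0 (Suc q)" "c = lin tv y"
    have c0: "lin tv c = 0" using y tv_tv' by blast
    \<comment> \<open>The class of \<open>c\<close> at \<open>(1, q)\<close>. Its horizontal image
      bounds \<open>y + b1\<close>, which exactness lifts to some \<open>w\<close> in column 1;
      subtracting the vertical boundary of \<open>w\<close> leaves a horizontally closed chain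
      \<open>?r\<close>, which comes from column 2.\<close>
    let ?x = "jm [(a, \<one>)] c"
    have x: "?x \<in> XX G I 1 q" "lin tv ?x = 0" using jm_in[OF c _ x1] tv_jm[OF c, of "[(a, \<one>)]"] c0 by (auto simp: jm_def)
    obtain b1 where b1: "b1 \<in> XX G I 0 (Suc q)" "lin th ?x = jm [] c + lin tv b1" using d1[OF words_Nil x1[unfolded One_nat_def] _ _ _ c c0] by auto
    have hx: "lin th ?x = lin tv (y + b1)" using b1(2) jm_Nil[OF c] y(2) by (simp add: lin_add)
    have yb: "y + b1 \<in> XX G I 0 (Suc q)" using y b1 by simp
    have "lin th (y + b1) = 0" using yb by (rule th_0)
    then obtain w where w: "w \<in> XX G I 1 (Suc q)" "lin th w = y + b1" using columns_exact[OF less.prems(1) _ yb] less.prems(3) by auto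
    let ?r = "?x - lin tv w"
    have r: "?r \<in> XX G I 1 q" "lin th ?r = 0" "lin tv ?r = 0" using x XX_tv[OF w(1)] hx w(2) tv_tv'[OF w(1)] by (auto simp: lin_diff th_tv)
    then obtain t where t: "t \<in> XX G I 2 q" "lin th t = ?r" using columns_exact[OF less.prems(1) _ r(1,2)] less.prems(3) by (auto simp: numeral_2_eq_2)
    obtain t' where t': "t' \<in> XX G I 2 q" "lin tv t' = 0" "lin th t' = ?r"
      using chase[OF less.prems(1), of 2 q t] e2[of 2] less.prems(3) t r(3) by (auto simp: th_tv)
    obtain v where v: "v \<in> gw G I 1" "v = [(a, \<one>)]" using x1 by blast
    have "card (I - fst ` set v) \<noteq> 0" using card_compl_word[OF less.prems(1) v(1)] less.prems(3) by simp
    then obtain a' where a': "a' \<in> I - fst ` set v" by (metis card.empty ex_in_conv)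
    let ?v = "v @ [(a', \<one>)]"
    have v2: "?v \<in> gw G I (Suc 1)" by (rule words_extend[OF v(1) a'])
    obtain d b2 where d: "d \<in> XX G (I - fst ` set ?v) 0 q" "lin tv d = 0" "b2 \<in> XX G I 2 (Suc q)" "t' = jm ?v d + lin tv b2"
      using word_shapiro_surj[OF v2, of t' q] t' by (auto simp: numeral_2_eq_2)
    \<comment> \<open>From column 2 to column 1 the first differential is zero, so \<open>d\<close>
      contributes only a vertical boundary.\<close>
    obtain b3 where b3: "b3 \<in> XX G I 1 (Suc q)" "lin th (jm ?v d) = lin tv b3" using d1[OF v(1) v2 _ _ _ d(1,2)] by auto
    have "?x = lin tv (w + b3 + lin th b2)" using t'(3) unfolding d(4) lin_add th_tv b3(2) by (simp add: lin_add algebra_simps)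
    moreover have "w + b3 + lin th b2 \<in> XX G I 1 (Suc q)" using w b3 XX_th[of b2 G I 1] d(3) by (simp add: numeral_2_eq_2)
    ultimately show "\<exists>b \<in> XX G (I - {a}) 0 (Suc q). c = lin tv b" using word_shapiro_inj[OF x1, of c q] c unfolding I1 by blast
  qed
  ultimately show ?case by blast
qed

end

section \<open>Chains over the ideal of an idempotent \<eta>: those fixed by multiplication with
  \<eta>\<close>

definition ech :: "'u::comm_ring_1 => 'b set => ('b, 'u) chain set" where "ech \<eta> A = {f \<in> fspan A. scale \<eta> f = f}"

lemma ech_fspan [intro]: "f \<in> ech \<eta> A ==> f \<in> fspan A" by (simp add: ech_def)

lemma ech_eta: "f \<in> ech \<eta> A ==> scale \<eta> f = f" by (simp add: ech_def)

lemma ech_sg: "s \<in> A ==> \<eta> * r = r ==> sg s r \<in> ech \<eta> A" by (simp add: ech_def)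

lemma ech_lin: "f \<in> ech \<eta> A ==> (!!s. s \<in> A ==> \<phi> s \<in> fspan B) ==> lin \<phi> f \<in> ech \<eta> B"
  by (auto simp: ech_def lin_scale[symmetric] intro: fspan_lin)

lemma ech_lin': "f \<in> fspan A ==> (!!s. s \<in> A ==> \<phi> s \<in> ech \<eta> B) ==> lin \<phi> f \<in> ech \<eta> B"
proof -
  assume *: "f \<in> fspan A" "!!s. s \<in> A ==> \<phi> s \<in> ech \<eta> B"
  have "scale \<eta> (lin \<phi> f) = lin (\<lambda>s. scale \<eta> (\<phi> s)) f" by (simp add: lin_fun)
  also have "... = lin \<phi> f" by (rule lin_cong'[OF *(1)]) (use * ech_eta in blast)
  finally show ?thesis using * by (auto simp: ech_def intro: fspan_lin)
qed

text \<open>An algebra with basis \<open>D\<close>, multiplied by \<open>prd\<close> up to the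
  scalars \<open>c\<close>, in which \<open>T\<close> is a copy of the group \<open>W\<close> and
  \<open>D - T\<close> spans an ideal. The free module of degree \<open>q\<close> has the basis
  \<open>S q\<close>, so its elements are chains on \<open>D \<times> S q\<close>. The maps
  \<open>ch\<close> and \<open>cell\<close> pass between a cell and the cycle that it bounds, and
  \<open>a0\<close> is the augmentation on cells of degree 0.\<close>

locale basis_res =
  fixes D T :: "'s set" and prd :: "'s => 's => 's" and c :: "'s => 's => 'u::comm_ring_1" and e0 :: 's
    and \<eta> :: 'u and S :: "nat => 'c set" and ch :: "'c => ('s \<times> 'c, 'u) chain" and cell :: "('s \<times> 'c, 'u) chain => 'c"
    and a0 :: "'c => 'u" and s0 :: 'c and W :: "('a => 'a) set" and \<iota> :: "('a => 'a) => 's"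
  assumes prd_D: "x \<in> D ==> y \<in> D ==> prd x y \<in> D"
    and prd_assoc: "x \<in> D ==> y \<in> D ==> z \<in> D ==> prd (prd x y) z = prd x (prd y z)"
    and c_assoc: "x \<in> D ==> y \<in> D ==> z \<in> D ==> c x y * c (prd x y) z = c y z * c x (prd y z)"
    and e0: "e0 \<in> T" "x \<in> D ==> prd e0 x = x" "x \<in> D ==> c e0 x = \<eta>"
      "x \<in> D ==> prd x e0 = x" "x \<in> D ==> c x e0 = \<eta>"
    and T_D: "T \<subseteq> D" and T_prd: "x \<in> D ==> y \<in> D ==> prd x y \<in> T \<longleftrightarrow> x \<in> T \<and> y \<in> T"
    and T_c: "x \<in> T ==> y \<in> T ==> c x y = \<eta>"
    and \<eta>: "\<eta> * \<eta> = \<eta>" "x \<in> D ==> y \<in> D ==> \<eta> * c x y = c x y"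
    and W: "w \<in> W ==> bij w" "v \<in> W ==> w \<in> W ==> v \<circ> w \<in> W" "w \<in> W ==> finv w \<in> W" "id \<in> W"
    and \<iota>: "bij_betw \<iota> W T" "v \<in> W ==> w \<in> W ==> \<iota> (v \<circ> w) = prd (\<iota> v) (\<iota> w)" "\<iota> id = e0"
begin

abbreviation "FC q \<equiv> fspan (D \<times> S q)"
abbreviation "ec \<equiv> ech \<eta>"
abbreviation "EC q \<equiv> ec (D \<times> S q)"

definition lm :: "'s => ('s \<times> 'b, 'u) chain => ('s \<times> 'b, 'u) chain" where
  "lm x = lin (\<lambda>y. sg (prd x (fst y), snd y) (c x (fst y)))"

definition dd :: "'s \<times> 'c => ('s \<times> 'c, 'u) chain" where "dd y = lm (fst y) (ch (snd y))"

text \<open>The augmentation takes values in chains on one point, so that \<open>lin\<close> applies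
  to it as to the differentials.\<close>

definition ag :: "'s \<times> 'c => (unit \<Rightarrow>\<^sub>0 'u)" where "ag y = (if fst y \<in> T then sg () (a0 (snd y)) else 0)"

lemma ag_pair: "ag (d, s) = (if d \<in> T then sg () (a0 s) else 0)" by (simp add: ag_def)

definition cyc :: "nat => ('s \<times> 'c, 'u) chain set" where "cyc q = {f \<in> EC q. if q = 0 then lin ag f = 0 else lin dd f = 0}"

text \<open>The projection of a free module onto its tensor product with the trivial module: basis
  elements in \<open>T\<close> act as 1, the others as 0.\<close>

definition ppi :: "('s \<times> 'b, 'u) chain => ('b, 'u) chain" where "ppi = lin (\<lambda>y. if fst y \<in> T then sg (snd y) 1 else 0)"

definition dk :: "'c => ('c, 'u) chain" where "dk s = ppi (ch s)"

lemma lm_simps [simp]: "lm x (f + g) = lm x f + lm x g" "lm x (f - g) = lm x f - lm x g" "lm x (scale r f) = scale r (lm x f)" by (simp_all add: lm_def lin_simps)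

lemma ppi_simps [simp]: "ppi (f + g) = ppi f + ppi g" "ppi (f - g) = ppi f - ppi g" "ppi (scale r f) = scale r (ppi f)" by (simp_all add: ppi_def lin_simps)

lemma lm_0 [simp]: "lm x 0 = 0" "ppi 0 = 0" by (simp_all add: lm_def ppi_def)

lemma lm_sg [simp]: "lm x (sg (y, s) r) = sg (prd x y, s) (r * c x y)" by (simp add: lm_def)

lemma ppi_sg [simp]: "ppi (sg (d, s) r) = (if d \<in> T then sg s r else 0)" by (simp add: ppi_def)

lemma lin_lm: "lin \<phi> (lm x f) = lin (\<lambda>y. scale (c x (fst y)) (\<phi> (prd x (fst y), snd y))) f" by (simp add: lm_def lin_lin)

lemma lm_lin: "lm x (lin \<phi> f) = lin (\<lambda>y. lm x (\<phi> y)) f" by (simp add: lm_def lin_lin)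

lemma ppi_lin: "ppi (lin \<phi> f) = lin (\<lambda>y. ppi (\<phi> y)) f" by (simp add: ppi_def lin_lin)

lemma TD: "x \<in> T ==> x \<in> D" using T_D by blast

lemma lm_in: "x \<in> D ==> f \<in> fspan (D \<times> A) ==> lm x f \<in> fspan (D \<times> A)"
  unfolding lm_def by (erule fspan_lin) (rule fspan_single, auto intro: prd_D)

lemma lm_lm:
  assumes "x \<in> D" "y \<in> D" "f \<in> fspan (D \<times> A)" shows "lm x (lm y f) = scale (c x y) (lm (prd x y) f)"
  using assms(3) by (induction rule: chain_induct)
    (use assms in \<open>auto simp: prd_assoc c_assoc scale_distrib mult_ac\<close>)

lemma lm_e0: "f \<in> fspan (D \<times> A) ==> lm e0 f = scale \<eta> f" by (induction rule: chain_induct) (auto simp: e0 scale_distrib mult.commute)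

lemma lm_scale_eta:
  assumes "x \<in> D" "f \<in> fspan (D \<times> A)" shows "scale \<eta> (lm x f) = lm x f"
  using assms(2) by (induction rule: chain_induct) (use assms(1) in \<open>auto simp: mult.left_commute \<eta> scale_distrib\<close>)

lemma ppi_lm:
  assumes "x \<in> D" "f \<in> fspan (D \<times> A)" shows "ppi (lm x f) = (if x \<in> T then scale \<eta> (ppi f) else 0)"
  using assms(2) by (induction rule: chain_induct)
    (use assms(1) in \<open>auto simp: T_prd T_c TD scale_distrib mult.commute\<close>)

lemma ech_closed [simp, intro]:
  "0 \<in> ec A" "f \<in> ec A ==> g \<in> ec A ==> f + g \<in> ec A" "f \<in> ec A ==> g \<in> ec A ==> f - g \<in> ec A"
  "f \<in> fspan A ==> scale \<eta> f \<in> ec A" "f \<in> ec A ==> scale r f \<in> ec A"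
  by (auto simp: ech_def scale_distrib \<eta> mult.left_commute) (metis mult.commute scale_simps(6))

lemma \<iota>_in: "w \<in> W ==> \<iota> w \<in> T" using \<iota>(1) by (auto simp: bij_betw_def)

definition \<kappa> :: "'s => 'a => 'a" where "\<kappa> d = inv_into W \<iota> d"

lemma \<kappa>: "d \<in> T ==> \<kappa> d \<in> W" "d \<in> T ==> \<iota> (\<kappa> d) = d" "w \<in> W ==> \<kappa> (\<iota> w) = w"
  using \<iota>(1) by (auto simp: \<kappa>_def bij_betw_def inv_into_into f_inv_into_f)

lemma \<kappa>_prd: "d \<in> T ==> d' \<in> T ==> \<kappa> (prd d d') = \<kappa> d \<circ> \<kappa> d'"
  using \<kappa> \<iota>(2)[of "\<kappa> d" "\<kappa> d'"] W(2)[of "\<kappa> d" "\<kappa> d'"] by metis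

definition LW :: "nat => ('a => 'a) list set" where "LW q = {L. set L \<subseteq> W \<and> length L = q}"

lemma LW_bd: "L \<in> LW (Suc q) ==> bd L \<in> fspan (LW q)" using keys_bd_length keys_bd_set by (fastforce simp: LW_def fspan_def)

lemma LW_map: "w \<in> W ==> L \<in> LW q ==> lact w L \<in> LW q" using W by (auto simp: LW_def)

lemma LW_Cons: "w # L \<in> LW (Suc q) \<longleftrightarrow> w \<in> W \<and> L \<in> LW q" by (auto simp: LW_def)

lemma LW_blists: "L \<in> LW q ==> L \<in> blists" using W(1) by (auto simp: LW_def blists_def)

lemma finv_W: "w \<in> W ==> finv w \<circ> (w \<circ> u) = u" "w \<in> W ==> w \<circ> (finv w \<circ> u) = u"
  using finv_f[OF W(1)] by (auto simp: fun_eq_iff)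

end

text \<open>Every cycle is the boundary of a single cell, as in the canonical resolution; exactness
  is thereby built in.\<close>

locale basis_complex = basis_res D T prd c e0 \<eta> S ch cell a0 s0 W \<iota>
  for D T :: "'s set" and prd and c :: "'s => 's => 'u::comm_ring_1" and e0 \<eta>
    and S :: "nat => 'c set" and ch cell a0 s0 and W :: "('a => 'a) set" and \<iota> +
  assumes S_ch: "s \<in> S (Suc q) ==> ch s \<in> cyc q"
    and cell: "f \<in> cyc q ==> cell f \<in> S (Suc q)" "f \<in> cyc q ==> ch (cell f) = f"
    and s0: "s0 \<in> S 0" "a0 s0 = \<eta>" and a0: "s \<in> S 0 ==> \<eta> * a0 s = a0 s"
begin

lemma cyc_fspan: "f \<in> cyc q ==> f \<in> FC q" by (auto simp: cyc_def)

lemma S_ech: "s \<in> S (Suc q) ==> ch s \<in> EC q" using S_ch by (simp add: cyc_def)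

lemma dd_in: "f \<in> FC (Suc q) ==> lin dd f \<in> EC q"
proof (erule ech_lin')
  fix y assume "y \<in> D \<times> S (Suc q)"
  thus "dd y \<in> EC q" using S_ech[of "snd y" q] lm_in lm_scale_eta unfolding dd_def ech_def by fastforce
qed

lemma dd_lm:
  assumes "x \<in> D" "f \<in> FC (Suc q)" shows "lin dd (lm x f) = lm x (lin dd f)" unfolding lin_lm lm_lin
proof (rule lin_cong'[OF assms(2)])
  fix y assume y: "y \<in> D \<times> S (Suc q)"
  have "lm x (lm (fst y) (ch (snd y))) = scale (c x (fst y)) (lm (prd x (fst y)) (ch (snd y)))"
    using y assms(1) S_ech[of "snd y" q] by (intro lm_lm[of _ _ _ "S q"]) auto
  thus "scale (c x (fst y)) (dd (prd x (fst y), snd y)) = lm x (dd y)" by (simp add: dd_def)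
qed

lemma ag_lm:
  assumes "x \<in> D" "f \<in> FC 0" shows "lin ag (lm x f) = (if x \<in> T then scale \<eta> (lin ag f) else 0)" using assms(2) by (induction rule: chain_induct)
    (use assms(1) in \<open>auto simp: lin_add ag_pair T_prd T_c TD scale_distrib mult_ac\<close>)

lemma dd_e0:
  assumes "s \<in> S (Suc q)" shows "lin dd (sg (e0, s) \<eta>) = ch s"
  using lm_e0[OF ech_fspan[OF S_ech[OF assms]]] ech_eta[OF S_ech[OF assms]] by (simp add: dd_def)

lemma dd_dd: "f \<in> fspan (D \<times> S (Suc (Suc q))) ==> lin dd (lin dd f) = 0"
proof -
  assume f: "f \<in> fspan (D \<times> S (Suc (Suc q)))"
  have "lin dd (lin dd f) = lin (\<lambda>y. 0) f" unfolding lin_lin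
  proof (rule lin_cong'[OF f])
    fix y assume y: "y \<in> D \<times> S (Suc (Suc q))"
    hence c: "ch (snd y) \<in> cyc (Suc q)" using S_ch by auto
    have "lin dd (lm (fst y) (ch (snd y))) = lm (fst y) (lin dd (ch (snd y)))" by (rule dd_lm) (use y c in \<open>auto simp: cyc_def\<close>)
    thus "lin dd (dd y) = 0" using c by (simp add: dd_def cyc_def)
  qed
  thus ?thesis by (simp add: lin_fun)
qed

lemma exact:
  assumes "f \<in> cyc q" shows "sg (e0, cell f) \<eta> \<in> EC (Suc q)" "lin dd (sg (e0, cell f) \<eta>) = f"
  using cell[OF assms] dd_e0[of "cell f" q] e0 TD \<eta> by (auto intro!: ech_sg)

lemma ppi_dd: "f \<in> FC (Suc q) ==> ppi (lin dd f) = lin dk (ppi f)" unfolding ppi_lin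
proof -
  assume f: "f \<in> FC (Suc q)"
  have "lin (\<lambda>y. ppi (dd y)) f = lin (\<lambda>y. lin dk (if fst y \<in> T then sg (snd y) 1 else 0)) f"
  proof (rule lin_cong'[OF f])
    fix y assume y: "y \<in> D \<times> S (Suc q)"
    hence c: "ch (snd y) \<in> EC q" using S_ech by auto
    have "scale \<eta> (ppi (ch (snd y))) = ppi (ch (snd y))" using ppi_simps(3)[of \<eta> "ch (snd y)"] ech_eta[OF c] by simp
    thus "ppi (dd y) = lin dk (if fst y \<in> T then sg (snd y) 1 else 0)" using y ppi_lm[OF _ ech_fspan[OF c], of "fst y"] by (auto simp: dd_def dk_def)
  qed
  thus "lin (\<lambda>y. ppi (dd y)) f = lin dk (ppi f)" by (simp add: ppi_def lin_lin)
qed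

lemma ppi_in: "f \<in> fspan (D \<times> A) ==> ppi f \<in> fspan A" unfolding ppi_def by (erule fspan_lin) auto

lemma dk_in: "f \<in> fspan (S (Suc q)) ==> lin dk f \<in> ec (S q)"
proof (erule ech_lin')
  fix s assume "s \<in> S (Suc q)"
  hence c: "ch s \<in> EC q" by (rule S_ech)
  thus "dk s \<in> ec (S q)" using ppi_in[of "ch s" "S q"] ppi_simps(3)[of \<eta> "ch s"] unfolding dk_def ech_def by auto
qed

lemma dk_dk: "f \<in> fspan (S (Suc (Suc q))) ==> lin dk (lin dk f) = 0"
proof -
  assume f: "f \<in> fspan (S (Suc (Suc q)))"
  have "lin dk (lin dk f) = lin (\<lambda>y. 0) f" unfolding lin_lin
  proof (rule lin_cong'[OF f])
    fix s assume "s \<in> S (Suc (Suc q))"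
    hence c: "ch s \<in> cyc (Suc q)" by (rule S_ch)
    thus "lin dk (dk s) = 0" using ppi_dd[of "ch s" q] ech_fspan[of "ch s" \<eta> "D \<times> S (Suc q)"] by (auto simp: dk_def cyc_def)
  qed
  thus ?thesis by (simp add: lin_fun)
qed

subsection \<open>From the bar complex to the resolution\<close>

text \<open>The equivariant extension of \<open>b\<close> to homogeneous tuples: the first entry is
  factored out and acts through \<iota>.\<close>

fun tau :: "(('a => 'a) list => 'c) => ('a => 'a) list => ('s \<times> 'c, 'u) chain" where "tau b [] = 0"
| "tau b (v # vs) = sg (\<iota> v, b (lact (finv v) vs)) \<eta>"

text \<open>The comparison map sends a normalised bar generator to one cell, namely the cell that
  bounds the image of its boundary.\<close>

primrec bc :: "nat => ('a => 'a) list => 'c" where "bc 0 = (\<lambda>ws. s0)"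
| "bc (Suc q) = (\<lambda>ws. cell (lin (tau (bc q)) (bd (id # ws))))"

lemma tau_map:
  assumes "w \<in> W" "L \<in> LW (Suc q)" shows "tau b (lact w L) = lm (\<iota> w) (tau b L)"
proof -
  obtain v vs where L: "L = v # vs" "v \<in> W" using assms(2) by (cases L) (auto simp: LW_def)
  have "map ((\<circ>) (finv (w \<circ> v)) \<circ> (\<circ>) w) vs = lact (finv v) vs" by (simp add: finv_finv_comp[OF W(1)[OF assms(1)] W(1)[OF L(2)]])
  thus ?thesis using assms L by (simp add: \<iota> T_c \<iota>_in \<eta> del: map_eq_conv)
qed

lemma lin_tau_map:
  assumes "w \<in> W" "f \<in> fspan (LW (Suc q))" shows "lin (tau b) (pm (lact w) f) = lm (\<iota> w) (lin (tau b) f)"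
  unfolding lin_pm lm_lin by (rule lin_cong'[OF assms(2)]) (rule tau_map[OF assms(1)])

text \<open>The three claims go together: the next cell is legitimate only once the image of a
  boundary is known to be a cycle.\<close>

lemma tau_bc: "(\<forall>ws \<in> LW q. bc q ws \<in> S q) \<and>
   (\<forall>L \<in> LW (Suc q). tau (bc q) L \<in> ec (T \<times> S q)) \<and>
   (\<forall>L \<in> LW (Suc (Suc q)). lin (tau (bc q)) (bd L) \<in> cyc q)"
proof (induction q)
  case 0
  have 1: "tau (bc 0) L \<in> ec (T \<times> S 0)" if "L \<in> LW (Suc 0)" for L using that by (cases L) (auto simp: LW_def \<iota>_in \<eta> s0 intro!: ech_sg)
  have "lin (tau (bc 0)) (bd L) \<in> cyc 0" if L0: "L \<in> LW (Suc (Suc 0))" for L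
  proof -
    obtain v L' where "L = v # L'" "v \<in> W" "L' \<in> LW (Suc 0)" using L0 by (cases L) (auto simp: LW_def)
    moreover then obtain w where "L' = [w]" "w \<in> W" by (cases L') (auto simp: LW_def)
    ultimately have L: "L = [v, w]" "v \<in> W" "w \<in> W" by auto
    thus ?thesis using \<iota>_in TD s0(1) by (simp add: cyc_def lin_diff ag_def ech_sg \<eta> s0)
  qed
  thus ?case using 1 s0 by auto
next
  case (Suc q)
  have id: "id # ws \<in> LW (Suc (Suc q))" if "ws \<in> LW (Suc q)" for ws using that W by (simp add: LW_Cons)
  have 1: "bc (Suc q) ws \<in> S (Suc q)" if "ws \<in> LW (Suc q)" for ws using Suc.IH id[OF that] cell(1) by auto
  have 2: "tau (bc (Suc q)) L \<in> ec (T \<times> S (Suc q))" if L0: "L \<in> LW (Suc (Suc q))" for L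
  proof -
    obtain v vs where L: "L = v # vs" "v \<in> W" "vs \<in> LW (Suc q)" using L0 by (cases L) (auto simp: LW_def)
    show ?thesis unfolding L(1) tau.simps using L W 1[OF LW_map[OF W(3)[OF L(2)] L(3)]] by (intro ech_sg) (auto simp: \<iota>_in \<eta>)
  qed
  have 3: "lin dd (tau (bc (Suc q)) L) = lin (tau (bc q)) (bd L)" if L0: "L \<in> LW (Suc (Suc q))" for L
  proof -
    obtain v vs where vs: "L = v # vs" "v \<in> W" "vs \<in> LW (Suc q)" using L0 by (cases L) (auto simp: LW_def)
    let ?ws = "lact (finv v) vs"
    have ws: "?ws \<in> LW (Suc q)" using vs W LW_map by blast
    let ?f = "lin (tau (bc q)) (bd (id # ?ws))"
    have f: "?f \<in> cyc q" using Suc.IH id[OF ws] by blast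
    have "lin dd (tau (bc (Suc q)) L) = scale \<eta> (lm (\<iota> v) (ch (cell ?f)))" by (simp add: vs(1) dd_def del: bd.simps)
    also have "... = lm (\<iota> v) ?f" using cell(2)[OF f] lm_scale_eta[of "\<iota> v" ?f "S q"] f vs \<iota>_in TD by (auto simp: cyc_def simp del: bd.simps)
    also have "... = lin (tau (bc q)) (bd (lact v (id # ?ws)))" unfolding bd_map using lin_tau_map[OF vs(2) LW_bd[OF id[OF ws]]] by simp
    also have "lact v (id # ?ws) = L" by (auto simp: vs(1) finv_W(2)[OF vs(2)] intro: map_idI)
    finally show ?thesis .
  qed
  have "lin (tau (bc (Suc q))) (bd L) \<in> cyc (Suc q)" if L: "L \<in> LW (Suc (Suc (Suc q)))" for L
  proof -
    have "lin dd (lin (tau (bc (Suc q))) (bd L)) = lin (\<lambda>l. lin (tau (bc q)) (bd l)) (bd L)" unfolding lin_lin by (rule lin_cong'[OF LW_bd[OF L]]) (rule 3)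
    also have "... = 0" by (simp add: lin_lin[symmetric] bd_bd)
    finally have "lin dd (lin (tau (bc (Suc q))) (bd L)) = 0" .
    moreover have "lin (tau (bc (Suc q))) (bd L) \<in> EC (Suc q)"
    proof (rule ech_lin'[OF LW_bd[OF L]])
      fix l assume "l \<in> LW (Suc (Suc q))"
      hence "tau (bc (Suc q)) l \<in> ec (T \<times> S (Suc q))" by (rule 2)
      thus "tau (bc (Suc q)) l \<in> EC (Suc q)" using T_D by (auto simp: ech_def elim!: fspan_mono)
    qed
    ultimately show ?thesis by (simp add: cyc_def)
  qed
  thus ?case using 1 2 by blast
qed

lemma bc_in: "ws \<in> LW q ==> bc q ws \<in> S q" and tau_in: "L \<in> LW (Suc q) ==> tau (bc q) L \<in> ec (T \<times> S q)"
  and tau_bd_cyc: "L \<in> LW (Suc (Suc q)) ==> lin (tau (bc q)) (bd L) \<in> cyc q" using tau_bc[of q] by blast+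

lemma LW_id: "ws \<in> LW q ==> id # ws \<in> LW (Suc q)" using W(4) by (simp add: LW_Cons)

lemma ch_bc: "ws \<in> LW (Suc q) ==> ch (bc (Suc q) ws) = lin (tau (bc q)) (bd (id # ws))" using cell(2)[OF tau_bd_cyc[OF LW_id]] by simp

lemma ech_TD: "f \<in> ec (T \<times> A) ==> f \<in> ec (D \<times> A)" using T_D by (auto simp: ech_def elim!: fspan_mono)

lemma dd_tau:
  assumes L: "L \<in> LW (Suc (Suc q))" shows "lin dd (tau (bc (Suc q)) L) = lin (tau (bc q)) (bd L)"
proof -
  obtain v vs where vs: "L = v # vs" "v \<in> W" "vs \<in> LW (Suc q)" using L by (cases L) (auto simp: LW_def)
  let ?ws = "lact (finv v) vs"
  have ws: "?ws \<in> LW (Suc q)" using vs W LW_map by blast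
  let ?f = "lin (tau (bc q)) (bd (id # ?ws))"
  have f: "?f \<in> EC q" using tau_bd_cyc[OF LW_id[OF ws]] by (simp add: cyc_def)
  have "lin dd (tau (bc (Suc q)) L) = scale \<eta> (lm (\<iota> v) ?f)" using ch_bc[OF ws] by (simp add: vs(1) dd_def del: bd.simps bc.simps)
  also have "... = lm (\<iota> v) ?f" by (rule lm_scale_eta[OF TD[OF \<iota>_in[OF vs(2)]] ech_fspan[OF f]])
  also have "... = lin (tau (bc q)) (bd (lact v (id # ?ws)))" unfolding bd_map using lin_tau_map[OF vs(2) LW_bd[OF LW_id[OF ws]]] by simp
  also have "lact v (id # ?ws) = L" by (auto simp: vs(1) finv_W(2)[OF vs(2)] intro: map_idI)
  finally show ?thesis .
qed

text \<open>The way back. The bar resolution is a module over the algebra through the quotient by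
  the ideal, so basis elements outside \<open>T\<close> act as 0.\<close>

definition rho :: "('c => (('a => 'a) list, 'u) chain) => 's \<times> 'c => (('a => 'a) list, 'u) chain" where
  "rho r y = (if fst y \<in> T then pm (map ((\<circ>) (\<kappa> (fst y)))) (r (snd y)) else 0)"

text \<open>In positive degree the image of the boundary of a cell is coned off by prefixing
  \<open>id\<close>, the contraction of homogeneous tuples.\<close>

primrec rr :: "nat => 'c => (('a => 'a) list, 'u) chain" where "rr 0 = (\<lambda>s. sg [id] (a0 s))"
| "rr (Suc q) = (\<lambda>s. pm (Cons id) (lin (rho (rr q)) (ch s)))"

lemma rr_in: "s \<in> S q ==> rr q s \<in> fspan (LW (Suc q))"
  and rho_in: "y \<in> D \<times> S q ==> rho (rr q) y \<in> fspan (LW (Suc q))"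
proof (induction q arbitrary: s y)
  case 0
  {
    case 1
    thus ?case using W(4) by (simp add: LW_def)
  next
    case 2
    thus ?case using W \<kappa> by (auto simp: rho_def LW_def)
  }
next
  case (Suc q)
  have *: "rr (Suc q) s \<in> fspan (LW (Suc (Suc q)))" if "s \<in> S (Suc q)" for s
  proof -
    have "lin (rho (rr q)) (ch s) \<in> fspan (LW (Suc q))" using ech_fspan[OF S_ech[OF that]] Suc.IH(2) by (rule fspan_lin)
    thus ?thesis unfolding rr.simps by (rule fspan_pm) (simp add: LW_id)
  qed
  {
    case 1
    thus ?case by (rule *)
  next
    case 2
    hence s: "snd y \<in> S (Suc q)" by auto
    have "fst y \<in> T ==> pm (map ((\<circ>) (\<kappa> (fst y)))) (rr (Suc q) (snd y)) \<in> fspan (LW (Suc (Suc q)))"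
      by (rule fspan_pm[OF *[OF s]], rule LW_map) (auto intro: \<kappa>(1))
    thus ?case by (simp add: rho_def del: rr.simps)
  }
qed

lemma map_comp_map: "lact (v \<circ> w) = (\<lambda>l. lact v (lact w l))" by (simp add: fun_eq_iff)

lemma pm_map_comp: "pm (lact (v \<circ> w)) f = pm (lact v) (pm (lact w) f)" unfolding pm_pm map_comp_map ..

lemma rho_lm:
  assumes "x \<in> D" "f \<in> fspan (D \<times> A)" shows "lin (rho r) (lm x f) = (if x \<in> T then scale \<eta> (pm (lact (\<kappa> x)) (lin (rho r) f)) else 0)"
  using assms(2)
proof (induction rule: chain_induct)
  case (single y k)
  thus ?case using assms(1) TD by (cases y) (auto simp: rho_def T_prd T_c \<kappa>_prd pm_map_comp mult.commute, simp add: comp_def[abs_def])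
qed (auto simp: lin_add scale_distrib, simp_all add: comp_def[abs_def])

lemma lin_rho_eta: "f \<in> ec A ==> scale \<eta> (lin (rho r) f) = lin (rho r) f" using ech_eta lin_scale by metis

text \<open>Prefixing \<open>id\<close> inverts \<open>bd\<close> only on cycles. That the image of
  \<open>ch s\<close> is a cycle is the statement one degree lower, and in degree 0 it is the
  vanishing of the augmentation.\<close>

lemma bd_rho: "(\<forall>f \<in> FC 0. lin bd (lin (rho (rr 0)) f) = pm (\<lambda>_. []) (lin ag f)) \<and>
   (\<forall>f \<in> FC (Suc q). lin bd (lin (rho (rr (Suc q))) f) = lin (rho (rr q)) (lin dd f))"
proof -
  have base: "lin bd (lin (rho (rr 0)) f) = pm (\<lambda>_. []) (lin ag f)" if "f \<in> FC 0" for f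
    unfolding lin_lin pm_lin by (rule lin_cong'[OF that]) (auto simp: rho_def ag_def)
  have step: "\<forall>f \<in> FC (Suc q). lin bd (lin (rho (rr (Suc q))) f) = lin (rho (rr q)) (lin dd f)"
    if z: "!!s. s \<in> S (Suc q) ==> lin bd (lin (rho (rr q)) (ch s)) = 0" for q
  proof
    fix f :: "('s \<times> 'c, 'u) chain"
    assume f: "f \<in> FC (Suc q)"
    show "lin bd (lin (rho (rr (Suc q))) f) = lin (rho (rr q)) (lin dd f)" unfolding lin_lin
    proof (rule lin_cong'[OF f])
      fix y assume y: "y \<in> D \<times> S (Suc q)"
      hence c: "ch (snd y) \<in> EC q" using S_ech by auto
      have "lin (rho (rr q)) (dd y) = (if fst y \<in> T then pm (map ((\<circ>) (\<kappa> (fst y)))) (lin (rho (rr q)) (ch (snd y))) else 0)"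
        unfolding dd_def using y by (subst rho_lm[OF _ ech_fspan[OF c]]) (auto simp flip: pm_simps(5) simp: lin_rho_eta[OF c])
      moreover have "lin bd (rr (Suc q) (snd y)) = lin (rho (rr q)) (ch (snd y))" using z[of "snd y"] y by (auto simp: lin_bd_Cons)
      ultimately show "lin bd (rho (rr (Suc q)) y) = lin (rho (rr q)) (dd y)" by (simp add: rho_def lin_bd_map del: rr.simps)
    qed
  qed
  have "\<forall>f \<in> FC (Suc q). lin bd (lin (rho (rr (Suc q))) f) = lin (rho (rr q)) (lin dd f)"
  proof (induction q)
    case 0
    show ?case
    proof (rule step)
      fix s assume "s \<in> S (Suc 0)"
      hence c: "ch s \<in> cyc 0" by (rule S_ch)
      thus "lin bd (lin (rho (rr 0)) (ch s)) = 0" using base[OF cyc_fspan[OF c]] by (simp add: cyc_def del: rr.simps)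
    qed
  next
    case (Suc q)
    show ?case
    proof (rule step)
      fix s assume "s \<in> S (Suc (Suc q))"
      hence c: "ch s \<in> cyc (Suc q)" by (rule S_ch)
      thus "lin bd (lin (rho (rr (Suc q))) (ch s)) = 0" using Suc cyc_fspan[OF c] by (simp add: cyc_def del: rr.simps)
    qed
  qed
  thus ?thesis using base by blast
qed

lemma bd_rho_0: "f \<in> FC 0 ==> lin bd (lin (rho (rr 0)) f) = pm (\<lambda>_. []) (lin ag f)"
  and bd_rho_Suc: "f \<in> FC (Suc q) ==> lin bd (lin (rho (rr (Suc q))) f) = lin (rho (rr q)) (lin dd f)" using bd_rho[of q] by blast+

lemma bd_rr: "s \<in> S (Suc q) ==> lin bd (rr (Suc q) s) = lin (rho (rr q)) (ch s)"
proof -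
  assume s: "s \<in> S (Suc q)"
  have "lin bd (lin (rho (rr q)) (ch s)) = 0" using S_ch[OF s] cyc_fspan[OF S_ch[OF s]] by (cases q) (auto simp: cyc_def bd_rho_0 bd_rho_Suc simp del: rr.simps)
  thus ?thesis by (simp add: lin_bd_Cons)
qed

definition nfo :: "('a => 'a) list => 'a list \<times> ('a => 'a) list" where "nfo L = nf ([], L)"

text \<open>Bar generators with an empty word component, so that they agree with column 0 of the
  double complex used for stability.\<close>

definition BX :: "nat => ('a list \<times> ('a => 'a) list) set" where "BX q = {[]} \<times> LW q"

text \<open>\<open>tb\<close> and \<open>rb\<close> are induced by the two comparison maps after
  tensoring with the trivial module, which replaces the bar resolution by its orbit complex.\<close>

definition tb :: "nat => 'a list \<times> ('a => 'a) list => ('c, 'u) chain" where "tb q y = sg (bc q (snd y)) \<eta>"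

definition rb :: "nat => 'c => ('a list \<times> ('a => 'a) list, 'u) chain" where "rb q s = pm nfo (rr q s)"

lemma nfo_in: "L \<in> LW (Suc q) ==> nfo L \<in> BX q" by (cases L) (auto simp: nfo_def BX_def LW_def W)

lemma nfo_map: "w \<in> W ==> L \<in> LW (Suc q) ==> nfo (lact w L) = nfo L"
proof -
  assume w: "w \<in> W" and L: "L \<in> LW (Suc q)"
  hence "L \<noteq> []" by (auto simp: LW_def)
  thus ?thesis using nf_act[OF W(1)[OF w] _ LW_blists[OF L], of "[]"] by (simp only: nfo_def list.map simp_thms)
qed

lemma pm_nfo_map: "w \<in> W ==> f \<in> fspan (LW (Suc q)) ==> pm nfo (pm (lact w) f) = pm nfo f"
  unfolding pm_pm by (erule pm_cong') (rule nfo_map)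

lemma tb_in: "z \<in> fspan (BX q) ==> lin (tb q) z \<in> ec (S q)" by (erule ech_lin') (auto simp: tb_def BX_def bc_in \<eta> intro!: ech_sg)

lemma rb_in: "k \<in> fspan (S q) ==> lin (rb q) k \<in> fspan (BX q)" by (erule fspan_lin) (auto simp: rb_def intro: fspan_pm[OF rr_in nfo_in])

lemma ppi_tau: "f \<in> fspan (LW (Suc q)) ==> ppi (lin (tau (bc q)) f) = lin (tb q) (pm nfo f)" unfolding ppi_lin lin_pm
proof (erule lin_cong')
  fix L assume "L \<in> LW (Suc q)"
  thus "ppi (tau (bc q) L) = tb q (nfo L)" by (cases L) (auto simp: LW_def nfo_def tb_def \<iota>_in)
qed

lemma tv_nfo: "y \<in> BX (Suc q) ==> tv y = pm nfo (bd (id # snd y))"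
  by (auto simp: BX_def LW_def tv_def uv_def pm_pm nfo_def[abs_def] simp del: bd.simps)

lemma tv_pm_nfo: "f \<in> fspan (LW (Suc (Suc q))) ==> lin tv (pm nfo f) = pm nfo (lin bd f)" unfolding lin_pm pm_lin
proof (erule lin_cong')
  fix L assume "L \<in> LW (Suc (Suc q))"
  hence "tv (nfo L) = pm nf (uv ([], L))" unfolding nfo_def by (intro tv_nf) (auto simp: LW_blists, simp add: LW_def)
  thus "tv (nfo L) = pm nfo (bd L)" by (simp add: uv_def pm_pm nfo_def[abs_def])
qed

lemma tb_tv: "z \<in> fspan (BX (Suc q)) ==> lin (tb q) (lin tv z) = lin dk (lin (tb (Suc q)) z)" unfolding lin_lin
proof (erule lin_cong')
  fix y assume y: "y \<in> BX (Suc q)"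
  hence ws: "snd y \<in> LW (Suc q)" by (auto simp: BX_def)
  have "lin (tb q) (tv y) = ppi (ch (bc (Suc q) (snd y)))" unfolding tv_nfo[OF y] ch_bc[OF ws] by (rule ppi_tau[OF LW_bd[OF LW_id[OF ws]], symmetric])
  also have "... = lin dk (tb (Suc q) y)" using dk_in[OF fspan_single[OF bc_in[OF ws]], of 1] by (simp add: tb_def dk_def ech_eta del: bc.simps)
  finally show "lin (tb q) (tv y) = lin dk (tb (Suc q) y)" .
qed

lemma nfo_rho: "f \<in> FC q ==> pm nfo (lin (rho (rr q)) f) = lin (rb q) (ppi f)"
proof -
  assume f: "f \<in> FC q"
  have "pm nfo (lin (rho (rr q)) f) = lin (\<lambda>y. lin (rb q) (if fst y \<in> T then sg (snd y) 1 else 0)) f" unfolding pm_lin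
  proof (rule lin_cong'[OF f])
    fix y assume "y \<in> D \<times> S q"
    thus "pm nfo (rho (rr q) y) = lin (rb q) (if fst y \<in> T then sg (snd y) 1 else 0)" using pm_nfo_map[OF \<kappa>(1) rr_in] by (auto simp: rho_def rb_def)
  qed
  thus ?thesis by (simp add: ppi_def lin_lin)
qed

lemma rb_dk: "k \<in> fspan (S (Suc q)) ==> lin tv (lin (rb (Suc q)) k) = lin (rb q) (lin dk k)" unfolding lin_lin
proof (erule lin_cong')
  fix s assume s: "s \<in> S (Suc q)"
  show "lin tv (rb (Suc q) s) = lin (rb q) (dk s)" unfolding rb_def[of "Suc q"] tv_pm_nfo[OF rr_in[OF s]] bd_rr[OF s] dk_def
    by (rule nfo_rho) (rule ech_fspan[OF S_ech[OF s]])
qed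

end

section \<open>Acyclicity of the ideal from idempotents\<close>

lemma ech_mono: "f \<in> ech \<eta> A ==> A \<subseteq> B ==> f \<in> ech \<eta> B" by (auto simp: ech_def fspan_def)

context basis_complex
begin

lemma lm_idem:
  assumes "f \<in> fspan (P \<times> S q)" "!!d. d \<in> P ==> prd e d = d \<and> c e d = u" shows "lm e f = scale u f"
  using assms(1) by (induction rule: chain_induct) (use assms(2) in \<open>auto simp: scale_distrib mult.commute\<close>)

lemma fspan_split:
  assumes "f \<in> ec ((A \<union> B) \<times> C)"
  obtains f1 f2 where "f1 \<in> ec (A \<times> C)" "f2 \<in> ec (B \<times> C)" "f = f1 + f2"
proof -
  define f1 where "f1 = lin (\<lambda>y. if fst y \<in> A then sg y 1 else 0) f"
  define f2 where "f2 = lin (\<lambda>y. if fst y \<in> A then 0 else sg y 1) f"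
  have "f1 \<in> ec (A \<times> C)" unfolding f1_def by (rule ech_lin[OF assms]) auto
  moreover have "f2 \<in> ec (B \<times> C)" unfolding f2_def by (rule ech_lin[OF assms]) auto
  moreover have "f1 + f2 = lin (\<lambda>y. sg y 1) f" unfolding f1_def f2_def lin_fun(1)[symmetric] by (rule lin_cong) simp
  ultimately show thesis using that by simp
qed

text \<open>Each nonempty \<open>P\<close> spans the right ideal generated by some \<open>e\<close>
  which multiplies its elements on the left by the scalar \<open>u\<close>. If a cycle in
  \<open>P\<close> bounds any chain \<open>y\<close> of the resolution, it also bounds
  \<open>v\<close> times \<open>e y\<close>, and this lies over \<open>P\<close>. Finite unions
  follow by Mayer-Vietoris, as intersections stay in the family.\<close>

lemma acyc_from_idempotents:
  assumes cover: "!!d. d \<in> D - T ==> \<exists>P\<in>\<P>. d \<in> P" and sub: "!!P. P \<in> \<P> ==> P \<subseteq> D - T"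
    and inter: "!!P Q. P \<in> \<P> ==> Q \<in> \<P> ==> P \<inter> Q \<in> \<P>"
    and idem: "!!P. P \<in> \<P> ==> P \<noteq> {} ==>
      \<exists>e\<in>D. \<exists>u v. v * u = \<eta> \<and> (\<forall>d\<in>P. prd e d = d \<and> c e d = u) \<and> (\<forall>y\<in>D. prd e y \<in> P)"
    and f: "f \<in> ec ((D - T) \<times> S q)" "0 < q ==> lin dd f = 0" shows "\<exists>g \<in> ec ((D - T) \<times> S (Suc q)). lin dd g = f"
proof -
  have base: "\<exists>g \<in> ec (P \<times> S (Suc q)). lin dd g = f"
    if P: "P \<in> \<P>" and f: "f \<in> ec (P \<times> S q)" "0 < q ==> lin dd f = 0" for P q f
  proof (cases "P = {}")
    case True
    hence "f = 0" using f(1) by (simp add: ech_def fspan_def)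
    thus ?thesis by (intro bexI[of _ 0]) auto
  next
    case False
    obtain e u v where e: "e \<in> D" "v * u = \<eta>" "!!d. d \<in> P ==> prd e d = d \<and> c e d = u" "!!y. y \<in> D ==> prd e y \<in> P"
      using idem[OF P False] by blast
    have PD: "P \<times> A \<subseteq> D \<times> A" for A using sub[OF P] by auto
    have fD: "f \<in> EC q" using ech_mono[OF f(1) PD] .
    have "lin ag f = lin (\<lambda>_. 0) f" by (rule lin_cong'[OF ech_fspan[OF f(1)]]) (use sub[OF P] in \<open>auto simp: ag_def\<close>)
    hence "f \<in> cyc q" using fD f(2) by (simp add: cyc_def lin_fun)
    from exact[OF this] obtain y where y: "y \<in> EC (Suc q)" "lin dd y = f" by blast
    note yf = ech_fspan[OF y(1)]
    have "lm e y \<in> fspan (P \<times> S (Suc q))" using yf unfolding lm_def by (rule fspan_lin) (rule fspan_single, auto simp: e)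
    hence "scale v (lm e y) \<in> ec (P \<times> S (Suc q))" using lm_scale_eta[OF e(1) yf] by (intro ech_closed(5)) (simp add: ech_def)
    moreover have "lin dd (scale v (lm e y)) = f" using lm_idem[OF ech_fspan[OF f(1)] e(3)] ech_eta[OF f(1)] by (simp add: lin_scale dd_lm[OF e(1) yf] y(2) e(2))
    ultimately show ?thesis by blast
  qed
  have dd_P: "lin dd f \<in> ec (P \<times> S q)" if P: "P \<in> \<P>" and f: "f \<in> ec (P \<times> S (Suc q))" for P q f
  proof (rule ech_lin'[OF ech_fspan[OF f]])
    fix y assume y: "y \<in> P \<times> S (Suc q)"
    hence ne: "P \<noteq> {}" by auto
    obtain e u v where e: "e \<in> D" "v * u = \<eta>" "!!d. d \<in> P ==> prd e d = d \<and> c e d = u" "!!y. y \<in> D ==> prd e y \<in> P"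
      using idem[OF P ne] by blast
    have yD: "fst y \<in> D" using y sub[OF P] by auto
    \<comment> \<open>Left multiplication by \<open>e\<close> fixes \<open>fst y\<close> up to a
      scalar and maps everything into \<open>P\<close>, so \<open>P\<close> absorbs multiplication
      on the right.\<close>
    have mem: "prd (fst y) z \<in> P" if "z \<in> D" for z using prd_assoc[OF e(1) yD that] e(3)[of "fst y"] e(4)[OF prd_D[OF yD that]] y by auto
    have c: "ch (snd y) \<in> FC q" by (rule ech_fspan[OF S_ech]) (use y in auto)
    have "lm (fst y) (ch (snd y)) \<in> fspan (P \<times> S q)" using c unfolding lm_def by (rule fspan_lin) (rule fspan_single, auto simp: mem)
    thus "dd y \<in> ec (P \<times> S q)" using lm_scale_eta[OF yD c] by (simp add: dd_def ech_def)
  qed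
  have step: "\<exists>g \<in> ec (\<Union>\<Q> \<times> S (Suc q)). lin dd g = f"
    if "finite \<Q>" "\<Q> \<subseteq> \<P>" "f \<in> ec (\<Union>\<Q> \<times> S q)" "0 < q ==> lin dd f = 0" for \<Q> q f using that
  proof (induction "card \<Q>" arbitrary: \<Q> q f rule: less_induct)
    case less
    show ?case
    proof (cases "\<Q> = {}")
      case True
      hence "f = 0" using less.prems(3) by (simp add: ech_def fspan_def)
      thus ?thesis by (intro bexI[of _ 0]) auto
    next
      case False
      then obtain P \<Q>' where Q: "\<Q> = insert P \<Q>'" "P \<notin> \<Q>'" by (meson ex_in_conv mk_disjoint_insert)
      have fin: "finite \<Q>'" and card: "card \<Q>' < card \<Q>" and P: "P \<in> \<P>" "\<Q>' \<subseteq> \<P>" using less.prems Q by auto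
      obtain f1 f2 where f12: "f1 \<in> ec (P \<times> S q)" "f2 \<in> ec (\<Union>\<Q>' \<times> S q)" "f = f1 + f2"
        using fspan_split[of f P "\<Union>\<Q>'" "S q"] less.prems(3) Q by auto
      \<comment> \<open>The boundary of \<open>f1\<close> lies over the overlap, a union of fewer
        members of the family, and is filled there by \<open>w\<close>. Then \<open>f1 - w\<close>
        and \<open>f2 + w\<close> are cycles over the two pieces. In degree 0 there is nothing to
        fill.\<close>
      obtain w where w: "w \<in> ec ((P \<inter> \<Union>\<Q>') \<times> S q)" "0 < q ==> lin dd w = lin dd f1"
      proof (cases q)
        case 0
        thus ?thesis using that[of 0] by simp
      next
        case (Suc q')
        let ?Q = "(\<inter>) P ` \<Q>'"
        have U: "\<Union>?Q = P \<inter> \<Union>\<Q>'" by auto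
        have "card ?Q < card \<Q>" using card_image_le[OF fin, of "(\<inter>) P"] card by linarith
        moreover have "?Q \<subseteq> \<P>" using P inter by auto
        moreover have "lin dd f1 \<in> ec (\<Union>?Q \<times> S q')"
        proof -
          have "lin dd f1 = - lin dd f2" using less.prems(4) f12(3) Suc by (simp add: lin_add eq_neg_iff_add_eq_0)
          moreover have "lin dd f2 \<in> fspan (\<Union>\<Q>' \<times> S q')"
          proof -
            have "dd y \<in> fspan (\<Union>\<Q>' \<times> S q')" if y: "y \<in> \<Union>\<Q>' \<times> S (Suc q')" for y
            proof -
              obtain Q where Q: "Q \<in> \<Q>'" "fst y \<in> Q" using y by auto
              have "lin dd (sg y \<eta>) \<in> ec (Q \<times> S q')" by (rule dd_P) (use Q P y in \<open>auto intro!: ech_sg simp: \<eta> mem_Times_iff\<close>)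
              moreover have "scale \<eta> (dd y) = dd y"
              proof -
                have "fst y \<in> D" "snd y \<in> S (Suc q')" using Q P sub y by auto
                thus ?thesis unfolding dd_def using lm_scale_eta S_ech by blast
              qed
              ultimately have "dd y \<in> fspan (Q \<times> S q')" by auto
              thus ?thesis by (rule fspan_mono) (use Q in auto)
            qed
            thus ?thesis by (rule fspan_lin[OF ech_fspan[OF f12(2)[unfolded Suc]]])
          qed
          moreover have "lin dd f1 \<in> ec (P \<times> S q')" using dd_P[OF P(1)] f12(1) Suc by simp
          ultimately show ?thesis unfolding U by (auto simp: ech_def fspan_def)
        qed
        moreover have "0 < q' ==> lin dd (lin dd f1) = 0"
        proof -
          assume "0 < q'"
          then obtain q'' where "q' = Suc q''" by (cases q') auto
          moreover have "f1 \<in> FC q" using ech_fspan[OF ech_mono[OF f12(1)], of "D \<times> S q"] sub[OF P(1)] by blast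
          ultimately show ?thesis using dd_dd Suc by blast
        qed
        ultimately obtain w where "w \<in> ec (\<Union>?Q \<times> S (Suc q'))" "lin dd w = lin dd f1" using less.hyps[of ?Q "lin dd f1" q'] fin by blast
        thus ?thesis using that[of w] unfolding U Suc by blast
      qed
      have wP: "w \<in> ec (P \<times> S q)" "w \<in> ec (\<Union>\<Q>' \<times> S q)" using w(1) by (auto simp: ech_def fspan_def)
      obtain g1 where g1: "g1 \<in> ec (P \<times> S (Suc q))" "lin dd g1 = f1 - w" using base[OF P(1), of "f1 - w" q] f12(1) wP w(2) by (auto simp: lin_diff)
      have "0 < q ==> lin dd (f2 + w) = 0" using less.prems(4) w(2) f12(3) by (simp add: lin_add add.commute)
      then obtain g2 where g2: "g2 \<in> ec (\<Union>\<Q>' \<times> S (Suc q))" "lin dd g2 = f2 + w"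
        using less.hyps[OF card fin P(2), of "f2 + w" q] f12(2) wP by auto
      have "g1 + g2 \<in> ec (\<Union>\<Q> \<times> S (Suc q))"
      proof (rule ech_closed(2))
        show "g1 \<in> ec (\<Union>\<Q> \<times> S (Suc q))" "g2 \<in> ec (\<Union>\<Q> \<times> S (Suc q))" using g1(1) g2(1) by (auto simp: ech_def fspan_def Q)
      qed
      moreover have "lin dd (g1 + g2) = f" by (simp add: lin_add g1 g2 f12(3))
      ultimately show ?thesis by blast
    qed
  qed
  have "\<forall>d. \<exists>P. d \<in> D - T \<longrightarrow> P \<in> \<P> \<and> d \<in> P" using cover by blast
  then obtain h where h: "!!d. d \<in> D - T ==> h d \<in> \<P> \<and> d \<in> h d" by metis
  \<comment> \<open>The cover may be infinite, but the support of \<open>f\<close> needs only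
    finitely many members.\<close>
  define \<Q> where "\<Q> = h ` fst ` keys f"
  have kf: "keys f \<subseteq> (D - T) \<times> S q" using f(1) by (auto simp: ech_def fspan_def)
  have Q: "\<Q> \<subseteq> \<P>" "finite \<Q>" using kf h by (auto simp: \<Q>_def)
  have "f \<in> ec (\<Union>\<Q> \<times> S q)" using f(1) kf h by (fastforce simp: ech_def fspan_def \<Q>_def)
  then obtain g where g: "g \<in> ec (\<Union>\<Q> \<times> S (Suc q))" "lin dd g = f" using step[OF Q(2,1) _ f(2)] by blast
  moreover have "\<Union>\<Q> \<times> S (Suc q) \<subseteq> (D - T) \<times> S (Suc q)" using Q sub by blast
  ultimately show ?thesis using ech_mono by blast
qed

end

section \<open>The comparison with the bar complex is an isomorphism on homology\<close>

locale basis_resolution = basis_complex D T prd c e0 \<eta> S ch cell a0 s0 W \<iota>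
  for D T :: "'s set" and prd and c :: "'s => 's => 'u::comm_ring_1" and e0 \<eta>
    and S :: "nat => 'c set" and ch cell a0 s0 and W :: "('a => 'a) set" and \<iota> +
  assumes acyc: "f \<in> ec ((D - T) \<times> S q) ==> (0 < q ==> lin dd f = 0) ==>
       \<exists>g \<in> ec ((D - T) \<times> S (Suc q)). lin dd g = f"
begin

fun hx :: "(('a => 'a) list => (('a => 'a) list, 'u) chain) => ('a => 'a) list => (('a => 'a) list, 'u) chain" where
  "hx h [] = 0"
| "hx h (w # ws) = pm (lact w) (h (lact (finv w) ws))"

text \<open>Round trip on the bar resolution minus the identity, which over the ideal of \<eta> is
  multiplication by \<eta>.\<close>

definition ph :: "nat => ('a => 'a) list => (('a => 'a) list, 'u) chain" where
  "ph q L = lin (rho (rr q)) (tau (bc q) L) - sg L \<eta>"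

text \<open>The null-homotopy of \<open>ph\<close> given by the contraction of homogeneous tuples:
  \<open>id\<close> is prefixed to the part of \<open>ph\<close> that the homotopy one degree lower
  has not yet accounted for.\<close>

primrec hb :: "nat => ('a => 'a) list => (('a => 'a) list, 'u) chain" where
  "hb 0 = (\<lambda>ws. pm (Cons id) (ph 0 (id # ws)))"
| "hb (Suc q) = (\<lambda>ws. pm (Cons id) (ph (Suc q) (id # ws) - lin (hx (hb q)) (bd (id # ws))))"

lemma hx_map:
  assumes "w \<in> W" "L \<in> LW (Suc q)" shows "hx h (lact w L) = pm (lact w) (hx h L)"
proof -
  obtain v vs where L: "L = v # vs" "v \<in> W" using assms(2) by (cases L) (auto simp: LW_def)
  have "map ((\<circ>) (finv (w \<circ> v)) \<circ> (\<circ>) w) vs = lact (finv v) vs" by (simp add: finv_finv_comp[OF W(1)[OF assms(1)] W(1)[OF L(2)]])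
  thus ?thesis using L by (simp add: pm_map_comp del: map_eq_conv)
qed

lemma tau_D: "L \<in> LW (Suc q) ==> tau (bc q) L \<in> EC q" by (rule ech_TD[OF tau_in])

lemma ph_in: "L \<in> LW (Suc q) ==> ph q L \<in> fspan (LW (Suc q))"
  unfolding ph_def by (intro fspan_diff fspan_single fspan_lin[OF ech_fspan[OF tau_D]] rho_in)

lemma ph_map: "w \<in> W ==> L \<in> LW (Suc q) ==> ph q (lact w L) = pm (lact w) (ph q L)"
proof -
  assume w: "w \<in> W" and L: "L \<in> LW (Suc q)"
  have "lin (rho (rr q)) (lm (\<iota> w) (tau (bc q) L)) = scale \<eta> (pm (lact w) (lin (rho (rr q)) (tau (bc q) L)))"
    using rho_lm[OF TD[OF \<iota>_in[OF w]] ech_fspan[OF tau_D[OF L]]] \<iota>_in[OF w] \<kappa>(3)[OF w] by simp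
  also have "... = pm (lact w) (lin (rho (rr q)) (tau (bc q) L))" using lin_rho_eta[OF tau_D[OF L]] by (simp flip: pm_simps(5))
  finally show ?thesis by (simp add: ph_def tau_map[OF w L])
qed

lemma bd_ph: "L \<in> LW (Suc (Suc q)) ==> lin bd (ph (Suc q) L) = lin (ph q) (bd L)"
proof -
  assume L: "L \<in> LW (Suc (Suc q))"
  have "lin (ph q) (bd L) = lin (rho (rr q)) (lin (tau (bc q)) (bd L)) - scale \<eta> (bd L)" unfolding ph_def[abs_def] by (simp add: lin_fun lin_lin lin_scaled)
  thus ?thesis using bd_rho_Suc[OF ech_fspan[OF tau_D[OF L]]] dd_tau[OF L] by (simp add: ph_def lin_diff del: rr.simps bc.simps)
qed

lemma bd_ph_0: "L \<in> LW (Suc 0) ==> lin bd (ph 0 L) = 0"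
proof -
  assume L: "L \<in> LW (Suc 0)"
  then obtain w where w: "L = [w]" "w \<in> W" by (cases L) (auto simp: LW_def)
  show ?thesis using bd_rho_0[OF ech_fspan[OF tau_D[OF L]]] w \<iota>_in by (simp add: ph_def lin_diff ag_pair \<eta> s0(2) del: rr.simps)
qed

lemma hb_homotopy: "L \<in> LW (Suc q) ==> hx (hb q) L \<in> fspan (LW (Suc (Suc q))) \<and>
    lin bd (hx (hb q) L) = ph q L - (case q of 0 => 0 | Suc q' => lin (hx (hb q')) (bd L))"
proof (induction q arbitrary: L)
  case 0
  then obtain w where w: "L = [w]" "w \<in> W" by (cases L) (auto simp: LW_def)
  have id: "[id] \<in> LW (Suc 0)" using LW_id[of "[]" 0] by (simp add: LW_def)
  have m: "hx (hb 0) L = pm (lact w) (pm (Cons id) (ph 0 [id]))" by (simp add: w)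
  have "pm (Cons id) (ph 0 [id]) \<in> fspan (LW (Suc (Suc 0)))" by (rule fspan_pm[OF ph_in[OF id]]) (rule LW_id)
  hence "hx (hb 0) L \<in> fspan (LW (Suc (Suc 0)))" unfolding m by (rule fspan_pm) (rule LW_map[OF w(2)])
  moreover have "lin bd (hx (hb 0) L) = ph 0 (lact w [id])" unfolding ph_map[OF w(2) id] m lin_bd_map lin_bd_Cons bd_ph_0[OF id] by simp
  ultimately show ?case by (simp add: w del: hx.simps hb.simps)
next
  case (Suc q)
  then obtain w ws0 where w: "L = w # ws0" "w \<in> W" "ws0 \<in> LW (Suc q)" by (cases L) (auto simp: LW_def)
  define M where "M = id # lact (finv w) ws0"
  have M: "M \<in> LW (Suc (Suc q))" unfolding M_def by (rule LW_id[OF LW_map[OF W(3)[OF w(2)] w(3)]])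
  have LM: "L = lact w M" by (auto simp: M_def w(1) finv_W(2)[OF w(2)] intro: map_idI[symmetric])
  define y where "y = ph (Suc q) M - lin (hx (hb q)) (bd M)"
  have y: "y \<in> fspan (LW (Suc (Suc q)))" unfolding y_def using ph_in[OF M] fspan_lin[OF LW_bd[OF M]] Suc.IH by blast
  have m: "hx (hb (Suc q)) L = pm (lact w) (pm (Cons id) y)" unfolding w(1) hx.simps hb.simps(2) y_def M_def ..
  have "pm (Cons id) y \<in> fspan (LW (Suc (Suc (Suc q))))" by (rule fspan_pm[OF y]) (rule LW_id)
  hence 1: "hx (hb (Suc q)) L \<in> fspan (LW (Suc (Suc (Suc q))))" unfolding m by (rule fspan_pm) (rule LW_map[OF w(2)])
  have "lin bd (lin (hx (hb q)) (bd M)) = lin (\<lambda>l. ph q l - (case q of 0 => 0 | Suc q' => lin (hx (hb q')) (bd l))) (bd M)"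
    unfolding lin_lin by (rule lin_cong'[OF LW_bd[OF M]]) (use Suc.IH in blast)
  also have "... = lin (ph q) (bd M) - (case q of 0 => 0 | Suc q' => lin (hx (hb q')) (lin bd (bd M)))"
    by (cases q) (simp_all add: lin_fun lin_lin)
  also have "... = lin (ph q) (bd M)" by (cases q) (simp_all add: bd_bd)
  finally have "lin bd y = 0" by (simp add: y_def lin_diff bd_ph[OF M])
  hence "lin bd (hx (hb (Suc q)) L) = pm (lact w) y" unfolding m lin_bd_map lin_bd_Cons by simp
  also have "... = ph (Suc q) L - lin (hx (hb q)) (bd L)"
  proof -
    have "lin (hx (hb q)) (bd L) = pm (lact w) (lin (hx (hb q)) (bd M))" unfolding LM bd_map lin_pm pm_lin by (rule lin_cong'[OF LW_bd[OF M]]) (rule hx_map[OF w(2)])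
    thus ?thesis using ph_map[OF w(2) M] by (simp add: y_def LM)
  qed
  finally show ?case using 1 by simp
qed

lemma bar_retract:
  assumes z: "z \<in> ec (BX q)" "lin tv z = 0" shows "\<exists>b \<in> fspan (BX (Suc q)). z = lin (rb q) (lin (tb q) z) + lin tv b"
proof -
  define k where "k y = pm nfo (hx (hb q) (id # snd y))" for y :: "'a list \<times> ('a => 'a) list"
  define k' where "k' y = (case q of 0 => 0 | Suc q' => pm nfo (hx (hb q') (id # snd y)))" for y :: "'a list \<times> ('a => 'a) list"
  note zf = ech_fspan[OF z(1)]
  have "lin tv (lin k z) = lin (\<lambda>y. lin (rb q) (tb q y) - sg y \<eta> - lin k' (tv y)) z" unfolding lin_lin
  proof (rule lin_cong'[OF zf])
    fix y assume y: "y \<in> BX q"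
    hence y': "y = ([], snd y)" and L: "id # snd y \<in> LW (Suc q)" by (auto simp: BX_def LW_id)
    have ny: "nfo (id # snd y) = y" using y' by (metis nfo_def nf_id)
    have "lin tv (k y) = pm nfo (lin bd (hx (hb q) (id # snd y)))" unfolding k_def using hb_homotopy[OF L] tv_pm_nfo by blast
    also have "... = pm nfo (ph q (id # snd y)) - pm nfo (case q of 0 => 0 | Suc q' => lin (hx (hb q')) (bd (id # snd y)))"
      using hb_homotopy[OF L] by (simp del: hx.simps bd.simps)
    also have "pm nfo (ph q (id # snd y)) = lin (rb q) (tb q y) - sg y \<eta>"
    proof -
      have "pm nfo (lin (rho (rr q)) (tau (bc q) (id # snd y))) = lin (rb q) (ppi (tau (bc q) (id # snd y)))" by (rule nfo_rho[OF ech_fspan[OF tau_D[OF L]]])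
      also have "ppi (tau (bc q) (id # snd y)) = tb q y" using ppi_tau[OF fspan_single[OF L], of 1] by (simp add: ny del: tau.simps)
      finally show ?thesis unfolding ph_def pm_simps ny by (simp only:)
    qed
    also have "pm nfo (case q of 0 => 0 | Suc q' => lin (hx (hb q')) (bd (id # snd y))) = lin k' (tv y)"
    proof (cases q)
      case 0
      thus ?thesis by (simp add: k'_def[abs_def] lin_fun)
    next
      case (Suc q')
      have "lin k' (tv y) = lin (\<lambda>l. k' (nfo l)) (bd (id # snd y))" unfolding tv_nfo[OF y[unfolded Suc]] lin_pm ..
      also have "... = lin (\<lambda>l. pm nfo (hx (hb q') l)) (bd (id # snd y))"
      proof (rule lin_cong'[OF LW_bd[OF L]])
        fix l assume "l \<in> LW q"
        hence l: "l \<in> LW (Suc q')" using Suc by simp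
        then obtain w ws where w: "l = w # ws" "w \<in> W" "ws \<in> LW q'" by (cases l) (auto simp: LW_def)
        let ?m = "id # lact (finv w) ws"
        have m: "?m \<in> LW (Suc q')" by (rule LW_id[OF LW_map[OF W(3)[OF w(2)] w(3)]])
        have "l = lact w ?m" by (auto simp: w(1) finv_W(2)[OF w(2)] intro: map_idI[symmetric])
        hence "pm nfo (hx (hb q') l) = pm nfo (pm (lact w) (hx (hb q') ?m))" using hx_map[OF w(2) m] by simp
        also have "... = pm nfo (hx (hb q') ?m)" using pm_nfo_map[OF w(2)] hb_homotopy[OF m] by blast
        also have "... = k' (nfo l)" by (simp add: k'_def Suc nfo_def w(1) del: hx.simps)
        finally show "k' (nfo l) = pm nfo (hx (hb q') l)" ..
      qed
      finally show ?thesis by (simp add: Suc pm_lin del: bd.simps)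
    qed
    finally show "lin tv (k y) = lin (rb q) (tb q y) - sg y \<eta> - lin k' (tv y)" .
  qed
  also have "... = lin (rb q) (lin (tb q) z) - z - lin k' (lin tv z)" by (simp add: lin_fun lin_lin lin_scaled ech_eta[OF z(1)])
  finally have "z = lin (rb q) (lin (tb q) z) + lin tv (- lin k z)" using z(2) by (simp add: lin_uminus algebra_simps)
  moreover have "lin k z \<in> fspan (BX (Suc q))"
  proof (rule fspan_lin[OF zf])
    fix y assume "y \<in> BX q"
    hence "id # snd y \<in> LW (Suc q)" by (auto simp: BX_def LW_id)
    thus "k y \<in> fspan (BX (Suc q))" unfolding k_def using hb_homotopy fspan_pm nfo_in by blast
  qed
  ultimately show ?thesis by blast
qed

text \<open>The part of the free module that belongs to the ideal; \<open>ppi\<close> kills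
  it.\<close>

definition IFs :: "nat => ('s \<times> 'c, 'u) chain set" where "IFs q = fspan ((D - T) \<times> S q)"

lemma IFs_closed [simp, intro]:
  "0 \<in> IFs q" "f \<in> IFs q ==> g \<in> IFs q ==> f + g \<in> IFs q" "f \<in> IFs q ==> g \<in> IFs q ==> f - g \<in> IFs q"
  "f \<in> IFs q ==> scale r f \<in> IFs q" "f \<in> IFs q ==> - f \<in> IFs q" by (auto simp: IFs_def)

lemma lm_IFs: "d \<in> D ==> f \<in> IFs q ==> lm d f \<in> IFs q"
  unfolding lm_def IFs_def by (erule fspan_lin) (rule fspan_single, auto simp: prd_D T_prd)

lemma lm_nonT: "d \<in> D ==> d \<notin> T ==> f \<in> FC q ==> lm d f \<in> IFs q"
  unfolding lm_def IFs_def by (erule fspan_lin) (rule fspan_single, auto simp: prd_D T_prd)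

lemma ppi_IFs: "f \<in> IFs q ==> ppi f = 0"
  unfolding IFs_def ppi_def using lin_cong'[of f "(D - T) \<times> S q" "\<lambda>y. if fst y \<in> T then sg (snd y) 1 else 0" "\<lambda>_. 0"]
  by (auto simp: lin_fun)

text \<open>Identity minus round trip on the resolution, at a generator. The map \<open>tau\<close>
  is compatible with the action of \<open>T\<close> only, so the round trip is linear only modulo
  the ideal; this is why the homotopy equation below is a congruence modulo
  \<open>IFs\<close>.\<close>

definition xf :: "nat => 'c => ('s \<times> 'c, 'u) chain" where "xf q s = sg (e0, s) \<eta> - lin (tau (bc q)) (rr q s)"

definition hfx :: "('c => ('s \<times> 'c, 'u) chain) => 's \<times> 'c => ('s \<times> 'c, 'u) chain" where
  "hfx h y = lm (fst y) (h (snd y))"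

text \<open>The homotopy is chosen cell by cell. That a choice exists in positive degrees is where
  the acyclicity of the ideal enters.\<close>

primrec hf :: "nat => 'c => ('s \<times> 'c, 'u) chain" where
  "hf 0 = (\<lambda>s. SOME g. g \<in> EC (Suc 0) \<and> lin dd g - xf 0 s \<in> IFs 0)"
| "hf (Suc q) = (\<lambda>s. SOME g. g \<in> ec (D \<times> S (Suc (Suc q))) \<and>
     lin dd g - (xf (Suc q) s - lin (hfx (hf q)) (ch s)) \<in> IFs (Suc q))"

text \<open>The term that the homotopy equation takes from the degree below, with value 0 in degree
  0.\<close>

definition hfr :: "nat => ('s \<times> 'c, 'u) chain => ('s \<times> 'c, 'u) chain" where
  "hfr q f = (case q of 0 => 0 | Suc q' => lin (hfx (hf q')) f)"

lemma xf_in: "s \<in> S q ==> xf q s \<in> EC q" unfolding xf_def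
  by (intro ech_closed(3) ech_sg ech_lin'[OF rr_in]) (auto simp: e0 TD \<eta> intro: tau_D)

lemma hfx_in:
  assumes "!!s. s \<in> S q ==> h s \<in> EC (Suc q)" "f \<in> FC q" shows "lin (hfx h) f \<in> EC (Suc q)"
proof (rule ech_lin'[OF assms(2)])
  fix y assume y: "y \<in> D \<times> S q"
  hence "h (snd y) \<in> FC (Suc q)" "fst y \<in> D" using assms(1)[of "snd y"] by auto
  thus "hfx h y \<in> EC (Suc q)" unfolding hfx_def ech_def using lm_in lm_scale_eta by blast
qed

lemma hfx_lm:
  assumes h: "!!s. s \<in> S q ==> h s \<in> EC (Suc q)" and d: "d \<in> D" and f: "f \<in> FC q"
  shows "lin (hfx h) (lm d f) = lm d (lin (hfx h) f)" unfolding lin_lm lm_lin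
proof (rule lin_cong'[OF f])
  fix y assume y: "y \<in> D \<times> S q"
  hence hy: "h (snd y) \<in> FC (Suc q)" "fst y \<in> D" using h[of "snd y"] by auto
  show "scale (c d (fst y)) (hfx h (prd d (fst y), snd y)) = lm d (hfx h y)" using lm_lm[OF d hy(2,1)] by (simp add: hfx_def)
qed

lemma hf_spec_0:
  assumes s: "s \<in> S 0" shows "hf 0 s \<in> EC (Suc 0) \<and> lin dd (hf 0 s) - xf 0 s \<in> IFs 0"
proof -
  have "lin ag (xf 0 s) = 0" using s \<iota>_in[OF W(4)] e0(1) by (simp add: xf_def lin_diff ag_pair a0 s0(2) \<eta> mult.commute)
  hence "xf 0 s \<in> cyc 0" using xf_in[OF s] by (simp add: cyc_def)
  from exact[OF this] have "\<exists>g. g \<in> EC (Suc 0) \<and> lin dd g - xf 0 s \<in> IFs 0" by (metis IFs_closed(1) diff_self)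
  from someI_ex[OF this] show ?thesis by simp
qed

text \<open>The congruence passes from cells to all chains: multiplication by \<open>d\<close> keeps
  the error in the ideal, and the failure of \<open>tau\<close> to commute with \<open>d\<close>
  lies in the ideal as well.\<close>

lemma hfr_extend:
  assumes h: "!!s. s \<in> S q ==> hf q s \<in> EC (Suc q) \<and> lin dd (hf q s) - (xf q s - hfr q (ch s)) \<in> IFs q"
    and h': "!!q' s. q = Suc q' ==> s \<in> S q' ==> hf q' s \<in> EC (Suc q')" and f: "f \<in> FC q"
  shows "lin dd (lin (hfx (hf q)) f) - (scale \<eta> f - lin (tau (bc q)) (lin (rho (rr q)) f) - hfr q (lin dd f)) \<in> IFs q"
proof -
  let ?F = "\<lambda>y. lin dd (hfx (hf q) y) - (sg y \<eta> - lin (tau (bc q)) (rho (rr q) y) - hfr q (dd y))"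
  have "lin dd (lin (hfx (hf q)) f) - (scale \<eta> f - lin (tau (bc q)) (lin (rho (rr q)) f) - hfr q (lin dd f)) = lin ?F f"
    by (cases q) (simp_all add: lin_fun lin_lin lin_scaled hfr_def del: rr.simps bc.simps hf.simps)
  moreover have "lin ?F f \<in> IFs q" unfolding IFs_def
  proof (rule fspan_lin[OF f], fold IFs_def)
    fix y assume y: "y \<in> D \<times> S q"
    obtain d s where ds: "y = (d, s)" "d \<in> D" "s \<in> S q" using y by auto
    note hs = conjunct1[OF h[OF ds(3)]]
    have 1: "lm d (lin dd (hf q s) - (xf q s - hfr q (ch s))) \<in> IFs q" using lm_IFs[OF ds(2)] h[OF ds(3)] by blast
    have 2: "lm d (hfr q (ch s)) = hfr q (dd y)"
    proof (cases q)
      case (Suc q')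
      thus ?thesis using hfx_lm[OF h'[OF Suc] ds(2) ech_fspan[OF S_ech[of s q']]] ds(3) by (simp add: hfr_def dd_def ds(1))
    qed (simp add: hfr_def)
    have rs: "rr q s \<in> fspan (LW (Suc q))" by (rule rr_in[OF ds(3)])
    have tr: "lin (tau (bc q)) (rr q s) \<in> FC q" by (rule fspan_lin[OF rs]) (rule ech_fspan[OF tau_D])
    have 3: "lm d (lin (tau (bc q)) (rr q s)) - lin (tau (bc q)) (rho (rr q) y) \<in> IFs q"
    proof (cases "d \<in> T")
      case True
      thus ?thesis using lin_tau_map[OF \<kappa>(1)[OF True] rs, of "bc q"] \<kappa>(2)[OF True] by (simp add: rho_def ds(1) del: rr.simps bc.simps)
    next
      case False
      thus ?thesis using lm_nonT[OF ds(2) False tr] by (simp add: rho_def ds(1))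
    qed
    have 4: "lm d (sg (e0, s) \<eta>) = sg y \<eta>" using ds e0 by (simp add: \<eta>)
    have 5: "lm d (lin dd (hf q s)) = lin dd (hfx (hf q) y)" using dd_lm[OF ds(2) ech_fspan[OF hs]] by (simp add: hfx_def ds(1))
    have "?F y = lm d (lin dd (hf q s) - (xf q s - hfr q (ch s))) - (lm d (lin (tau (bc q)) (rr q s)) - lin (tau (bc q)) (rho (rr q) y))"
      unfolding xf_def lm_simps 2 4 5 by simp
    thus "?F y \<in> IFs q" using 1 3 IFs_closed(3) by (simp only:)
  qed
  ultimately show ?thesis by simp
qed

lemma hf_spec: "s \<in> S q ==> hf q s \<in> EC (Suc q) \<and> lin dd (hf q s) - (xf q s - hfr q (ch s)) \<in> IFs q"
proof (induction q arbitrary: s rule: less_induct)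
  case (less q0)
  show ?case
  proof (cases q0)
  case 0
  thus ?thesis using hf_spec_0 less.prems by (simp add: hfr_def)
next
  case (Suc q)
  have s: "s \<in> S (Suc q)" using less.prems Suc by simp
  have IH: "t \<in> S q ==> hf q t \<in> EC (Suc q) \<and> lin dd (hf q t) - (xf q t - hfr q (ch t)) \<in> IFs q" for t using less.IH[of q] Suc by simp
  have h': "q = Suc q' ==> t \<in> S q' ==> hf q' t \<in> EC (Suc q')" for q' t using less.IH[of q'] Suc by simp
  have c: "ch s \<in> cyc q" by (rule S_ch[OF s])
  have cf: "ch s \<in> FC q" by (rule cyc_fspan[OF c])
  define Xc where "Xc = xf (Suc q) s - lin (hfx (hf q)) (ch s)"
  have Xc: "Xc \<in> EC (Suc q)" unfolding Xc_def using xf_in[OF s] hfx_in[OF _ cf, of "hf q"] IH by blast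
  have "lin dd (lin (tau (bc (Suc q))) (rr (Suc q) s)) = lin (\<lambda>l. lin (tau (bc q)) (bd l)) (rr (Suc q) s)"
    unfolding lin_lin by (rule lin_cong'[OF rr_in[OF s]]) (rule dd_tau)
  also have "... = lin (tau (bc q)) (lin (rho (rr q)) (ch s))" unfolding lin_lin[symmetric] bd_rr[OF s] ..
  finally have "lin dd Xc = ch s - lin (tau (bc q)) (lin (rho (rr q)) (ch s)) - lin dd (lin (hfx (hf q)) (ch s))"
    unfolding Xc_def xf_def lin_diff dd_e0[OF s] by simp
  moreover have "hfr q (lin dd (ch s)) = 0" using c by (cases q) (auto simp: hfr_def cyc_def)
  moreover have "scale \<eta> (ch s) = ch s" using c ech_eta unfolding cyc_def by blast
  ultimately have "lin dd (lin (hfx (hf q)) (ch s)) - (scale \<eta> (ch s) - lin (tau (bc q)) (lin (rho (rr q)) (ch s)) - hfr q (lin dd (ch s)))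
      = - lin dd Xc" by simp
  hence "- lin dd Xc \<in> IFs q" using hfr_extend[OF IH h' cf] by (simp only:)
  hence "lin dd Xc \<in> IFs q" using IFs_closed(5) by fastforce
  hence "lin dd Xc \<in> ec ((D - T) \<times> S q)" using dd_in[OF ech_fspan[OF Xc]] by (simp add: ech_def IFs_def)
  moreover have "0 < q ==> lin dd (lin dd Xc) = 0" using dd_dd[of Xc "q - 1"] Xc by auto
  \<comment> \<open>The boundary of the remaining defect \<open>Xc\<close> is a cycle over the
    ideal, so it is filled by some \<open>g\<close> over the ideal. Then \<open>Xc - g\<close> is a
    cycle of the resolution and bounds a cell.\<close>
  ultimately obtain g where g: "g \<in> ec ((D - T) \<times> S (Suc q))" "lin dd g = lin dd Xc" using acyc[of "lin dd Xc" q] by blast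
  hence "g \<in> EC (Suc q)" by (auto simp: ech_def elim: fspan_mono)
  hence "Xc - g \<in> cyc (Suc q)" using Xc g by (simp add: cyc_def lin_diff)
  from exact[OF this] have "\<exists>y. y \<in> ec (D \<times> S (Suc (Suc q))) \<and> lin dd y - Xc \<in> IFs (Suc q)"
    using g(1) by (intro exI[of _ "sg (e0, cell (Xc - g)) \<eta>"]) (auto simp: IFs_def ech_def)
  from someI_ex[OF this] show ?thesis by (simp add: Xc_def hfr_def Suc)
  qed
qed

text \<open>Tensoring with the trivial module kills the ideal, so the congruence modulo
  \<open>IFs\<close> becomes an honest homotopy.\<close>

lemma res_retract:
  assumes k: "k \<in> ec (S q)" "0 < q ==> lin dk k = 0" shows "\<exists>y \<in> ec (S (Suc q)). k = lin (tb q) (lin (rb q) k) + lin dk y"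
proof -
  define g where "g s = ppi (hf q s)" for s
  define g' where "g' s = (case q of 0 => 0 | Suc q' => ppi (hf q' s))" for s
  note kf = ech_fspan[OF k(1)]
  have "lin dk (lin g k) = lin (\<lambda>s. sg s \<eta> - lin (tb q) (rb q s) - (case q of 0 => 0 | Suc q' => lin g' (dk s))) k"
    unfolding lin_lin
  proof (rule lin_cong'[OF kf])
    fix s assume s: "s \<in> S q"
    note h = hf_spec[OF s]
    have "lin dk (g s) = ppi (lin dd (hf q s))" unfolding g_def by (rule ppi_dd[symmetric]) (use h in blast)
    also have "... = ppi (xf q s - hfr q (ch s))" using ppi_IFs[OF conjunct2[OF h]] by simp
    also have "... = sg s \<eta> - lin (tb q) (rb q s) - ppi (hfr q (ch s))"
      using ppi_tau[OF rr_in[OF s]] e0(1) by (simp add: xf_def rb_def del: rr.simps bc.simps)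
    also have "ppi (hfr q (ch s)) = (case q of 0 => 0 | Suc q' => lin g' (dk s))"
    proof (cases q)
      case (Suc q')
      have c: "ch s \<in> FC q'" using S_ech[of s q'] s Suc by auto
      have "ppi (lin (hfx (hf q')) (ch s)) = lin (\<lambda>y. lin g' (if fst y \<in> T then sg (snd y) 1 else 0)) (ch s)" unfolding ppi_lin
      proof (rule lin_cong'[OF c])
        fix y assume y: "y \<in> D \<times> S q'"
        hence e: "hf q' (snd y) \<in> EC (Suc q')" using hf_spec[of "snd y" q'] by auto
        have "scale \<eta> (ppi (hf q' (snd y))) = ppi (hf q' (snd y))" using ech_eta[OF e] ppi_simps(3) by metis
        thus "ppi (hfx (hf q') y) = lin g' (if fst y \<in> T then sg (snd y) 1 else 0)"
          using y ppi_lm[OF _ ech_fspan[OF e], of "fst y"] by (auto simp: hfx_def g'_def Suc)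
      qed
      also have "... = lin g' (dk s)" by (simp add: dk_def ppi_def lin_lin)
      finally show ?thesis by (simp add: hfr_def Suc)
    qed (simp add: hfr_def)
    finally show "lin dk (g s) = sg s \<eta> - lin (tb q) (rb q s) - (case q of 0 => 0 | Suc q' => lin g' (dk s))" .
  qed
  also have "... = k - lin (tb q) (lin (rb q) k) - (case q of 0 => 0 | Suc q' => lin g' (lin dk k))"
    by (cases q) (simp_all add: lin_fun lin_lin lin_scaled ech_eta[OF k(1)] del: rr.simps bc.simps)
  also have "... = k - lin (tb q) (lin (rb q) k)" using k(2) by (cases q) auto
  finally have "k = lin (tb q) (lin (rb q) k) + lin dk (lin g k)" by simp
  moreover have "lin g k \<in> ec (S (Suc q))"
  proof (rule ech_lin'[OF kf])
    fix s assume "s \<in> S q"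
    hence e: "hf q s \<in> EC (Suc q)" using hf_spec by blast
    have "scale \<eta> (g s) = g s" unfolding g_def using ech_eta[OF e] ppi_simps(3) by metis
    thus "g s \<in> ec (S (Suc q))" using ppi_in[OF ech_fspan[OF e]] by (simp add: ech_def g_def)
  qed
  ultimately show ?thesis by blast
qed

lemma bar_to_res_surj:
  assumes k: "k \<in> ec (S q)" "0 < q ==> lin dk k = 0"
  obtains z y where "z \<in> ec (BX q)" "lin tv z = 0" "y \<in> ec (S (Suc q))" "k = lin (tb q) z + lin dk y"
proof -
  let ?z = "lin (rb q) k"
  obtain y where y: "y \<in> ec (S (Suc q))" "k = lin (tb q) ?z + lin dk y" using res_retract[OF k] by blast
  have z: "?z \<in> fspan (BX q)" by (rule rb_in[OF ech_fspan[OF k(1)]])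
  have "scale \<eta> ?z = ?z" using ech_eta[OF k(1)] lin_scale by metis
  hence "?z \<in> ec (BX q)" using z by (simp add: ech_def)
  moreover have "lin tv ?z = 0"
  proof (cases q)
    case 0
    have "lin tv ?z = lin (\<lambda>_. 0) ?z" by (rule lin_cong'[OF z]) (auto simp: 0 BX_def LW_def tv_def)
    thus ?thesis by (simp add: lin_fun)
  next
    case (Suc q')
    thus ?thesis using rb_dk[of k q'] k by auto
  qed
  ultimately show thesis using that y by blast
qed

lemma bar_to_res_inj:
  assumes z: "z \<in> ec (BX q)" "lin tv z = 0" and y: "y \<in> fspan (S (Suc q))" "lin (tb q) z = lin dk y" shows "\<exists>b \<in> ec (BX (Suc q)). z = lin tv b"
proof -
  obtain b where b: "b \<in> fspan (BX (Suc q))" "z = lin (rb q) (lin (tb q) z) + lin tv b" using bar_retract[OF z] by blast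
  have "z = lin tv (lin (rb (Suc q)) y + b)" using b(2) rb_dk[OF y(1)] y(2) by (simp add: lin_add)
  hence "scale \<eta> z = lin tv (scale \<eta> (lin (rb (Suc q)) y + b))" by (metis lin_scale)
  moreover have "scale \<eta> (lin (rb (Suc q)) y + b) \<in> ec (BX (Suc q))" using rb_in[OF y(1)] b(1) by (intro ech_closed(4) fspan_add)
  ultimately show ?thesis using ech_eta[OF z(1)] by auto
qed

end

section \<open>Quotient modules presented by chains\<close>

locale quot_presentation =
  fixes M :: "('k, 'm, 'y) module_scheme" and k :: "('k, 'z) ring_scheme" and p :: "'v::ab_group_add => 'm"
    and Vs Y :: "'v set" and sc :: "'k => 'v => 'v"
  assumes bij: "bij_betw p Vs (carrier M)"
    and Vs: "x \<in> Vs ==> y \<in> Vs ==> x + y \<in> Vs" "r \<in> carrier k ==> x \<in> Vs ==> sc r x \<in> Vs"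
    and Y: "Y \<subseteq> Vs" "0 \<in> Y" "x \<in> Y ==> y \<in> Y ==> x + y \<in> Y" "x \<in> Y ==> - x \<in> Y" "r \<in> carrier k ==> x \<in> Y ==> sc r x \<in> Y"
    and p: "x \<in> Vs ==> y \<in> Vs ==> p (x + y) = p x \<oplus>\<^bsub>M\<^esub> p y" "r \<in> carrier k ==> x \<in> Vs ==> p (sc r x) = r \<odot>\<^bsub>M\<^esub> p x"
    and sc: "r \<in> carrier k ==> sc r (x + y) = sc r x + sc r y"
begin

text \<open>The coset of \<open>p x\<close> modulo the image of \<open>Y\<close>, written through
  the addition of chains instead of that of \<open>M\<close>.\<close>

definition qv :: "'v => 'm set" where "qv x = (\<lambda>y. p (y + x)) ` Y"

lemma YX: "y \<in> Y ==> y \<in> Vs" using Y(1) by blast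

lemma coset: "x \<in> Vs ==> p ` Y +>\<^bsub>M\<^esub> p x = qv x" by (auto simp: a_r_coset_def' qv_def p YX image_iff)

lemma qv_shift: "y \<in> Y ==> qv (y + x) = qv x"
proof -
  assume y: "y \<in> Y"
  have "p (z + (y + x)) \<in> qv x" if "z \<in> Y" for z using Y(3)[OF that y] by (auto simp: qv_def add.assoc[symmetric])
  moreover have "p (z + x) \<in> qv (y + x)" if "z \<in> Y" for z
  proof -
    have "z + x = (z + - y) + (y + x)" by simp
    moreover have "z + - y \<in> Y" using Y(3)[OF that Y(4)[OF y]] .
    ultimately show ?thesis unfolding qv_def by (metis image_eqI)
  qed
  ultimately show ?thesis by (auto simp: qv_def)
qed

lemma qv_eq: "x \<in> Vs ==> x' \<in> Vs ==> qv x = qv x' \<longleftrightarrow> x - x' \<in> Y"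
proof
  assume x: "x \<in> Vs" "x' \<in> Vs" and eq: "qv x = qv x'"
  have "p x \<in> qv x" using Y(2) by (force simp: qv_def)
  then obtain y where y: "y \<in> Y" "p x = p (y + x')" using eq by (auto simp: qv_def)
  hence "x = y + x'" using inj_onD[OF bij_betw_imp_inj_on[OF bij], of x "y + x'"] x YX Vs(1) by auto
  thus "x - x' \<in> Y" using y by simp
next
  assume "x - x' \<in> Y"
  from qv_shift[OF this, of x'] show "qv x = qv x'" by simp
qed

lemma carrier_quot: "carrier (quot_mod M (p ` Y)) = qv ` Vs"
proof -
  have "carrier (quot_mod M (p ` Y)) = (\<lambda>a. p ` Y +>\<^bsub>M\<^esub> a) ` carrier M" by (auto simp: quot_mod_def A_RCOSETS_def')
  also have "... = (\<lambda>x. p ` Y +>\<^bsub>M\<^esub> p x) ` Vs" unfolding bij_betw_imp_surj_on[OF bij, symmetric] image_image ..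
  finally show ?thesis using coset by auto
qed

lemma add_quot: "x \<in> Vs ==> x' \<in> Vs ==> qv x \<oplus>\<^bsub>quot_mod M (p ` Y)\<^esub> qv x' = qv (x + x')"
proof -
  assume x: "x \<in> Vs" "x' \<in> Vs"
  have "qv x \<oplus>\<^bsub>quot_mod M (p ` Y)\<^esub> qv x' = {p (y + x) \<oplus>\<^bsub>M\<^esub> p (y' + x') | y y'. y \<in> Y \<and> y' \<in> Y}"
    by (auto simp: quot_mod_def set_add_def' qv_def)
  also have "... = {p ((y + y') + (x + x')) | y y'. y \<in> Y \<and> y' \<in> Y}"
  proof -
    have "p (y + x) \<oplus>\<^bsub>M\<^esub> p (y' + x') = p ((y + y') + (x + x'))" if "y \<in> Y" "y' \<in> Y" for y y'
      using that x YX Vs(1) p(1)[of "y + x" "y' + x'"] by (simp add: algebra_simps)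
    thus ?thesis by metis
  qed
  also have "... = qv (x + x')"
  proof -
    have "p (y + (x + x')) \<in> {p ((y + y') + (x + x')) | y y'. y \<in> Y \<and> y' \<in> Y}" if "y \<in> Y" for y
    proof -
      have "p (y + (x + x')) = p ((y + 0) + (x + x'))" by simp
      thus ?thesis using that Y(2) by blast
    qed
    thus ?thesis using Y(3) unfolding qv_def by blast
  qed
  finally show ?thesis .
qed

lemma smult_quot: "r \<in> carrier k ==> x \<in> Vs ==> r \<odot>\<^bsub>quot_mod M (p ` Y)\<^esub> qv x = qv (sc r x)"
proof -
  assume r: "r \<in> carrier k" and x: "x \<in> Vs"
  have "p ` Y +>\<^bsub>M\<^esub> (r \<odot>\<^bsub>M\<^esub> p (y + x)) = qv (sc r x)" if y: "y \<in> Y" for y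
  proof -
    have yx: "y + x \<in> Vs" using y x YX Vs(1) by blast
    have "p ` Y +>\<^bsub>M\<^esub> (r \<odot>\<^bsub>M\<^esub> p (y + x)) = qv (sc r (y + x))" using coset[OF Vs(2)[OF r yx]] p(2)[OF r yx] by simp
    also have "... = qv (sc r x)" unfolding sc[OF r] by (rule qv_shift[OF Y(5)[OF r y]])
    finally show ?thesis .
  qed
  hence "(\<Union>z\<in>qv x. p ` Y +>\<^bsub>M\<^esub> (r \<odot>\<^bsub>M\<^esub> z)) = qv (sc r x)" using Y(2) unfolding qv_def[of x] by auto
  thus ?thesis by (simp add: quot_mod_def)
qed

lemma zero_quot: "\<zero>\<^bsub>quot_mod M (p ` Y)\<^esub> = qv 0" by (simp add: quot_mod_def qv_def)

end

lemma quot_map_qv: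
  assumes "quot_presentation M k p Vs Y sc" "quot_presentation M' k' p' Vs' Y' sc'"
    and f: "!!x. x \<in> Vs ==> f (p x) = p' (g x)" "!!x. x \<in> Vs ==> g x \<in> Vs'" "!!y. y \<in> Y ==> g y \<in> Y'"
      "!!x y. x \<in> Vs ==> y \<in> Vs ==> g (x + y) = g x + g y" and x: "x \<in> Vs"
  shows "quot_map M' (p' ` Y') f (quot_presentation.qv p Y x) = quot_presentation.qv p' Y' (g x)"
proof -
  interpret A: quot_presentation M k p Vs Y sc by fact
  interpret B: quot_presentation M' k' p' Vs' Y' sc' by fact
  have "p' ` Y' +>\<^bsub>M'\<^esub> f (p (y + x)) = B.qv (g x)" if y: "y \<in> Y" for y
  proof -
    have yx: "y + x \<in> Vs" "y \<in> Vs" using y x A.YX A.Vs(1) by auto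
    have "p' ` Y' +>\<^bsub>M'\<^esub> f (p (y + x)) = B.qv (g (y + x))" using f(1,2)[OF yx(1)] B.coset by simp
    also have "... = B.qv (g x)" using f(4)[OF yx(2) x] B.qv_shift[OF f(3)[OF y]] by simp
    finally show ?thesis .
  qed
  thus ?thesis using A.Y(2) by (auto simp: quot_map_def A.qv_def)
qed

section \<open>Translation between functions with values in \<open>k\<close> and chains\<close>

definition tu :: "('k, 'x) ring_scheme => ('s => 'k) => ('s, 'k coef) chain" where
  "tu k f = Abs_poly_mapping (\<lambda>s. emb k (f s))"

definition ut :: "('k, 'x) ring_scheme => ('s, 'k coef) chain => ('s => 'k)" where "ut k g = (\<lambda>s. unemb k (lkp g s))"

abbreviation eta :: "('k, 'x) ring_scheme => 'k coef" where "eta k \<equiv> emb k \<one>\<^bsub>k\<^esub>"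

context cring
begin

lemma fin_funD: "f \<in> fin_fun R S ==> f s \<in> carrier R" "f \<in> fin_fun R S ==> finite {s. f s \<noteq> \<zero>}" "f \<in> fin_fun R S ==> s \<notin> S ==> f s = \<zero>"
  by (auto simp: fin_fun_def)

lemma lkp_tu [simp]: "f \<in> fin_fun R S ==> lkp (tu R f) s = emb R (f s)"
proof -
  assume f: "f \<in> fin_fun R S"
  have "{s. emb R (f s) \<noteq> 0} \<subseteq> {s. f s \<noteq> \<zero>}" by auto
  hence "finite {s. emb R (f s) \<noteq> 0}" using fin_funD(2)[OF f] finite_subset by blast
  thus ?thesis by (simp add: tu_def)
qed

lemma keys_tu:
  assumes f: "f \<in> fin_fun R S" shows "keys (tu R f) = {s. f s \<noteq> \<zero>}" by (auto simp: in_keys_iff lkp_tu[OF f] emb_eq_0[OF fin_funD(1)[OF f]])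

lemma eta_emb: "eta R * eta R = eta R" "r \<in> carrier R ==> eta R * emb R r = emb R r" by simp_all

lemma tu_ech:
  assumes f: "f \<in> fin_fun R S" shows "tu R f \<in> ech (eta R) S"
proof -
  have "keys (tu R f) \<subseteq> S" using fin_funD(3)[OF f] by (auto simp: keys_tu[OF f])
  moreover have "scale (eta R) (tu R f) = tu R f" by (rule poly_mapping_eqI) (simp add: lkp_tu[OF f] fin_funD(1)[OF f])
  ultimately show ?thesis by (simp add: ech_def fspan_def)
qed

lemma tu_inj: "f \<in> fin_fun R S ==> g \<in> fin_fun R S' ==> tu R f = tu R g ==> f = g"
proof
  fix s assume f: "f \<in> fin_fun R S" "g \<in> fin_fun R S'" "tu R f = tu R g"
  hence "emb R (f s) = emb R (g s)" using lkp_tu by metis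
  thus "f s = g s" using emb_inj fin_funD(1) f by metis
qed

lemma ut_in: "g \<in> fspan S ==> ut R g \<in> fin_fun R S"
proof -
  assume g: "g \<in> fspan S"
  have "{s. ut R g s \<noteq> \<zero>} \<subseteq> keys g" by (auto simp: ut_def in_keys_iff)
  hence "finite {s. ut R g s \<noteq> \<zero>}" by (rule finite_subset) simp
  moreover have "lkp g s = 0" if "s \<notin> S" for s using g that by (auto simp: fspan_def in_keys_iff)
  ultimately show ?thesis by (auto simp: fin_fun_def ut_def)
qed

lemma tu_ut: "g \<in> ech (eta R) S ==> tu R (ut R g) = g"
proof (rule poly_mapping_eqI)
  fix s assume g: "g \<in> ech (eta R) S"
  have "lkp (tu R (ut R g)) s = eta R * lkp g s" using lkp_tu[OF ut_in[OF ech_fspan[OF g]]] by (simp add: ut_def emb_unemb)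
  also have "... = lkp g s" using ech_eta[OF g] by (metis lookup_scale)
  finally show "lkp (tu R (ut R g)) s = lkp g s" .
qed

lemma ut_tu: "f \<in> fin_fun R S ==> ut R (tu R f) = f" using fin_funD(1)[of f S] by (simp add: ut_def)

lemma fin_fun_add: "f \<in> fin_fun R S ==> g \<in> fin_fun R S ==> (\<lambda>s. f s \<oplus> g s) \<in> fin_fun R S"
proof -
  assume f: "f \<in> fin_fun R S" "g \<in> fin_fun R S"
  have "{s. f s \<oplus> g s \<noteq> \<zero>} \<subseteq> {s. f s \<noteq> \<zero>} \<union> {s. g s \<noteq> \<zero>}" by auto
  hence "finite {s. f s \<oplus> g s \<noteq> \<zero>}" by (rule finite_subset) (use f in \<open>auto dest: fin_funD(2)\<close>)
  thus ?thesis using f by (auto simp: fin_fun_def)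
qed

lemma fin_fun_smult: "r \<in> carrier R ==> f \<in> fin_fun R S ==> (\<lambda>s. r \<otimes> f s) \<in> fin_fun R S"
proof -
  assume r: "r \<in> carrier R" and f: "f \<in> fin_fun R S"
  have "{s. r \<otimes> f s \<noteq> \<zero>} \<subseteq> {s. f s \<noteq> \<zero>}" using r by auto
  hence "finite {s. r \<otimes> f s \<noteq> \<zero>}" by (rule finite_subset) (use f in \<open>auto dest: fin_funD(2)\<close>)
  thus ?thesis using f r by (auto simp: fin_fun_def)
qed

lemma fin_fun_minus: "f \<in> fin_fun R S ==> (\<lambda>s. \<ominus> f s) \<in> fin_fun R S"
proof -
  assume f: "f \<in> fin_fun R S"
  have "{s. \<ominus> f s \<noteq> \<zero>} \<subseteq> {s. f s \<noteq> \<zero>}" by auto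
  hence "finite {s. \<ominus> f s \<noteq> \<zero>}" by (rule finite_subset) (use f in \<open>auto dest: fin_funD(2)\<close>)
  thus ?thesis using f by (auto simp: fin_fun_def)
qed

lemma fin_fun_zero: "(\<lambda>s. \<zero>) \<in> fin_fun R S" by (simp add: fin_fun_def)

lemma fin_fun_single: "s \<in> S ==> r \<in> carrier R ==> Defs.single R s r \<in> fin_fun R S"
  by (auto simp: fin_fun_def Defs.single_def)

lemma tu_single: "s \<in> S ==> r \<in> carrier R ==> tu R (Defs.single R s r) = sg s (emb R r)"
proof (rule poly_mapping_eqI)
  fix t assume "s \<in> S" "r \<in> carrier R"
  from lkp_tu[OF fin_fun_single[OF this]] show "lkp (tu R (Defs.single R s r)) t = lkp (sg s (emb R r)) t" by (simp add: Defs.single_def lookup_single when_def)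
qed

lemma tu_add: "f \<in> fin_fun R S ==> g \<in> fin_fun R S ==> tu R (\<lambda>s. f s \<oplus> g s) = tu R f + tu R g"
  by (rule poly_mapping_eqI) (simp add: lkp_tu[OF fin_fun_add] lookup_add emb_add fin_funD(1))

lemma tu_smult: "r \<in> carrier R ==> f \<in> fin_fun R S ==> tu R (\<lambda>s. r \<otimes> f s) = scale (emb R r) (tu R f)"
  by (rule poly_mapping_eqI) (simp add: lkp_tu[OF fin_fun_smult] emb_mult fin_funD(1))

lemma tu_minus: "f \<in> fin_fun R S ==> tu R (\<lambda>s. \<ominus> f s) = - tu R f"
  by (rule poly_mapping_eqI) (simp add: lkp_tu[OF fin_fun_minus] emb_uminus fin_funD(1))

lemma tu_zero: "tu R (\<lambda>s. \<zero>) = 0" by (rule poly_mapping_eqI) (simp add: lkp_tu[OF fin_fun_zero])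

lemma free_mod_simps [simp]: "carrier (free_mod R S) = fin_fun R S" "\<zero>\<^bsub>free_mod R S\<^esub> = (\<lambda>_. \<zero>)"
  "f \<oplus>\<^bsub>free_mod R S\<^esub> g = (\<lambda>s. f s \<oplus> g s)" "r \<odot>\<^bsub>free_mod R S\<^esub> f = (\<lambda>s. r \<otimes> f s)"
  by (simp_all add: free_mod_def)

lemma free_mod_group: "abelian_group (free_mod R S)"
proof (rule abelian_groupI)
  fix f assume "f \<in> carrier (free_mod R S)"
  thus "\<exists>g\<in>carrier (free_mod R S). g \<oplus>\<^bsub>free_mod R S\<^esub> f = \<zero>\<^bsub>free_mod R S\<^esub>"
    by (intro bexI[of _ "\<lambda>s. \<ominus> f s"]) (auto simp: fin_fun_minus fin_funD(1) l_neg)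
qed (auto simp: fin_fun_add fin_fun_zero fin_funD(1) a_ac)

lemma free_mod_minus: "f \<in> fin_fun R S ==> \<ominus>\<^bsub>free_mod R S\<^esub> f = (\<lambda>s. \<ominus> f s)"
  by (rule abelian_group.minus_equality[OF free_mod_group]) (auto simp: fin_fun_minus fin_funD(1) l_neg)

lemma free_mod_diff: "f \<in> fin_fun R S ==> g \<in> fin_fun R S ==> tu R (f \<ominus>\<^bsub>free_mod R S\<^esub> g) = tu R f - tu R g"
  by (simp add: a_minus_def free_mod_minus tu_add[OF _ fin_fun_minus] tu_minus)

end

lemma map_key_lin:
  assumes "inj g" shows "Poly_Mapping.map_key g (lin \<phi> f) = lin (\<lambda>s. Poly_Mapping.map_key g (\<phi> s)) f"
  by (rule poly_mapping_eqI) (simp add: map_key.rep_eq[OF assms] lin_def lookup_sum)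

lemma (in cring) tu_finsum:
  assumes "g \<in> Z \<rightarrow> fin_fun R S"
  shows "tu R (\<Oplus>\<^bsub>free_mod R S\<^esub>x\<in>Z. g x) = (\<Sum>x\<in>Z. tu R (g x)) \<and> (\<Oplus>\<^bsub>free_mod R S\<^esub>x\<in>Z. g x) \<in> fin_fun R S"
proof -
  interpret F: abelian_group "free_mod R S" by (rule free_mod_group)
  show ?thesis using assms
  proof (induction Z rule: infinite_finite_induct)
    case (insert x Z)
    have "(\<Oplus>\<^bsub>free_mod R S\<^esub>x\<in>insert x Z. g x) = (\<lambda>s. g x s \<oplus> (\<Oplus>\<^bsub>free_mod R S\<^esub>x\<in>Z. g x) s)"
      using insert by (subst F.finsum_insert) auto
    thus ?case using insert by (auto simp: tu_add fin_fun_add)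
  qed (auto simp: F.finsum_infinite tu_zero fin_fun_zero)
qed

text \<open>An element of a free module over an algebra with basis is a function with functions as
  values. It is flattened to a chain on pairs, the basis element of the algebra coming first;
  \<open>ul\<close> is the inverse and \<open>slt\<close> reads off one value.\<close>

definition fl :: "('k, 'x) ring_scheme => ('c => 's => 'k) => ('s \<times> 'c, 'k coef) chain" where
  "fl k f = (\<Sum>t\<in>{t. f t \<noteq> (\<lambda>_. \<zero>\<^bsub>k\<^esub>)}. pm (\<lambda>d. (d, t)) (tu k (f t)))"

definition ul :: "('k, 'x) ring_scheme => ('s \<times> 'c, 'k coef) chain => ('c => 's => 'k)" where
  "ul k g = (\<lambda>t d. unemb k (lkp g (d, t)))"

definition slt :: "'c => ('s \<times> 'c, 'u::comm_ring_1) chain => ('s, 'u) chain" where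
  "slt t g = Poly_Mapping.map_key (\<lambda>d. (d, t)) g"

lemma inj_fst: "inj (\<lambda>d. (d, t))" by (auto intro: injI)

lemma lkp_slt [simp]: "lkp (slt t g) d = lkp g (d, t)" by (simp add: slt_def map_key.rep_eq[OF inj_fst])

lemma slt_single: "slt t (sg (d, s) r) = (if s = t then sg d r else 0)" by (rule poly_mapping_eqI) (auto simp: lookup_single when_def)

lemma slt_lin: "slt t (lin \<phi> f) = lin (\<lambda>s. slt t (\<phi> s)) f" unfolding slt_def by (rule map_key_lin[OF inj_fst])

lemma slt_eqI: "(!!t. slt t f = slt t g) ==> f = g" by (rule poly_mapping_eqI) (metis lkp_slt prod.collapse)

section \<open>Algebras with a basis and their canonical resolutions\<close>

locale basis_algebra = cring k for k :: "('k, 'y) ring_scheme" (structure) +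
  fixes D T :: "'s set" and prd :: "'s => 's => 's" and cf :: "'s => 's => 'k" and e0 :: 's
    and W :: "('a => 'a) set" and \<iota> :: "('a => 'a) => 's"
  assumes D_prd: "x \<in> D ==> y \<in> D ==> prd x y \<in> D"
    and D_assoc: "x \<in> D ==> y \<in> D ==> z \<in> D ==> prd (prd x y) z = prd x (prd y z)"
    and cf: "x \<in> D ==> y \<in> D ==> cf x y \<in> carrier k"
      "x \<in> D ==> y \<in> D ==> z \<in> D ==> cf x y \<otimes> cf (prd x y) z = cf y z \<otimes> cf x (prd y z)"
    and D_e0: "e0 \<in> T" "x \<in> D ==> prd e0 x = x" "x \<in> D ==> cf e0 x = \<one>"
      "x \<in> D ==> prd x e0 = x" "x \<in> D ==> cf x e0 = \<one>"
    and D_T: "T \<subseteq> D" "x \<in> D ==> y \<in> D ==> prd x y \<in> T \<longleftrightarrow> x \<in> T \<and> y \<in> T"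
      "x \<in> T ==> y \<in> T ==> cf x y = \<one>"
    and D_W: "w \<in> W ==> bij w" "v \<in> W ==> w \<in> W ==> v \<circ> w \<in> W" "w \<in> W ==> finv w \<in> W" "id \<in> W"
    and D_\<iota>: "bij_betw \<iota> W T" "v \<in> W ==> w \<in> W ==> \<iota> (v \<circ> w) = prd (\<iota> v) (\<iota> w)" "\<iota> id = e0"
begin

abbreviation "et \<equiv> eta k"
abbreviation "ts m n \<equiv> Defs.single k (m, n) \<one>"

definition cu :: "'s => 's => 'k coef" where "cu x y = emb k (cf x y)"

definition Al :: "('k, 's => 'k) module" where "Al = basis_alg k D prd cf e0"

definition Nt :: "('s => 'k, 'k) module" where "Nt = triv_mod k T"

type_synonym ('kk, 'ss) kcell = "('ss => 'kk, 'kk) cell"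

definition Sc :: "nat => ('k, 's) kcell set" where "Sc q = cells Al Nt q"

definition chn :: "('k, 's) kcell => ('s \<times> ('k, 's) kcell, 'k coef) chain" where "chn s = fl k (chain_of Al s)"

definition cll :: "('s \<times> ('k, 's) kcell, 'k coef) chain => ('k, 's) kcell" where "cll f = cell_of Al (ul k f)"

definition au :: "('k, 's) kcell => 'k coef" where "au s = emb k (the_gen s)"

sublocale basis_res D T prd cu e0 "eta k" Sc chn cll au "Gen \<one>" W \<iota>
proof unfold_locales
  fix x y z assume *: "x \<in> D" "y \<in> D" "z \<in> D"
  show "cu x y * cu (prd x y) z = cu y z * cu x (prd y z)" using * cf D_prd by (simp add: cu_def emb_mult[symmetric])
qed (use D_prd D_assoc D_e0 D_T D_W D_\<iota> cf in \<open>auto simp: cu_def\<close>)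

lemma Al_simps [simp]:
  "carrier Al = fin_fun k D" "\<zero>\<^bsub>Al\<^esub> = (\<lambda>_. \<zero>)" "f \<oplus>\<^bsub>Al\<^esub> g = (\<lambda>s. f s \<oplus> g s)" "\<one>\<^bsub>Al\<^esub> = Defs.single k e0 \<one>"
  "r \<odot>\<^bsub>Al\<^esub> f = (\<lambda>s. r \<otimes> f s)" by (simp_all add: Al_def basis_alg_def free_mod_def)

lemma finsum_Al: "finsum Al f Z = finsum (free_mod k D) f Z"
  unfolding finsum_def Al_def by (rule arg_cong[of _ _ "\<lambda>M. finprod M f Z"]) (simp add: basis_alg_def free_mod_def)

lemma finsum_Nt: "finsum Nt f Z = finsum k f Z" by (simp add: finsum_def finprod_def Nt_def triv_mod_def)

definition mulc :: "('s, 'k coef) chain => ('s, 'k coef) chain => ('s, 'k coef) chain" where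
  "mulc a b = lin (\<lambda>x. lin (\<lambda>y. sg (prd x y) (cu x y)) b) a"

lemma mulc_in: "a \<in> ech et D ==> b \<in> fspan D ==> mulc a b \<in> ech et D"
  unfolding mulc_def by (erule ech_lin) (erule fspan_lin, rule fspan_single, rule D_prd)

lemma mult_eq:
  assumes a: "a \<in> fin_fun k D" and b: "b \<in> fin_fun k D" shows "a \<otimes>\<^bsub>Al\<^esub> b = ut k (mulc (tu k a) (tu k b))"
proof
  fix z
  let ?P = "{p. a (fst p) \<noteq> \<zero> \<and> b (snd p) \<noteq> \<zero> \<and> prd (fst p) (snd p) = z}"
  let ?g = "\<lambda>p. a (fst p) \<otimes> b (snd p) \<otimes> cf (fst p) (snd p)"
  let ?K = "{s. a s \<noteq> \<zero>}" and ?L = "{s. b s \<noteq> \<zero>}"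
  have KD: "x \<in> D" if "a x \<noteq> \<zero>" for x using that fin_funD(3)[OF a] by blast
  have LD: "x \<in> D" if "b x \<noteq> \<zero>" for x using that fin_funD(3)[OF b] by blast
  have g: "?g \<in> ?P \<rightarrow> carrier k" using KD LD fin_funD(1)[OF a] fin_funD(1)[OF b] cf(1) by auto
  have fin: "finite ?K" "finite ?L" using fin_funD(2) a b by blast+
  have "emb k ((a \<otimes>\<^bsub>Al\<^esub> b) z) = emb k (\<Oplus>p\<in>?P. ?g p)" by (simp add: Al_def basis_alg_def)
  also have "... = (\<Sum>p\<in>?P. emb k (?g p))" by (rule emb_finsum[OF g])
  also have "... = (\<Sum>p\<in>?P. emb k (a (fst p)) * (emb k (b (snd p)) * cu (fst p) (snd p)))"
    by (rule sum.cong) (use KD LD fin_funD(1)[OF a] fin_funD(1)[OF b] cf(1) in \<open>auto simp: emb_mult cu_def mult.assoc\<close>)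
  also have "... = (\<Sum>p\<in>?K \<times> ?L. if prd (fst p) (snd p) = z then emb k (a (fst p)) * (emb k (b (snd p)) * cu (fst p) (snd p)) else 0)"
    by (subst sum.inter_filter[symmetric]) (use fin in \<open>auto intro!: sum.cong\<close>)
  also have "... = (\<Sum>x\<in>?K. \<Sum>y\<in>?L. if prd x y = z then emb k (a x) * (emb k (b y) * cu x y) else 0)"
    by (simp add: sum.cartesian_product split_beta)
  also have "... = lkp (mulc (tu k a) (tu k b)) z"
    unfolding mulc_def lin_def lookup_sum keys_tu[OF a] keys_tu[OF b] lookup_scale lkp_tu[OF a] lkp_tu[OF b] sum_distrib_left
    by (intro sum.cong refl) (auto simp: lookup_single when_def)
  finally have "emb k ((a \<otimes>\<^bsub>Al\<^esub> b) z) = lkp (mulc (tu k a) (tu k b)) z" .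
  moreover have "(a \<otimes>\<^bsub>Al\<^esub> b) z \<in> carrier k" using finsum_closed[OF g] by (simp add: Al_def basis_alg_def)
  ultimately show "(a \<otimes>\<^bsub>Al\<^esub> b) z = ut k (mulc (tu k a) (tu k b)) z" by (metis ut_def unemb_emb)
qed

lemma mult_Al:
  assumes "a \<in> fin_fun k D" "b \<in> fin_fun k D"
  shows "a \<otimes>\<^bsub>Al\<^esub> b \<in> fin_fun k D" "tu k (a \<otimes>\<^bsub>Al\<^esub> b) = mulc (tu k a) (tu k b)"
proof -
  have m: "mulc (tu k a) (tu k b) \<in> ech et D" by (rule mulc_in[OF tu_ech[OF assms(1)] ech_fspan[OF tu_ech[OF assms(2)]]])
  show "a \<otimes>\<^bsub>Al\<^esub> b \<in> fin_fun k D" unfolding mult_eq[OF assms] by (rule ut_in[OF ech_fspan[OF m]])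
  show "tu k (a \<otimes>\<^bsub>Al\<^esub> b) = mulc (tu k a) (tu k b)" unfolding mult_eq[OF assms] by (rule tu_ut[OF m])
qed

lemma FD: "f \<in> fin_fun Al A ==> f t \<in> fin_fun k D" "f \<in> fin_fun Al A ==> finite {t. f t \<noteq> (\<lambda>_. \<zero>)}"
  "f \<in> fin_fun Al A ==> t \<notin> A ==> f t = (\<lambda>_. \<zero>)" by (auto simp: fin_fun_def)

lemma slt_fl:
  assumes f: "f \<in> fin_fun Al A" shows "slt t (fl k f) = tu k (f t)"
proof (rule poly_mapping_eqI)
  fix d
  have "lkp (fl k f) (d, t) = (\<Sum>s\<in>{s. f s \<noteq> (\<lambda>_. \<zero>)}. if s = t then lkp (tu k (f t)) d else 0)" unfolding fl_def lookup_sum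
  proof (rule sum.cong[OF refl])
    fix s
    show "lkp (pm (\<lambda>d. (d, s)) (tu k (f s))) (d, t) = (if s = t then lkp (tu k (f t)) d else 0)"
      using lookup_pm_inj[OF inj_fst, of s "tu k (f s)" d] by (auto intro!: lookup_pm_notin)
  qed
  also have "... = lkp (tu k (f t)) d" using FD(2)[OF f] by (auto simp: tu_zero)
  finally show "lkp (slt t (fl k f)) d = lkp (tu k (f t)) d" by simp
qed

lemma lkp_fl: "f \<in> fin_fun Al A ==> lkp (fl k f) (d, t) = emb k (f t d)" using slt_fl lkp_slt lkp_tu[OF FD(1)] by metis

lemma fl_in:
  assumes f: "f \<in> fin_fun Al A" shows "fl k f \<in> ech et (D \<times> A)"
proof -
  have "keys (fl k f) \<subseteq> D \<times> A"
  proof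
    fix y assume y: "y \<in> keys (fl k f)"
    obtain d t where dt: "y = (d, t)" by fastforce
    hence "f t d \<noteq> \<zero>" using y lkp_fl[OF f] by (auto simp: in_keys_iff)
    thus "y \<in> D \<times> A" using FD(3)[OF f, of t] fin_funD(3)[OF FD(1)[OF f], of d t] dt by fastforce
  qed
  moreover have "scale et (fl k f) = fl k f"
  proof (rule poly_mapping_eqI)
    fix y :: "'s \<times> 'b"
    show "lkp (scale et (fl k f)) y = lkp (fl k f) y" using lkp_fl[OF f] fin_funD(1)[OF FD(1)[OF f]] by (cases y) simp
  qed
  ultimately show ?thesis by (simp add: ech_def fspan_def)
qed

lemma ul_in:
  assumes g: "g \<in> fspan (D \<times> A)" shows "ul k g \<in> fin_fun Al A"
proof -
  have *: "ul k g t = ut k (slt t g)" for t by (simp add: ul_def ut_def)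
  have "slt t g \<in> fspan D" for t using g by (auto simp: fspan_def in_keys_iff)
  hence 1: "ul k g t \<in> fin_fun k D" for t unfolding * by (rule ut_in)
  have 2: "ul k g t = (\<lambda>_. \<zero>)" if "t \<notin> snd ` keys g" for t
  proof
    fix d
    have "(d, t) \<notin> keys g" using that by force
    thus "ul k g t d = \<zero>" by (simp add: ul_def in_keys_iff)
  qed
  hence "{t. ul k g t \<noteq> (\<lambda>_. \<zero>)} \<subseteq> snd ` keys g" by blast
  hence "finite {t. ul k g t \<noteq> (\<lambda>_. \<zero>)}" by (rule finite_subset) simp
  moreover have "ul k g t = (\<lambda>_. \<zero>)" if "t \<notin> A" for t by (rule 2) (use g that in \<open>auto simp: fspan_def\<close>)
  ultimately show ?thesis unfolding fin_fun_def[of Al] using 1 by simp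
qed

lemma fl_ul: "g \<in> ech et (D \<times> A) ==> fl k (ul k g) = g"
proof (rule poly_mapping_eqI)
  fix y :: "'s \<times> 'b"
  assume g: "g \<in> ech et (D \<times> A)"
  obtain d t where y: "y = (d, t)" by fastforce
  have "lkp (fl k (ul k g)) y = eta k * lkp g y" unfolding y lkp_fl[OF ul_in[OF ech_fspan[OF g]]] by (simp add: ul_def emb_unemb)
  also have "... = lkp g y" using ech_eta[OF g] by (metis lookup_scale)
  finally show "lkp (fl k (ul k g)) y = lkp g y" .
qed

lemma ul_fl: "f \<in> fin_fun Al A ==> ul k (fl k f) = f" by (simp add: ul_def lkp_fl fin_funD(1)[OF FD(1)])

lemma fl_inj: "f \<in> fin_fun Al A ==> g \<in> fin_fun Al B ==> fl k f = fl k g ==> f = g" using ul_fl by metis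

lemma F_add: "f \<in> fin_fun Al A ==> g \<in> fin_fun Al A ==> (\<lambda>t. f t \<oplus>\<^bsub>Al\<^esub> g t) \<in> fin_fun Al A"
proof -
  assume f: "f \<in> fin_fun Al A" "g \<in> fin_fun Al A"
  have "{t. f t \<oplus>\<^bsub>Al\<^esub> g t \<noteq> (\<lambda>_. \<zero>)} \<subseteq> {t. f t \<noteq> (\<lambda>_. \<zero>)} \<union> {t. g t \<noteq> (\<lambda>_. \<zero>)}" by auto
  hence "finite {t. f t \<oplus>\<^bsub>Al\<^esub> g t \<noteq> (\<lambda>_. \<zero>)}" by (rule finite_subset) (use f FD(2) in blast)
  thus ?thesis using fin_fun_add[OF FD(1)[OF f(1)] FD(1)[OF f(2)]] FD(3)[OF f(1)] FD(3)[OF f(2)] unfolding fin_fun_def[of Al] by simp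
qed

lemma fl_add: "f \<in> fin_fun Al A ==> g \<in> fin_fun Al A ==> fl k (\<lambda>t. f t \<oplus>\<^bsub>Al\<^esub> g t) = fl k f + fl k g"
proof (rule slt_eqI)
  fix t assume f: "f \<in> fin_fun Al A" "g \<in> fin_fun Al A"
  have "slt t (fl k f + fl k g) = slt t (fl k f) + slt t (fl k g)" unfolding slt_def by (rule map_key_plus[OF inj_fst])
  thus "slt t (fl k (\<lambda>t. f t \<oplus>\<^bsub>Al\<^esub> g t)) = slt t (fl k f + fl k g)"
    using f slt_fl[OF F_add[OF f]] slt_fl[OF f(1)] slt_fl[OF f(2)] by (simp add: tu_add[OF FD(1) FD(1)])
qed

lemma slt_lm: "slt t (lm x G) = lin (\<lambda>y. sg (prd x y) (cu x y)) (slt t G)"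
proof -
  have "slt t G = lin (\<lambda>y. slt t (sg y 1)) G" by (simp flip: slt_lin)
  hence "lin (\<lambda>y. sg (prd x y) (cu x y)) (slt t G) = lin (\<lambda>y. lin (\<lambda>y. sg (prd x y) (cu x y)) (slt t (sg y 1))) G" by (simp add: lin_lin)
  also have "... = slt t (lm x G)" unfolding lm_def slt_lin by (rule lin_cong) (auto simp: slt_single split: prod.splits)
  finally show ?thesis ..
qed

lemma slt_mulF: "slt t (lin (\<lambda>x. lm x G) a) = mulc a (slt t G)" by (simp add: slt_lin slt_lm mulc_def)

lemma F_smult:
  assumes a: "a \<in> fin_fun k D" and f: "f \<in> fin_fun Al A"
  shows "(\<lambda>t. a \<otimes>\<^bsub>Al\<^esub> f t) \<in> fin_fun Al A" "fl k (\<lambda>t. a \<otimes>\<^bsub>Al\<^esub> f t) = lin (\<lambda>x. lm x (fl k f)) (tu k a)"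
proof -
  have "lin (\<lambda>x. lm x (fl k f)) (tu k a) \<in> ech et (D \<times> A)" using lm_in[OF _ ech_fspan[OF fl_in[OF f]]] by (rule ech_lin[OF tu_ech[OF a]])
  note m = this
  have "(\<lambda>t. a \<otimes>\<^bsub>Al\<^esub> f t) = ul k (lin (\<lambda>x. lm x (fl k f)) (tu k a))"
  proof
    fix t
    have "ul k (lin (\<lambda>x. lm x (fl k f)) (tu k a)) t = ut k (slt t (lin (\<lambda>x. lm x (fl k f)) (tu k a)))" by (simp add: ul_def ut_def)
    thus "a \<otimes>\<^bsub>Al\<^esub> f t = ul k (lin (\<lambda>x. lm x (fl k f)) (tu k a)) t" by (simp add: slt_mulF slt_fl[OF f] mult_eq[OF a FD(1)[OF f]])
  qed
  thus "(\<lambda>t. a \<otimes>\<^bsub>Al\<^esub> f t) \<in> fin_fun Al A" "fl k (\<lambda>t. a \<otimes>\<^bsub>Al\<^esub> f t) = lin (\<lambda>x. lm x (fl k f)) (tu k a)"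
    using ul_in[OF ech_fspan[OF m]] fl_ul[OF m] by simp_all
qed

text \<open>The character through which the algebra acts on the trivial module.\<close>

definition chi :: "('s => 'k) => 'k" where "chi a = (\<Oplus>x\<in>{x \<in> T. a x \<noteq> \<zero>}. a x)"

lemma chi:
  assumes a: "a \<in> fin_fun k D" shows "chi a \<in> carrier k" "sg () (emb k (chi a)) = lin (\<lambda>x. if x \<in> T then sg () 1 else 0) (tu k a)"
proof -
  have g: "a \<in> {x \<in> T. a x \<noteq> \<zero>} \<rightarrow> carrier k" using fin_funD(1)[OF a] by auto
  show "chi a \<in> carrier k" unfolding chi_def by (rule finsum_closed[OF g])
  have "sg () (emb k (chi a)) = (\<Sum>x\<in>{x \<in> T. a x \<noteq> \<zero>}. sg () (emb k (a x)))"
    unfolding chi_def emb_finsum[OF g] by (rule poly_mapping_eqI) (simp add: lookup_sum)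
  also have "... = (\<Sum>x\<in>{x. a x \<noteq> \<zero>}. if x \<in> T then sg () (emb k (a x)) else 0)"
  proof -
    have "{x \<in> T. a x \<noteq> \<zero>} = {x \<in> {x. a x \<noteq> \<zero>}. x \<in> T}" by auto
    thus ?thesis using fin_funD(2)[OF a] by (simp only: sum.inter_filter)
  qed
  also have "... = lin (\<lambda>x. if x \<in> T then sg () 1 else 0) (tu k a)" unfolding lin_def keys_tu[OF a] lkp_tu[OF a] by (intro sum.cong) auto
  finally show "sg () (emb k (chi a)) = lin (\<lambda>x. if x \<in> T then sg () 1 else 0) (tu k a)" .
qed

lemma Nt_simps [simp]:
  "carrier Nt = carrier k" "\<zero>\<^bsub>Nt\<^esub> = \<zero>" "x \<oplus>\<^bsub>Nt\<^esub> y = x \<oplus> y" "a \<odot>\<^bsub>Nt\<^esub> c = chi a \<otimes> c"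
  by (simp_all add: Nt_def triv_mod_def chi_def)

lemma Sc_0: "Sc 0 = Gen ` carrier k" by (simp add: Sc_def)

lemma fl_lin:
  assumes f: "f \<in> fin_fun Al A" shows "lin \<phi> (fl k f) = (\<Sum>s\<in>{s. f s \<noteq> (\<lambda>_. \<zero>)}. lin (\<lambda>d. \<phi> (d, s)) (tu k (f s)))"
  unfolding fl_def lin_sum lin_pm ..

lemma aug_eq:
  assumes f: "f \<in> fin_fun Al (Sc 0)" shows "aug Al Nt f \<in> carrier k" "sg () (emb k (aug Al Nt f)) = lin ag (fl k f)"
proof -
  let ?S = "{s. f s \<noteq> (\<lambda>_. \<zero>)}"
  have gen: "the_gen s \<in> carrier k" if "s \<in> ?S" for s
  proof -
    have "s \<in> Gen ` carrier k" using that FD(3)[OF f, of s] unfolding Sc_0 by blast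
    thus ?thesis by auto
  qed
  have g: "(\<lambda>s. chi (f s) \<otimes> the_gen s) \<in> ?S \<rightarrow> carrier k" using gen chi(1)[OF FD(1)[OF f]] by auto
  have e: "aug Al Nt f = (\<Oplus>s\<in>?S. chi (f s) \<otimes> the_gen s)" by (simp add: aug_def finsum_Nt)
  show "aug Al Nt f \<in> carrier k" unfolding e by (rule finsum_closed[OF g])
  have "sg () (emb k (aug Al Nt f)) = (\<Sum>s\<in>?S. sg () (emb k (chi (f s) \<otimes> the_gen s)))"
    unfolding e emb_finsum[OF g] by (rule poly_mapping_eqI) (simp add: lookup_sum)
  also have "... = (\<Sum>s\<in>?S. lin (\<lambda>d. ag (d, s)) (tu k (f s)))"
  proof (rule sum.cong[OF refl])
    fix s assume s: "s \<in> ?S"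
    have "sg () (emb k (chi (f s) \<otimes> the_gen s)) = scale (au s) (sg () (emb k (chi (f s))))"
      using gen[OF s] chi(1)[OF FD(1)[OF f]] by (simp add: emb_mult au_def mult.commute)
    also have "... = lin (\<lambda>x. scale (au s) (if x \<in> T then sg () 1 else 0)) (tu k (f s))" unfolding chi(2)[OF FD(1)[OF f]] by (simp add: lin_fun)
    also have "... = lin (\<lambda>d. ag (d, s)) (tu k (f s))" by (rule lin_cong) (simp add: ag_pair)
    finally show "sg () (emb k (chi (f s) \<otimes> the_gen s)) = lin (\<lambda>d. ag (d, s)) (tu k (f s))" .
  qed
  finally show "sg () (emb k (aug Al Nt f)) = lin ag (fl k f)" unfolding fl_lin[OF f] .
qed

lemma bdry_eq:
  assumes f: "f \<in> fin_fun Al A" and ch: "!!s. s \<in> A ==> chain_of Al s \<in> fin_fun Al B"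
  shows "bdry Al f \<in> fin_fun Al B" "fl k (bdry Al f) = lin dd (fl k f)"
proof -
  let ?S = "{s. f s \<noteq> (\<lambda>_. \<zero>)}"
  have SA: "s \<in> A" if "s \<in> ?S" for s using that FD(3)[OF f, of s] by auto
  have m: "lin dd (fl k f) \<in> ech et (D \<times> B)"
  proof (rule ech_lin[OF fl_in[OF f]])
    fix y assume y: "y \<in> D \<times> A"
    hence "chn (snd y) \<in> fspan (D \<times> B)" using ech_fspan[OF fl_in[OF ch[of "snd y"]]] unfolding chn_def by auto
    thus "dd y \<in> fspan (D \<times> B)" unfolding dd_def using y by (intro lm_in) auto
  qed
  have "bdry Al f t = ul k (lin dd (fl k f)) t" for t
  proof -
    have g: "(\<lambda>s. f s \<otimes>\<^bsub>Al\<^esub> chain_of Al s t) \<in> ?S \<rightarrow> fin_fun k D"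
      using FD(1)[OF f] FD(1)[OF ch[OF SA]] mult_Al(1) by auto
    have b: "bdry Al f t = (\<Oplus>\<^bsub>free_mod k D\<^esub>s\<in>?S. f s \<otimes>\<^bsub>Al\<^esub> chain_of Al s t)" by (simp add: bdry_def finsum_Al)
    have "tu k (bdry Al f t) = (\<Sum>s\<in>?S. tu k (f s \<otimes>\<^bsub>Al\<^esub> chain_of Al s t))" unfolding b using tu_finsum[OF g] by blast
    also have "... = (\<Sum>s\<in>?S. slt t (lin (\<lambda>x. dd (x, s)) (tu k (f s))))"
    proof (rule sum.cong[OF refl])
      fix s assume s: "s \<in> ?S"
      have "tu k (f s \<otimes>\<^bsub>Al\<^esub> chain_of Al s t) = mulc (tu k (f s)) (slt t (chn s))"
        using mult_Al(2)[OF FD(1)[OF f] FD(1)[OF ch[OF SA[OF s]]]] slt_fl[OF ch[OF SA[OF s]]] by (simp add: chn_def)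
      thus "tu k (f s \<otimes>\<^bsub>Al\<^esub> chain_of Al s t) = slt t (lin (\<lambda>x. dd (x, s)) (tu k (f s)))" by (simp add: dd_def slt_mulF)
    qed
    also have "... = slt t (lin dd (fl k f))" unfolding fl_lin[OF f] by (rule poly_mapping_eqI) (simp add: lookup_sum)
    finally have "tu k (bdry Al f t) = slt t (lin dd (fl k f))" .
    moreover have "ul k (lin dd (fl k f)) t = ut k (slt t (lin dd (fl k f)))" by (simp add: ul_def ut_def)
    moreover have "bdry Al f t \<in> fin_fun k D" unfolding b using tu_finsum[OF g] by blast
    ultimately show ?thesis using ut_tu by metis
  qed
  hence "bdry Al f = ul k (lin dd (fl k f))" by blast
  thus "bdry Al f \<in> fin_fun Al B" "fl k (bdry Al f) = lin dd (fl k f)" using ul_in[OF ech_fspan[OF m]] fl_ul[OF m] by simp_all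
qed

lemma finite_supp: "c \<in> fin_fun Al A ==> finite {s. c s \<noteq> \<zero>\<^bsub>Al\<^esub>}" using FD(2) by simp

abbreviation "FA q \<equiv> fin_fun Al (Sc q)"

lemma cells_Suc: "Sc (Suc q) = cell_of Al ` {c \<in> FA q. if q = 0 then aug Al Nt c = \<zero> else bdry Al c = (\<lambda>_. \<zero>\<^bsub>Al\<^esub>)}"
  by (cases q) (simp_all add: Sc_def)

lemma chain_of_in: "s \<in> Sc (Suc q) ==> chain_of Al s \<in> FA q" unfolding cells_Suc using chain_of_cell_of finite_supp by fastforce

lemma fl_zero_iff: "f \<in> fin_fun Al A ==> fl k f = 0 \<longleftrightarrow> f = (\<lambda>_. \<zero>\<^bsub>Al\<^esub>)"
proof
  assume f: "f \<in> fin_fun Al A" "fl k f = 0"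
  have "f t d = \<zero>" for t d using lkp_fl[OF f(1), of d t] f(2) emb_eq_0[OF fin_funD(1)[OF FD(1)[OF f(1)]], of t d] by simp
  thus "f = (\<lambda>_. \<zero>\<^bsub>Al\<^esub>)" by (simp add: fun_eq_iff)
qed (simp add: fl_def)

text \<open>The cycle conditions of both sides agree under flattening, the kernel of the
  augmentation in degree 0 included. This identifies the cells of the canonical resolution with
  abstract cells that bound cycles.\<close>

lemma cyc_iff:
  assumes f: "f \<in> FA q"
  shows "fl k f \<in> cyc q \<longleftrightarrow> (if q = 0 then aug Al Nt f = \<zero> else bdry Al f = (\<lambda>_. \<zero>\<^bsub>Al\<^esub>))"
proof (cases q)
  case 0
  have "lin ag (fl k f) = 0 \<longleftrightarrow> emb k (aug Al Nt f) = 0" using aug_eq(2)[of f] f 0 by (metis lookup_single_eq lookup_zero single_zero)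
  thus ?thesis using f 0 fl_in[OF f] aug_eq(1)[of f] emb_eq_0 by (auto simp: cyc_def)
next
  case (Suc q')
  note b = bdry_eq[OF f[unfolded Suc] chain_of_in]
  have "lin dd (fl k f) = 0 \<longleftrightarrow> bdry Al f = (\<lambda>_. \<zero>\<^bsub>Al\<^esub>)" using fl_zero_iff[OF b(1)] b(2) by simp
  thus ?thesis using fl_in[OF f] Suc by (simp add: cyc_def del: Al_simps)
qed

lemma cell_fl: "f \<in> fin_fun Al A ==> cll (fl k f) = cell_of Al f" by (simp add: cll_def ul_fl)

sublocale basis_complex D T prd cu e0 "eta k" Sc chn cll au "Gen \<one>" W \<iota>
proof unfold_locales
  fix s q assume "s \<in> Sc (Suc q)"
  then obtain c where c: "c \<in> FA q" "s = cell_of Al c" "fl k c \<in> cyc q" unfolding cells_Suc using cyc_iff by auto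
  thus "chn s \<in> cyc q" using chain_of_cell_of[OF finite_supp[OF c(1)]] by (simp add: chn_def)
next
  fix f q assume f: "f \<in> cyc q"
  hence fe: "f \<in> ech et (D \<times> Sc q)" by (simp add: cyc_def)
  note u = ul_in[OF ech_fspan[OF fe]]
  show "cll f \<in> Sc (Suc q)" unfolding cells_Suc cll_def using u cyc_iff[OF u] f by (auto simp: fl_ul[OF fe] simp del: Al_simps)
  show "chn (cll f) = f" using chain_of_cell_of[OF finite_supp[OF u]] by (simp add: chn_def cll_def fl_ul[OF fe])
qed (auto simp: Sc_0 au_def)

end

lemma (in cring) free_mod_module: "module R (free_mod R S)" using free_mod_group
  by (intro moduleI is_cring) (auto simp: fin_fun_smult fin_funD(1) l_distr r_distr m_assoc fin_fun_add)

lemma (in cring) push_eq: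
  assumes f: "f \<in> fin_fun R S" shows "push R R id u f = ut R (pm u (tu R f))"
proof
  fix t
  have g: "f \<in> Z \<rightarrow> carrier R" for Z using fin_funD(1)[OF f] by auto
  have fin: "finite {s. f s \<noteq> \<zero>}" by (rule fin_funD(2)[OF f])
  have "emb R (push R R id u f t) = (\<Sum>s\<in>{s. f s \<noteq> \<zero> \<and> u s = t}. emb R (f s))" unfolding push_def id_def by (rule emb_finsum[OF g])
  also have "... = (\<Sum>s\<in>{s. f s \<noteq> \<zero>}. if u s = t then emb R (f s) else 0)"
    by (subst sum.inter_filter[OF fin, symmetric]) (auto intro!: sum.cong)
  also have "... = lkp (pm u (tu R f)) t" unfolding pm_def lin_def lookup_sum keys_tu[OF f] lkp_tu[OF f]
    by (intro sum.cong refl) (auto simp: lkp_tu[OF f] lookup_single when_def)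
  finally have e: "emb R (push R R id u f t) = lkp (pm u (tu R f)) t" .
  have "push R R id u f t \<in> carrier R" unfolding push_def id_def by (rule finsum_closed[OF g])
  thus "push R R id u f t = ut R (pm u (tu R f)) t" using e by (metis ut_def unemb_emb)
qed

section \<open>The tensor product with the trivial module\<close>

context basis_algebra
begin

definition PB :: "nat => ('k \<times> (('k, 's) kcell => 's => 'k)) set" where "PB q = carrier k \<times> fin_fun Al (Sc q)"

text \<open>The balanced map that sends \<open>(m, f)\<close> to \<open>m\<close> times the
  projection of \<open>f\<close>. The tensor product is computed by showing that the defining
  relations span the kernel of this map.\<close>

definition th1 :: "'k \<times> (('k, 's) kcell => 's => 'k) => (('k, 's) kcell, 'k coef) chain" where
  "th1 y = scale (emb k (fst y)) (ppi (fl k (snd y)))"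

definition bs :: "('k, 's) kcell => (('k, 's) kcell => 's => 'k)" where "bs s = Defs.single Al s \<one>\<^bsub>Al\<^esub>"

text \<open>A section of \<open>th1\<close> through the generators
  \<open>(\<one>, bs s)\<close>.\<close>

definition lft :: "(('k, 's) kcell, 'k coef) chain => ('k \<times> (('k, 's) kcell => 's => 'k), 'k coef) chain" where
  "lft = lin (\<lambda>s. sg (\<one>, bs s) et)"

definition VB :: "nat => ('k \<times> (('k, 's) kcell => 's => 'k), 'k coef) chain set" where "VB q = ech et (PB q)"

definition YB :: "nat => ('k \<times> (('k, 's) kcell => 's => 'k), 'k coef) chain set" where "YB q = {y \<in> VB q. lin th1 y = 0}"

lemma res_simps [simp]: "carrier (res Al Nt q) = fin_fun Al (Sc q)" "f \<oplus>\<^bsub>res Al Nt q\<^esub> g = (\<lambda>t. f t \<oplus>\<^bsub>Al\<^esub> g t)"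
  "a \<odot>\<^bsub>res Al Nt q\<^esub> f = (\<lambda>t. a \<otimes>\<^bsub>Al\<^esub> f t)" by (simp_all add: res_def free_mod_def Sc_def)

lemma e0D: "e0 \<in> D" using D_e0 D_T by blast

lemma one_Al: "\<one>\<^bsub>Al\<^esub> \<in> fin_fun k D" "tu k \<one>\<^bsub>Al\<^esub> = sg e0 et"
  using fin_fun_single[OF e0D one_closed] tu_single[OF e0D one_closed] by simp_all

lemma Fsingle:
  assumes "s \<in> A" "a \<in> fin_fun k D" shows "Defs.single Al s a \<in> fin_fun Al A" "fl k (Defs.single Al s a) = pm (\<lambda>d. (d, s)) (tu k a)"
proof -
  have "finite {t. (if t = s then a else (\<lambda>_. \<zero>)) \<noteq> (\<lambda>_. \<zero>)}" by (rule finite_subset[of _ "{s}"]) (auto split: if_splits)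
  thus *: "Defs.single Al s a \<in> fin_fun Al A" using assms by (auto simp: Defs.single_def fin_fun_def[of Al] fin_fun_zero)
  show "fl k (Defs.single Al s a) = pm (\<lambda>d. (d, s)) (tu k a)"
  proof (rule slt_eqI)
    fix t
    have "slt t (pm (\<lambda>d. (d, s)) (tu k a)) = (if s = t then tu k a else 0)" unfolding pm_def slt_lin by (simp add: slt_single lin_fun)
    thus "slt t (fl k (Defs.single Al s a)) = slt t (pm (\<lambda>d. (d, s)) (tu k a))" unfolding slt_fl[OF *] by (auto simp: Defs.single_def tu_zero)
  qed
qed

lemma bs_in: "s \<in> A ==> bs s \<in> fin_fun Al A" "fl k (bs s) = sg (e0, s) et"
  using Fsingle(1)[OF _ one_Al(1)] Fsingle(2)[OF UNIV_I one_Al(1)] one_Al(2) unfolding bs_def by auto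

lemma bs_smult:
  assumes s: "s \<in> A" and a: "a \<in> fin_fun k D" shows "(\<lambda>t. a \<otimes>\<^bsub>Al\<^esub> bs s t) = Defs.single Al s a"
proof (rule fl_inj[OF F_smult(1)[OF a bs_in(1)[OF s]] Fsingle(1)[OF s a]])
  have "lin (\<lambda>x. lm x (sg (e0, s) et)) (tu k a) = lin (\<lambda>x. sg (x, s) et) (tu k a)"
    by (rule lin_cong'[OF ech_fspan[OF tu_ech[OF a]]]) (use D_e0 in \<open>auto simp: cu_def\<close>)
  also have "... = scale et (pm (\<lambda>x. (x, s)) (tu k a))" unfolding pm_def by (simp flip: lin_fun(4))
  also have "... = pm (\<lambda>x. (x, s)) (tu k a)" using ech_eta[OF tu_ech[OF a]] by (simp flip: pm_simps(5))
  finally show "fl k (\<lambda>t. a \<otimes>\<^bsub>Al\<^esub> bs s t) = fl k (Defs.single Al s a)"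
    unfolding F_smult(2)[OF a bs_in(1)[OF s]] Fsingle(2)[OF s a] bs_in(2) .
qed

lemma ppi_single:
  assumes "s \<in> A" "a \<in> fin_fun k D" shows "ppi (fl k (Defs.single Al s a)) = sg s (emb k (chi a))"
proof -
  have "ppi (fl k (Defs.single Al s a)) = pm (\<lambda>_. s) (lin (\<lambda>x. if x \<in> T then sg () 1 else 0) (tu k a))"
    unfolding Fsingle(2)[OF assms] ppi_def lin_pm pm_lin by (rule lin_cong) auto
  thus ?thesis unfolding chi(2)[OF assms(2), symmetric] by simp
qed

lemma chi_scalar:
  assumes r: "r \<in> carrier k"
  shows "(\<lambda>s. r \<otimes> \<one>\<^bsub>Al\<^esub> s) \<in> fin_fun k D" "chi (\<lambda>s. r \<otimes> \<one>\<^bsub>Al\<^esub> s) = r"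
proof -
  show 1: "(\<lambda>s. r \<otimes> \<one>\<^bsub>Al\<^esub> s) \<in> fin_fun k D" by (rule fin_fun_smult[OF r one_Al(1)])
  have "sg () (emb k (chi (\<lambda>s. r \<otimes> \<one>\<^bsub>Al\<^esub> s))) = sg () (emb k r)"
    unfolding chi(2)[OF 1] tu_smult[OF r one_Al(1)] one_Al(2) using D_e0(1) emb_one_mult[OF r] by (simp add: mult.commute[of _ "eta k"])
  thus "chi (\<lambda>s. r \<otimes> \<one>\<^bsub>Al\<^esub> s) = r" using emb_inj[OF chi(1)[OF 1] r] by (metis lookup_single_eq)
qed

lemma ppi_fl_ech: "f \<in> fin_fun Al A ==> ppi (fl k f) \<in> ech et A"
proof -
  assume f: "f \<in> fin_fun Al A"
  show ?thesis using ppi_in[OF ech_fspan[OF fl_in[OF f]]] ppi_simps(3)[of "eta k" "fl k f"] unfolding ech_eta[OF fl_in[OF f]] by (simp add: ech_def)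
qed

lemma th1_in: "y \<in> PB q ==> th1 y \<in> ech et (Sc q)" by (auto simp: th1_def PB_def intro!: ech_closed(5) ppi_fl_ech)

lemma TH_in: "y \<in> VB q ==> lin th1 y \<in> ech et (Sc q)" unfolding VB_def by (rule ech_lin'[OF ech_fspan th1_in])

lemma lft_in: "kc \<in> ech et (Sc q) ==> lft kc \<in> VB q" unfolding lft_def VB_def using bs_in(1)
  by (intro ech_lin'[OF ech_fspan]) (auto intro!: ech_sg simp: PB_def)

lemma TH_lft: "kc \<in> ech et (Sc q) ==> lin th1 (lft kc) = kc"
proof -
  assume k: "kc \<in> ech et (Sc q)"
  have "lin th1 (lft kc) = lin (\<lambda>s. sg s et) kc" unfolding lft_def lin_lin using D_e0(1) by (intro lin_cong) (simp add: th1_def bs_in(2))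
  thus ?thesis using ech_eta[OF k] by (simp add: lin_scaled)
qed

abbreviation FF :: "nat => ('k, 'k \<times> (('k, 's) kcell => 's => 'k) => 'k) module" where
  "FF q \<equiv> free_mod k (carrier Nt \<times> carrier (res Al Nt q))"

lemma FF: "carrier (FF q) = fin_fun k (PB q)" by (simp add: PB_def)

abbreviation "TR q \<equiv> tensor_rels k Al Nt (res Al Nt q)"

lemma PBe: "carrier Nt \<times> carrier (res Al Nt q) = PB q" by (simp add: PB_def)

lemma sgF: "m \<in> carrier k ==> n \<in> FA q ==> ts m n \<in> fin_fun k (PB q)" by (intro fin_fun_single) (auto simp: PB_def)

lemma tus: "m \<in> carrier k ==> n \<in> FA q ==> tu k (ts m n) = sg (m, n) et" by (intro tu_single[of _ "PB q"]) (auto simp: PB_def)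

lemma tensor_rels_ker:
  assumes "z \<in> TR q" shows "z \<in> fin_fun k (PB q) \<and> lin th1 (tu k z) = 0"
proof -
  interpret F: module k "free_mod k (PB q)" by (rule free_mod_module)
  have diff: "f \<ominus>\<^bsub>free_mod k (PB q)\<^esub> g \<in> fin_fun k (PB q) \<and> lin th1 (tu k (f \<ominus>\<^bsub>free_mod k (PB q)\<^esub> g)) = 0"
    if "f \<in> fin_fun k (PB q)" "g \<in> fin_fun k (PB q)" "lin th1 (tu k f) = lin th1 (tu k g)" for f g
    using that F.minus_closed[of f g] by (auto simp: free_mod_diff lin_diff)
  have eta_th: "scale et (th1 (m, n)) = th1 (m, n)" if "m \<in> carrier k" "n \<in> FA q" for m n
    using that by (intro ech_eta[OF th1_in[of _ q]]) (auto simp: PB_def)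
  have add: "lin th1 (tu k (\<lambda>s. f s \<oplus> g s)) = lin th1 (tu k f) + lin th1 (tu k g)" if "f \<in> fin_fun k (PB q)" "g \<in> fin_fun k (PB q)" for f g
    using that by (simp add: tu_add lin_add)
  from assms consider
      (1) m m' n where "m \<in> carrier k" "m' \<in> carrier k" "n \<in> FA q"
        "z = ts (m \<oplus> m') n \<ominus>\<^bsub>free_mod k (PB q)\<^esub> (\<lambda>s. ts m n s \<oplus> ts m' n s)"
    | (2) m n n' where "m \<in> carrier k" "n \<in> FA q" "n' \<in> FA q"
        "z = ts m (\<lambda>t. n t \<oplus>\<^bsub>Al\<^esub> n' t) \<ominus>\<^bsub>free_mod k (PB q)\<^esub> (\<lambda>s. ts m n s \<oplus> ts m n' s)"
    | (3) a m n where "a \<in> fin_fun k D" "m \<in> carrier k" "n \<in> FA q"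
        "z = ts (chi a \<otimes> m) n \<ominus>\<^bsub>free_mod k (PB q)\<^esub> ts m (\<lambda>t. a \<otimes>\<^bsub>Al\<^esub> n t)"
    | (4) r m n where "r \<in> carrier k" "m \<in> carrier k" "n \<in> FA q"
        "z = ts (chi (\<lambda>s. r \<otimes> \<one>\<^bsub>Al\<^esub> s) \<otimes> m) n \<ominus>\<^bsub>free_mod k (PB q)\<^esub> (\<lambda>s. r \<otimes> ts m n s)"
    unfolding tensor_rels_def Let_def PBe by (auto simp del: Al_simps(3,4) simp: Al_simps(5))
  thus ?thesis
  proof cases
    case 1
    thus ?thesis using fin_fun_add[OF sgF sgF] sgF unfolding 1(4) by (intro diff) (auto simp: add tus eta_th, auto simp: th1_def emb_add scale_distrib)
  next
    case 2
    have n: "(\<lambda>t. n t \<oplus>\<^bsub>Al\<^esub> n' t) \<in> FA q" by (rule F_add[OF 2(2,3)])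
    thus ?thesis using 2 fin_fun_add[OF sgF sgF] sgF unfolding 2(4)
      by (intro diff) (auto simp: add tus eta_th simp del: Al_simps, auto simp: th1_def fl_add scale_distrib simp del: Al_simps)
  next
    case 3
    note n = F_smult[OF 3(1,3)]
    \<comment> \<open>Balancing over the algebra: under \<open>ppi\<close> left multiplication by
      \<open>a\<close> becomes multiplication by \<open>chi a\<close>.\<close>
    have "ppi (lin (\<lambda>x. lm x (fl k n)) (tu k a)) = lin (\<lambda>x. if x \<in> T then ppi (fl k n) else 0) (tu k a)"
    proof -
      have e: "fl k n \<in> fspan (D \<times> Sc q)" "scale et (ppi (fl k n)) = ppi (fl k n)"
        using ech_fspan[OF fl_in[OF 3(3)]] ech_eta[OF ppi_fl_ech[OF 3(3)]] by blast+
      show ?thesis unfolding ppi_lin by (rule lin_cong'[OF ech_fspan[OF tu_ech[OF 3(1)]]]) (simp add: ppi_lm[OF _ e(1)] e(2))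
    qed
    also have "... = lin (\<lambda>_. ppi (fl k n)) (lin (\<lambda>x. if x \<in> T then sg () 1 else 0) (tu k a))" unfolding lin_lin by (rule lin_cong) auto
    also have "... = scale (emb k (chi a)) (ppi (fl k n))" unfolding chi(2)[OF 3(1), symmetric] by simp
    finally show ?thesis using sgF n(1) 3 chi(1)[OF 3(1)] unfolding 3(4) by (intro diff) (auto simp: tus eta_th, auto simp: th1_def n(2) emb_mult mult.commute)
  next
    case 4
    thus ?thesis using sgF fin_fun_smult[OF 4(1) sgF] unfolding 4(4) chi_scalar(2)[OF 4(1)]
      by (intro diff) (auto simp: tus eta_th tu_smult[OF 4(1) sgF[OF 4(2,3)]] lin_scale, auto simp: th1_def emb_mult mult.assoc)
  qed
qed

lemma tensor_sub_le: "tensor_sub k Al Nt (res Al Nt q) \<subseteq> ut k ` YB q"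
proof
  fix z assume z: "z \<in> tensor_sub k Al Nt (res Al Nt q)"
  let ?H = "{h \<in> fin_fun k (PB q). lin th1 (tu k h) = 0}"
  interpret F: module k "free_mod k (PB q)" by (rule free_mod_module)
  have "submodule ?H k (free_mod k (PB q))" by (rule F.submoduleI)
      (auto simp: fin_fun_zero tu_zero free_mod_minus fin_fun_minus tu_minus lin_uminus fin_fun_add tu_add lin_add fin_fun_smult tu_smult lin_scale)
  hence "z \<in> ?H" using z tensor_rels_ker unfolding tensor_sub_def mod_span_def by (auto simp: PB_def)
  thus "z \<in> ut k ` YB q" using tu_ech[of z "PB q"] ut_tu[of z "PB q"] by (intro image_eqI[of _ _ "tu k z"]) (auto simp: YB_def VB_def)
qed

text \<open>Modulo the relations a generator \<open>(m, n)\<close> agrees with the lift of its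
  image: \<open>m\<close> is pulled out as a scalar, and \<open>n\<close> is decomposed into
  multiples of the basis elements \<open>bs s\<close>, whose coefficients move to the other side.
  \<open>E y\<close> is the resulting difference between \<open>y\<close> and that lift; on the
  kernel of \<open>th1\<close> it is \<open>y\<close> itself.\<close>

lemma tensor_sub_ge:
  assumes H: "submodule H k (FF q)" "TR q \<subseteq> H" and y: "y \<in> YB q" shows "ut k y \<in> H"
proof -
  define HH where "HH = tu k ` H"
  define E where "E y = y - lft (lin th1 y)" for y
  interpret F: module k "free_mod k (PB q)" by (rule free_mod_module)
  note H' = F.submoduleE[OF H(1)[unfolded PBe]]
  have HF: "h \<in> fin_fun k (PB q)" if "h \<in> H" for h using H'(1) that by auto
  have add: "x + x' \<in> HH" if xx: "x \<in> HH" "x' \<in> HH" for x x'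
  proof -
    obtain h h' where h: "x = tu k h" "x' = tu k h'" "h \<in> H" "h' \<in> H" using xx unfolding HH_def by auto
    have "x + x' = tu k (\<lambda>s. h s \<oplus> h' s)" using tu_add[OF HF HF, of h h'] h by simp
    thus ?thesis using H'(5)[OF h(3,4)] by (auto simp: HH_def)
  qed
  \<comment> \<open>\<open>H\<close> is closed under scalars from \<open>k\<close> only, but on
    chains fixed by the idempotent every coefficient acts like one of these.\<close>
  have scl: "scale c x \<in> HH" if xx: "x \<in> HH" for c x
  proof -
    obtain h where h: "x = tu k h" "h \<in> H" using xx unfolding HH_def by auto
    have "scale c x = scale c (scale et x)" using ech_eta[OF tu_ech[OF HF[OF h(2)]]] h(1) by simp
    also have "... = scale (emb k (unemb k c)) x" by (simp add: emb_unemb mult.commute)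
    also have "... = tu k (\<lambda>s. unemb k c \<otimes> h s)" using tu_smult[OF unemb_closed HF[OF h(2)]] h(1) by simp
    finally show ?thesis using H'(4)[OF unemb_closed h(2)] by (auto simp: HH_def)
  qed
  have neg: "- x \<in> HH" if "x \<in> HH" for x using scl[OF that, of "- 1"] by simp
  have dif: "x - x' \<in> HH" if "x \<in> HH" "x' \<in> HH" for x x' using add[OF that(1) neg[OF that(2)]] by simp
  have R2: "sg (\<one>, \<lambda>t. n t \<oplus>\<^bsub>Al\<^esub> n' t) et - (sg (\<one>, n) et + sg (\<one>, n') et) \<in> HH"
    if n: "n \<in> FA q" "n' \<in> FA q" for n n'
  proof -
    let ?r = "ts \<one> (\<lambda>t. n t \<oplus>\<^bsub>Al\<^esub> n' t) \<ominus>\<^bsub>FF q\<^esub> (ts \<one> n \<oplus>\<^bsub>FF q\<^esub> ts \<one> n')"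
    have "?r \<in> TR q" unfolding tensor_rels_def Let_def using n by (intro UnI1 UnI2) (use res_simps(2) in fastforce)
    hence "tu k ?r \<in> HH" using H(2) by (auto simp: HH_def)
    moreover have "tu k ?r = sg (\<one>, \<lambda>t. n t \<oplus>\<^bsub>Al\<^esub> n' t) et - (sg (\<one>, n) et + sg (\<one>, n') et)"
      unfolding PBe using n sgF F_add[OF n] by (simp add: free_mod_diff fin_fun_add tu_add[OF sgF[OF one_closed n(1)] sgF[OF one_closed n(2)]] tus del: Al_simps)
    ultimately show ?thesis by simp
  qed
  have R3: "sg (chi a, n) et - sg (\<one>, \<lambda>t. a \<otimes>\<^bsub>Al\<^esub> n t) et \<in> HH" if n: "a \<in> fin_fun k D" "n \<in> FA q" for a n
  proof -
    let ?r = "ts (a \<odot>\<^bsub>Nt\<^esub> \<one>) n \<ominus>\<^bsub>FF q\<^esub> ts \<one> (\<lambda>t. a \<otimes>\<^bsub>Al\<^esub> n t)"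
    have "?r \<in> TR q" unfolding tensor_rels_def Let_def using n by (intro UnI1 UnI2) (use res_simps(3) in fastforce)
    hence "tu k ?r \<in> HH" using H(2) by (auto simp: HH_def)
    moreover have "tu k ?r = sg (chi a, n) et - sg (\<one>, \<lambda>t. a \<otimes>\<^bsub>Al\<^esub> n t) et"
      unfolding PBe using n sgF F_smult(1)[OF n] chi(1)[OF n(1)] by (simp add: free_mod_diff tus del: Al_simps)
    ultimately show ?thesis by simp
  qed
  have R4: "sg (m, n) et - sg (\<one>, n) (emb k m) \<in> HH" if n: "m \<in> carrier k" "n \<in> FA q" for m n
  proof -
    let ?r = "ts ((m \<odot>\<^bsub>Al\<^esub> \<one>\<^bsub>Al\<^esub>) \<odot>\<^bsub>Nt\<^esub> \<one>) n \<ominus>\<^bsub>FF q\<^esub> m \<odot>\<^bsub>FF q\<^esub> ts \<one> n"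
    have "?r \<in> TR q" unfolding tensor_rels_def Let_def using n by (intro UnI2) (auto simp del: Al_simps free_mod_simps)
    hence "tu k ?r \<in> HH" using H(2) by (auto simp: HH_def)
    moreover have "(m \<odot>\<^bsub>Al\<^esub> \<one>\<^bsub>Al\<^esub>) \<odot>\<^bsub>Nt\<^esub> \<one> = m" using chi_scalar(2)[OF n(1)] n(1) by simp
    hence "tu k ?r = sg (m, n) et - sg (\<one>, n) (emb k m)"
      unfolding PBe using n sgF fin_fun_smult[OF n(1) sgF[OF one_closed n(2)]] tu_smult[OF n(1) sgF[OF one_closed n(2)]]
      by (simp add: free_mod_diff tus mult.commute[of _ "eta k"] del: Al_simps)
    ultimately show ?thesis by simp
  qed
  have E_add: "E (x + x') = E x + E x'" "E (x - x') = E x - E x'" "E (scale c x) = scale c (E x)" for x x' c by (simp_all add: E_def lft_def lin_simps scale_distrib)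
  have thf: "lin th1 (sg (\<one>, n) et) = ppi (fl k n)" if "n \<in> FA q" for n using ech_eta[OF ppi_fl_ech[OF that]] eta_emb(1) by (simp add: th1_def)
  have E1: "E (sg (\<one>, n) et) \<in> HH" if n: "n \<in> FA q" for n
  proof -
    have ul_plus: "E (sg (\<one>, \<lambda>t. n t \<oplus>\<^bsub>Al\<^esub> n' t) et) \<in> HH"
      if n: "n \<in> FA q" "n' \<in> FA q" "E (sg (\<one>, n) et) \<in> HH" "E (sg (\<one>, n') et) \<in> HH" for n n'
    proof -
      have "lin th1 (sg (\<one>, \<lambda>t. n t \<oplus>\<^bsub>Al\<^esub> n' t) et) = lin th1 (sg (\<one>, n) et) + lin th1 (sg (\<one>, n') et)"
        unfolding thf[OF n(1)] thf[OF n(2)] thf[OF F_add[OF n(1,2)]] fl_add[OF n(1,2)] by simp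
      hence "E (sg (\<one>, \<lambda>t. n t \<oplus>\<^bsub>Al\<^esub> n' t) et) =
          (sg (\<one>, \<lambda>t. n t \<oplus>\<^bsub>Al\<^esub> n' t) et - (sg (\<one>, n) et + sg (\<one>, n') et)) + E (sg (\<one>, n) et) + E (sg (\<one>, n') et)"
        by (simp add: E_def lft_def lin_add)
      thus ?thesis using add[OF add[OF R2[OF n(1,2)] n(3)] n(4)] by simp
    qed
    have zer: "E (sg (\<one>, \<lambda>_ _. \<zero>) et) \<in> HH"
    proof -
      have z: "(\<lambda>_ _. \<zero>) \<in> FA q" using ul_in[of 0 "Sc q"] by (simp add: ul_def)
      have "lin th1 (sg (\<one>, \<lambda>_ _. \<zero>) et) = 0" using thf[OF z] by (simp add: fl_def)
      thus ?thesis using neg[OF R2[OF z z]] by (simp add: E_def lft_def)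
    qed
    have sgl: "E (sg (\<one>, Defs.single Al s a) et) \<in> HH" if s: "s \<in> Sc q" "a \<in> fin_fun k D" for s a
    proof -
      note b = bs_in(1)[OF s(1)]
      have "lin th1 (sg (\<one>, Defs.single Al s a) et) = sg s (emb k (chi a))" unfolding thf[OF Fsingle(1)[OF s]] by (rule ppi_single[OF s])
      hence "E (sg (\<one>, Defs.single Al s a) et) =
        (sg (chi a, bs s) et - sg (\<one>, bs s) (emb k (chi a))) - (sg (chi a, bs s) et - sg (\<one>, Defs.single Al s a) et)"
        using chi(1)[OF s(2)] by (simp add: E_def lft_def mult.commute[of _ "eta k"])
      thus ?thesis using dif[OF R4[OF chi(1)[OF s(2)] b] R3[OF s(2) b]] unfolding bs_smult[OF s] by simp
    qed
    \<comment> \<open>Induction along the flattened form of \<open>n\<close>. Individual terms may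
      have coefficients outside \<open>k\<close>; the factor \<open>et\<close> projects each of them
      back.\<close>
    have "fl k n \<in> fspan (D \<times> Sc q) \<and> E (sg (\<one>, ul k (scale et (fl k n))) et) \<in> HH" using ech_fspan[OF fl_in[OF n]]
    proof (induction rule: chain_induct)
      case (single y c)
      obtain d s where y: "y = (d, s)" "d \<in> D" "s \<in> Sc q" using single by auto
      have a: "Defs.single k d (unemb k c) \<in> fin_fun k D" "tu k (Defs.single k d (unemb k c)) = sg d (eta k * c)"
        using y(2) fin_fun_single[OF y(2)] tu_single[OF y(2)] by (auto simp: emb_unemb)
      have "ul k (scale et (sg y c)) = Defs.single Al s (Defs.single k d (unemb k c))"
      proof (rule fl_inj[OF ul_in Fsingle(1)[OF y(3) a(1)]])
        show "scale et (sg y c) \<in> fspan (D \<times> Sc q)" using y by auto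
        have "scale et (sg y c) \<in> ech et (D \<times> Sc q)" using y by (intro ech_closed(4)) auto
        thus "fl k (ul k (scale et (sg y c))) = fl k (Defs.single Al s (Defs.single k d (unemb k c)))"
          unfolding Fsingle(2)[OF y(3) a(1)] a(2) by (simp add: fl_ul y(1))
      qed
      thus ?case using sgl[OF y(3) a(1)] y by simp
    next
      case zero
      thus ?case using zer by (simp add: ul_def)
    next
      case (add f g)
      have e: "scale et f \<in> ech et (D \<times> Sc q)" "scale et g \<in> ech et (D \<times> Sc q)" using add by auto
      note u = ul_in[OF ech_fspan[OF e(1)]] ul_in[OF ech_fspan[OF e(2)]]
      have e3: "scale et (f + g) \<in> ech et (D \<times> Sc q)" using add by auto
      have "ul k (scale et (f + g)) = (\<lambda>t. ul k (scale et f) t \<oplus>\<^bsub>Al\<^esub> ul k (scale et g) t)"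
        by (rule fl_inj[OF ul_in[OF ech_fspan[OF e3]] F_add[OF u]])
          (simp add: fl_add[OF u] fl_ul[OF e(1)] fl_ul[OF e(2)] fl_ul[OF e3] scale_distrib(1)[symmetric] del: Al_simps)
      thus ?case using ul_plus[OF u] add by simp
    qed
    thus ?thesis using ech_eta[OF fl_in[OF n]] ul_fl[OF n] by simp
  qed
  have E2: "E (sg (m, n) et) \<in> HH" if n: "m \<in> carrier k" "n \<in> FA q" for m n
  proof -
    have "lin th1 (sg (m, n) et) = lin th1 (scale (emb k m) (sg (\<one>, n) et))"
      using ech_eta[OF th1_in[of "(m, n)" q]] n ech_eta[OF ppi_fl_ech[OF n(2)]] mult.commute[of "eta k" "emb k m"]
      by (simp add: PB_def th1_def mult.assoc eta_emb(1))
    hence "E (sg (m, n) et) = (sg (m, n) et - sg (\<one>, n) (emb k m)) + scale (emb k m) (E (sg (\<one>, n) et))"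
      using n(1) by (simp add: E_def scale_distrib lft_def lin_scale mult.commute[of _ "eta k"])
    thus ?thesis using add[OF R4[OF n] scl[OF E1[OF n(2)]]] by simp
  qed
  have yV: "y \<in> fspan (PB q)" "scale et y = y" "lin th1 y = 0" using y ech_eta by (auto simp: YB_def VB_def)
  have "E (scale et y) \<in> HH" using yV(1)
  proof (induction rule: chain_induct)
    case (single p c)
    have "E (scale et (sg p c)) = scale c (E (sg p et))" unfolding E_add(3)[symmetric] by (simp add: mult.commute)
    thus ?case using scl[OF E2] single by (auto simp: PB_def)
  next
    case zero
    thus ?case using scl[OF E1[of "\<lambda>_ _. \<zero>"], of 0] ul_in[of 0 "Sc q"] by (simp add: ul_def E_def lft_def)
  next
    case (add f g)
    thus ?case using \<open>!!x x'. x \<in> HH ==> x' \<in> HH ==> x + x' \<in> HH\<close> by (simp add: scale_distrib E_add)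
  qed
  hence "y \<in> HH" using yV by (simp add: E_def lft_def)
  thus ?thesis using HF ut_tu unfolding HH_def by fastforce
qed

lemma tensor_sub_eq: "tensor_sub k Al Nt (res Al Nt q) = ut k ` YB q"
proof
  show "ut k ` YB q \<subseteq> tensor_sub k Al Nt (res Al Nt q)" unfolding tensor_sub_def mod_span_def using tensor_sub_ge by blast
qed (rule tensor_sub_le)

end

section \<open>Tor as cycles modulo boundaries of chains on cells\<close>

context basis_algebra
begin

lemma ut_add: "x \<in> ech et A ==> y \<in> ech et A ==> ut k (x + y) = (\<lambda>s. ut k x s \<oplus> ut k y s)"
proof -
  assume x: "x \<in> ech et A" "y \<in> ech et A"
  note u = ut_in[OF ech_fspan[OF x(1)]] ut_in[OF ech_fspan[OF x(2)]]
  show ?thesis by (rule tu_inj[OF ut_in[OF ech_fspan[OF ech_closed(2)[OF x]]] fin_fun_add[OF u]])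
      (simp add: tu_add[OF u] tu_ut[OF x(1)] tu_ut[OF x(2)] tu_ut[OF ech_closed(2)[OF x]])
qed

lemma ut_scale: "r \<in> carrier k ==> x \<in> ech et A ==> ut k (scale (emb k r) x) = (\<lambda>s. r \<otimes> ut k x s)"
proof -
  assume r: "r \<in> carrier k" and x: "x \<in> ech et A"
  note u = ut_in[OF ech_fspan[OF x]]
  show ?thesis by (rule tu_inj[OF ut_in[OF ech_fspan[OF ech_closed(5)[OF x]]] fin_fun_smult[OF r u]])
      (simp add: tu_smult[OF r u] tu_ut[OF x] tu_ut[OF ech_closed(5)[OF x]])
qed

lemma ech_uminus: "x \<in> ech et A ==> - x \<in> ech et A" using ech_closed(3)[OF ech_closed(1), of x] by simp

lemma pres1: "quot_presentation (FF q) k (ut k) (VB q) (YB q) (\<lambda>r. scale (emb k r))"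
proof
  have "inj_on (ut k) (VB q)" unfolding VB_def using tu_ut by (metis inj_onI)
  moreover have "ut k ` VB q = carrier (FF q)" unfolding FF VB_def
  proof (intro equalityI subsetI)
    fix f assume f: "f \<in> fin_fun k (PB q)"
    show "f \<in> ut k ` ech et (PB q)" by (rule image_eqI[of _ "ut k" "tu k f", OF ut_tu[OF f, symmetric] tu_ech[OF f]])
  qed (use ut_in[OF ech_fspan] in auto)
  ultimately show "bij_betw (ut k) (VB q) (carrier (FF q))" by (simp add: bij_betw_def)
qed (auto simp: VB_def YB_def lin_add lin_scale lin_uminus scale_distrib ut_add ut_scale ech_uminus)

text \<open>Chains on cells serve as coordinates on the tensor product: each is sent to the class of
  its lift.\<close>

definition tc :: "nat => (('k, 's) kcell, 'k coef) chain => ('k \<times> (('k, 's) kcell => 's => 'k) => 'k) set" where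
  "tc q kc = quot_presentation.qv (ut k) (YB q) (lft kc)"

lemma tor_cx_eq: "tor_cx k Al Nt Nt q = quot_mod (FF q) (ut k ` YB q)" by (simp add: tor_cx_def tensor_def tensor_sub_eq)

lemma qv_tc:
  assumes "y \<in> VB q" shows "quot_presentation.qv (ut k) (YB q) y = tc q (lin th1 y)"
proof -
  interpret Q: quot_presentation "FF q" k "ut k" "VB q" "YB q" "\<lambda>r. scale (emb k r)" by (rule pres1)
  have l: "lft (lin th1 y) \<in> VB q" "lin th1 (lft (lin th1 y)) = lin th1 y" using lft_in[OF TH_in[OF assms]] TH_lft[OF TH_in[OF assms]] .
  thus ?thesis unfolding tc_def using Q.qv_eq[OF assms l(1)] assms by (auto simp: YB_def VB_def lin_diff)
qed

lemma lft_lin: "lft (x + y) = lft x + lft y" "lft (scale c x) = scale c (lft x)" "lft (x - y) = lft x - lft y" by (simp_all add: lft_def lin_simps)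

lemma tc_bij: "bij_betw (tc q) (ech et (Sc q)) (carrier (tor_cx k Al Nt Nt q))"
proof -
  interpret Q: quot_presentation "FF q" k "ut k" "VB q" "YB q" "\<lambda>r. scale (emb k r)" by (rule pres1)
  have "inj_on (tc q) (ech et (Sc q))"
  proof (rule inj_onI)
    fix x y assume xy: "x \<in> ech et (Sc q)" "y \<in> ech et (Sc q)" "tc q x = tc q y"
    have "lft x - lft y \<in> YB q" using xy(3) unfolding tc_def Q.qv_eq[OF lft_in[OF xy(1)] lft_in[OF xy(2)]] .
    thus "x = y" using TH_lft[OF xy(1)] TH_lft[OF xy(2)] by (simp add: YB_def lin_diff)
  qed
  moreover have "tc q ` ech et (Sc q) = carrier (tor_cx k Al Nt Nt q)"
  proof -
    have "Q.qv ` VB q = tc q ` ech et (Sc q)" using qv_tc TH_in lft_in by (force simp: tc_def)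
    thus ?thesis unfolding tor_cx_eq Q.carrier_quot by simp
  qed
  ultimately show ?thesis by (simp add: bij_betw_def)
qed

lemma tc_add: "x \<in> ech et (Sc q) ==> y \<in> ech et (Sc q) ==>
    tc q (x + y) = tc q x \<oplus>\<^bsub>tor_cx k Al Nt Nt q\<^esub> tc q y" unfolding tor_cx_eq tc_def lft_lin
  by (rule quot_presentation.add_quot[OF pres1, symmetric]) (auto simp: lft_in)

lemma tc_smult: "r \<in> carrier k ==> x \<in> ech et (Sc q) ==>
    tc q (scale (emb k r) x) = r \<odot>\<^bsub>tor_cx k Al Nt Nt q\<^esub> tc q x" unfolding tor_cx_eq tc_def lft_lin
  by (rule quot_presentation.smult_quot[OF pres1, symmetric]) (auto simp: lft_in)

lemma tc_zero: "\<zero>\<^bsub>tor_cx k Al Nt Nt q\<^esub> = tc q 0"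
  unfolding tor_cx_eq tc_def using quot_presentation.zero_quot[OF pres1, of q] by (simp add: lft_def)

end

text \<open>Two algebras are allowed so that one statement covers both the differential of the Tor
  complex, where they are equal, and the map induced by the inclusion.\<close>

lemma tensor_map_tc:
  assumes A: "basis_algebra k D T prd cf e0 W \<iota>" and B: "basis_algebra k D' T' prd' cf' e0' W' \<iota>'"
  defines "SA \<equiv> basis_algebra.Sc k D T prd cf e0" and "SB \<equiv> basis_algebra.Sc k D' T' prd' cf' e0'"
    and "AA \<equiv> basis_algebra.Al k D prd cf e0" and "AB \<equiv> basis_algebra.Al k D' prd' cf' e0'"
    and "NB \<equiv> basis_algebra.Nt k T'" and "tA \<equiv> basis_algebra.th1 k T" and "tB \<equiv> basis_algebra.th1 k T'"
  assumes u: "!!f. f \<in> fin_fun AA (SA q) ==> u f \<in> fin_fun AB (SB q')"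
    and g: "!!f. f \<in> fin_fun AA (SA q) ==> tB (\<one>\<^bsub>k\<^esub>, u f) = lin g (tA (\<one>\<^bsub>k\<^esub>, f))"
    and x: "x \<in> ech (eta k) (SA q)" shows "tensor_map k AB NB (res AB NB q') id u (basis_algebra.tc k D T prd cf e0 q x)
      = basis_algebra.tc k D' T' prd' cf' e0' q' (lin g x)"
proof -
  interpret A: basis_algebra k D T prd cf e0 W \<iota> by (rule A)
  interpret B: basis_algebra k D' T' prd' cf' e0' W' \<iota>' by (rule B)
  let ?mp = "map_prod id u :: 'a \<times> _ => 'a \<times> _"
  have th: "B.th1 (?mp y) = lin g (A.th1 y)" if "y \<in> A.PB q" for y
  proof -
    have f: "fst y \<in> carrier k" "snd y \<in> fin_fun AA (SA q)" using that unfolding A.PB_def SA_def AA_def by auto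
    note g' = g[OF f(2), unfolded tA_def tB_def]
    have 1: "A.th1 y = scale (emb k (fst y)) (A.th1 (\<one>\<^bsub>k\<^esub>, snd y))" "B.th1 (?mp y) = scale (emb k (fst y)) (B.th1 (\<one>\<^bsub>k\<^esub>, u (snd y)))"
      using A.emb_one_mult[OF f(1)] by (simp_all add: A.th1_def B.th1_def mult.commute)
    show ?thesis unfolding 1 lin_scale g' ..
  qed
  have mp: "?mp y \<in> B.PB q'" if "y \<in> A.PB q" for y using that u[of "snd y"] unfolding A.PB_def B.PB_def SA_def SB_def AA_def AB_def by auto
  have pin: "pm ?mp y \<in> B.VB q'" if "y \<in> A.VB q" for y using that mp unfolding A.VB_def B.VB_def pm_def by (auto intro: ech_lin)
  have TH: "lin B.th1 (pm ?mp y) = lin g (lin A.th1 y)" if "y \<in> A.VB q" for y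
    unfolding lin_pm lin_lin by (rule lin_cong'[OF ech_fspan[OF that[unfolded A.VB_def]]]) (rule th)
  have "tensor_map k AB NB (res AB NB q') id u (A.tc q x)
    = quot_map (B.FF q') (ut k ` B.YB q') (push k k id ?mp) (quot_presentation.qv (ut k) (A.YB q) (A.lft x))"
    unfolding tensor_map_def A.tc_def AB_def NB_def B.tensor_sub_eq ..
  also have "... = quot_presentation.qv (ut k) (B.YB q') (pm ?mp (A.lft x))"
  proof (rule quot_map_qv[OF A.pres1 B.pres1])
    fix y assume y: "y \<in> A.VB q"
    show "push k k id ?mp (ut k y) = ut k (pm ?mp y)"
      using A.push_eq[OF A.ut_in[OF ech_fspan[OF y[unfolded A.VB_def]]], of ?mp] A.tu_ut[OF y[unfolded A.VB_def]] by simp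
  next
    fix y assume "y \<in> A.YB q"
    thus "pm ?mp y \<in> B.YB q'" using pin TH by (auto simp: A.YB_def B.YB_def)
    next
    fix y assume "y \<in> A.VB q"
    thus "pm ?mp y \<in> B.VB q'" by (rule pin)
  next
    show "A.lft x \<in> A.VB q" by (rule A.lft_in[OF x[unfolded SA_def]])
  qed (rule pm_simps(2))
  also have "... = B.tc q' (lin g x)" using B.qv_tc[OF pin[OF A.lft_in]] TH[OF A.lft_in] A.TH_lft x unfolding SA_def by metis
  finally show ?thesis .
qed

context basis_algebra
begin

lemma bdry_in: "f \<in> FA (Suc q) ==> bdry Al f \<in> FA q" "f \<in> FA (Suc q) ==> fl k (bdry Al f) = lin dd (fl k f)"
  using bdry_eq chain_of_in by blast+

lemma th1_one: "f \<in> FA q ==> th1 (\<one>, f) = ppi (fl k f)" using ech_eta[OF ppi_fl_ech] by (simp add: th1_def)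

lemma tor_d_tc: "x \<in> ech et (Sc (Suc q)) ==> tor_d k Al Nt Nt q (tc (Suc q) x) = tc q (lin dk x)" unfolding tor_d_def
proof (rule tensor_map_tc[OF basis_algebra_axioms basis_algebra_axioms])
  fix f assume f: "f \<in> FA (Suc q)"
  show "th1 (\<one>, bdry Al f) = lin dk (th1 (\<one>, f))"
    unfolding th1_one[OF f] th1_one[OF bdry_in(1)[OF f]] bdry_in(2)[OF f] by (rule ppi_dd[OF ech_fspan[OF fl_in[OF f]]])
qed (rule bdry_in)

definition Zq :: "nat => (('k, 's) kcell, 'k coef) chain set" where "Zq q = {x \<in> ech et (Sc q). 0 < q \<longrightarrow> lin dk x = 0}"

definition Bq :: "nat => (('k, 's) kcell, 'k coef) chain set" where "Bq q = lin dk ` ech et (Sc (Suc q))"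

lemma cycles_eq: "cycles (tor_cx k Al Nt Nt) (tor_d k Al Nt Nt) q = tc q ` Zq q"
proof (cases q)
  case 0
  thus ?thesis using bij_betw_imp_surj_on[OF tc_bij, of 0] by (simp add: cycles_def Zq_def)
next
  case (Suc p)
  have "tc p (lin dk x) = tc p 0 \<longleftrightarrow> lin dk x = 0" if "x \<in> ech et (Sc (Suc p))" for x
    using inj_on_eq_iff[OF bij_betw_imp_inj_on[OF tc_bij] dk_in[OF ech_fspan[OF that]] ech_closed(1)] .
  thus ?thesis unfolding cycles_def Suc Zq_def tc_zero nat.case bij_betw_imp_surj_on[OF tc_bij, symmetric] by (auto simp: tor_d_tc)
qed

lemma boundaries_eq: "boundaries (tor_cx k Al Nt Nt) (tor_d k Al Nt Nt) q = tc q ` Bq q"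
  unfolding boundaries_def Bq_def bij_betw_imp_surj_on[OF tc_bij, symmetric] image_image by (rule image_cong) (auto simp: tor_d_tc)

lemma pres2: "quot_presentation ((tor_cx k Al Nt Nt q)\<lparr>carrier := tc q ` Zq q\<rparr>) k (tc q) (Zq q) (Bq q) (\<lambda>r. scale (emb k r))"
proof
  have "inj_on (tc q) (Zq q)" using bij_betw_imp_inj_on[OF tc_bij] by (rule inj_on_subset) (auto simp: Zq_def)
  thus "bij_betw (tc q) (Zq q) (carrier ((tor_cx k Al Nt Nt q)\<lparr>carrier := tc q ` Zq q\<rparr>))" by (simp add: bij_betw_def)
  show "Bq q \<subseteq> Zq q" using dk_in[OF ech_fspan] dk_dk[OF ech_fspan] by (cases q) (auto simp: Bq_def Zq_def)
  show "0 \<in> Bq q" unfolding Bq_def by (rule image_eqI[of _ _ 0]) auto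
  show "x + y \<in> Bq q" if xy: "x \<in> Bq q" "y \<in> Bq q" for x y using xy unfolding Bq_def by (auto simp flip: lin_add)
  show "- x \<in> Bq q" if "x \<in> Bq q" for x using that unfolding Bq_def by (auto simp flip: lin_uminus intro: ech_uminus)
  show "scale (emb k r) x \<in> Bq q" if "x \<in> Bq q" for x r using that unfolding Bq_def by (auto simp flip: lin_scale)
qed (auto simp: Zq_def lin_simps tc_add tc_smult scale_distrib)

definition tcl :: "nat => (('k, 's) kcell, 'k coef) chain => ('k \<times> (('k, 's) kcell => 's => 'k) => 'k) set set" where
  "tcl q = quot_presentation.qv (tc q) (Bq q)"

lemma Tor_eq: "Tor k Al Nt Nt q = quot_mod ((tor_cx k Al Nt Nt q)\<lparr>carrier := tc q ` Zq q\<rparr>) (tc q ` Bq q)"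
  unfolding Tor_def homology_def cycles_eq boundaries_eq ..

text \<open>The comparison map from bar cycles to Tor, through which all Tor modules are
  described.\<close>

definition \<alpha> :: "nat => ('a list \<times> ('a => 'a) list, 'k coef) chain => ('k \<times> (('k, 's) kcell => 's => 'k) => 'k) set set" where
  "\<alpha> q z = tcl q (lin (tb q) z)"

definition BZ :: "nat => ('a list \<times> ('a => 'a) list, 'k coef) chain set" where "BZ q = {z \<in> ech et (BX q). lin tv z = 0}"

lemma tb_Zq: "z \<in> BZ q ==> lin (tb q) z \<in> Zq q" using tb_in tb_tv[of z "q - 1"] by (auto simp: BZ_def Zq_def) (metis Suc_pred ech_fspan lin_0)

lemma \<alpha>_add: "z \<in> BZ q ==> z' \<in> BZ q ==> \<alpha> q (z + z') = \<alpha> q z \<oplus>\<^bsub>Tor k Al Nt Nt q\<^esub> \<alpha> q z'"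
  unfolding \<alpha>_def Tor_eq tcl_def lin_add by (rule quot_presentation.add_quot[OF pres2, symmetric]) (auto simp: tb_Zq)

lemma \<alpha>_smult: "r \<in> carrier k ==> z \<in> BZ q ==> \<alpha> q (scale (emb k r) z) = r \<odot>\<^bsub>Tor k Al Nt Nt q\<^esub> \<alpha> q z"
  unfolding \<alpha>_def Tor_eq tcl_def lin_scale by (rule quot_presentation.smult_quot[OF pres2, symmetric]) (auto simp: tb_Zq)

end

locale basis_algebra_res = basis_algebra k D T prd cf e0 W \<iota>
  for k :: "('k, 'y) ring_scheme" (structure) and D T :: "'s set" and prd cf e0 and W :: "('a => 'a) set" and \<iota> +
  assumes acyclic: "f \<in> ech et ((D - T) \<times> Sc q) ==> (0 < q ==> lin dd f = 0) ==>
       \<exists>g \<in> ech et ((D - T) \<times> Sc (Suc q)). lin dd g = f"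
begin

sublocale basis_resolution D T prd cu e0 "eta k" Sc chn cll au "Gen \<one>" W \<iota> by unfold_locales (rule acyclic)

text \<open>Equality of classes in Tor is decided in the bar complex, which is determined by
  \<open>W\<close> and \<open>k\<close> alone. This makes Tor modules over different algebras
  comparable.\<close>

lemma \<alpha>_eq:
  assumes z: "z \<in> BZ q" "z' \<in> BZ q" shows "\<alpha> q z = \<alpha> q z' \<longleftrightarrow> z - z' \<in> lin tv ` ech et (BX (Suc q))"
proof -
  have "\<alpha> q z = \<alpha> q z' \<longleftrightarrow> lin (tb q) (z - z') \<in> Bq q"
    unfolding \<alpha>_def tcl_def quot_presentation.qv_eq[OF pres2 tb_Zq[OF z(1)] tb_Zq[OF z(2)]] lin_diff ..
  also have "... \<longleftrightarrow> z - z' \<in> lin tv ` ech et (BX (Suc q))"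
  proof
    assume "lin (tb q) (z - z') \<in> Bq q"
    then obtain y where "y \<in> ech et (Sc (Suc q))" "lin (tb q) (z - z') = lin dk y" by (auto simp: Bq_def)
    thus "z - z' \<in> lin tv ` ech et (BX (Suc q))" using bar_to_res_inj[of "z - z'" q y] z by (auto simp: BZ_def lin_diff)
  next
    assume "z - z' \<in> lin tv ` ech et (BX (Suc q))"
    then obtain b where b: "b \<in> ech et (BX (Suc q))" "z - z' = lin tv b" by auto
    show "lin (tb q) (z - z') \<in> Bq q" unfolding b(2) Bq_def tb_tv[OF ech_fspan[OF b(1)]] using tb_in[OF ech_fspan[OF b(1)]] by auto
  qed
  finally show ?thesis .
qed

lemma carrier_Tor: "carrier (Tor k Al Nt Nt q) = \<alpha> q ` BZ q"
proof -
  interpret Q: quot_presentation "(tor_cx k Al Nt Nt q)\<lparr>carrier := tc q ` Zq q\<rparr>" k "tc q" "Zq q" "Bq q" "\<lambda>r. scale (emb k r)" by (rule pres2)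
  have "tcl q x \<in> \<alpha> q ` BZ q" if x: "x \<in> Zq q" for x
  proof -
    obtain z y where z: "z \<in> ech et (BX q)" "lin tv z = 0" "y \<in> ech et (Sc (Suc q))" "x = lin (tb q) z + lin dk y"
      using bar_to_res_surj[of x q] x by (auto simp: Zq_def)
    have zB: "z \<in> BZ q" using z by (simp add: BZ_def)
    have "tcl q x = \<alpha> q z" unfolding \<alpha>_def tcl_def Q.qv_eq[OF x tb_Zq[OF zB]] using z by (auto simp: Bq_def)
    thus ?thesis using zB by blast
  qed
  thus ?thesis unfolding Tor_eq Q.carrier_quot using tb_Zq by (auto simp: \<alpha>_def tcl_def)
qed

end

lemma quot_map_carrier: "quot_map (M\<lparr>carrier := Z\<rparr>) Y f = quot_map M Y f" by (simp add: quot_map_def a_r_coset_def' fun_eq_iff)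

section \<open>Homomorphisms that send basis elements to basis elements\<close>

locale basis_algebra_hom =
  A: basis_algebra k D T prd cf e0 W \<iota> + B: basis_algebra k D' T' prd' cf' e0' W' \<iota>'
  for k :: "('k, 'y) ring_scheme" (structure) and D T :: "'s set" and prd cf e0 and W :: "('a => 'a) set" and \<iota>
    and D' T' :: "'t set" and prd' cf' e0' and W' :: "('a => 'a) set" and \<iota>' +
  fixes j :: "'s => 't"
  assumes j_D: "x \<in> D ==> j x \<in> D'" and j_prd: "x \<in> D ==> y \<in> D ==> j (prd x y) = prd' (j x) (j y)"
    and j_cf: "x \<in> D ==> y \<in> D ==> cf' (j x) (j y) = cf x y"
    and j_T: "x \<in> D ==> j x \<in> T' \<longleftrightarrow> x \<in> T" and W_W': "W \<subseteq> W'" and j_\<iota>: "w \<in> W ==> \<iota>' w = j (\<iota> w)"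
begin

definition Ph :: "('s => 'k) => ('t => 'k)" where "Ph = push k k id j"

definition cm :: "nat => ('s => 'k, 'k) cell => ('t => 'k, 'k) cell" where "cm q = cell_map A.Al B.Al Ph id q"

abbreviation mj :: "nat => 's \<times> ('s => 'k, 'k) cell => 't \<times> ('t => 'k, 'k) cell" where
  "mj q \<equiv> map_prod j (cm q)"

lemma Ph:
  assumes a: "a \<in> fin_fun k D" shows "Ph a \<in> fin_fun k D'" "tu k (Ph a) = pm j (tu k a)"
proof -
  have p: "pm j (tu k a) \<in> ech (eta k) D'" unfolding pm_def by (rule ech_lin[OF A.tu_ech[OF a]]) (auto simp: j_D)
  show "Ph a \<in> fin_fun k D'" "tu k (Ph a) = pm j (tu k a)" unfolding Ph_def A.push_eq[OF a] using A.ut_in[OF ech_fspan[OF p]] A.tu_ut[OF p] by auto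
qed

lemma push_fl:
  assumes f: "f \<in> fin_fun A.Al X1" and u: "!!s. s \<in> X1 ==> u s \<in> X2"
  shows "push A.Al B.Al Ph u f \<in> fin_fun B.Al X2" "fl k (push A.Al B.Al Ph u f) = pm (map_prod j u) (fl k f)"
proof -
  let ?S = "{s. f s \<noteq> (\<lambda>_. \<zero>)}"
  have m: "pm (map_prod j u) (fl k f) \<in> ech (eta k) (D' \<times> X2)" unfolding pm_def by (rule ech_lin[OF A.fl_in[OF f]]) (auto simp: j_D u)
  have "push A.Al B.Al Ph u f t = ul k (pm (map_prod j u) (fl k f)) t" for t
  proof -
    let ?P = "{s. f s \<noteq> \<zero>\<^bsub>A.Al\<^esub> \<and> u s = t}"
    have g: "(\<lambda>s. Ph (f s)) \<in> ?P \<rightarrow> fin_fun k D'" using Ph(1)[OF A.FD(1)[OF f]] by auto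
    have b: "push A.Al B.Al Ph u f t = (\<Oplus>\<^bsub>free_mod k D'\<^esub>s\<in>?P. Ph (f s))" by (simp add: push_def B.finsum_Al)
    have "tu k (push A.Al B.Al Ph u f t) = (\<Sum>s\<in>?P. tu k (Ph (f s)))" unfolding b using A.tu_finsum[OF g] by blast
    also have "... = (\<Sum>s\<in>?S. if u s = t then pm j (tu k (f s)) else 0)"
    proof -
      have "?P = {s \<in> ?S. u s = t}" by auto
      thus ?thesis using A.FD(2)[OF f] Ph(2)[OF A.FD(1)[OF f]] by (simp only: sum.inter_filter)
    qed
    also have "... = (\<Sum>s\<in>?S. slt t (pm (map_prod j u) (pm (\<lambda>d. (d, s)) (tu k (f s)))))"
    proof (rule sum.cong[OF refl])
      fix s
      show "(if u s = t then pm j (tu k (f s)) else 0) = slt t (pm (map_prod j u) (pm (\<lambda>d. (d, s)) (tu k (f s))))"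
        unfolding pm_pm unfolding pm_def slt_lin by (simp add: slt_single lin_fun)
    qed
    also have "... = slt t (pm (map_prod j u) (fl k f))" unfolding fl_def pm_sum by (rule poly_mapping_eqI) (simp add: lookup_sum)
    finally have "tu k (push A.Al B.Al Ph u f t) = slt t (pm (map_prod j u) (fl k f))" .
    moreover have "ul k (pm (map_prod j u) (fl k f)) t = ut k (slt t (pm (map_prod j u) (fl k f)))" by (simp add: ul_def ut_def)
    moreover have "push A.Al B.Al Ph u f t \<in> fin_fun k D'" unfolding b using A.tu_finsum[OF g] by blast
    ultimately show ?thesis using A.ut_tu by metis
  qed
  hence "push A.Al B.Al Ph u f = ul k (pm (map_prod j u) (fl k f))" by blast
  thus "push A.Al B.Al Ph u f \<in> fin_fun B.Al X2" "fl k (push A.Al B.Al Ph u f) = pm (map_prod j u) (fl k f)"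
    using B.ul_in[OF ech_fspan[OF m]] B.fl_ul[OF m] by simp_all
qed

lemma pm_lm: "x \<in> D ==> f \<in> fspan (D \<times> X1) ==> pm (map_prod j u) (A.lm x f) = B.lm (j x) (pm (map_prod j u) f)"
  unfolding A.lm_def B.lm_def lin_pm pm_lin by (erule lin_cong') (auto simp: j_prd A.cu_def B.cu_def j_cf)

lemma pm_ppi: "f \<in> fspan (D \<times> X1) ==> B.ppi (pm (map_prod j u) f) = pm u (A.ppi f)"
  unfolding A.ppi_def B.ppi_def lin_pm pm_lin by (erule lin_cong') (auto simp: j_T)

lemma cm_step:
  assumes c: "!!s. s \<in> A.Sc q ==> cm q s \<in> B.Sc q"
    and cyc: "!!f. f \<in> A.cyc q ==> pm (mj q) f \<in> B.cyc q" and s: "s \<in> A.Sc (Suc q)"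
  shows "cm (Suc q) s = B.cll (pm (mj q) (A.chn s)) \<and> cm (Suc q) s \<in> B.Sc (Suc q)
    \<and> B.chn (cm (Suc q) s) = pm (mj q) (A.chn s)"
proof -
  have f: "chain_of A.Al s \<in> fin_fun A.Al (A.Sc q)" by (rule A.chain_of_in[OF s])
  have "cm (Suc q) s = B.cll (pm (mj q) (A.chn s))" using B.cell_fl[OF push_fl(1)[OF f c]] push_fl(2)[OF f c] by (simp add: cm_def A.chn_def)
  thus ?thesis using B.cell[OF cyc[OF A.S_ch[OF s]]] by simp
qed

text \<open>The cell map pushes boundaries forward, so it lands in cells only if cycles go to
  cycles; hence the joint induction.\<close>

lemma cm_main: "(\<forall>s\<in>A.Sc q. cm q s \<in> B.Sc q) \<and> (\<forall>f\<in>A.cyc q. pm (mj q) f \<in> B.cyc q)"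
proof (induction q)
  case 0
  have c: "cm 0 s \<in> B.Sc 0 \<and> B.au (cm 0 s) = A.au s" if "s \<in> A.Sc 0" for s using that by (auto simp: A.Sc_0 B.Sc_0 cm_def A.au_def B.au_def)
  have "pm (mj 0) f \<in> B.cyc 0" if f: "f \<in> A.cyc 0" for f
  proof -
    have e: "f \<in> ech (eta k) (D \<times> A.Sc 0)" using f by (simp add: A.cyc_def)
    have "lin B.ag (pm (mj 0) f) = lin A.ag f" unfolding lin_pm by (rule lin_cong'[OF ech_fspan[OF e]]) (auto simp: A.ag_def B.ag_def j_T c)
    moreover have "pm (mj 0) f \<in> ech (eta k) (D' \<times> B.Sc 0)" unfolding pm_def by (rule ech_lin[OF e]) (use c j_D in auto)
    ultimately show ?thesis using f by (simp add: A.cyc_def B.cyc_def)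
  qed
  thus ?case using c by blast
next
  case (Suc q)
  have st: "cm (Suc q) s \<in> B.Sc (Suc q)" "B.chn (cm (Suc q) s) = pm (mj q) (A.chn s)" if "s \<in> A.Sc (Suc q)" for s using cm_step[of q s] Suc.IH that by blast+
  have "pm (mj (Suc q)) f \<in> B.cyc (Suc q)" if f: "f \<in> A.cyc (Suc q)" for f
  proof -
    have e: "f \<in> ech (eta k) (D \<times> A.Sc (Suc q))" "lin A.dd f = 0" using f by (simp_all add: A.cyc_def)
    have "lin B.dd (pm (mj (Suc q)) f) = lin (\<lambda>y. pm (mj q) (A.dd y)) f" unfolding lin_pm
    proof (rule lin_cong'[OF ech_fspan[OF e(1)]])
      fix y assume y: "y \<in> D \<times> A.Sc (Suc q)"
      hence "A.chn (snd y) \<in> fspan (D \<times> A.Sc q)" using ech_fspan[OF A.S_ech[of "snd y" q]] by auto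
      thus "B.dd (mj (Suc q) y) = pm (mj q) (A.dd y)"
        using y st(2)[of "snd y"] pm_lm[of "fst y" "A.chn (snd y)" "A.Sc q" "cm q"] by (auto simp: A.dd_def B.dd_def)
    qed
    hence "lin B.dd (pm (mj (Suc q)) f) = 0" using e(2) by (simp flip: pm_lin)
    moreover have "pm (mj (Suc q)) f \<in> ech (eta k) (D' \<times> B.Sc (Suc q))" unfolding pm_def by (rule ech_lin[OF e(1)]) (use st j_D in auto)
    ultimately show ?thesis by (simp add: B.cyc_def)
  qed
  thus ?case using st by blast
qed

lemma cm_in: "s \<in> A.Sc q ==> cm q s \<in> B.Sc q" and cm_Suc: "s \<in> A.Sc (Suc q) ==> cm (Suc q) s = B.cll (pm (mj q) (A.chn s))"
  and cm_chn: "s \<in> A.Sc (Suc q) ==> B.chn (cm (Suc q) s) = pm (mj q) (A.chn s)" using cm_main[of q] cm_step[of q s] by blast+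

lemma LW_sub: "L \<in> A.LW q ==> L \<in> B.LW q" using W_W' by (auto simp: A.LW_def B.LW_def)

text \<open>The comparison cells are constructed from their boundaries without choice, so the cell
  map carries them to each other exactly and not merely up to homotopy.\<close>

lemma cm_bc: "ws \<in> A.LW q ==> cm q (A.bc q ws) = B.bc q ws"
proof (induction q arbitrary: ws)
  case 0
  thus ?case by (simp add: cm_def)
next
  case (Suc q)
  have "pm (mj q) (lin (A.tau (A.bc q)) (bd (id # ws))) = lin (B.tau (B.bc q)) (bd (id # ws))" unfolding pm_lin
  proof (rule lin_cong'[OF A.LW_bd[OF A.LW_id[OF Suc.prems]]])
    fix L assume "L \<in> A.LW (Suc q)"
    then obtain v vs where L: "L = v # vs" "v \<in> W" "vs \<in> A.LW q" by (cases L) (auto simp: A.LW_def)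
    thus "pm (mj q) (A.tau (A.bc q) L) = B.tau (B.bc q) L" using Suc.IH[OF A.LW_map[OF A.D_W(3)[OF L(2)] L(3)]] by (simp add: j_\<iota>)
  qed
  thus ?case using cm_Suc[OF A.bc_in[OF Suc.prems]] A.ch_bc[OF Suc.prems] by simp
qed

lemma pm_cm_in: "x \<in> ech (eta k) (A.Sc q) ==> pm (cm q) x \<in> ech (eta k) (B.Sc q)" unfolding pm_def by (erule ech_lin) (simp add: cm_in)

lemma dk_cm: "x \<in> ech (eta k) (A.Sc (Suc q)) ==> lin B.dk (pm (cm (Suc q)) x) = pm (cm q) (lin A.dk x)" unfolding lin_pm pm_lin
proof (rule lin_cong', erule ech_fspan)
  fix s assume s: "s \<in> A.Sc (Suc q)"
  show "B.dk (cm (Suc q) s) = pm (cm q) (A.dk s)" unfolding A.dk_def B.dk_def cm_chn[OF s] by (rule pm_ppi[OF ech_fspan[OF A.S_ech[OF s]]])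
qed

text \<open>As a consequence of \<open>cm_bc\<close>, the induced map on Tor is the inclusion of bar
  cycles, without any correction.\<close>

lemma Tor_map_\<alpha>:
  assumes z: "z \<in> A.BZ q" shows "Tor_map k A.Al B.Al B.Nt B.Nt Ph id id q (A.\<alpha> q z) = B.\<alpha> q z"
proof -
  let ?t = "tensor_map k B.Al B.Nt (res B.Al B.Nt q) id (push A.Al B.Al Ph (cm q))"
  have t: "?t (A.tc q x) = B.tc q (pm (cm q) x)" if "x \<in> ech (eta k) (A.Sc q)" for x unfolding pm_def
  proof (rule tensor_map_tc[OF A.basis_algebra_axioms B.basis_algebra_axioms _ _ that])
    fix f assume f: "f \<in> fin_fun A.Al (A.Sc q)"
    note p = push_fl[OF f cm_in]
    show "push A.Al B.Al Ph (cm q) f \<in> fin_fun B.Al (B.Sc q)" by (rule p(1))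
    show "B.th1 (\<one>, push A.Al B.Al Ph (cm q) f) = lin (\<lambda>s. sg (cm q s) 1) (A.th1 (\<one>, f))"
      using A.th1_one[OF f] B.th1_one[OF p(1)] p(2) pm_ppi[OF ech_fspan[OF A.fl_in[OF f]], of "cm q"] by (simp add: pm_def)
  qed
  have "Tor_map k A.Al B.Al B.Nt B.Nt Ph id id q (A.\<alpha> q z)
      = quot_map ((tor_cx k B.Al B.Nt B.Nt q)\<lparr>carrier := B.tc q ` B.Zq q\<rparr>) (B.tc q ` B.Bq q) ?t (A.tcl q (lin (A.tb q) z))"
    unfolding Tor_map_def A.\<alpha>_def B.boundaries_eq cm_def[symmetric] quot_map_carrier ..
  also have "... = B.tcl q (pm (cm q) (lin (A.tb q) z))" unfolding A.tcl_def B.tcl_def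
  proof (rule quot_map_qv[where g="pm (cm q)", OF A.pres2 B.pres2 _ _ _ _ A.tb_Zq[OF z]])
    show "?t (A.tc q x) = B.tc q (pm (cm q) x)" if "x \<in> A.Zq q" for x using t[of x] that by (simp add: A.Zq_def)
    show "pm (cm q) x \<in> B.Zq q" if x: "x \<in> A.Zq q" for x using x pm_cm_in[of x q] dk_cm[of x "q - 1"] by (cases q) (auto simp: A.Zq_def B.Zq_def)
    show "pm (cm q) x \<in> B.Bq q" if x: "x \<in> A.Bq q" for x
    proof -
      obtain y where y: "y \<in> ech (eta k) (A.Sc (Suc q))" "x = lin A.dk y" using x by (auto simp: A.Bq_def)
      show ?thesis unfolding B.Bq_def y(2) by (rule image_eqI[of _ "lin B.dk" _, OF dk_cm[OF y(1), symmetric] pm_cm_in[OF y(1)]])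
    qed
  qed (auto simp: A.Zq_def)
  also have "pm (cm q) (lin (A.tb q) z) = lin (B.tb q) z"
    unfolding pm_lin using z by (intro lin_cong'[of z "A.BX q"]) (auto simp: A.BZ_def A.BX_def A.tb_def B.tb_def cm_bc)
  finally show ?thesis unfolding B.\<alpha>_def .
qed

end

subsection \<open>Labelled graphs of degree at most two\<close>

text \<open>The tag separates edges of different diagrams that join the same nodes with the same
  label.\<close>

type_synonym ('t, 'v, 'g) edge = "'t \<times> 'v set \<times> 'g"

abbreviation ends :: "('t, 'v, 'g) edge => 'v set" where "ends e \<equiv> fst (snd e)"
abbreviation lab :: "('t, 'v, 'g) edge => 'g" where "lab e \<equiv> snd (snd e)"

definition adj :: "('t, 'v, 'g) edge set => ('v \<times> 'v) set" where "adj E = {(u, v). \<exists>e\<in>E. {u, v} = ends e}"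

definition cpt :: "('t, 'v, 'g) edge set => 'v => 'v set" where "cpt E v = (adj E)\<^sup>* `` {v}"

definition comps :: "('t, 'v, 'g) edge set => 'v set => 'v set set" where "comps E V = V // (adj E)\<^sup>*"

definition el :: "('t, 'v, 'g) edge set => 'v set => ('t, 'v, 'g) edge set" where "el E C = {e \<in> E. ends e \<subseteq> C}"

definition dgr :: "('t, 'v, 'g) edge set => 'v => nat" where "dgr E v = card {e \<in> E. v \<in> ends e}"

definition loopE :: "('t, 'v, 'g) edge set => 'v set => bool" where "loopE E C \<longleftrightarrow> (\<forall>v\<in>C. dgr E v = 2)"

definition gr :: "('g, 'x) monoid_scheme => ('t, 'v, 'g) edge set => 'v set => bool" where
  "gr G E V \<longleftrightarrow> finite E \<and> finite V \<and> (\<forall>e\<in>E. ends e \<subseteq> V \<and> card (ends e) = 2 \<and> lab e \<in> carrier G)"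

lemma comps_eq: "comps E V = cpt E ` V" by (auto simp: comps_def cpt_def quotient_def)

lemma sym_adj: "sym (adj E)" by (auto simp: sym_def adj_def insert_commute)

lemma comp_refl [simp]: "v \<in> cpt E v" by (simp add: cpt_def)

lemma comp_sym: "u \<in> cpt E v ==> v \<in> cpt E u" unfolding cpt_def using symD[OF sym_rtrancl[OF sym_adj]] by auto

lemma comp_trans: "u \<in> cpt E v ==> w \<in> cpt E u ==> w \<in> cpt E v" by (auto simp: cpt_def)

lemma comp_eq: "u \<in> cpt E v ==> cpt E u = cpt E v" using comp_trans[of u E v] comp_trans[OF comp_sym, of u E v] by auto

lemma comps_disj: "K \<in> comps E V ==> L \<in> comps E V ==> x \<in> K ==> x \<in> L ==> K = L"
  unfolding comps_eq using comp_eq[of x E] by (metis imageE)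

lemma comp_step: "u \<in> cpt E v ==> (u, w) \<in> adj E ==> w \<in> cpt E v" by (auto simp: cpt_def)

lemma comp_mono: "E \<subseteq> E' ==> cpt E v \<subseteq> cpt E' v"
  unfolding cpt_def by (intro Image_mono rtrancl_mono subset_refl) (force simp: adj_def)

lemma adjI: "e \<in> E ==> card (ends e) = 2 ==> u \<in> ends e ==> w \<in> ends e ==> u = w \<or> (u, w) \<in> adj E"
  by (auto simp: card_2_iff adj_def)

lemma comp_closed_edge: "e \<in> E ==> card (ends e) = 2 ==> u \<in> ends e ==> u \<in> cpt E v ==> ends e \<subseteq> cpt E v"
  using adjI[of e E u] comp_step[of u E v] by (metis subsetI)

lemma comp_least:
  assumes "v \<in> S" "!!u w. u \<in> S ==> (u, w) \<in> adj E ==> w \<in> S" shows "cpt E v \<subseteq> S"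
proof -
  have "w \<in> S" if "(v, w) \<in> (adj E)\<^sup>*" for w using that by induction (use assms in auto)
  thus ?thesis by (auto simp: cpt_def)
qed

lemma comp_sub: "gr G E V ==> v \<in> V ==> cpt E v \<subseteq> V" by (rule comp_least) (auto simp: gr_def adj_def)

lemma finite_el: "finite E ==> finite (el E C)" by (simp add: el_def)

lemma comp_finite:
  assumes "gr G E V" "v \<in> V" shows "finite (cpt E v)" using comp_sub[OF assms] assms(1) finite_subset unfolding gr_def by blast

text \<open>Take a largest set of nodes of the component that contains \<open>v\<close> and
  satisfies the inequality. An edge leaving it would allow one more node at the cost of at least one
  more edge, so the set is closed under adjacency.\<close>

lemma comp_edges:
  assumes "gr G E V" "v \<in> V" shows "card (cpt E v) \<le> card (el E (cpt E v)) + 1"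
proof -
  let ?C = "cpt E v"
  let ?P = "\<lambda>S. S \<subseteq> ?C \<and> v \<in> S \<and> card S \<le> card (el E S) + 1"
  note fC = comp_finite[OF assms]
  have "finite {S. ?P S}" using fC by simp
  hence f: "finite (card ` {S. ?P S})" by (rule finite_imageI)
  have "?P {v}" by simp
  hence "card ` {S. ?P S} \<noteq> {}" by blast
  from Max_in[OF f this] obtain S where S1: "?P S" "Max (card ` {S. ?P S}) = card S" by auto
  have S2: "card S' \<le> card S" if "?P S'" for S' unfolding S1(2)[symmetric] by (rule Max_ge[OF f]) (use that in blast)
  note S = S1(1) S2
  have "?C \<subseteq> S"
  proof (rule comp_least)
    fix a b assume ab: "a \<in> S" "(a, b) \<in> adj E"
    show "b \<in> S"
    proof (rule ccontr)
      assume b: "b \<notin> S"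
      obtain e where e: "e \<in> E" "{a, b} = ends e" using ab(2) by (auto simp: adj_def)
      have fin: "finite (el E (insert b S))" using assms(1) by (simp add: gr_def el_def)
      have "insert e (el E S) \<subseteq> el E (insert b S)" "e \<notin> el E S" using e b ab(1) by (auto simp: el_def)
      hence "card (el E S) + 1 \<le> card (el E (insert b S))" using card_mono[OF fin, of "insert e (el E S)"] finite_subset[OF _ fin, of "el E S"] by auto
      moreover have "b \<in> ?C" using S(1) ab(1) comp_step[OF _ ab(2)] by blast
      moreover have "card (insert b S) = card S + 1" using b S(1) finite_subset[OF _ fC] by auto
      ultimately have "?P (insert b S)" using S(1) by auto
      from S(2)[OF this] show False using \<open>card (insert b S) = card S + 1\<close> by simp
    qed
  qed (use S in auto)
  hence "S = ?C" using S(1) by blast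
  thus ?thesis using S(1) by simp
qed

lemma handshake:
  assumes "gr G E V" "v \<in> V" shows "(\<Sum>u\<in>cpt E v. dgr E u) = 2 * card (el E (cpt E v))"
proof -
  let ?C = "cpt E v"
  note fC = comp_finite[OF assms]
  have fE: "finite (el E ?C)" using assms(1) by (simp add: gr_def el_def)
  have "{e \<in> E. u \<in> ends e} = {e \<in> el E ?C. u \<in> ends e}" if "u \<in> ?C" for u
    using that comp_closed_edge[of _ E u v] assms(1) by (auto simp: el_def gr_def)
  hence "(\<Sum>u\<in>?C. dgr E u) = (\<Sum>u\<in>?C. card {e \<in> el E ?C. u \<in> ends e})" by (simp add: dgr_def)
  also have "... = 2 * card (el E ?C)"
  proof (rule sum_multicount[OF fC fE], rule ballI)
    fix e assume "e \<in> el E ?C"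
    hence "{u \<in> ?C. u \<in> ends e} = ends e" "card (ends e) = 2" using assms(1) by (auto simp: el_def gr_def)
    thus "card {u \<in> ?C. u \<in> ends e} = 2" by simp
  qed
  finally show ?thesis .
qed

text \<open>By \<open>handshake\<close> the sum is twice the number of nodes minus twice the number
  of edges, hence even, and \<open>comp_edges\<close> bounds it by 2. The value is 0 for a cycle and
  2 for a path.\<close>

lemma deficiency:
  assumes "gr G E V" "v \<in> V" "!!u. u \<in> cpt E v ==> dgr E u \<le> 2"
  shows "(\<Sum>u\<in>cpt E v. 2 - dgr E u) = 0 \<or> (\<Sum>u\<in>cpt E v. 2 - dgr E u) = 2"
proof -
  have "(\<Sum>u\<in>cpt E v. 2 - dgr E u) = (\<Sum>u\<in>cpt E v. 2) - (\<Sum>u\<in>cpt E v. dgr E u)" by (rule sum_subtractf_nat) (use assms(3) in auto)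
  thus ?thesis using handshake[OF assms(1,2)] comp_edges[OF assms(1,2)] by (simp, linarith)
qed

lemma deficiency_le:
  assumes "gr G E V" "v \<in> V" "!!u. u \<in> cpt E v ==> dgr E u \<le> 2" "S \<subseteq> cpt E v" shows "(\<Sum>u\<in>S. 2 - dgr E u) \<le> 2"
  using deficiency[OF assms(1-3)] sum_mono2[OF comp_finite[OF assms(1,2)] assms(4), of "\<lambda>u. 2 - dgr E u"] by fastforce

lemma card_ends:
  assumes "gr G E V" "v \<in> V" "!!u. u \<in> cpt E v ==> dgr E u \<le> 2" "!!u. u \<in> W ==> dgr E u \<le> 1"
  shows "card (cpt E v \<inter> W) \<le> 2"
proof -
  have "card (cpt E v \<inter> W) = (\<Sum>u\<in>cpt E v \<inter> W. 1)" by simp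
  also have "... \<le> (\<Sum>u\<in>cpt E v \<inter> W. 2 - dgr E u)" using assms(4) by (intro sum_mono) force
  also have "... \<le> 2" by (rule deficiency_le[OF assms(1-3)]) auto
  finally show ?thesis .
qed

lemma two_ends:
  assumes "gr G E V" "v \<in> V" "!!u. u \<in> cpt E v ==> dgr E u \<le> 2"
    and ab: "{a, b} \<subseteq> cpt E v" "a \<noteq> b" "dgr E a \<le> 1" "dgr E b \<le> 1"
  shows "dgr E a = 1" "u \<in> cpt E v ==> u \<noteq> a ==> u \<noteq> b ==> dgr E u = 2"
proof -
  have "(\<Sum>u\<in>{a, b}. 2 - dgr E u) \<le> 2" by (rule deficiency_le[OF assms(1-3) ab(1)])
  thus "dgr E a = 1" using ab by auto
  assume u: "u \<in> cpt E v" "u \<noteq> a" "u \<noteq> b"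
  have "(\<Sum>u\<in>{u, a, b}. 2 - dgr E u) \<le> 2" by (rule deficiency_le[OF assms(1-3)]) (use ab u in auto)
  hence "2 - dgr E u = 0" using ab u by auto
  thus "dgr E u = 2" using assms(3)[OF u(1)] by simp
qed

text \<open>The total deficiency is even and comes from \<open>v\<close> alone, so it is 2 and
  \<open>v\<close> is isolated.\<close>

lemma one_end:
  assumes "gr G E V" "v \<in> V" "dgr E v \<le> 1" "!!u. u \<in> cpt E v ==> u \<noteq> v ==> dgr E u = 2"
  shows "dgr E v = 0" "cpt E v = {v}"
proof -
  note fC = comp_finite[OF assms(1,2)]
  have "(\<Sum>u\<in>cpt E v. 2 - dgr E u) = 2 - dgr E v" using assms(4) by (subst sum.remove[OF fC comp_refl]) auto
  moreover have "dgr E u \<le> 2" if "u \<in> cpt E v" for u using assms(3,4) that by (cases "u = v") auto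
  ultimately show d: "dgr E v = 0" using deficiency[OF assms(1,2)] assms(3) by force
  hence "{e \<in> E. v \<in> ends e} = {}" using assms(1) by (simp add: dgr_def gr_def)
  hence "(v, w) \<notin> adj E" for w unfolding adj_def by blast
  hence "cpt E v \<subseteq> {v}" by (intro comp_least) auto
  thus "cpt E v = {v}" by auto
qed

lemma deg_out: "gr G F U ==> v \<notin> U ==> dgr F v = 0"
proof -
  assume "gr G F U" "v \<notin> U"
  hence "{e \<in> F. v \<in> ends e} = {}" unfolding gr_def by blast
  thus "dgr F v = 0" by (simp only: dgr_def card.empty)
qed

context comm_group
begin

definition glab :: "('t, 'v, 'a) edge set => 'v set => 'a" where "glab E C = finprod G lab (el E C)"

text \<open>Concatenation in abstract form: for two glued diagrams and \<open>W\<close> the outer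
  nodes, these are the edges of the product.\<close>

definition redE :: "('t, 'v, 'a) edge set => 'v set => 'v set => ('v set \<times> 'a) set" where
  "redE E V W = {(C \<inter> W, glab E C) | C. C \<in> comps E V \<and> card (C \<inter> W) = 2}"

lemma glab_closed: "gr G E V ==> glab E C \<in> carrier G" unfolding glab_def by (rule finprod_closed) (auto simp: el_def gr_def)

end

text \<open>
Replacing the subgraph \<open>E1\<close> by its reduction to the nodes \<open>O1\<close> does not change the reduction of \<open>E1 \<union> E2\<close>
to \<open>W\<close>. Reducing three glued diagrams in two ways thus gives associativity and the cocycle identity for the middle factors.
\<close>

locale staged = comm_group G for G (structure) +
  fixes E1 E2 :: "('t, 'v, 'a) edge set" and V1 V2 O1 W :: "'v set" and t :: 't
  assumes g1: "gr G E1 V1" and g2: "gr G E2 V2" and E12: "E1 \<inter> E2 = {}" and V12: "V1 \<inter> V2 \<subseteq> O1" "O1 \<subseteq> V1"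
    and W: "W \<inter> V1 \<subseteq> O1" "W \<subseteq> V1 \<union> V2"
    and d1: "dgr E1 v \<le> 2" "v \<in> O1 ==> dgr E1 v \<le> 1" and d2: "dgr E2 v \<le> 1" and dW: "v \<in> W ==> dgr (E1 \<union> E2) v \<le> 1"
    and t: "t \<notin> fst ` E2"
begin

definition R :: "('t, 'v, 'a) edge set" where "R = Pair t ` redE E1 V1 O1"

abbreviation "E \<equiv> E1 \<union> E2"
abbreviation "E' \<equiv> R \<union> E2"
abbreviation "V' \<equiv> O1 \<union> V2"

lemma R_iff: "r \<in> R \<longleftrightarrow> (\<exists>v\<in>V1. card (cpt E1 v \<inter> O1) = 2 \<and> r = (t, cpt E1 v \<inter> O1, glab E1 (cpt E1 v)))"
  by (auto simp: R_def redE_def comps_eq)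

lemma fin: "finite E1" "finite E2" "finite V1" "finite V2" "finite O1" using g1 g2 V12(2) finite_subset by (auto simp: gr_def)

lemma gE: "gr G E (V1 \<union> V2)" using g1 g2 by (auto simp: gr_def)

lemma gE': "gr G E' V'"
proof -
  have "finite (redE E1 V1 O1)"
    by (rule finite_subset[of _ "(\<lambda>v. (cpt E1 v \<inter> O1, glab E1 (cpt E1 v))) ` V1"]) (use fin in \<open>auto simp: redE_def comps_eq\<close>)
  hence "finite R" by (simp add: R_def)
  thus ?thesis using g2 fin glab_closed[OF g1] unfolding gr_def by (auto simp: R_iff)
qed

lemma deg_E: "dgr E v = dgr E1 v + dgr E2 v"
proof -
  have "{e \<in> E. v \<in> ends e} = {e \<in> E1. v \<in> ends e} \<union> {e \<in> E2. v \<in> ends e}" by auto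
  thus ?thesis unfolding dgr_def using E12 fin by (simp add: card_Un_disjoint disjoint_iff)
qed

lemmas deg_E1_0 = deg_out[OF g1] and deg_E2_0 = deg_out[OF g2]

lemma deg_E_le: "dgr E v \<le> 2" using d1(1)[of v] d1(2)[of v] d2[of v] deg_E1_0[of v] deg_E2_0[of v] V12 unfolding deg_E by force

lemma card_K: "v \<in> V1 ==> card (cpt E1 v \<inter> O1) \<le> 2" by (rule card_ends[OF g1 _ d1(1) d1(2)])

lemma R_edge:
  assumes "a \<in> O1" "b \<in> O1" "b \<in> cpt E1 a" "a \<noteq> b" shows "cpt E1 a \<inter> O1 = {a, b}" "(t, {a, b}, glab E1 (cpt E1 a)) \<in> R"
proof -
  have a: "a \<in> V1" using assms V12 by auto
  have "finite (cpt E1 a \<inter> O1)" using fin by simp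
  moreover have "{a, b} \<subseteq> cpt E1 a \<inter> O1" using assms by auto
  moreover have "card {a, b} = 2" using assms by simp
  ultimately show e: "cpt E1 a \<inter> O1 = {a, b}" using card_K[OF a] card_seteq by metis
  show "(t, {a, b}, glab E1 (cpt E1 a)) \<in> R" unfolding R_iff using a e assms(4) by (intro bexI[of _ a]) auto
qed

lemma comp_R: "a \<in> O1 ==> b \<in> O1 ==> b \<in> cpt E1 a ==> b \<in> cpt E' a"
  using R_edge(2)[of a b] comp_step[OF comp_refl, of a b E'] by (cases "a = b") (force simp: adj_def)+

lemma comp_E'_sub: "cpt E' u \<subseteq> cpt E u"
proof (rule comp_least)
  fix a b assume a: "a \<in> cpt E u" and ab: "(a, b) \<in> adj E'"
  then consider "(a, b) \<in> adj E2" | r where "r \<in> R" "{a, b} = ends r" by (auto simp: adj_def)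
  thus "b \<in> cpt E u"
  proof cases
    case 1
    hence "(a, b) \<in> adj E" by (auto simp: adj_def)
    thus ?thesis using comp_step[OF a] by blast
  next
    case 2
    then obtain v where "{a, b} = cpt E1 v \<inter> O1" by (auto simp: R_iff)
    hence "a \<in> cpt E1 v" "b \<in> cpt E1 v" by auto
    hence "b \<in> cpt E1 a" using comp_eq[of a E1 v] by simp
    thus ?thesis using comp_mono[of E1 E a] comp_trans[OF a, of b] by auto
  qed
qed simp

text \<open>A path in \<open>E\<close> leaves \<open>V1\<close> only through \<open>O1\<close>. For
  a node of \<open>V1\<close> the conclusion therefore records a node \<open>s\<close> of
  \<open>O1\<close> in the same component of \<open>E1\<close> that is already reached in the
  reduced graph.\<close>

lemma comp_E'_sup:
  assumes u: "u \<in> V'" and v: "v \<in> cpt E u"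
  shows "(v \<in> V1 \<longrightarrow> (\<exists>s\<in>O1. v \<in> cpt E1 s \<and> s \<in> cpt E' u)) \<and> (v \<in> V2 \<longrightarrow> v \<in> cpt E' u)"
proof -
  let ?S = "{v. (v \<in> V1 \<longrightarrow> (\<exists>s\<in>O1. v \<in> cpt E1 s \<and> s \<in> cpt E' u)) \<and> (v \<in> V2 \<longrightarrow> v \<in> cpt E' u)}"
  have "cpt E u \<subseteq> ?S"
  proof (rule comp_least)
    show "u \<in> ?S" using u V12 comp_refl[of u E1] comp_refl[of u E'] by blast
  next
    fix a b assume a: "a \<in> ?S" and ab: "(a, b) \<in> adj E"
    then consider (1) "(a, b) \<in> adj E1" | (2) "(a, b) \<in> adj E2" by (auto simp: adj_def)
    thus "b \<in> ?S"
    proof cases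
      case 1
      hence "a \<in> V1" "b \<in> V1" using g1 by (auto simp: gr_def adj_def)
      then obtain s where s: "s \<in> O1" "a \<in> cpt E1 s" "s \<in> cpt E' u" using a by auto
      have "b \<in> cpt E1 s" using comp_step[OF s(2) 1] .
      moreover have "b \<in> cpt E' u" if "b \<in> O1" using comp_R[OF s(1) that \<open>b \<in> cpt E1 s\<close>] comp_trans[OF s(3), of b] by simp
      ultimately show ?thesis using s V12 \<open>b \<in> V1\<close> by blast
    next
      case 2
      hence ab': "a \<in> V2" "b \<in> V2" using g2 by (auto simp: gr_def adj_def)
      have "(a, b) \<in> adj E'" using 2 by (auto simp: adj_def)
      hence "b \<in> cpt E' u" using a ab' comp_step[of a E' u b] by simp
      thus ?thesis using ab' V12 comp_refl[of b E1] by blast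
    qed
  qed
  thus ?thesis using v by blast
qed

lemma comp_E': "u \<in> V' ==> cpt E' u = cpt E u \<inter> V'"
proof
  assume u: "u \<in> V'"
  show "cpt E' u \<subseteq> cpt E u \<inter> V'" using comp_E'_sub comp_sub[OF gE' u] by blast
  show "cpt E u \<inter> V' \<subseteq> cpt E' u"
  proof
    fix v assume v: "v \<in> cpt E u \<inter> V'"
    show "v \<in> cpt E' u"
    proof (cases "v \<in> O1")
      case True
      then obtain s where "s \<in> O1" "v \<in> cpt E1 s" "s \<in> cpt E' u" using comp_E'_sup[OF u, of v] v V12 by auto
      thus ?thesis using comp_R[of s v] True comp_trans[of s E' u v] by simp
    qed (use comp_E'_sup[OF u, of v] v in auto)
  qed
qed

lemma comp_inner:
  assumes "v \<in> V1" "cpt E1 v \<inter> O1 = {}" shows "cpt E v = cpt E1 v"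
proof
  show "cpt E v \<subseteq> cpt E1 v"
  proof (rule comp_least)
    fix a b assume a: "a \<in> cpt E1 v" and ab: "(a, b) \<in> adj E"
    have "a \<in> V1" "a \<notin> O1" using comp_sub[OF g1 assms(1)] a assms(2) by auto
    hence "a \<notin> V2" using V12 by auto
    hence "(a, b) \<notin> adj E2" using g2 by (auto simp: gr_def adj_def)
    hence "(a, b) \<in> adj E1" using ab by (auto simp: adj_def)
    thus "b \<in> cpt E1 v" using comp_step[OF a] by blast
  qed simp
qed (rule comp_mono, simp)

text \<open>Components that avoid \<open>O1\<close> are settled when \<open>E1\<close> is reduced;
  all the others leave a trace in the reduced graph.\<close>

definition "inner = {C \<in> comps E1 V1. C \<inter> O1 = {}}"
definition "outer = cpt E ` V'"

lemma comps_E: "comps E (V1 \<union> V2) = inner \<union> outer"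
proof -
  have "cpt E v \<in> inner \<union> outer" if v: "v \<in> V1 \<union> V2" for v
  proof (cases "v \<in> V1 \<and> cpt E1 v \<inter> O1 = {}")
    case True
    thus ?thesis using comp_inner by (auto simp: inner_def comps_eq)
  next
    case nin: False
    show ?thesis
    proof (cases "v \<in> V2")
      case True
      thus ?thesis by (auto simp: outer_def)
    next
      case False
      then obtain s where "s \<in> cpt E1 v" "s \<in> O1" using v nin by auto
      hence "cpt E v = cpt E s" using comp_mono[of E1 E v] comp_eq[of s E v] by auto
      thus ?thesis using \<open>s \<in> O1\<close> by (auto simp: outer_def)
    qed
  qed
  moreover have "C \<in> cpt E ` (V1 \<union> V2)" if "C \<in> inner" for C using that comp_inner by (auto simp: inner_def comps_eq)
  ultimately show ?thesis using V12 by (auto simp: comps_eq outer_def)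
qed

lemma inner_V': "C \<in> inner ==> C \<inter> V' = {}" using V12 comp_sub[OF g1] by (fastforce simp: inner_def comps_eq)

lemma comps_E': "comps E' V' = (\<lambda>C. C \<inter> V') ` outer" by (auto simp: comps_eq outer_def comp_E')

lemma inj_outer: "inj_on (\<lambda>C. C \<inter> V') outer" unfolding outer_def
proof (rule inj_onI, clarify)
  fix u v assume "u \<in> V'" "cpt E u \<inter> V' = cpt E v \<inter> V'"
  hence "u \<in> cpt E v" using comp_refl[of u E] by blast
  thus "cpt E u = cpt E v" by (rule comp_eq)
qed

lemma W_V': "W \<subseteq> V'" using W by auto

text \<open>No path ends inside \<open>C\<close> away from \<open>W\<close>. The labels along a
  dangling end would be discarded by the reduction, and then the label of \<open>C\<close> would not
  be preserved.\<close>

definition "good C \<longleftrightarrow> (\<forall>v\<in>C - W. dgr E v = 2)"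

lemma card2_good:
  assumes C: "C \<in> comps E (V1 \<union> V2)" "card (C \<inter> W) = 2" shows "good C"
proof -
  obtain v where v: "v \<in> V1 \<union> V2" "C = cpt E v" using C by (auto simp: comps_eq)
  obtain a b where ab: "C \<inter> W = {a, b}" "a \<noteq> b" using C(2) by (auto simp: card_2_iff)
  hence "{a, b} \<subseteq> cpt E v" "dgr E a \<le> 1" "dgr E b \<le> 1" using v dW by auto
  from two_ends(2)[OF gE v(1) deg_E_le this(1) ab(2) this(2,3)]
  show ?thesis unfolding good_def v(2) using ab v by blast
qed

text \<open>Off \<open>O1\<close> the component has degree 2 in \<open>E1\<close>. By the deficiency
  count it is then either one isolated node of \<open>O1\<close> or a path between two nodes of
  \<open>O1\<close>.\<close>

lemma good_K:
  assumes C: "C \<in> outer" "good C" and v: "v \<in> C" "v \<in> V1"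
  obtains a where "cpt E1 v = {a}" "a \<in> O1" "dgr E1 a = 0" | "card (cpt E1 v \<inter> O1) = 2"
proof -
  obtain u where u: "u \<in> V'" "C = cpt E u" using C by (auto simp: outer_def)
  have sub: "cpt E1 v \<subseteq> C" using comp_mono[of E1 E v] comp_eq[of v E u] v u by auto
  obtain s where s: "s \<in> O1" "v \<in> cpt E1 s" using comp_E'_sup[OF u(1)] u(2) v by blast
  have sv: "cpt E1 s = cpt E1 v" using comp_eq[OF s(2)] by simp
  have sV: "s \<in> V1" using s V12 by auto
  have deg2: "dgr E1 x = 2" if "x \<in> cpt E1 v" "x \<notin> O1" for x
  proof -
    have "x \<in> V1" using that comp_sub[OF g1 v(2)] by auto
    hence "x \<notin> V2" "x \<notin> W" using that V12 W by auto
    thus ?thesis using C(2) that sub deg_E2_0 unfolding good_def deg_E by force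
  qed
  show ?thesis
  proof (cases "cpt E1 v \<inter> O1 = {s}")
    case True
    have "dgr E1 s = 0" "cpt E1 s = {s}" using one_end[OF g1 sV d1(2)[OF s(1)]] deg2 True unfolding sv by blast+
    thus ?thesis using that(1) s sv by metis
  next
    case False
    have "s \<in> cpt E1 v \<inter> O1" using s comp_sym[OF s(2)] by simp
    then obtain b where "b \<in> cpt E1 v \<inter> O1" "b \<noteq> s" using False by blast
    hence "cpt E1 s \<inter> O1 = {s, b}" using R_edge(1)[OF s(1), of b] sv by auto
    thus ?thesis using that(2) sv \<open>b \<noteq> s\<close> by auto
  qed
qed

lemma R_inj: "inj_on (\<lambda>K. (t, K \<inter> O1, glab E1 K)) {K \<in> comps E1 V1. card (K \<inter> O1) = 2}"
proof (rule inj_onI)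
  fix K L assume *: "K \<in> {K \<in> comps E1 V1. card (K \<inter> O1) = 2}" "L \<in> {K \<in> comps E1 V1. card (K \<inter> O1) = 2}"
    "(t, K \<inter> O1, glab E1 K) = (t, L \<inter> O1, glab E1 L)"
  hence "K \<inter> O1 \<noteq> {}" "K \<inter> O1 = L \<inter> O1" by auto
  then obtain x where "x \<in> K" "x \<in> L" by blast
  thus "K = L" using * comps_disj[of K E1 V1 L x] by simp
qed

text \<open>The edges of \<open>E1\<close> in \<open>C\<close> are sorted by the components of
  \<open>E1\<close>. Those with two ends in \<open>O1\<close> become edges of \<open>R\<close> that
  carry the product of their labels; the remaining ones are isolated nodes without edges.\<close>

lemma glab_good:
  assumes C: "C \<in> outer" "good C" shows "glab E C = glab E' (C \<inter> V')"
proof -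
  obtain u where u: "u \<in> V'" "C = cpt E u" using C by (auto simp: outer_def)
  have lc: "lab \<in> A \<rightarrow> carrier G" if "A \<subseteq> E1 \<or> A \<subseteq> E2 \<or> A \<subseteq> R" for A using that gE gE' by (auto simp: gr_def)
  have "el E C = el E1 C \<union> el E2 C" "el E1 C \<inter> el E2 C = {}" using E12 by (auto simp: el_def)
  hence 1: "glab E C = finprod G lab (el E1 C) \<otimes> finprod G lab (el E2 C)"
    unfolding glab_def using fin lc by (auto simp: finprod_Un_disjoint finite_el el_def)
  have RE2: "R \<inter> E2 = {}" using t by (force simp: R_def)
  have fR: "finite R" using gE' by (simp add: gr_def)
  have "el E' (C \<inter> V') = el R (C \<inter> V') \<union> el E2 C" "el R (C \<inter> V') \<inter> el E2 C = {}" using RE2 g2 by (auto simp: el_def gr_def)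
  hence 2: "glab E' (C \<inter> V') = finprod G lab (el R (C \<inter> V')) \<otimes> finprod G lab (el E2 C)"
    unfolding glab_def using fin fR lc by (auto simp: finprod_Un_disjoint finite_el el_def)
  let ?KK = "{K \<in> comps E1 V1. K \<subseteq> C}"
  let ?K2 = "{K \<in> comps E1 V1. K \<subseteq> C \<and> card (K \<inter> O1) = 2}"
  have fK: "finite (comps E1 V1)" using fin by (simp add: comps_eq)
  have subC: "cpt E1 v \<subseteq> C" if "v \<in> C" for v using that comp_mono[of E1 E v] comp_eq[of v E u] u by auto
  have U: "el E1 C = (\<Union>K\<in>?KK. el E1 K)"
  proof
    show "el E1 C \<subseteq> (\<Union>K\<in>?KK. el E1 K)"
    proof
      fix e assume e: "e \<in> el E1 C"
      hence ee: "e \<in> E1" "ends e \<subseteq> C" "ends e \<subseteq> V1" "card (ends e) = 2" using g1 by (auto simp: el_def gr_def)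
      then obtain v where v: "v \<in> ends e" by fastforce
      have "ends e \<subseteq> cpt E1 v" using comp_closed_edge[OF ee(1,4) v comp_refl] .
      thus "e \<in> (\<Union>K\<in>?KK. el E1 K)" using ee v subC[of v] by (intro UN_I[of "cpt E1 v"]) (auto simp: comps_eq el_def)
    qed
  qed (auto simp: el_def)
  have dj: "el E1 K \<inter> el E1 L = {}" if KL: "K \<in> comps E1 V1" "L \<in> comps E1 V1" "K \<noteq> L" for K L
  proof -
    have "K \<inter> L = {}" using KL comps_disj[of K E1 V1 L] by auto
    hence "ends e = {}" if "e \<in> el E1 K \<inter> el E1 L" for e using that by (auto simp: el_def)
    thus ?thesis using g1 by (fastforce simp: el_def gr_def)
  qed
  have "finprod G lab (el E1 C) = finprod G (\<lambda>K. glab E1 K) ?KK" unfolding U glab_def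
  proof (rule finprod_UN_disjoint)
    show "lab e \<in> carrier G" if "K \<in> ?KK" "e \<in> el E1 K" for K e using that g1 by (auto simp: el_def gr_def)
  qed (use fK fin dj in \<open>auto simp: pairwise_def disjnt_def finite_el\<close>)
  also have "... = finprod G (\<lambda>K. glab E1 K) ?K2"
  proof (rule finprod_mono_neutral_cong_right)
    fix K assume K: "K \<in> ?KK - ?K2"
    then obtain v where v: "v \<in> V1" "K = cpt E1 v" "K \<subseteq> C" "card (K \<inter> O1) \<noteq> 2" by (auto simp: comps_eq)
    hence "v \<in> C" using comp_refl[of v E1] by auto
    from good_K[OF C this v(1)] v(2,4) obtain a where a: "K = {a}" by metis
    have "el E1 K = {}"
    proof -
      have False if "e \<in> el E1 K" for e
      proof -
        have "ends e \<subseteq> {a}" "card (ends e) = 2" using that g1 a by (auto simp: el_def gr_def)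
        thus False using card_mono[of "{a}" "ends e"] by simp
      qed
      thus ?thesis by blast
    qed
    thus "glab E1 K = \<one>" by (simp add: glab_def)
  qed (use fK glab_closed[OF g1] in auto)
  also have "... = finprod G lab (el R (C \<inter> V'))"
  proof -
    let ?h = "\<lambda>K. (t, K \<inter> O1, glab E1 K)"
    have inj: "inj_on ?h ?K2" by (rule inj_on_subset[OF R_inj]) auto
    have "el R (C \<inter> V') = ?h ` ?K2"
    proof
      show "el R (C \<inter> V') \<subseteq> ?h ` ?K2"
      proof
        fix r assume r: "r \<in> el R (C \<inter> V')"
        then obtain v where v: "v \<in> V1" "card (cpt E1 v \<inter> O1) = 2" "r = ?h (cpt E1 v)" "cpt E1 v \<inter> O1 \<subseteq> C" by (auto simp: el_def R_iff)
        then obtain x where "x \<in> cpt E1 v" "x \<in> C" by (auto simp: card_2_iff)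
        hence "cpt E1 v \<subseteq> C" using subC comp_eq by metis
        thus "r \<in> ?h ` ?K2" using v by (auto simp: comps_eq)
      qed
      show "?h ` ?K2 \<subseteq> el R (C \<inter> V')" by (auto simp: el_def R_iff comps_eq)
    qed
    hence "finprod G lab (el R (C \<inter> V')) = finprod G (\<lambda>K. lab (?h K)) ?K2"
      using finprod_reindex[OF _ inj, of lab] glab_closed[OF g1] by (auto simp: Pi_def)
    thus ?thesis by simp
  qed
  finally show ?thesis unfolding 1 2 by simp
qed

lemma redE_staged: "redE E (V1 \<union> V2) W = redE E' V' W"
proof -
  have e: "C \<inter> V' \<inter> W = C \<inter> W" for C using W_V' by auto
  have "C \<inter> W = {}" if "C \<in> inner" for C using inner_V'[OF that] W_V' by auto
  hence *: "{C \<in> comps E (V1 \<union> V2). card (C \<inter> W) = 2} = {C \<in> outer. card (C \<inter> W) = 2}" unfolding comps_E by auto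
  have "redE E (V1 \<union> V2) W = (\<lambda>C. (C \<inter> W, glab E C)) ` {C \<in> outer. card (C \<inter> W) = 2}" unfolding redE_def *[symmetric] by auto
  also have "... = (\<lambda>C. (C \<inter> W, glab E' (C \<inter> V'))) ` {C \<in> outer. card (C \<inter> W) = 2}"
    by (rule image_cong) (use card2_good glab_good in \<open>auto simp: comps_E\<close>)
  also have "... = redE E' V' W"
  proof -
    have "redE E' V' W = (\<lambda>C. (C \<inter> W, glab E' C)) ` {C \<in> comps E' V'. card (C \<inter> W) = 2}" unfolding redE_def by auto
    also have "{C \<in> comps E' V'. card (C \<inter> W) = 2} = (\<lambda>C. C \<inter> V') ` {C \<in> outer. card (C \<inter> W) = 2}"
      unfolding comps_E' by (simp only: e Compr_image_eq)
    finally show ?thesis by (simp only: image_image e)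
  qed
  finally show ?thesis .
qed

lemma deg_R: "v \<in> O1 ==> dgr R v = (if card (cpt E1 v \<inter> O1) = 2 then 1 else 0)" "v \<notin> O1 ==> dgr R v = 0"
proof -
  have *: "{e \<in> R. v \<in> ends e} = (if v \<in> O1 \<and> card (cpt E1 v \<inter> O1) = 2 then {(t, cpt E1 v \<inter> O1, glab E1 (cpt E1 v))} else {})" for v
  proof -
    have "e = (t, cpt E1 v \<inter> O1, glab E1 (cpt E1 v)) \<and> v \<in> O1 \<and> card (cpt E1 v \<inter> O1) = 2" if ee: "e \<in> R" "v \<in> ends e" for e

    proof -
      obtain w where w: "w \<in> V1" "card (cpt E1 w \<inter> O1) = 2" "e = (t, cpt E1 w \<inter> O1, glab E1 (cpt E1 w))" using ee(1) unfolding R_iff by blast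
      hence "v \<in> cpt E1 w" "v \<in> O1" using ee(2) by auto
      thus ?thesis using w comp_eq[of v E1 w] by simp
    qed
    note 1 = this
    have 2: "(t, cpt E1 v \<inter> O1, glab E1 (cpt E1 v)) \<in> R" if "v \<in> O1" "card (cpt E1 v \<inter> O1) = 2" using that V12 by (auto simp: R_iff)
    show ?thesis
    proof (cases "v \<in> O1 \<and> card (cpt E1 v \<inter> O1) = 2")
      case True
      have "{e \<in> R. v \<in> ends e} = {(t, cpt E1 v \<inter> O1, glab E1 (cpt E1 v))}"
      proof (intro equalityI subsetI)
        fix e assume "e \<in> {(t, cpt E1 v \<inter> O1, glab E1 (cpt E1 v))}"
        thus "e \<in> {e \<in> R. v \<in> ends e}" using 2 True by simp
      qed (use 1 in simp)
      thus ?thesis using True by (simp only: if_True simp_thms)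
    next
      case False
      hence "{e \<in> R. v \<in> ends e} = {}" using 1 by blast
      thus ?thesis using False by (simp only: if_False)
    qed
  qed
  show "v \<in> O1 ==> dgr R v = (if card (cpt E1 v \<inter> O1) = 2 then 1 else 0)" "v \<notin> O1 ==> dgr R v = 0"
    unfolding dgr_def * by auto
qed

lemma deg_E': "dgr E' v = dgr R v + dgr E2 v"
proof -
  have "R \<inter> E2 = {}" "finite R" using t gE' by (force simp: R_def, simp add: gr_def)
  moreover have "{e \<in> E'. v \<in> ends e} = {e \<in> R. v \<in> ends e} \<union> {e \<in> E2. v \<in> ends e}" by auto
  ultimately show ?thesis unfolding dgr_def using fin by (simp add: card_Un_disjoint disjoint_iff)
qed

lemma K2_deg:
  assumes "v \<in> V1" "card (cpt E1 v \<inter> O1) = 2" "x \<in> cpt E1 v" shows "dgr E1 x = (if x \<in> O1 then 1 else 2)"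
proof -
  obtain a b where ab: "cpt E1 v \<inter> O1 = {a, b}" "a \<noteq> b" using assms(2) by (auto simp: card_2_iff)
  hence *: "{a, b} \<subseteq> cpt E1 v" "dgr E1 a \<le> 1" "dgr E1 b \<le> 1" using d1 by auto
  note 1 = two_ends[OF g1 assms(1) d1(1) *(1) ab(2) *(2,3)]
  have "{b, a} \<subseteq> cpt E1 v" using * by auto
  note 2 = two_ends[OF g1 assms(1) d1(1) this ab(2)[symmetric] *(3,2)]
  show ?thesis
  proof (cases "x \<in> O1")
    case True
    hence "x = a \<or> x = b" using ab(1) assms(3) by blast
    thus ?thesis using 1(1) 2(1) True by auto
  next
    case False
    hence "x \<noteq> a" "x \<noteq> b" using ab(1) by auto
    thus ?thesis using 1(2)[OF assms(3)] False by simp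
  qed
qed

text \<open>A loop is recognised by all degrees being 2. Replacing a path by an edge preserves the
  degrees of its ends and removes its inner nodes, which have degree 2.\<close>

lemma loop_staged:
  assumes C: "C \<in> outer" "C \<inter> W = {}" shows "loopE E C \<longleftrightarrow> loopE E' (C \<inter> V')"
proof
  assume l: "loopE E C"
  hence g: "good C" by (auto simp: good_def loopE_def)
  have "dgr R v = dgr E1 v" if v: "v \<in> C" "v \<in> V'" for v
  proof (cases "v \<in> O1")
    case True
    hence vV: "v \<in> V1" using V12 by auto
    show ?thesis
    proof (cases rule: good_K[OF C(1) g v(1) vV])
      case (1 a)
      thus ?thesis using deg_R(1)[OF True] comp_refl[of v E1] True by auto
    next
      case 2
      thus ?thesis using deg_R(1)[OF True] K2_deg[OF vV 2 comp_refl] True by simp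
    qed
  next
    case False
    thus ?thesis using deg_R(2) deg_E1_0[of v] v V12 by auto
  qed
  thus "loopE E' (C \<inter> V')" using l unfolding loopE_def deg_E deg_E' by auto
next
  assume l: "loopE E' (C \<inter> V')"
  obtain u where u: "u \<in> V'" "C = cpt E u" using C by (auto simp: outer_def)
  have K2: "card (cpt E1 s \<inter> O1) = 2" "dgr E2 s = 1" if s: "s \<in> O1" "s \<in> C" for s
  proof -
    have "dgr R s + dgr E2 s = 2" using l s unfolding loopE_def deg_E' by auto
    moreover have "dgr R s \<le> 1" unfolding deg_R(1)[OF s(1)] by simp
    ultimately have "dgr R s = 1" "dgr E2 s = 1" using d2[of s] by linarith+
    moreover have "dgr R s \<noteq> 1" if "card (cpt E1 s \<inter> O1) \<noteq> 2" unfolding deg_R(1)[OF s(1)] using that by simp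
    ultimately show "card (cpt E1 s \<inter> O1) = 2" "dgr E2 s = 1" by blast+
  qed
  have "dgr E v = 2" if v: "v \<in> C" for v
  proof (cases "v \<in> V1")
    case True
    obtain s where s: "s \<in> O1" "v \<in> cpt E1 s" using comp_E'_sup[OF u(1)] u(2) v True by blast
    have sC: "s \<in> C" using comp_mono[of E1 E v] comp_sym[OF s(2)] v u comp_trans[of v E u s] by auto
    have "dgr E1 v = (if v \<in> O1 then 1 else 2)" by (rule K2_deg[OF _ K2(1)[OF s(1) sC] s(2)]) (use s V12 in auto)
    moreover have "dgr E2 v = (if v \<in> O1 then 1 else 0)" using K2(2)[of v] v deg_E2_0[of v] True V12 by auto
    ultimately show ?thesis unfolding deg_E by simp
  next
    case False
    have "v \<in> V1 \<union> V2" using comp_sub[OF gE, of u] u v V12 by blast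
    hence "v \<in> V'" "v \<notin> O1" using False V12 by auto
    hence "dgr R v + dgr E2 v = 2" using l v unfolding loopE_def deg_E' by auto
    thus ?thesis using deg_R(2)[OF \<open>v \<notin> O1\<close>] d2[of v] by simp
  qed
  thus "loopE E C" by (simp add: loopE_def)
qed

lemma loop_inner: "C \<in> inner ==> loopE E C \<longleftrightarrow> loopE E1 C" "C \<in> inner ==> glab E C = glab E1 C"
proof -
  assume C: "C \<in> inner"
  have n: "v \<notin> V2" if "v \<in> C" for v using inner_V'[OF C] that by auto
  thus "loopE E C \<longleftrightarrow> loopE E1 C" unfolding loopE_def deg_E using deg_E2_0 by auto
  have "el E2 C = {}"
  proof -
    have False if "e \<in> el E2 C" for e
    proof -
      have "ends e \<noteq> {}" "ends e \<subseteq> V2" "ends e \<subseteq> C" using that g2 by (auto simp: el_def gr_def)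
      thus False using n by blast
    qed
    thus ?thesis by blast
  qed
  moreover have "el E C = el E1 C \<union> el E2 C" by (auto simp: el_def)
  ultimately have "el E C = el E1 C" by simp
  thus "glab E C = glab E1 C" by (simp add: glab_def)
qed

end

definition (in comm_group) fac :: "('k, 'y) ring_scheme => ('a => 'k => 'k) => 'k => 'k => ('t, 'v, 'a) edge set => 'v set => 'v set => 'k" where
  "fac k act \<delta> \<epsilon> E V W = (\<Otimes>\<^bsub>k\<^esub>C\<in>{C \<in> comps E V. C \<inter> W = {}}. if loopE E C then act (glab E C) \<delta> else \<epsilon>)"

context staged
begin

text \<open>A component without nodes in \<open>W\<close> is either inner, and counted when
  \<open>E1\<close> is reduced, or outer, and counted in the reduced graph; the loops among them
  keep their labels.\<close>

lemma fac_staged: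
  assumes "cring k" and act: "!!g. g \<in> carrier G ==> act g \<delta> \<in> carrier k" and ep: "\<epsilon> \<in> carrier k"
  shows "fac k act \<delta> \<epsilon> E (V1 \<union> V2) W = fac k act \<delta> \<epsilon> E1 V1 O1 \<otimes>\<^bsub>k\<^esub> fac k act \<delta> \<epsilon> E' V' W"
proof -
  interpret k: cring k by fact
  let ?f = "\<lambda>E C. if loopE E C then act (glab E C) \<delta> else \<epsilon>"
  let ?O = "{C \<in> outer. C \<inter> W = {}}"
  have fE: "?f E C \<in> carrier k" for C using act[OF glab_closed[OF gE]] ep by simp
  have fE1: "?f E1 C \<in> carrier k" for C using act[OF glab_closed[OF g1]] ep by simp
  have fE': "?f E' C \<in> carrier k" for C using act[OF glab_closed[OF gE']] ep by simp
  have iW: "C \<inter> W = {}" if "C \<in> inner" for C using inner_V'[OF that] W_V' by auto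
  have s: "{C \<in> comps E (V1 \<union> V2). C \<inter> W = {}} = inner \<union> ?O" unfolding comps_E using iW by auto
  have dj: "inner \<inter> ?O = {}"
  proof -
    have "C \<inter> V' \<noteq> {}" if "C \<in> outer" for C using that unfolding outer_def using comp_refl[of _ E] by blast
    thus ?thesis using inner_V' by blast
  qed
  have fO: "finite ?O" "finite inner" using fin by (auto simp: outer_def inner_def comps_eq)
  have "fac k act \<delta> \<epsilon> E (V1 \<union> V2) W = finprod k (?f E) inner \<otimes>\<^bsub>k\<^esub> finprod k (?f E) ?O"
    unfolding fac_def s by (rule k.finprod_Un_disjoint) (use fO dj fE in auto)
  also have "finprod k (?f E) inner = fac k act \<delta> \<epsilon> E1 V1 O1" unfolding fac_def inner_def[symmetric]
    by (rule k.finprod_cong') (use loop_inner fE1 in auto)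
  also have "finprod k (?f E) ?O = finprod k (\<lambda>C. ?f E' (C \<inter> V')) ?O"
  proof (rule k.finprod_cong')
    fix C assume C: "C \<in> ?O"
    hence l: "loopE E C \<longleftrightarrow> loopE E' (C \<inter> V')" using loop_staged by blast
    have "glab E C = glab E' (C \<inter> V')" if "loopE E C" using that C by (intro glab_good) (auto simp: good_def loopE_def)
    thus "?f E C = ?f E' (C \<inter> V')" using l by auto
  qed (use fE' in auto)
  also have "... = finprod k (?f E') ((\<lambda>C. C \<inter> V') ` ?O)" by (rule k.finprod_reindex[symmetric]) (use fE' inj_on_subset[OF inj_outer] in auto)
  also have "(\<lambda>C. C \<inter> V') ` ?O = {C \<in> comps E' V'. C \<inter> W = {}}"
  proof -
    have e: "C \<inter> V' \<inter> W = C \<inter> W" for C using W_V' by auto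
    show ?thesis unfolding comps_E' by (simp only: e Compr_image_eq)
  qed
  finally show ?thesis by (simp add: fac_def)
qed

end

section \<open>Transport of graphs along injections\<close>

definition mp :: "('t => 's) => ('v => 'w) => ('t, 'v, 'g) edge set => ('s, 'w, 'g) edge set" where
  "mp \<tau> f E = (\<lambda>e. (\<tau> (fst e), f ` ends e, lab e)) ` E"

context
  fixes f :: "'v => 'w" and \<tau> :: "'t => 's" and E :: "('t, 'v, 'g) edge set"
  assumes f: "inj f" and \<tau>: "inj_on \<tau> (fst ` E)"
begin

lemma mp_inj: "inj_on (\<lambda>e. (\<tau> (fst e), f ` ends e, lab e)) E"
proof (rule inj_onI)
  fix e e' assume e: "e \<in> E" "e' \<in> E" "(\<tau> (fst e), f ` ends e, lab e) = (\<tau> (fst e'), f ` ends e', lab e')"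
  hence "fst e = fst e'" using inj_onD[OF \<tau>, of "fst e" "fst e'"] by simp
  thus "e = e'" using e(3) inj_image_eq_iff[OF f] by (simp add: prod_eq_iff)
qed

lemma adj_mp: "adj (mp \<tau> f E) = map_prod f f ` adj E"
proof
  show "adj (mp \<tau> f E) \<subseteq> map_prod f f ` adj E"
  proof clarify
    fix a b assume "(a, b) \<in> adj (mp \<tau> f E)"
    then obtain e where e: "e \<in> E" "{a, b} = f ` ends e" by (auto simp: adj_def mp_def)
    then obtain u v where uv: "a = f u" "b = f v" by (metis image_iff insertCI)
    hence "f ` {u, v} = f ` ends e" using e by simp
    hence "{u, v} = ends e" unfolding inj_image_eq_iff[OF f] .
    thus "(a, b) \<in> map_prod f f ` adj E" using e uv by (auto simp: adj_def)
  qed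
  show "map_prod f f ` adj E \<subseteq> adj (mp \<tau> f E)"
  proof (rule image_subsetI)
    fix p assume "p \<in> adj E"
    then obtain u v e where e: "p = (u, v)" "e \<in> E" "{u, v} = ends e" by (auto simp: adj_def)
    hence "{f u, f v} = f ` ends e" by (metis image_empty image_insert)
    thus "map_prod f f p \<in> adj (mp \<tau> f E)" using e by (auto simp: adj_def mp_def)
  qed
qed

lemma cpt_mp: "cpt (mp \<tau> f E) (f v) = f ` cpt E v"
proof
  show "cpt (mp \<tau> f E) (f v) \<subseteq> f ` cpt E v"
  proof (rule comp_least)
    fix a b assume "a \<in> f ` cpt E v" "(a, b) \<in> adj (mp \<tau> f E)"
    then obtain u w where "b = f w" "f u = a" "(u, w) \<in> adj E" "a \<in> f ` cpt E v" unfolding adj_mp by auto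
    thus "b \<in> f ` cpt E v" using comp_step[of u E v w] inj_image_mem_iff[OF f] by blast
  qed simp
  have "f w \<in> cpt (mp \<tau> f E) (f v)" if "(v, w) \<in> (adj E)\<^sup>*" for w using that
  proof induction
    case (step y z)
    hence "(f y, f z) \<in> adj (mp \<tau> f E)" unfolding adj_mp by force
    thus ?case using step comp_step by metis
  qed simp
  thus "f ` cpt E v \<subseteq> cpt (mp \<tau> f E) (f v)" by (auto simp: cpt_def[of E])
qed

lemma comps_mp: "comps (mp \<tau> f E) (f ` V) = (`) f ` comps E V" by (simp add: comps_eq image_image cpt_mp)

lemma el_mp: "el (mp \<tau> f E) (f ` C) = (\<lambda>e. (\<tau> (fst e), f ` ends e, lab e)) ` el E C"
  unfolding el_def mp_def by (simp add: Compr_image_eq inj_image_subset_iff[OF f])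

lemma dgr_mp: "dgr (mp \<tau> f E) (f v) = dgr E v"
proof -
  have "{e \<in> mp \<tau> f E. f v \<in> ends e} = (\<lambda>e. (\<tau> (fst e), f ` ends e, lab e)) ` {e \<in> E. v \<in> ends e}"
    unfolding mp_def by (simp add: Compr_image_eq inj_image_mem_iff[OF f])
  thus ?thesis unfolding dgr_def by (metis (no_types, lifting) card_image inj_on_subset mem_Collect_eq mp_inj subsetI)
qed

lemma loopE_mp: "loopE (mp \<tau> f E) (f ` C) = loopE E C" by (simp add: loopE_def dgr_mp)

end

context comm_group
begin

lemma glab_mp:
  assumes "inj f" "inj_on \<tau> (fst ` E)" "!!e. e \<in> E ==> lab e \<in> carrier G" shows "glab (mp \<tau> f E) (f ` C) = glab E C"
  unfolding glab_def el_mp[OF assms(1,2)] by (subst finprod_reindex) (use assms(3) inj_on_subset[OF mp_inj[OF assms(1,2)]] in \<open>auto simp: el_def\<close>)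

lemma redE_mp:
  assumes "inj f" "inj_on \<tau> (fst ` E)" "!!e. e \<in> E ==> lab e \<in> carrier G"
  shows "redE (mp \<tau> f E) (f ` V) (f ` W) = (\<lambda>s. (f ` fst s, snd s)) ` redE E V W"
proof -
  have c: "f ` C \<inter> f ` W = f ` (C \<inter> W)" for C using assms(1) by (simp add: image_Int)
  have d: "card (f ` C) = card C" for C using assms(1) by (simp add: card_image inj_on_def)
  have e: "{(C \<inter> W, h C) |C. C \<in> K \<and> P C} = (\<lambda>C. (C \<inter> W, h C)) ` {C \<in> K. P C}" for W h K P by auto
  have gl: "glab (mp \<tau> f E) (f ` C) = glab E C" for C by (rule glab_mp) (use assms in auto)
  show ?thesis unfolding redE_def comps_mp[OF assms(1,2)] e Compr_image_eq image_image gl c d by simp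
qed

lemma fac_mp:
  assumes "inj f" "inj_on \<tau> (fst ` E)" "!!e. e \<in> E ==> lab e \<in> carrier G" "cring k"
    "!!C. act (glab E C) \<delta> \<in> carrier k" "\<epsilon> \<in> carrier k"
  shows "fac k act \<delta> \<epsilon> (mp \<tau> f E) (f ` V) (f ` W) = fac k act \<delta> \<epsilon> E V W"
proof -
  interpret k: cring k by fact
  have c: "f ` C \<inter> f ` W = {} \<longleftrightarrow> C \<inter> W = {}" for C using assms(1) by (simp flip: image_Int)
  have i: "inj_on ((`) f) K" for K using assms(1) by (simp add: inj_image_eq_iff inj_on_def)
  have gl: "glab (mp \<tau> f E) (f ` C) = glab E C" for C by (rule glab_mp) (use assms in auto)
  show ?thesis unfolding fac_def comps_mp[OF assms(1,2)] Compr_image_eq c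
    by (subst k.finprod_reindex[OF _ i]) (use assms(5,6) in \<open>auto simp: gl loopE_mp[OF assms(1,2)] cong: if_cong\<close>)
qed

end

subsection \<open>Gluing diagrams\<close>

definition pd :: "'t => (node => 'v) => 'g diagram => ('t, 'v, 'g) edge set" where
  "pd t f x = (\<lambda>p. (t, f ` fst p, snd p)) ` x"

text \<open>The tags 0 and 1 keep a middle edge of \<open>x\<close> apart from one of
  \<open>y\<close> with the same nodes and the same label; together these two form a loop.\<close>

definition TT :: "'g diagram => 'g diagram => (nat, gnode, 'g) edge set" where "TT x y = pd 0 glue_fst x \<union> pd 1 glue_snd y"

lemma mp_Un: "mp \<tau> f (A \<union> B) = mp \<tau> f A \<union> mp \<tau> f B" by (simp add: mp_def image_Un)

lemma mp_pd: "mp \<tau> g (pd t f x) = pd (\<tau> t) (g \<circ> f) x" by (simp add: mp_def pd_def image_image)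

lemma glue_inj: "inj glue_fst" "inj glue_snd" by (rule injI, case_tac x; case_tac y; simp)+

lemma finite_nodes: "finite (nodes n)" "finite (gnodes n)" by (simp_all add: nodes_def gnodes_def)

lemma glue_nodes: "glue_fst ` nodes n \<subseteq> gnodes n" "glue_snd ` nodes n \<subseteq> gnodes n" by (auto simp: nodes_def gnodes_def)

lemma diagramD:
  assumes "x \<in> diagrams G n"
  shows "p \<in> x ==> fst p \<subseteq> nodes n" "p \<in> x ==> card (fst p) = 2" "p \<in> x ==> snd p \<in> carrier G"
    "p \<in> x ==> p' \<in> x ==> v \<in> fst p ==> v \<in> fst p' ==> p = p'"
proof -
  have 1: "\<forall>p\<in>x. fst p \<subseteq> nodes n \<and> card (fst p) = 2 \<and> snd p \<in> carrier G"
    and 2: "\<forall>p\<in>x. \<forall>p'\<in>x. p \<noteq> p' \<longrightarrow> fst p \<inter> fst p' = {}" using assms unfolding diagrams_def by blast+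
  show "p \<in> x ==> fst p \<subseteq> nodes n" "p \<in> x ==> card (fst p) = 2" "p \<in> x ==> snd p \<in> carrier G" using 1 by blast+
  show "p \<in> x ==> p' \<in> x ==> v \<in> fst p ==> v \<in> fst p' ==> p = p'" using 2 by blast
qed

lemma diagram_finite: "x \<in> diagrams G n ==> finite x"
proof -
  assume x: "x \<in> diagrams G n"
  have "inj_on fst x"
  proof (rule inj_onI)
    fix p p' assume p: "p \<in> x" "p' \<in> x" "fst p = fst p'"
    then obtain v where "v \<in> fst p" using diagramD(2)[OF x p(1)] by fastforce
    thus "p = p'" using diagramD(4)[OF x p(1,2)] p(3) by simp
  qed
  moreover have "finite (fst ` x)" by (rule finite_subset[of _ "Pow (nodes n)"]) (use diagramD(1)[OF x] finite_nodes in auto)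
  ultimately show "finite x" using finite_image_iff by blast
qed

lemma pd_gr: "x \<in> diagrams G n ==> inj f ==> gr G (pd t f x) (f ` nodes n)" unfolding gr_def pd_def
proof (intro conjI ballI)
  fix e assume x: "x \<in> diagrams G n" and f: "inj f" and "e \<in> (\<lambda>p. (t, f ` fst p, snd p)) ` x"
  then obtain p where p: "p \<in> x" "e = (t, f ` fst p, snd p)" by blast
  show "ends e \<subseteq> f ` nodes n" "lab e \<in> carrier G" using p diagramD(1,3)[OF x p(1)] by auto
  show "card (ends e) = 2" using p diagramD(2)[OF x p(1)] card_image[OF inj_on_subset[OF f subset_UNIV], of "fst p"] by simp
qed (use diagram_finite finite_nodes in blast)+

lemma gr_mono: "gr G E V ==> V \<subseteq> V' ==> finite V' ==> gr G E V'" unfolding gr_def by blast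

lemma gr_Un: "gr G E V ==> gr G E' V ==> gr G (E \<union> E') V" unfolding gr_def by auto

lemma pd_inj: "inj f ==> inj_on (\<lambda>p. (t, f ` fst p, snd p)) x" by (auto intro!: inj_onI simp: inj_image_eq_iff)

lemma pd_dgr:
  assumes "x \<in> diagrams G n" "inj f" shows "dgr (pd t f x) (f v) = (if \<exists>p\<in>x. v \<in> fst p then 1 else 0)" "dgr (pd t f x) w \<le> 1"
proof -
  have "{e \<in> pd t f x. w \<in> ends e} = (\<lambda>p. (t, f ` fst p, snd p)) ` {p \<in> x. w \<in> f ` fst p}" for w by (auto simp: pd_def)
  hence c: "dgr (pd t f x) w = card {p \<in> x. w \<in> f ` fst p}" for w unfolding dgr_def by (simp only: card_image[OF pd_inj[OF assms(2)]])
  have "\<exists>p. {p \<in> x. v \<in> fst p} \<subseteq> {p}" for v using diagramD(4)[OF assms(1)] by blast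
  hence le: "card {p \<in> x. v \<in> fst p} \<le> 1" for v
  proof -
    obtain p where "{p \<in> x. v \<in> fst p} \<subseteq> {p}" using \<open>!!v. \<exists>p. {p \<in> x. v \<in> fst p} \<subseteq> {p}\<close>[of v] by blast
    thus ?thesis using card_mono[of "{p}" "{p \<in> x. v \<in> fst p}"] by simp
  qed
  show "dgr (pd t f x) w \<le> 1"
  proof (cases "w \<in> range f")
    case True
    then obtain v where "w = f v" by auto
    thus ?thesis unfolding c using le[of v] inj_image_mem_iff[OF assms(2)] by simp
  next
    case False
    hence "{p \<in> x. w \<in> f ` fst p} = {}" by auto
    thus ?thesis unfolding c by (simp only: card.empty)
  qed
  show "dgr (pd t f x) (f v) = (if \<exists>p\<in>x. v \<in> fst p then 1 else 0)"
  proof (cases "\<exists>p\<in>x. v \<in> fst p")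
    case True
    hence "card {p \<in> x. v \<in> fst p} \<noteq> 0" using diagram_finite[OF assms(1)] by auto
    thus ?thesis unfolding c inj_image_mem_iff[OF assms(2)] using le[of v] True by simp
  next
    case False
    hence "{p \<in> x. v \<in> fst p} = {}" by auto
    thus ?thesis unfolding c inj_image_mem_iff[OF assms(2)] using False by (simp only: card.empty if_False)
  qed
qed

lemma dgr_Un: "dgr (A \<union> B) v \<le> dgr A v + dgr B v"
proof -
  have "{e \<in> A \<union> B. v \<in> ends e} = {e \<in> A. v \<in> ends e} \<union> {e \<in> B. v \<in> ends e}" by auto
  thus ?thesis unfolding dgr_def by (simp only: card_Un_le)
qed

lemma TT_gr: "x \<in> diagrams G n ==> y \<in> diagrams G n ==> gr G (TT x y) (gnodes n)"
  unfolding TT_def by (intro gr_Un; rule gr_mono[OF pd_gr _ finite_nodes(2)]) (auto intro: glue_inj glue_nodes[THEN subsetD])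

lemma adjacent_eq: "adjacent x y = adj (TT x y)" by (simp add: adjacent_def adj_def TT_def pd_def bex_Un)

lemma components_eq: "components n x y = comps (TT x y) (gnodes n)" by (simp add: components_def comps_def adjacent_eq)

lemma TT_comp_sub:
  assumes "x \<in> diagrams G n" "y \<in> diagrams G n" "C \<in> components n x y" shows "C \<subseteq> gnodes n"
  using assms comp_sub[OF TT_gr[OF assms(1,2)]] by (auto simp: components_eq comps_eq)

lemma is_loop_eq:
  assumes x: "x \<in> diagrams G n" and y: "y \<in> diagrams G n" and C: "C \<subseteq> range Mid" shows "is_loop x y C \<longleftrightarrow> loopE (TT x y) C"
proof -
  have "(\<exists>p\<in>x. v \<in> glue_fst ` fst p) \<and> (\<exists>p\<in>y. v \<in> glue_snd ` fst p) \<longleftrightarrow> dgr (TT x y) v = 2" if "v \<in> C" for v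
  proof -
    obtain i where i: "v = glue_fst (Rgt i)" "v = glue_snd (Lft i)" using \<open>v \<in> C\<close> C by auto
    have dj: "pd (0::nat) glue_fst x \<inter> pd 1 glue_snd y = {}" by (auto simp: pd_def)
    have f: "finite (pd (0::nat) glue_fst x)" "finite (pd (1::nat) glue_snd y)" using diagram_finite x y by (auto simp: pd_def)
    have "{e \<in> TT x y. v \<in> ends e} = {e \<in> pd 0 glue_fst x. v \<in> ends e} \<union> {e \<in> pd 1 glue_snd y. v \<in> ends e}" by (auto simp: TT_def)
    hence "dgr (TT x y) v = dgr (pd (0::nat) glue_fst x) v + dgr (pd (1::nat) glue_snd y) v"
      unfolding dgr_def using f dj by (simp add: card_Un_disjoint disjoint_iff)
    moreover have "dgr (pd (0::nat) glue_fst x) v = (if \<exists>p\<in>x. Rgt i \<in> fst p then 1 else 0)" unfolding i(1) by (rule pd_dgr(1)[OF x glue_inj(1)])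
    moreover have "dgr (pd (1::nat) glue_snd y) v = (if \<exists>p\<in>y. Lft i \<in> fst p then 1 else 0)" unfolding i(2) by (rule pd_dgr(1)[OF y glue_inj(2)])
    moreover have "v \<in> glue_fst ` s \<longleftrightarrow> Rgt i \<in> s" for s unfolding i(1) by (rule inj_image_mem_iff[OF glue_inj(1)])
    moreover have "v \<in> glue_snd ` s \<longleftrightarrow> Lft i \<in> s" for s unfolding i(2) by (rule inj_image_mem_iff[OF glue_inj(2)])
    ultimately show ?thesis by simp
  qed
  thus ?thesis by (simp add: is_loop_def loopE_def)
qed

context comm_group
begin

lemma comp_label_eq:
  assumes x: "x \<in> diagrams G n" and y: "y \<in> diagrams G n" shows "comp_label G x y C = glab (TT x y) C"
proof -
  have "el (TT x y) C = (\<lambda>p. (0, glue_fst ` fst p, snd p)) ` {p \<in> x. glue_fst ` fst p \<subseteq> C} \<union>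
     (\<lambda>p. (1, glue_snd ` fst p, snd p)) ` {p \<in> y. glue_snd ` fst p \<subseteq> C}" (is "_ = ?f ` ?X \<union> ?h ` ?Y")
  proof -
    have u: "{e \<in> A \<union> B. P e} = {e \<in> A. P e} \<union> {e \<in> B. P e}" for A B :: "(nat, gnode, 'a) edge set" and P by blast
    show ?thesis unfolding el_def TT_def pd_def u Compr_image_eq by simp
  qed
  moreover have "finite ?X" "finite ?Y" using diagram_finite[OF x] diagram_finite[OF y] by auto
  moreover have "?f ` ?X \<inter> ?h ` ?Y = {}" by auto
  ultimately have "glab (TT x y) C = finprod G lab (?f ` ?X) \<otimes> finprod G lab (?h ` ?Y)"
    unfolding glab_def using diagramD(3)[OF x] diagramD(3)[OF y] by (auto intro!: finprod_Un_disjoint)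
  also have "finprod G lab (?f ` ?X) = finprod G (\<lambda>p. lab (?f p)) ?X" by (rule finprod_reindex[OF _ pd_inj[OF glue_inj(1)]]) (use diagramD(3)[OF x] in auto)
  also have "finprod G lab (?h ` ?Y) = finprod G (\<lambda>p. lab (?h p)) ?Y" by (rule finprod_reindex[OF _ pd_inj[OF glue_inj(2)]]) (use diagramD(3)[OF y] in auto)
  finally show ?thesis by (simp add: comp_label_def)
qed

abbreviation Outs :: "nat => gnode set" where "Outs n \<equiv> Outer ` nodes n"

abbreviation "cc \<equiv> concat_diagram"

lemma concat_eq:
  assumes x: "x \<in> diagrams G n" and y: "y \<in> diagrams G n" shows "cc G n x y = (\<lambda>s. (Outer -` fst s, snd s)) ` redE (TT x y) (gnodes n) (Outs n)"
    "redE (TT x y) (gnodes n) (Outs n) = (\<lambda>s. (Outer ` fst s, snd s)) ` cc G n x y"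
proof -
  have 1: "Outer -` (C \<inter> Outs n) = {v. Outer v \<in> C}" "Outer ` {v. Outer v \<in> C} = C \<inter> Outs n" if "C \<in> components n x y" for C
    using TT_comp_sub[OF x y that] by (auto simp: gnodes_def)
  have 2: "card {v. Outer v \<in> C} = card (C \<inter> Outs n)" if "C \<in> components n x y" for C
    using card_image[of Outer "{v. Outer v \<in> C}"] 1(2)[OF that] by (simp add: inj_on_def)
  have e: "{(h C, l C) |C. C \<in> K \<and> P C} = (\<lambda>C. (h C, l C)) ` {C \<in> K. P C}" for h :: "gnode set => 'c" and l K P by auto
  have K: "{C \<in> components n x y. card {v. Outer v \<in> C} = 2} = {C \<in> components n x y. card (C \<inter> Outs n) = 2}" using 2 by auto
  show "cc G n x y = (\<lambda>s. (Outer -` fst s, snd s)) ` redE (TT x y) (gnodes n) (Outs n)"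
    unfolding concat_diagram_def redE_def comp_label_eq[OF x y] components_eq[symmetric] e K image_image
    by (rule image_cong[OF refl]) (simp add: 1(1) del: vimage_Int)
  show "redE (TT x y) (gnodes n) (Outs n) = (\<lambda>s. (Outer ` fst s, snd s)) ` cc G n x y"
    unfolding concat_diagram_def redE_def comp_label_eq[OF x y] components_eq[symmetric] e K image_image by (rule image_cong[OF refl]) (simp add: 1(2))
qed

lemma concat_closed:
  assumes x: "x \<in> diagrams G n" and y: "y \<in> diagrams G n" shows "cc G n x y \<in> diagrams G n"
proof -
  have "{v. Outer v \<in> C} \<subseteq> nodes n" if "C \<in> components n x y" for C using TT_comp_sub[OF x y that] by (auto simp: gnodes_def)
  note sub = this
  have eq: "C = C'" if "C \<in> components n x y" "C' \<in> components n x y" "Outer v \<in> C" "Outer v \<in> C'" for C C' v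
    using that comps_disj by (metis components_eq)
  show ?thesis unfolding diagrams_def
  proof (intro CollectI conjI ballI impI)
    fix p assume "p \<in> cc G n x y"
    then obtain C where p: "C \<in> components n x y" "p = ({v. Outer v \<in> C}, comp_label G x y C)" "card {v. Outer v \<in> C} = 2"
      by (auto simp: concat_diagram_def)
    show "fst p \<subseteq> nodes n" "card (fst p) = 2" "snd p \<in> carrier G"
      using p sub[OF p(1)] glab_closed[OF TT_gr[OF x y]] by (auto simp: comp_label_eq[OF x y])
    fix p' assume "p' \<in> cc G n x y" and ne: "p \<noteq> p'"
    then obtain C' where p': "C' \<in> components n x y" "p' = ({v. Outer v \<in> C'}, comp_label G x y C')" by (auto simp: concat_diagram_def)
    hence "C \<noteq> C'" using ne p by auto
    thus "fst p \<inter> fst p' = {}" using eq[OF p(1) p'(1)] p(2) p'(2) by auto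
  qed
qed

end

section \<open>Associativity of concatenation and the cocycle of middle factors\<close>

locale rook = comm_group G + k: cring k for G (structure) and k :: "('k, 'y) ring_scheme" +
  fixes act :: "'a => 'k => 'k" and \<delta> \<epsilon> :: 'k
  assumes act_closed: "g \<in> carrier G ==> act g \<delta> \<in> carrier k" and eps: "\<epsilon> \<in> carrier k"
begin

abbreviation "mf \<equiv> middle_factor G k act \<delta> \<epsilon>"
abbreviation "fc \<equiv> fac k act \<delta> \<epsilon>"

lemma middle_eq:
  assumes x: "x \<in> diagrams G n" and y: "y \<in> diagrams G n" shows "mf n x y = fc (TT x y) (gnodes n) (Outs n)"
proof -
  have g: "C \<subseteq> range Mid \<longleftrightarrow> C \<inter> Outs n = {}" if "C \<subseteq> gnodes n" for C
  proof
    assume "C \<inter> Outs n = {}"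
    hence "C \<subseteq> Mid ` {1..n}" using that unfolding gnodes_def by blast
    thus "C \<subseteq> range Mid" by blast
  qed auto
  have s: "{C \<in> components n x y. C \<subseteq> range Mid} = {C \<in> comps (TT x y) (gnodes n). C \<inter> Outs n = {}}"
    using g[OF TT_comp_sub[OF x y]] unfolding components_eq by blast
  show ?thesis unfolding middle_factor_def fac_def s[symmetric] comp_label_eq[OF x y]
    by (rule k.finprod_cong') (use is_loop_eq[OF x y] act_closed glab_closed[OF TT_gr[OF x y]] eps in auto)
qed

end

text \<open>Nodes are put into numbered columns. Three glued diagrams then occupy columns 0 to 3,
  and a bracketing is the choice of the middle column that is eliminated first.\<close>

fun place :: "nat => nat => node => nat \<times> nat" where "place a b (Lft i) = (a, i)"
| "place a b (Rgt i) = (b, i)"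

fun gplace :: "nat => nat => nat => gnode => nat \<times> nat" where "gplace a b c (Outer v) = place a c v"
| "gplace a b c (Mid i) = (b, i)"

lemma place_inj: "a \<noteq> b ==> inj (place a b)" by (rule injI, case_tac x; case_tac y; simp)

lemma gplace_inj: "a \<noteq> b ==> b \<noteq> c ==> a \<noteq> c ==> inj (gplace a b c)"
proof (rule injI)
  fix x y assume "a \<noteq> b" "b \<noteq> c" "a \<noteq> c" "gplace a b c x = gplace a b c y"
  thus "x = y" by (cases "(a, b, c, x)" rule: gplace.cases; cases "(a, b, c, y)" rule: gplace.cases)
    (auto, (metis inj_eq place_inj node.exhaust place.simps prod.inject)+)
qed

lemma gplace_comp: "gplace a b c \<circ> glue_fst = place a b" "gplace a b c \<circ> glue_snd = place b c" by (rule ext, case_tac x; simp)+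

lemma place_nodes: "place a b ` nodes n = {a, b} \<times> {1..n}" "gplace a b c ` gnodes n = {a, b, c} \<times> {1..n}"
proof -
  show 1: "place a b ` nodes n = {a, b} \<times> {1..n}" for a b by (auto simp: nodes_def image_Un image_image)
  show "gplace a b c ` gnodes n = {a, b, c} \<times> {1..n}" using 1[of a c] by (auto simp: gnodes_def image_Un image_image)
qed

context rook
begin

context
  fixes x y :: "'a diagram" and n a b c s t :: nat
  assumes x: "x \<in> diagrams G n" and y: "y \<in> diagrams G n" and abc: "a \<noteq> b" "b \<noteq> c" "a \<noteq> c" and s: "s \<noteq> t"
begin

private abbreviation "\<tau> \<equiv> \<lambda>i::nat. if i = 0 then s else t"

private lemma place_aux: "inj_on \<tau> (fst ` TT x y)" "mp \<tau> (gplace a b c) (TT x y) = pd s (place a b) x \<union> pd t (place b c) y"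
  "gplace a b c ` Outs n = {a, c} \<times> {1..n}" "e \<in> TT x y ==> lab e \<in> carrier G"
proof -
  show "inj_on \<tau> (fst ` TT x y)" using s by (auto simp: inj_on_def TT_def pd_def)
  show "mp \<tau> (gplace a b c) (TT x y) = pd s (place a b) x \<union> pd t (place b c) y" by (simp add: TT_def mp_Un mp_pd gplace_comp)
  show "gplace a b c ` Outs n = {a, c} \<times> {1..n}" using place_nodes(1)[of a c n] by (simp add: image_image)
  show "e \<in> TT x y ==> lab e \<in> carrier G" using TT_gr[OF x y] by (auto simp: gr_def)
qed

lemma redE_place: "redE (pd s (place a b) x \<union> pd t (place b c) y) ({a, b, c} \<times> {1..n}) ({a, c} \<times> {1..n})
     = (\<lambda>p. (place a c ` fst p, snd p)) ` cc G n x y"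
proof -
  have "redE (mp \<tau> (gplace a b c) (TT x y)) (gplace a b c ` gnodes n) (gplace a b c ` Outs n) =
      (\<lambda>s. (gplace a b c ` fst s, snd s)) ` redE (TT x y) (gnodes n) (Outs n)" by (rule redE_mp[OF gplace_inj[OF abc] place_aux(1)]) (rule place_aux(4))
  thus ?thesis unfolding place_aux(2,3) place_nodes(2) concat_eq(2)[OF x y] image_image by (simp add: image_image place_nodes)
qed

lemma fac_place: "fc (pd s (place a b) x \<union> pd t (place b c) y) ({a, b, c} \<times> {1..n}) ({a, c} \<times> {1..n}) = mf n x y"
proof -
  have "fc (mp \<tau> (gplace a b c) (TT x y)) (gplace a b c ` gnodes n) (gplace a b c ` Outs n) = fc (TT x y) (gnodes n) (Outs n)"
    by (rule fac_mp[OF gplace_inj[OF abc] place_aux(1)])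
      (use place_aux(4) act_closed glab_closed[OF TT_gr[OF x y]] eps k.is_cring in auto)
  thus ?thesis unfolding place_aux(2,3) place_nodes(2) middle_eq[OF x y] .
qed

end

context
  fixes n :: nat and x y z :: "'a diagram"
  assumes x: "x \<in> diagrams G n" and y: "y \<in> diagrams G n" and z: "z \<in> diagrams G n"
begin

private abbreviation "px \<equiv> pd (0::nat) (place 0 1) x"
private abbreviation "py \<equiv> pd (1::nat) (place 1 2) y"
private abbreviation "pz \<equiv> pd (2::nat) (place 2 3) z"

private lemma pgr: "w \<in> diagrams G n ==> a \<noteq> b ==> {a, b} \<subseteq> A ==> finite A ==> gr G (pd t (place a b) w) (A \<times> {1..n})"
  by (rule gr_mono[OF pd_gr[OF _ place_inj]]) (auto simp: place_nodes)

private lemma pdg: "w \<in> diagrams G n ==> a \<noteq> b ==> dgr (pd t (place a b) w) v \<le> 1"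
  "w \<in> diagrams G n ==> a \<noteq> b ==> fst v \<noteq> a ==> fst v \<noteq> b ==> dgr (pd t (place a b) w) v = 0"
proof -
  show "w \<in> diagrams G n ==> a \<noteq> b ==> dgr (pd t (place a b) w) v \<le> 1" by (rule pd_dgr(2)[OF _ place_inj])
  show "w \<in> diagrams G n ==> a \<noteq> b ==> fst v \<noteq> a ==> fst v \<noteq> b ==> dgr (pd t (place a b) w) v = 0"
    by (rule deg_out[OF pgr[of w a b "{a, b}" t]]) auto
qed

private lemma degs: "dgr (px \<union> py) v \<le> dgr px v + dgr py v" "dgr (py \<union> pz) v \<le> dgr py v + dgr pz v"
  "dgr (px \<union> py \<union> pz) v \<le> dgr px v + dgr py v + dgr pz v" using dgr_Un[of px py v] dgr_Un[of py pz v] dgr_Un[of "px \<union> py" pz v] by linarith+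

private lemma le1: "dgr px v \<le> 1" "dgr py v \<le> 1" "dgr pz v \<le> 1" by (rule pdg(1)[OF x] pdg(1)[OF y] pdg(1)[OF z]; simp)+

private lemma is0: "fst v \<noteq> 0 ==> fst v \<noteq> 1 ==> dgr px v = 0" "fst v \<noteq> 1 ==> fst v \<noteq> 2 ==> dgr py v = 0"
  "fst v \<noteq> 2 ==> fst v \<noteq> 3 ==> dgr pz v = 0" by (rule pdg(2)[OF x] pdg(2)[OF y] pdg(2)[OF z]; simp)+

private lemma outer_deg: "v \<in> {0, 3} \<times> {1..n} ==> dgr (px \<union> py \<union> pz) v \<le> 1"
  using degs(3)[of v] le1[of v] is0[of v] by auto

private lemma staged_left: "staged G (px \<union> py) pz ({0, 1, 2} \<times> {1..n}) ({2, 3} \<times> {1..n}) ({0, 2} \<times> {1..n}) ({0, 3} \<times> {1..n}) 0"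
proof
  show "gr G (px \<union> py) ({0, 1, 2} \<times> {1..n})" by (rule gr_Un; rule pgr[OF x] pgr[OF y]; simp)
  show "gr G pz ({2, 3} \<times> {1..n})" by (rule pgr[OF z]; simp)
  show "(px \<union> py) \<inter> pz = {}" by (auto simp: pd_def)
  show "dgr (px \<union> py) v \<le> 2" for v using degs(1)[of v] le1[of v] by linarith
  show "dgr (px \<union> py) v \<le> 1" if "v \<in> {0, 2} \<times> {1..n}" for v using that degs(1)[of v] le1[of v] is0[of v] by auto
  show "dgr pz v \<le> 1" for v by (rule le1)
  show "dgr ((px \<union> py) \<union> pz) v \<le> 1" if "v \<in> {0, 3} \<times> {1..n}" for v by (rule outer_deg[OF that])
  show "0 \<notin> fst ` pz" by (auto simp: pd_def)
qed auto

private lemma staged_right: "staged G (py \<union> pz) px ({1, 2, 3} \<times> {1..n}) ({0, 1} \<times> {1..n}) ({1, 3} \<times> {1..n}) ({0, 3} \<times> {1..n}) 1"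
proof
  show "gr G (py \<union> pz) ({1, 2, 3} \<times> {1..n})" by (rule gr_Un; rule pgr[OF y] pgr[OF z]; simp)
  show "gr G px ({0, 1} \<times> {1..n})" by (rule pgr[OF x]; simp)
  show "(py \<union> pz) \<inter> px = {}" by (auto simp: pd_def)
  show "dgr (py \<union> pz) v \<le> 2" for v using degs(2)[of v] le1[of v] by linarith
  show "dgr (py \<union> pz) v \<le> 1" if "v \<in> {1, 3} \<times> {1..n}" for v using that degs(2)[of v] le1[of v] is0[of v] by auto
  show "dgr px v \<le> 1" for v by (rule le1)
  have "(py \<union> pz) \<union> px = px \<union> py \<union> pz" by auto
  thus "dgr ((py \<union> pz) \<union> px) v \<le> 1" if "v \<in> {0, 3} \<times> {1..n}" for v using outer_deg[OF that] by simp
  show "1 \<notin> fst ` px" by (auto simp: pd_def)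
qed auto

private lemma Pair_pd: "Pair t ` (\<lambda>p. (f ` fst p, snd p)) ` w = pd t f w" by (simp add: pd_def image_image)

private lemma V4: "{0, 1, 2} \<times> {1..n} \<union> {2, 3} \<times> {1..n} = {0, 1, 2, 3::nat} \<times> {1..n}"
  "{1, 2, 3} \<times> {1..n} \<union> {0, 1} \<times> {1..n} = {0, 1, 2, 3::nat} \<times> {1..n}"
  "{0, 2} \<times> {1..n} \<union> {2, 3} \<times> {1..n} = {0, 2, 3::nat} \<times> {1..n}"
  "{1, 3} \<times> {1..n} \<union> {0, 1} \<times> {1..n} = {0, 1, 3::nat} \<times> {1..n}" by auto

private lemma left_R: "staged.R G (px \<union> py) ({0, 1, 2} \<times> {1..n}) ({0, 2} \<times> {1..n}) 0 = pd 0 (place 0 2) (cc G n x y)"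
  unfolding staged.R_def[OF staged_left] using redE_place[OF x y, of 0 1 2 0 1] by (simp add: Pair_pd)

private lemma right_R: "staged.R G (py \<union> pz) ({1, 2, 3} \<times> {1..n}) ({1, 3} \<times> {1..n}) 1 = pd 1 (place 1 3) (cc G n y z)"
  unfolding staged.R_def[OF staged_right] using redE_place[OF y z, of 1 2 3 1 2] by (simp add: Pair_pd)

private lemma pq: "py \<union> pz \<union> px = px \<union> py \<union> pz" by auto

text \<open>Both bracketings reduce the same graph on four columns to its outer columns, one
  eliminating column 1 first, the other column 2.\<close>

lemma concat_assoc: "cc G n (cc G n x y) z = cc G n x (cc G n y z)"
proof -
  let ?h = "\<lambda>p :: node set \<times> 'a. (place 0 3 ` fst p, snd p)"
  have "?h ` cc G n (cc G n x y) z = redE (px \<union> py \<union> pz) ({0, 1, 2, 3} \<times> {1..n}) ({0, 3} \<times> {1..n})"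
    using staged.redE_staged[OF staged_left] redE_place[OF concat_closed[OF x y] z, of 0 2 3 0 2] unfolding left_R V4 by simp
  moreover have "?h ` cc G n x (cc G n y z) = redE (px \<union> py \<union> pz) ({0, 1, 2, 3} \<times> {1..n}) ({0, 3} \<times> {1..n})"
    using staged.redE_staged[OF staged_right] redE_place[OF x concat_closed[OF y z], of 0 1 3 0 1] unfolding right_R V4 pq by (simp add: Un_commute)
  ultimately have e: "?h ` cc G n (cc G n x y) z = ?h ` cc G n x (cc G n y z)" by (simp only:)
  have "inj ?h" using place_inj[of 0 3] by (auto intro!: injI simp: prod_eq_iff inj_image_eq_iff)
  from e[unfolded inj_image_eq_iff[OF this]] show ?thesis .
qed

lemma middle_cocycle: "mf n x y \<otimes>\<^bsub>k\<^esub> mf n (cc G n x y) z = mf n y z \<otimes>\<^bsub>k\<^esub> mf n x (cc G n y z)"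
proof -
  have "mf n x y \<otimes>\<^bsub>k\<^esub> mf n (cc G n x y) z = fc (px \<union> py \<union> pz) ({0, 1, 2, 3} \<times> {1..n}) ({0, 3} \<times> {1..n})"
    using staged.fac_staged[where act=act and \<delta>=\<delta> and \<epsilon>=\<epsilon>, OF staged_left k.is_cring act_closed eps] fac_place[OF x y, of 0 1 2 0 1]
      fac_place[OF concat_closed[OF x y] z, of 0 2 3 0 2] unfolding left_R V4 by simp
  moreover have "mf n y z \<otimes>\<^bsub>k\<^esub> mf n x (cc G n y z) = fc (px \<union> py \<union> pz) ({0, 1, 2, 3} \<times> {1..n}) ({0, 3} \<times> {1..n})"
    using staged.fac_staged[where act=act and \<delta>=\<delta> and \<epsilon>=\<epsilon>, OF staged_right k.is_cring act_closed eps] fac_place[OF y z, of 1 2 3 1 2]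
      fac_place[OF x concat_closed[OF y z], of 0 1 3 0 1] unfolding right_R V4 pq by (simp add: Un_commute)
  ultimately show ?thesis by simp
qed

end

end

section \<open>Explicit components of glued diagrams\<close>

lemma cpt_block:
  assumes v: "v \<in> C" and F: "F \<subseteq> E" "!!e. e \<in> F ==> ends e \<subseteq> C" and conn: "C \<subseteq> cpt F v"
    and cl: "!!e u. e \<in> E ==> u \<in> ends e ==> u \<in> C ==> e \<in> F" and ne: "!!e. e \<in> E ==> ends e \<noteq> {}"
  shows "cpt E v = C" "el E C = F"
proof -
  have "cpt E v \<subseteq> C"
  proof (rule comp_least[OF v])
    fix a b assume a: "a \<in> C" and "(a, b) \<in> adj E"
    then obtain e where e: "e \<in> E" "{a, b} = ends e" by (auto simp: adj_def)
    thus "b \<in> C" using F(2)[OF cl[OF e(1) _ a]] by auto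
  qed
  thus "cpt E v = C" using conn comp_mono[OF F(1), of v] by auto
  show "el E C = F"
  proof
    show "el E C \<subseteq> F"
    proof
      fix e assume e: "e \<in> el E C"
      then obtain u where "u \<in> ends e" using ne[of e] by (auto simp: el_def)
      thus "e \<in> F" using cl[of e u] e by (auto simp: el_def)
    qed
    show "F \<subseteq> el E C" unfolding el_def using F by blast
  qed
qed

lemma cpt_edge: "e \<in> F ==> ends e = {a, b} ==> a \<in> cpt F v ==> b \<in> cpt F v"
  by (rule comp_step[of a]) (auto simp: adj_def)

abbreviation xe :: "node set \<times> 'g => nat \<times> gnode set \<times> 'g" where "xe p \<equiv> (0, glue_fst ` fst p, snd p)"
abbreviation ye :: "node set \<times> 'g => nat \<times> gnode set \<times> 'g" where "ye p \<equiv> (1, glue_snd ` fst p, snd p)"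

lemma TT_iff: "e \<in> TT x y \<longleftrightarrow> (\<exists>p\<in>x. e = xe p) \<or> (\<exists>p\<in>y. e = ye p)" by (auto simp: TT_def pd_def)

lemma glue_mem [simp]:
  "Outer (Lft i) \<in> glue_fst ` s \<longleftrightarrow> Lft i \<in> s" "Mid i \<in> glue_fst ` s \<longleftrightarrow> Rgt i \<in> s" "Outer (Rgt i) \<notin> glue_fst ` s"
  "Outer (Rgt i) \<in> glue_snd ` s \<longleftrightarrow> Rgt i \<in> s" "Mid i \<in> glue_snd ` s \<longleftrightarrow> Lft i \<in> s" "Outer (Lft i) \<notin> glue_snd ` s"
  using inj_image_mem_iff[OF glue_inj(1), of "Lft i" s] inj_image_mem_iff[OF glue_inj(1), of "Rgt i" s]
    inj_image_mem_iff[OF glue_inj(2), of "Lft i" s] inj_image_mem_iff[OF glue_inj(2), of "Rgt i" s]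
  by simp_all (metis gnode.distinct(1) gnode.inject(1) glue_fst.simps glue_snd.simps imageE node.distinct(1) node.exhaust)+

text \<open>Every edge of \<open>d'\<close> meets some edge of \<open>d\<close>, and two edges of
  \<open>d'\<close> with a common node coincide.\<close>

lemma diagram_eqI:
  assumes d: "d \<in> diagrams G n" and d': "d' \<in> diagrams G n" and sub: "d \<subseteq> d'"
    and iso: "!!v. v \<in> nodes n ==> \<forall>p\<in>d. v \<notin> fst p ==> \<forall>p\<in>d'. v \<notin> fst p" shows "d = d'"
proof
  show "d' \<subseteq> d"
  proof
    fix p assume p: "p \<in> d'"
    then obtain v where v: "v \<in> fst p" using diagramD(2)[OF d' p] by fastforce
    hence "v \<in> nodes n" using diagramD(1)[OF d' p] by auto
    then obtain q where "q \<in> d" "v \<in> fst q" using iso[of v] p v by blast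
    thus "p \<in> d" using diagramD(4)[OF d' p, of q v] sub v by auto
  qed
qed (rule sub)

context comm_group
begin

text \<open>All explicit components below are obtained by exhibiting a set \<open>C\<close> of nodes
  and a set \<open>F\<close> of edges such that \<open>F\<close> connects \<open>C\<close> and
  contains every edge that touches \<open>C\<close>.\<close>

lemma block:
  assumes x: "x \<in> diagrams G n" and y: "y \<in> diagrams G n" and C: "C \<subseteq> gnodes n" and v: "v \<in> C"
    and F: "F \<subseteq> TT x y" "!!e. e \<in> F ==> ends e \<subseteq> C" and conn: "C \<subseteq> cpt F v"
    and clx: "!!p u. p \<in> x ==> u \<in> glue_fst ` fst p ==> u \<in> C ==> xe p \<in> F"
    and cly: "!!p u. p \<in> y ==> u \<in> glue_snd ` fst p ==> u \<in> C ==> ye p \<in> F"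
  shows "cpt (TT x y) v = C" "C \<in> components n x y" "comp_label G x y C = finprod G lab F"
proof -
  have ne: "ends e \<noteq> {}" if "e \<in> TT x y" for e using that TT_gr[OF x y] by (fastforce simp: gr_def)
  have cl: "e \<in> F" if "e \<in> TT x y" "u \<in> ends e" "u \<in> C" for e u using that clx cly by (auto simp: TT_iff)
  show c: "cpt (TT x y) v = C" by (rule cpt_block(1)[OF v F(1)]) (use F(2) conn cl ne in blast)+
  thus "C \<in> components n x y" using C v by (auto simp: components_eq comps_eq)
  have "el (TT x y) C = F" by (rule cpt_block(2)[OF v F(1)]) (use F(2) conn cl ne in blast)+
  thus "comp_label G x y C = finprod G lab F" by (simp add: comp_label_eq[OF x y] glab_def)
qed

lemma concat_isolated:
  assumes x: "x \<in> diagrams G n" and y: "y \<in> diagrams G n" and v: "{u. Outer u \<in> cpt (TT x y) (Outer v)} \<subseteq> {v}" and p: "p \<in> cc G n x y"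
  shows "v \<notin> fst p"
proof
  assume vp: "v \<in> fst p"
  obtain C where C: "C \<in> components n x y" "fst p = {v. Outer v \<in> C}" "card (fst p) = 2" using p by (auto simp: concat_diagram_def)
  hence "C = cpt (TT x y) (Outer v)" using vp comp_eq[of "Outer v" "TT x y"] by (auto simp: components_eq comps_eq)
  hence "fst p \<subseteq> {v}" using v C(2) by simp
  thus False using C(3) card_mono[of "{v}" "fst p"] by simp
qed

lemma concatI: "C \<in> components n x y ==> card {v. Outer v \<in> C} = 2 ==> ({v. Outer v \<in> C}, comp_label G x y C) \<in> cc G n x y"
  by (auto simp: concat_diagram_def)

lemma left_edge:
  assumes x: "x \<in> diagrams G n" and y: "y \<in> diagrams G n" and p: "p \<in> x" "fst p \<subseteq> range Lft" shows "p \<in> cc G n x y"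
proof -
  obtain i j where ij: "fst p = {Lft i, Lft j}" "i \<noteq> j"
  proof -
    obtain a b where ab: "fst p = {a, b}" "a \<noteq> b" using diagramD(2)[OF x p(1)] by (auto simp: card_2_iff)
    then obtain i j where "a = Lft i" "b = Lft j" using p(2) by auto
    thus ?thesis using that ab by blast
  qed
  let ?C = "{Outer (Lft i), Outer (Lft j)}"
  have c: "glue_fst ` fst p = ?C" using ij by simp
  have in_p: "q = p" if "q \<in> x" "u \<in> glue_fst ` fst q" "u \<in> ?C" for q u
  proof -
    have "u = Outer (Lft i) \<or> u = Outer (Lft j)" using that(3) by simp
    hence "Lft i \<in> fst q \<or> Lft j \<in> fst q" using that(2) by (metis glue_mem(1))
    thus ?thesis using diagramD(4)[OF x that(1) p(1)] ij by auto
  qed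
  have "?C \<subseteq> cpt {xe p} (Outer (Lft i))" using cpt_edge[of "xe p" "{xe p}" "Outer (Lft i)" "Outer (Lft j)"] c by simp
  note conn = this
  have 1: "?C \<subseteq> gnodes n" using diagramD(1)[OF x p(1)] ij by (simp add: gnodes_def)
  have 2: "Outer (Lft i) \<in> ?C" by simp
  have 3: "{xe p} \<subseteq> TT x y" using p(1) by (simp add: TT_def pd_def)
  have 4: "ends e \<subseteq> ?C" if "e \<in> {xe p}" for e using that c by simp
  have 5: "xe q \<in> {xe p}" if "q \<in> x" "u \<in> glue_fst ` fst q" "u \<in> ?C" for q u using in_p[OF that] by simp
  have 6: "ye q \<in> {xe p}" if "q \<in> y" "u \<in> glue_snd ` fst q" "u \<in> ?C" for q u using that(2,3) by (metis empty_iff glue_mem(6) insert_iff)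
  have C: "?C \<in> components n x y" "comp_label G x y ?C = finprod G lab {xe p}" by (rule block(2,3)[OF x y 1 2 3 4 conn 5 6]; assumption)+
  have "{v. Outer v \<in> ?C} = fst p" using ij by auto
  thus ?thesis using concatI[OF C(1)] C(2) diagramD(2,3)[OF x p(1)] by simp
qed

lemma left_isolated:
  assumes x: "x \<in> diagrams G n" and y: "y \<in> diagrams G n" and i: "i \<in> {1..n}" "!!p. p \<in> x ==> Lft i \<notin> fst p"
    and p: "p \<in> cc G n x y" shows "Lft i \<notin> fst p"
proof -
  have "cpt (TT x y) (Outer (Lft i)) = {Outer (Lft i)}"
  proof (rule block(1)[OF x y, of _ _ "{}"])
    show "xe q \<in> {}" if "q \<in> x" "u \<in> glue_fst ` fst q" "u \<in> {Outer (Lft i)}" for q u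
      using that i(2)[of q] by (metis empty_iff glue_mem(1) insert_iff)
    show "ye q \<in> {}" if "q \<in> y" "u \<in> glue_snd ` fst q" "u \<in> {Outer (Lft i)}" for q u using that(2,3) by (metis empty_iff glue_mem(6) insert_iff)
  qed (use i(1) in \<open>simp_all add: gnodes_def nodes_def\<close>)
  thus ?thesis using concat_isolated[OF x y _ p] by auto
qed

end

subsection \<open>Transposition\<close>

fun sw :: "node => node" where "sw (Lft i) = Rgt i"
| "sw (Rgt i) = Lft i"

fun gsw :: "gnode => gnode" where "gsw (Outer v) = Outer (sw v)"
| "gsw (Mid i) = Mid i"

definition trd :: "'g diagram => 'g diagram" where "trd x = (\<lambda>p. (sw ` fst p, snd p)) ` x"

lemma sw_sw [simp]: "sw (sw v) = v" by (cases v) auto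

lemma gsw_gsw [simp]: "gsw (gsw v) = v" by (cases v) auto

lemma sw_inj: "inj sw" "inj gsw" by (metis injI sw_sw, metis injI gsw_gsw)

lemma trd_trd [simp]: "trd (trd x) = x" by (simp add: trd_def image_image)

lemma sw_nodes: "sw ` nodes n = nodes n" "gsw ` gnodes n = gnodes n"
proof -
  show 1: "sw ` nodes n = nodes n" by (auto simp: nodes_def image_Un image_image)
  have "gsw ` Outer ` nodes n = Outer ` sw ` nodes n" by (simp add: image_image)
  thus "gsw ` gnodes n = gnodes n" unfolding gnodes_def image_Un 1 by (simp add: image_image)
qed

lemma trd_diagrams: "x \<in> diagrams G n ==> trd x \<in> diagrams G n"
proof -
  assume x: "x \<in> diagrams G n"
  show "trd x \<in> diagrams G n" unfolding diagrams_def trd_def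
  proof (intro CollectI conjI ballI impI)
    fix q assume "q \<in> (\<lambda>p. (sw ` fst p, snd p)) ` x"
    then obtain p where p: "p \<in> x" "q = (sw ` fst p, snd p)" by blast
    show "fst q \<subseteq> nodes n" using diagramD(1)[OF x p(1)] p(2) sw_nodes(1) by force
    show "card (fst q) = 2" "snd q \<in> carrier G"
      using diagramD(2,3)[OF x p(1)] p(2) card_image[OF inj_on_subset[OF sw_inj(1) subset_UNIV], of "fst p"] by simp_all
    fix q' assume "q' \<in> (\<lambda>p. (sw ` fst p, snd p)) ` x" and ne: "q \<noteq> q'"
    then obtain p' where p': "p' \<in> x" "q' = (sw ` fst p', snd p')" by blast
    hence "p \<noteq> p'" using ne p by auto
    hence "fst p \<inter> fst p' = {}" using diagramD(4)[OF x p(1) p'(1)] by blast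
    thus "fst q \<inter> fst q' = {}" unfolding p(2) p'(2) by (simp flip: image_Int[OF sw_inj(1)])
  qed
qed

lemma TT_trd: "mp (\<lambda>t. 1 - t) gsw (TT x y) = TT (trd y) (trd x)"
proof -
  have c: "gsw \<circ> glue_fst = glue_snd \<circ> sw" "gsw \<circ> glue_snd = glue_fst \<circ> sw" by (rule ext, case_tac x, simp, simp)+
  have "pd t (f \<circ> sw) x = pd t f (trd x)" for t :: nat and f :: "node => gnode" and x :: "'a diagram" by (simp add: pd_def trd_def image_image)
  thus ?thesis unfolding TT_def mp_Un mp_pd c by (simp add: Un_commute)
qed

context rook
begin

text \<open>Transposition reverses products and preserves middle factors, so statements about the
  left factor or column carry over to the right.\<close>

lemma trd_concat:
  assumes x: "x \<in> diagrams G n" and y: "y \<in> diagrams G n" shows "cc G n (trd y) (trd x) = trd (cc G n x y)" "mf n (trd y) (trd x) = mf n x y"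
proof -
  have \<tau>: "inj_on (\<lambda>t::nat. 1 - t) (fst ` TT x y)" by (auto simp: inj_on_def TT_def pd_def)
  have l: "lab e \<in> carrier G" if "e \<in> TT x y" for e using that TT_gr[OF x y] by (auto simp: gr_def)
  have o: "gsw ` Outs n = Outs n"
  proof -
    have "gsw ` Outer ` nodes n = Outer ` sw ` nodes n" by (simp add: image_image)
    thus ?thesis unfolding sw_nodes .
  qed
  note t = trd_diagrams[OF y] trd_diagrams[OF x]
  have "redE (TT (trd y) (trd x)) (gnodes n) (Outs n) = (\<lambda>s. (gsw ` fst s, snd s)) ` redE (TT x y) (gnodes n) (Outs n)"
    using redE_mp[OF sw_inj(2) \<tau> l, of "gnodes n" "Outs n"] unfolding TT_trd sw_nodes o .
  hence "cc G n (trd y) (trd x) = (\<lambda>s. (Outer -` gsw ` Outer ` fst s, snd s)) ` cc G n x y"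
    unfolding concat_eq(1)[OF t] concat_eq(2)[OF x y] by (simp only: image_image fst_conv snd_conv)
  moreover have "Outer -` gsw ` Outer ` s = sw ` s" for s
  proof -
    have "gsw ` Outer ` s = Outer ` sw ` s" by (simp add: image_image)
    thus ?thesis by (simp add: inj_vimage_image_eq inj_on_def)
  qed
  ultimately show "cc G n (trd y) (trd x) = trd (cc G n x y)" by (simp add: trd_def)
  have "fc (mp (\<lambda>t. 1 - t) gsw (TT x y)) (gsw ` gnodes n) (gsw ` Outs n) = fc (TT x y) (gnodes n) (Outs n)"
    by (rule fac_mp[OF sw_inj(2) \<tau>]) (use l act_closed glab_closed[OF TT_gr[OF x y]] eps k.is_cring in auto)
  thus "mf n (trd y) (trd x) = mf n x y" unfolding TT_trd sw_nodes o middle_eq[OF x y] middle_eq[OF t] .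
qed

end

subsection \<open>Idempotents\<close>

text \<open>The edges \<open>M\<close> on the left, their mirror images with inverse labels on the
  right, the nodes of \<open>S\<close> isolated on both sides, and identity strands elsewhere. In a
  product with a diagram containing \<open>M\<close>, each mirror image closes a loop with its
  original, and the inverse labels cancel.\<close>

definition idem :: "('g, 'x) monoid_scheme => nat => nat set => 'g diagram => 'g diagram" where
  "idem G n S M = M \<union> (\<lambda>p. (sw ` fst p, inv\<^bsub>G\<^esub> snd p)) ` M \<union>
     {({Lft i, Rgt i}, \<one>\<^bsub>G\<^esub>) | i. i \<in> {1..n} \<and> i \<notin> S \<and> (\<forall>p\<in>M. Lft i \<notin> fst p)}"

definition lfam :: "('g, 'x) monoid_scheme => nat => nat set => 'g diagram => 'g diagram set" where
  "lfam G n S M = {d \<in> diagrams G n. M \<subseteq> d \<and> (\<forall>p\<in>d. \<forall>i\<in>S. Lft i \<notin> fst p)}"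

definition lset :: "nat => nat set => 'g diagram => bool" where
  "lset n S M \<longleftrightarrow> S \<subseteq> {1..n} \<and> (\<forall>p\<in>M. fst p \<subseteq> range Lft)"

text \<open>The middle components in the product of \<open>idem G n S M\<close> with any member of
  \<open>lfam G n S M\<close>: one isolated node for each element of \<open>S\<close> and one loop
  with two nodes for each edge of \<open>M\<close>.\<close>

definition mids :: "nat set => 'g diagram => gnode set set" where
  "mids S M = (\<lambda>i. {Mid i}) ` S \<union> (\<lambda>p. glue_snd ` fst p) ` M"

lemma lfam_inter: "lfam G n S M \<inter> lfam G n S' M' = lfam G n (S \<union> S') (M \<union> M')" by (auto simp: lfam_def)

context comm_group
begin

context
  fixes n S M d
  assumes L: "lset n S M" and d: "d \<in> lfam G n S M"
begin

private abbreviation "ed \<equiv> idem G n S M"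

lemma dD: "d \<in> diagrams G n" using d by (simp add: lfam_def)

lemma Mp: "p \<in> M ==> p \<in> d" "p \<in> M ==> Rgt i \<notin> fst p" "p \<in> M ==> fst p \<subseteq> nodes n" "p \<in> M ==> card (fst p) = 2"
  "p \<in> M ==> snd p \<in> carrier G" "p \<in> M ==> i \<in> S ==> Lft i \<notin> fst p"
proof -
  assume p: "p \<in> M"
  thus pd: "p \<in> d" using d by (auto simp: lfam_def)
  show "Rgt i \<notin> fst p" using L p by (auto simp: lset_def)
  show "fst p \<subseteq> nodes n" "card (fst p) = 2" "snd p \<in> carrier G" using diagramD(1-3)[OF dD pd] .
  show "i \<in> S ==> Lft i \<notin> fst p" using d pd by (auto simp: lfam_def)
qed

lemma sw_mem: "v \<in> sw ` s \<longleftrightarrow> sw v \<in> s" by (metis image_iff sw_sw)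

definition "Ai i \<longleftrightarrow> i \<in> {1..n} \<and> i \<notin> S \<and> (\<forall>p\<in>M. Lft i \<notin> fst p)"

lemma idem_iff: "p \<in> ed \<longleftrightarrow> p \<in> M \<or> (\<exists>q\<in>M. p = (sw ` fst q, inv snd q)) \<or> (\<exists>i. Ai i \<and> p = ({Lft i, Rgt i}, \<one>))"
  by (auto simp: idem_def Ai_def)

lemma idem_cases:
  assumes "p \<in> ed"
  obtains "p \<in> M" | q where "q \<in> M" "p = (sw ` fst q, inv snd q)" | i where "Ai i" "p = ({Lft i, Rgt i}, \<one>)" using assms unfolding idem_iff by blast

lemma idem_left:
  assumes "p \<in> ed" "Lft i \<in> fst p" shows "p \<in> M \<or> Ai i \<and> p = ({Lft i, Rgt i}, \<one>)" using assms(1)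
proof (cases rule: idem_cases)
  case (2 q)
  thus ?thesis using Mp(2)[OF 2(1), of i] assms(2) by (simp add: sw_mem)
qed (use assms(2) in auto)

lemma idem_right:
  assumes "p \<in> ed" "Rgt i \<in> fst p"
  shows "(\<exists>q\<in>M. Lft i \<in> fst q \<and> p = (sw ` fst q, inv snd q)) \<or> Ai i \<and> p = ({Lft i, Rgt i}, \<one>)" using assms(1)
proof (cases rule: idem_cases)
  case 1
  thus ?thesis using Mp(2)[OF 1, of i] assms(2) by simp
next
  case (2 q)
  thus ?thesis using assms(2) by (auto simp: sw_mem)
qed (use assms(2) in auto)

lemma M_eq: "p \<in> M ==> q \<in> M ==> v \<in> fst p ==> v \<in> fst q ==> p = q"
  using diagramD(4)[OF dD] Mp(1) by blast

lemma idem_in: "ed \<in> diagrams G n" unfolding diagrams_def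
proof (intro CollectI conjI ballI impI)
  fix p assume p: "p \<in> ed"
  have c: "card (sw ` s) = card s" for s using card_image[OF inj_on_subset[OF sw_inj(1) subset_UNIV]] .
  have s: "sw ` s \<subseteq> nodes n" if "s \<subseteq> nodes n" for s using image_mono[OF that, of sw] sw_nodes(1) by simp
  show "fst p \<subseteq> nodes n" "card (fst p) = 2" "snd p \<in> carrier G"
    using p by (cases rule: idem_cases; use Mp s c in \<open>simp add: Ai_def nodes_def\<close>)+
  fix p' assume p': "p' \<in> ed" and ne: "p \<noteq> p'"
  have "v \<notin> fst p'" if v: "v \<in> fst p" for v
  proof
    assume v': "v \<in> fst p'"
    show False
    proof (cases v)
      case (Lft i)
      have 1: "p \<in> M \<or> Ai i \<and> p = ({Lft i, Rgt i}, \<one>)" by (rule idem_left[OF p]) (use v Lft in simp)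
      have 2: "p' \<in> M \<or> Ai i \<and> p' = ({Lft i, Rgt i}, \<one>)" by (rule idem_left[OF p']) (use v' Lft in simp)
      have "p = p'" using 1 2 M_eq[of p p' v] v v' Lft unfolding Ai_def by metis
      thus False using ne by simp
    next
      case (Rgt i)
      have 1: "(\<exists>q\<in>M. Lft i \<in> fst q \<and> p = (sw ` fst q, inv snd q)) \<or> Ai i \<and> p = ({Lft i, Rgt i}, \<one>)"
        by (rule idem_right[OF p]) (use v Rgt in simp)
      have 2: "(\<exists>q\<in>M. Lft i \<in> fst q \<and> p' = (sw ` fst q, inv snd q)) \<or> Ai i \<and> p' = ({Lft i, Rgt i}, \<one>)"
        by (rule idem_right[OF p']) (use v' Rgt in simp)
      have "p = p'" using 1 2 M_eq[of _ _ "Lft i"] unfolding Ai_def by metis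
      thus False using ne by simp
    qed
  qed
  thus "fst p \<inter> fst p' = {}" by blast
qed

lemma strand_in: "Ai i ==> ({Lft i, Rgt i}, \<one>) \<in> ed" by (auto simp: idem_iff)

definition strands :: "node set => (nat \<times> gnode set \<times> 'a) set" where "strands s = {xe ({Lft i, Rgt i}, \<one>) | i. Lft i \<in> s}"

text \<open>A piece of \<open>d\<close> whose left nodes avoid \<open>S\<close> and \<open>M\<close>
  is merely lengthened by identity strands at these nodes.\<close>

lemma idem_block:
  assumes s: "s \<subseteq> nodes n" "a \<in> s" and Y: "Y \<subseteq> ye ` d" "!!e. e \<in> Y ==> ends e \<subseteq> glue_snd ` s"
    and cl: "!!q v. q \<in> d ==> v \<in> fst q ==> v \<in> s ==> ye q \<in> Y" and A: "!!i. Lft i \<in> s ==> Ai i"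
    and conn: "glue_snd ` s \<subseteq> cpt Y (glue_snd a)" shows "cpt (TT ed d) (glue_snd a) = glue_snd ` s \<union> Outer ` s"
    "glue_snd ` s \<union> Outer ` s \<in> components n ed d" "comp_label G ed d (glue_snd ` s \<union> Outer ` s) = finprod G lab (Y \<union> strands s)"
proof -
  let ?C = "glue_snd ` s \<union> Outer ` s" and ?F = "Y \<union> strands s"
  have 1: "?C \<subseteq> gnodes n" using s(1) glue_nodes(2)[of n] by (auto simp: gnodes_def)
  have 2: "glue_snd a \<in> ?C" using s(2) by simp
  have 3: "?F \<subseteq> TT ed d"
  proof -
    have "strands s \<subseteq> xe ` ed" unfolding strands_def using A strand_in by blast
    thus ?thesis using Y(1) unfolding TT_def pd_def by blast
  qed
  have 4: "ends e \<subseteq> ?C" if "e \<in> ?F" for e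
  proof (cases "e \<in> Y")
    case False
    hence "e \<in> strands s" using \<open>e \<in> ?F\<close> by blast
    then obtain i where "Lft i \<in> s" "e = xe ({Lft i, Rgt i}, \<one>)" unfolding strands_def by blast
    thus ?thesis using image_eqI[of "Mid i" glue_snd "Lft i" s] by simp
  qed (use Y(2) in blast)
  have 5: "?C \<subseteq> cpt ?F (glue_snd a)"
  proof -
    have c: "glue_snd ` s \<subseteq> cpt ?F (glue_snd a)" using conn comp_mono[of Y ?F] by blast
    have "Outer v \<in> cpt ?F (glue_snd a)" if v: "v \<in> s" for v
    proof (cases v)
      case (Lft i)
      hence "xe ({Lft i, Rgt i}, \<one>) \<in> ?F" using v unfolding strands_def by blast
      moreover have "ends (xe ({Lft i, Rgt i}, \<one>)) = {Mid i, Outer (Lft i)}" by auto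
      moreover have "Mid i \<in> cpt ?F (glue_snd a)" using c v Lft by force
      ultimately show ?thesis unfolding Lft by (rule cpt_edge)
    next
      case (Rgt i)
      thus ?thesis using c v by force
    qed
    thus ?thesis using c by blast
  qed
  have node: "(\<exists>i. u = Outer (Lft i) \<and> Lft i \<in> s) \<or> (\<exists>i. u = Mid i \<and> Lft i \<in> s) \<or> (\<exists>i. u = Outer (Rgt i) \<and> Rgt i \<in> s)" if "u \<in> ?C" for u
  proof -
    obtain v where v: "v \<in> s" "u = glue_snd v \<or> u = Outer v" using \<open>u \<in> ?C\<close> by blast
    thus ?thesis by (cases v) auto
  qed
  have 6: "xe q \<in> ?F" if q: "q \<in> ed" "u \<in> glue_fst ` fst q" "u \<in> ?C" for q u
  proof -
    obtain i where i: "Lft i \<in> s" "Lft i \<in> fst q \<or> Rgt i \<in> fst q" using node[OF q(3)] q(2) by (metis glue_mem(1-3))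
    have Ai: "Ai i" by (rule A[OF i(1)])
    have "q = ({Lft i, Rgt i}, \<one>)" using i(2) idem_left[OF q(1), of i] idem_right[OF q(1), of i] Ai unfolding Ai_def by blast
    thus ?thesis using i(1) unfolding strands_def by blast
  qed
  have 7: "ye q \<in> ?F" if q: "q \<in> d" "u \<in> glue_snd ` fst q" "u \<in> ?C" for q u
  proof -
    obtain v where "v \<in> s" "v \<in> fst q" using node[OF q(3)] q(2) by (metis glue_mem(4-6))
    thus ?thesis using cl[OF q(1)] by blast
  qed
  note b = block[OF idem_in dD 1 2 3 4 5 6 7]
  show "cpt (TT ed d) (glue_snd a) = ?C" by (rule b(1))
  show "?C \<in> components n ed d" by (rule b(2))
  show "comp_label G ed d ?C = finprod G lab ?F" by (rule b(3))
qed

lemma outers: "{v. Outer v \<in> glue_snd ` s \<union> Outer ` s} = s"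
proof -
  have "Outer v \<in> glue_snd ` s \<union> Outer ` s \<longleftrightarrow> v \<in> s" for v by (cases v) auto
  thus ?thesis by blast
qed

lemma finite_strands: "finite s ==> finite (strands s)"
proof -
  assume "finite s"
  moreover have "strands s \<subseteq> (\<lambda>v. xe ({v, sw v}, \<one>)) ` s" unfolding strands_def by force
  ultimately show ?thesis using finite_surj by blast
qed

text \<open>By \<open>diagram_eqI\<close> it suffices that every edge of \<open>d\<close> survives
  and that no node isolated in \<open>d\<close> acquires an edge.\<close>

lemma idem_concat: "cc G n ed d = d"
proof (rule diagram_eqI[OF dD concat_closed[OF idem_in dD], symmetric])
  show "d \<subseteq> cc G n ed d"
  proof
    fix p assume p: "p \<in> d"
    show "p \<in> cc G n ed d"
    proof (cases "p \<in> M")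
      case True
      have "fst p \<subseteq> range Lft" using L True by (simp add: lset_def)
      thus ?thesis using left_edge[OF idem_in dD, of p] True by (simp add: idem_iff)
    next
      case False
      obtain a b where ab: "fst p = {a, b}" "a \<noteq> b" using diagramD(2)[OF dD p] by (auto simp: card_2_iff)
      have A: "Ai i" if "Lft i \<in> fst p" for i
      proof -
        have "i \<in> {1..n}" using that diagramD(1)[OF dD p] by (auto simp: nodes_def)
        moreover have "i \<notin> S" using d p that by (auto simp: lfam_def)
        moreover have "\<forall>q\<in>M. Lft i \<notin> fst q" using False that p diagramD(4)[OF dD p] Mp(1) by metis
        ultimately show ?thesis by (simp add: Ai_def)
      qed
      have c: "glue_snd ` fst p \<subseteq> cpt {ye p} (glue_snd a)" using cpt_edge[of "ye p" "{ye p}" "glue_snd a" "glue_snd b"] ab by simp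
      have only: "ye q \<in> {ye p}" if "q \<in> d" "v \<in> fst q" "v \<in> fst p" for q v using diagramD(4)[OF dD that(1) p that(2,3)] by simp
      have a: "a \<in> fst p" using ab by simp
      have Y1: "{ye p} \<subseteq> ye ` d" "!!e. e \<in> {ye p} ==> ends e \<subseteq> glue_snd ` fst p" using p by auto
      note b = idem_block[OF diagramD(1)[OF dD p] a Y1 only A c]
      have "finite (fst p)" using ab by simp
      hence "finprod G lab (insert (ye p) (strands (fst p))) = snd p \<otimes> finprod G lab (strands (fst p))" using diagramD(3)[OF dD p] finite_strands
        by (subst finprod_insert) (auto simp: strands_def)
      also have "finprod G lab (strands (fst p)) = \<one>" by (rule finprod_one_eqI) (auto simp: strands_def)
      finally have "finprod G lab ({ye p} \<union> strands (fst p)) = snd p" using diagramD(3)[OF dD p] by simp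
      thus ?thesis using concatI[OF b(2)] b(3) diagramD(2)[OF dD p] unfolding outers by simp
    qed
  qed
next
  fix v assume v: "v \<in> nodes n" and iso: "\<forall>p\<in>d. v \<notin> fst p"
  show "\<forall>p\<in>cc G n ed d. v \<notin> fst p"
  proof (cases "\<exists>i\<in>S. v = Lft i")
    case True
    then obtain i where i: "i \<in> S" "v = Lft i" by blast
    have "Lft i \<notin> fst p" if "p \<in> ed" for p using idem_left[OF that, of i] Mp(6)[of p i] i(1) unfolding Ai_def by blast
    thus ?thesis using left_isolated[OF idem_in dD] v i by (auto simp: nodes_def)
  next
    case False
    have A: "Ai i" if "Lft i \<in> {v}" for i using that v iso Mp(1) False by (auto simp: Ai_def nodes_def)
    have s: "{v} \<subseteq> nodes n" "v \<in> {v}" using v by auto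
    have c: "cpt (TT ed d) (glue_snd v) = glue_snd ` {v} \<union> Outer ` {v}" by (rule idem_block(1)[OF s, of "{}"]) (use iso A in auto)
    hence "Outer v \<in> cpt (TT ed d) (glue_snd v)" by simp
    note e = comp_eq[OF this, unfolded c]
    have "{u. Outer u \<in> cpt (TT ed d) (Outer v)} \<subseteq> {v}" unfolding e outers by (rule subset_refl)
    thus ?thesis using concat_isolated[OF idem_in dD] by blast
  qed
qed

lemma mid_S:
  assumes i: "i \<in> S" shows "cpt (TT ed d) (Mid i) = {Mid i}" "{Mid i} \<in> components n ed d"
proof -
  have 1: "{Mid i} \<subseteq> gnodes n" using L i by (auto simp: gnodes_def lset_def)
  have 6: "xe q \<in> {}" if q: "q \<in> ed" "u \<in> glue_fst ` fst q" "u \<in> {Mid i}" for q u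
  proof -
    have "Rgt i \<in> fst q" using q(2,3) by (metis empty_iff glue_mem(2) insert_iff)
    thus ?thesis using idem_right[OF q(1), of i] Mp(6)[of _ i] i unfolding Ai_def by blast
  qed
  have 7: "ye q \<in> {}" if q: "q \<in> d" "u \<in> glue_snd ` fst q" "u \<in> {Mid i}" for q u
  proof -
    have "Lft i \<in> fst q" using q(2,3) by (metis empty_iff glue_mem(5) insert_iff)
    thus ?thesis using d q(1) i by (auto simp: lfam_def)
  qed
  have v: "Mid i \<in> {Mid i}" and F: "{} \<subseteq> TT ed d" "!!e. e \<in> {} ==> ends e \<subseteq> {Mid i}" and c: "{Mid i} \<subseteq> cpt {} (Mid i)"
    by auto
  note b = block(1,2)[OF idem_in dD 1 v F c 6 7]
  show "cpt (TT ed d) (Mid i) = {Mid i}" by (rule b(1))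
  show "{Mid i} \<in> components n ed d" by (rule b(2))
qed

lemma mid_M:
  assumes p: "p \<in> M" and i: "Lft i \<in> fst p" shows "cpt (TT ed d) (Mid i) = glue_snd ` fst p" "glue_snd ` fst p \<in> components n ed d"
    "comp_label G ed d (glue_snd ` fst p) = \<one>" "card (glue_snd ` fst p) = 2"
proof -
  let ?p = "(sw ` fst p, inv snd p)" and ?C = "glue_snd ` fst p"
  let ?F = "{ye p, xe ?p}"
  have gs: "glue_fst ` sw ` fst p = ?C"
  proof -
    have "glue_fst (sw v) = glue_snd v" if "v \<in> fst p" for v using that Mp(2)[OF p] by (cases v) auto
    thus ?thesis by (simp add: image_image)
  qed
  obtain b where ab: "fst p = {Lft i, b}" "b \<noteq> Lft i" using Mp(4)[OF p] i by (auto simp: card_2_iff insert_commute)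
  have 1: "?C \<subseteq> gnodes n" using Mp(3)[OF p] glue_nodes(2)[of n] by blast
  have v: "Mid i \<in> ?C" using i by simp
  have F: "?F \<subseteq> TT ed d"
  proof -
    have "?p \<in> ed" using p unfolding idem_iff by blast
    hence "xe ?p \<in> TT ed d" unfolding TT_iff by blast
    moreover have "ye p \<in> TT ed d" unfolding TT_iff using Mp(1)[OF p] by blast
    ultimately show ?thesis by blast
  qed
  have F2: "ends e \<subseteq> ?C" if "e \<in> ?F" for e using that gs by auto
  have c: "?C \<subseteq> cpt ?F (Mid i)" using cpt_edge[of "ye p" ?F "Mid i" "glue_snd b"] ab by simp
  have mem: "\<exists>j. u = Mid j \<and> Lft j \<in> fst p" if "u \<in> ?C" for u
  proof -
    obtain w where w: "w \<in> fst p" "u = glue_snd w" using \<open>u \<in> ?C\<close> by blast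
    thus ?thesis using Mp(2)[OF p] by (cases w) auto
  qed
  have 6: "xe q \<in> ?F" if q: "q \<in> ed" "u \<in> glue_fst ` fst q" "u \<in> ?C" for q u
  proof -
    obtain j where j: "u = Mid j" "Lft j \<in> fst p" using mem[OF q(3)] by blast
    hence "Rgt j \<in> fst q" using q(2) by simp
    then obtain q' where "q' \<in> M" "Lft j \<in> fst q'" "q = (sw ` fst q', inv snd q')" using idem_right[OF q(1)] j(2) p unfolding Ai_def by blast
    thus ?thesis using M_eq[OF p _ j(2)] by blast
  qed
  have 7: "ye q \<in> ?F" if q: "q \<in> d" "u \<in> glue_snd ` fst q" "u \<in> ?C" for q u
  proof -
    obtain j where j: "u = Mid j" "Lft j \<in> fst p" using mem[OF q(3)] by blast
    hence "Lft j \<in> fst q" using q(2) by simp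
    thus ?thesis using diagramD(4)[OF dD q(1) Mp(1)[OF p], of "Lft j"] j by simp
  qed
  note b = block[OF idem_in dD 1 v F F2 c 6 7]
  show "cpt (TT ed d) (Mid i) = ?C" by (rule b(1))
  show "?C \<in> components n ed d" by (rule b(2))
  have "finprod G lab ?F = snd p \<otimes> inv (snd p)" using Mp(5)[OF p] by (subst finprod_insert) (auto simp: finprod_insert)
  thus "comp_label G ed d ?C = \<one>" using b(3) Mp(5)[OF p] by simp
  show "card ?C = 2" using Mp(4)[OF p] card_image[OF inj_on_subset[OF glue_inj(2) subset_UNIV]] by simp
qed

lemma M_Lft: "p \<in> M ==> \<exists>i. Lft i \<in> fst p"
proof -
  assume p: "p \<in> M"
  then obtain v where "v \<in> fst p" using Mp(4) by fastforce
  thus ?thesis using Mp(2)[OF p] by (cases v) auto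
qed

text \<open>Any other middle node is joined to the left column by an identity strand, so its
  component does not stay in the middle.\<close>

lemma mid_components: "{C \<in> components n ed d. C \<subseteq> range Mid} = mids S M"
proof
  show "mids S M \<subseteq> {C \<in> components n ed d. C \<subseteq> range Mid}"
  proof
    fix C assume "C \<in> mids S M"
    then consider i where "i \<in> S" "C = {Mid i}" | p where "p \<in> M" "C = glue_snd ` fst p" unfolding mids_def by blast
    thus "C \<in> {C \<in> components n ed d. C \<subseteq> range Mid}"
    proof cases
      case (2 p)
      obtain i where i: "Lft i \<in> fst p" using M_Lft[OF 2(1)] by blast
      have "glue_snd v \<in> range Mid" if "v \<in> fst p" for v using that Mp(2)[OF 2(1)] by (cases v) auto
      thus ?thesis using mid_M(2)[OF 2(1) i] 2 by blast
    qed (use mid_S in auto)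
  qed
  show "{C \<in> components n ed d. C \<subseteq> range Mid} \<subseteq> mids S M"
  proof clarify
    fix C assume C: "C \<in> components n ed d" "C \<subseteq> range Mid"
    then obtain w where w: "w \<in> gnodes n" "C = cpt (TT ed d) w" by (auto simp: components_eq comps_eq)
    then obtain i where i: "w = Mid i" using C(2) comp_refl[of w] by blast
    hence n: "i \<in> {1..n}" using w(1) by (auto simp: gnodes_def)
    show "C \<in> mids S M"
    proof (cases "Ai i")
      case True
      have "xe ({Lft i, Rgt i}, \<one>) \<in> TT ed d" using strand_in[OF True] unfolding TT_def pd_def by blast
      moreover have "ends (xe ({Lft i, Rgt i}, \<one>)) = {Mid i, Outer (Lft i)}" by auto
      ultimately have "Outer (Lft i) \<in> C" unfolding w(2) i by (rule cpt_edge) simp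
      thus ?thesis using C(2) by auto
    next
      case False
      then consider "i \<in> S" | p where "p \<in> M" "Lft i \<in> fst p" using n unfolding Ai_def by blast
      thus ?thesis
      proof cases
        case 1
        thus ?thesis using mid_S(1) w(2) i unfolding mids_def by auto
      next
        case (2 p)
        thus ?thesis using mid_M(1)[OF 2] w(2) i unfolding mids_def by auto
      qed
    qed
  qed
qed

end
end

context rook
begin

text \<open>A middle component with one node is contractible, one with two nodes is a loop with
  trivial label. The value depends on \<open>S\<close> and \<open>M\<close> only, so one scalar
  serves the whole right ideal.\<close>

definition uu :: "nat set => 'a diagram => 'k" where
  "uu S M = (\<Otimes>\<^bsub>k\<^esub>C\<in>mids S M. if card C = 1 then \<epsilon> else act \<one> \<delta>)"

lemma idem_mf:
  assumes L: "lset n S M" and d: "d \<in> lfam G n S M" shows "mf n (idem G n S M) d = uu S M" unfolding middle_factor_def uu_def mid_components[OF L d]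
proof (rule k.finprod_cong')
  fix C assume "C \<in> mids S M"
  then consider i where "i \<in> S" "C = {Mid i}" | p where "p \<in> M" "C = glue_snd ` fst p" unfolding mids_def by blast
  thus "(if is_loop (idem G n S M) d C then act (comp_label G (idem G n S M) d C) \<delta> else \<epsilon>) = (if card C = 1 then \<epsilon> else act \<one> \<delta>)"
  proof cases
    case (1 i)
    have "\<not> is_loop (idem G n S M) d {Mid i}" using d 1(1) by (auto simp: is_loop_def lfam_def)
    thus ?thesis using 1 by simp
  next
    case (2 p)
    obtain i where i: "Lft i \<in> fst p" using M_Lft[OF L d 2(1)] by blast
    have "is_loop (idem G n S M) d C" unfolding is_loop_def
    proof
      fix u assume "u \<in> C"
      then obtain v where v: "v \<in> fst p" "u = glue_snd v" using 2(2) by blast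
      then obtain j where j: "v = Lft j" using Mp(2)[OF L d 2(1)] by (cases v) auto
      have "(sw ` fst p, inv snd p) \<in> idem G n S M" using 2(1) unfolding idem_iff[OF L d] by blast
      moreover have "u \<in> glue_fst ` sw ` fst p" using v j by (force simp: image_image)
      ultimately show "(\<exists>q\<in>idem G n S M. u \<in> glue_fst ` fst q) \<and> (\<exists>q\<in>d. u \<in> glue_snd ` fst q)"
        using Mp(1)[OF L d 2(1)] v by (metis fst_conv image_eqI)
    qed
    thus ?thesis using mid_M[OF L d 2(1) i] 2(2) by simp
  qed
qed (use act_closed eps in auto)

end

section \<open>Permutation diagrams and the augmentation ideal\<close>

lemma permI_left:
  assumes x: "x \<in> diagrams G n" and l: "!!i. i \<in> {1..n} ==> \<exists>p\<in>x. Lft i \<in> fst p \<and> \<not> fst p \<subseteq> range Lft"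
  shows "x \<in> perm_diagrams G n"
proof -
  have "\<exists>p j. p \<in> x \<and> fst p = {Lft i, Rgt j}" if i: "i \<in> {1..n}" for i
  proof -
    obtain p where p: "p \<in> x" "Lft i \<in> fst p" "\<not> fst p \<subseteq> range Lft" using l[OF i] by blast
    obtain a b where ab: "fst p = {a, b}" "a \<noteq> b" using diagramD(2)[OF x p(1)] by (auto simp: card_2_iff)
    then obtain c where c: "fst p = {Lft i, c}" using p(2) by auto
    then obtain j where "c = Rgt j" using p(3) by (cases c) auto
    thus ?thesis using p(1) c by blast
  qed
  then obtain P r where P: "!!i. i \<in> {1..n} ==> P i \<in> x \<and> fst (P i) = {Lft i, Rgt (r i)}" by metis
  have r: "r i \<in> {1..n}" if "i \<in> {1..n}" for i using diagramD(1)[OF x, of "P i"] P[OF that] by (auto simp: nodes_def)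
  \<comment> \<open>Different left nodes have different partners, so the edges at the
    \<open>n\<close> left nodes exhaust the right column too.\<close>
  have "inj_on r {1..n}"
  proof (rule inj_onI)
    fix i j assume ij: "i \<in> {1..n}" "j \<in> {1..n}" "r i = r j"
    hence "P i = P j" using diagramD(4)[OF x, of "P i" "P j" "Rgt (r i)"] P by auto
    hence "{Lft i, Rgt (r i)} = {Lft j, Rgt (r j)}" using P[OF ij(1)] P[OF ij(2)] by metis
    thus "i = j" by (auto simp: doubleton_eq_iff)
  qed
  hence r_surj: "r ` {1..n} = {1..n}" using r by (intro endo_inj_surj) auto
  have cov: "\<exists>i\<in>{1..n}. v \<in> fst (P i)" if "v \<in> nodes n" for v
  proof (cases v)
    case (Lft i)
    hence "i \<in> {1..n}" using that by (auto simp: nodes_def)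
    thus ?thesis using P[of i] Lft by (intro bexI[of _ i]) auto
  next
    case (Rgt j)
    hence "j \<in> r ` {1..n}" using that unfolding r_surj by (auto simp: nodes_def)
    then obtain i where "i \<in> {1..n}" "j = r i" by blast
    thus ?thesis using P[of i] Rgt by (intro bexI[of _ i]) auto
  qed
  show ?thesis unfolding perm_diagrams_def
  proof (intro CollectI conjI ballI)
    show "x \<in> diagrams G n" by (rule x)
    show "\<exists>p\<in>x. v \<in> fst p" if "v \<in> nodes n" for v using cov[OF that] P by blast
    fix p assume p: "p \<in> x"
    then obtain v where v: "v \<in> fst p" using diagramD(2)[OF x p] by fastforce
    then obtain i where i: "i \<in> {1..n}" "v \<in> fst (P i)" using cov diagramD(1)[OF x p] by blast
    hence "p = P i" using diagramD(4)[OF x p _ v i(2)] P by blast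
    thus "\<not> fst p \<subseteq> range Lft" "\<not> fst p \<subseteq> range Rgt" using P[OF i(1)] by auto
  qed
qed

lemma permD:
  assumes "x \<in> perm_diagrams G n"
  shows "x \<in> diagrams G n" "v \<in> nodes n ==> \<exists>p\<in>x. v \<in> fst p" "p \<in> x ==> \<not> fst p \<subseteq> range Lft" "p \<in> x ==> \<not> fst p \<subseteq> range Rgt"
  using assms unfolding perm_diagrams_def by blast+

lemma perm_edge:
  assumes x: "x \<in> perm_diagrams G n" and p: "p \<in> x"
  obtains i j where "i \<in> {1..n}" "j \<in> {1..n}" "fst p = {Lft i, Rgt j}"
proof -
  obtain a b where ab: "fst p = {a, b}" using diagramD(2)[OF permD(1)[OF x] p] by (auto simp: card_2_iff)
  hence "\<exists>i j. fst p = {Lft i, Rgt j}" using permD(3,4)[OF x p] by (cases a; cases b) (auto simp: insert_commute)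
  then obtain i j where "fst p = {Lft i, Rgt j}" by blast
  thus ?thesis using that[of i j] diagramD(1)[OF permD(1)[OF x] p] by (auto simp: nodes_def)
qed

lemma perm_edge_at:
  assumes "x \<in> perm_diagrams G n" "p \<in> x"
  shows "Lft i \<in> fst p ==> \<exists>j\<in>{1..n}. fst p = {Lft i, Rgt j}" "Rgt i \<in> fst p ==> \<exists>j\<in>{1..n}. fst p = {Lft j, Rgt i}"
  by (rule perm_edge[OF assms]; auto)+

lemma trd_perm: "x \<in> perm_diagrams G n ==> trd x \<in> perm_diagrams G n"
proof -
  assume x: "x \<in> perm_diagrams G n"
  show "trd x \<in> perm_diagrams G n"
  proof (rule permI_left)
    show "trd x \<in> diagrams G n" by (rule trd_diagrams[OF permD(1)[OF x]])
    fix i assume "i \<in> {1..n}"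
    then obtain p where p: "p \<in> x" "Rgt i \<in> fst p" using permD(2)[OF x, of "Rgt i"] by (auto simp: nodes_def)
    then obtain j where "fst p = {Lft j, Rgt i}" using perm_edge_at(2)[OF x p] by blast
    hence "sw ` fst p = {Rgt j, Lft i}" by simp
    thus "\<exists>p\<in>trd x. Lft i \<in> fst p \<and> \<not> fst p \<subseteq> range Lft"
      using p(1) unfolding trd_def by (intro bexI[of _ "(sw ` fst p, snd p)"]) auto
  qed
qed

lemma id_diagram_idem: "id_diagram G n = idem G n {} {}" by (auto simp: id_diagram_def idem_def)

lemma trd_id: "trd (id_diagram G n) = id_diagram G n"
proof -
  have "id_diagram G n = (\<lambda>i. ({Lft i, Rgt i}, \<one>\<^bsub>G\<^esub>)) ` {1..n}" by (auto simp: id_diagram_def)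
  thus ?thesis by (simp add: trd_def image_image insert_commute)
qed

context rook
begin

lemma lset0: "lset n {} {}" "d \<in> diagrams G n ==> d \<in> lfam G n {} {}" by (auto simp: lset_def lfam_def)

lemma uu0: "uu {} {} = \<one>\<^bsub>k\<^esub>" by (simp add: uu_def mids_def)

lemma id_in: "id_diagram G n \<in> diagrams G n"
proof -
  have "{} \<in> diagrams G n" by (simp add: diagrams_def)
  thus ?thesis unfolding id_diagram_idem by (rule idem_in[OF lset0])
qed

lemma id_left: "d \<in> diagrams G n ==> cc G n (id_diagram G n) d = d"
  "d \<in> diagrams G n ==> mf n (id_diagram G n) d = \<one>\<^bsub>k\<^esub>"
  unfolding id_diagram_idem by (simp_all add: idem_concat[OF lset0] idem_mf[OF lset0] uu0)

lemma id_right: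
  assumes d: "d \<in> diagrams G n" shows "cc G n d (id_diagram G n) = d" "mf n d (id_diagram G n) = \<one>\<^bsub>k\<^esub>"
  using trd_concat[OF id_in trd_diagrams[OF d]] id_left[OF trd_diagrams[OF d]] by (simp_all add: trd_id)

lemma mf_closed: "x \<in> diagrams G n ==> y \<in> diagrams G n ==> mf n x y \<in> carrier k" unfolding middle_factor_def
  by (rule k.finprod_closed) (auto simp: comp_label_eq eps intro!: act_closed glab_closed[OF TT_gr])

text \<open>A left node that is isolated in \<open>x\<close>, or lies on a left-to-left edge of
  \<open>x\<close>, stays so in the product.\<close>

lemma perm_concat_left:
  assumes x: "x \<in> diagrams G n" and y: "y \<in> diagrams G n" and xy: "cc G n x y \<in> perm_diagrams G n" shows "x \<in> perm_diagrams G n"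
proof (rule permI_left[OF x], rule ccontr)
  fix i assume i: "i \<in> {1..n}" and "\<not> (\<exists>p\<in>x. Lft i \<in> fst p \<and> \<not> fst p \<subseteq> range Lft)"
  then consider "!!p. p \<in> x ==> Lft i \<notin> fst p" | p where "p \<in> x" "fst p \<subseteq> range Lft" by blast
  thus False
  proof cases
    case 1
    have "Lft i \<in> nodes n" using i by (auto simp: nodes_def)
    from permD(2)[OF xy this] show False using left_isolated[OF x y i 1] by blast
  next
    case (2 p)
    thus False using left_edge[OF x y] permD(3)[OF xy] by blast
  qed
qed

lemma perm_concat_right:
  assumes x: "x \<in> diagrams G n" and y: "y \<in> diagrams G n" and xy: "cc G n x y \<in> perm_diagrams G n" shows "y \<in> perm_diagrams G n"
proof -
  have "cc G n (trd y) (trd x) \<in> perm_diagrams G n" unfolding trd_concat(1)[OF x y] by (rule trd_perm[OF xy])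
  hence "trd y \<in> perm_diagrams G n" by (rule perm_concat_left[OF trd_diagrams[OF y] trd_diagrams[OF x]])
  from trd_perm[OF this] show ?thesis by simp
qed

text \<open>In a permutation diagram every left node is joined to the right column, so no component
  remains in the middle.\<close>

lemma mf_perm:
  assumes x: "x \<in> diagrams G n" and y: "y \<in> perm_diagrams G n" shows "mf n x y = \<one>\<^bsub>k\<^esub>"
proof -
  have "\<not> C \<subseteq> range Mid" if C: "C \<in> components n x y" for C
  proof
    assume s: "C \<subseteq> range Mid"
    obtain w where w: "w \<in> gnodes n" "C = cpt (TT x y) w" using C by (auto simp: components_eq comps_eq)
    then obtain j where j: "w = Mid j" using s comp_refl[of w] by blast
    hence "Lft j \<in> nodes n" using w(1) by (auto simp: gnodes_def nodes_def)
    then obtain q where q: "q \<in> y" "Lft j \<in> fst q" using permD(2)[OF y] by blast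
    then obtain i where i: "fst q = {Lft j, Rgt i}" using perm_edge_at(1)[OF y q] by blast
    have "ye q \<in> TT x y" using q(1) unfolding TT_iff by blast
    moreover have "ends (ye q) = {Mid j, Outer (Rgt i)}" using i by simp
    ultimately have "Outer (Rgt i) \<in> C" unfolding w(2) j by (rule cpt_edge) simp
    thus False using s by auto
  qed
  hence "{C \<in> components n x y. C \<subseteq> range Mid} = {}" by blast
  thus ?thesis unfolding middle_factor_def by (simp only: k.finprod_empty)
qed

end

section \<open>Permutation diagrams as equivariant permutations\<close>

definition iot :: "('g, 'x) monoid_scheme => nat => (nat \<times> 'g => nat \<times> 'g) => 'g diagram" where
  "iot G n f = (\<lambda>i. ({Lft (fst (f (i, \<one>\<^bsub>G\<^esub>))), Rgt i}, snd (f (i, \<one>\<^bsub>G\<^esub>)))) ` {1..n}"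

context comm_group
begin

lemma wp_one:
  assumes f: "f \<in> wp G I" and i: "i \<in> I"
  shows "fst (f (i, \<one>)) \<in> I" "snd (f (i, \<one>)) \<in> carrier G" "h \<in> carrier G ==> f (i, h) = (fst (f (i, \<one>)), snd (f (i, \<one>)) \<otimes> h)"
proof -
  have "f (i, \<one>) \<in> lt G I" by (rule wp_in[OF f]) (use i in auto)
  thus "fst (f (i, \<one>)) \<in> I" "snd (f (i, \<one>)) \<in> carrier G" by auto
  show "h \<in> carrier G ==> f (i, h) = (fst (f (i, \<one>)), snd (f (i, \<one>)) \<otimes> h)"
    using wp_equivar[OF f i one_closed, of h "fst (f (i, \<one>))" "snd (f (i, \<one>))"] by simp
qed

lemma wp_bij_fst:
  assumes f: "f \<in> wp G {1..n}" shows "inj_on (\<lambda>i. fst (f (i, \<one>))) {1..n}" "(\<lambda>i. fst (f (i, \<one>))) ` {1..n} = {1..n}"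
proof -
  show i: "inj_on (\<lambda>i. fst (f (i, \<one>))) {1..n}" by (rule inj_onI) (use wp_fst_inj[OF f, of "(_, \<one>)" "(_, \<one>)"] in auto)
  show "(\<lambda>i. fst (f (i, \<one>))) ` {1..n} = {1..n}" by (rule endo_inj_surj[OF _ _ i]) (use wp_one(1)[OF f] in auto)
qed

lemma wp_eqI:
  assumes f: "f \<in> wp G I" and g: "g \<in> wp G I" and eq: "!!i. i \<in> I ==> f (i, \<one>) = g (i, \<one>)" shows "f = g"
proof
  fix x :: "nat \<times> 'a"
  obtain i h where x: "x = (i, h)" by fastforce
  show "f x = g x"
  proof (cases "i \<in> I \<and> h \<in> carrier G")
    case True
    thus ?thesis using wp_one(3)[OF f, of i h] wp_one(3)[OF g, of i h] eq[of i] x by (simp only:)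
  next
    case False
    hence "x \<notin> lt G I" using x by auto
    thus ?thesis using wp_out[OF f] wp_out[OF g] by simp
  qed
qed

lemma iot_perm:
  assumes f: "f \<in> wp G {1..n}" shows "iot G n f \<in> perm_diagrams G n"
proof -
  let ?s = "\<lambda>i. fst (f (i, \<one>))"
  have D: "iot G n f \<in> diagrams G n" unfolding diagrams_def
  proof (intro CollectI conjI ballI impI)
    fix p assume "p \<in> iot G n f"
    then obtain i where i: "i \<in> {1..n}" "p = ({Lft (?s i), Rgt i}, snd (f (i, \<one>)))" unfolding iot_def by blast
    show "fst p \<subseteq> nodes n" using i wp_one(1)[OF f i(1)] by (auto simp: nodes_def)
    show "card (fst p) = 2" "snd p \<in> carrier G" using i wp_one(2)[OF f i(1)] by auto
    fix p' assume "p' \<in> iot G n f" and ne: "p \<noteq> p'"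
    then obtain j where j: "j \<in> {1..n}" "p' = ({Lft (?s j), Rgt j}, snd (f (j, \<one>)))" unfolding iot_def by blast
    hence "i \<noteq> j" using ne i by auto
    hence "?s i \<noteq> ?s j" using inj_onD[OF wp_bij_fst(1)[OF f]] i(1) j(1) by blast
    thus "fst p \<inter> fst p' = {}" using i(2) j(2) \<open>i \<noteq> j\<close> by auto
  qed
  show ?thesis
  proof (rule permI_left[OF D])
    fix i assume "i \<in> {1..n}"
    then obtain j where "j \<in> {1..n}" "i = ?s j" using wp_bij_fst(2)[OF f] by blast
    thus "\<exists>p\<in>iot G n f. Lft i \<in> fst p \<and> \<not> fst p \<subseteq> range Lft" unfolding iot_def by auto
  qed
qed

lemma iot_inj: "inj_on (iot G n) (wp G {1..n})"
proof (rule inj_onI)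
  fix f g assume f: "f \<in> wp G {1..n}" and g: "g \<in> wp G {1..n}" and eq: "iot G n f = iot G n g"
  show "f = g"
  proof (rule wp_eqI[OF f g])
    fix i assume i: "i \<in> {1..n}"
    have "({Lft (fst (f (i, \<one>))), Rgt i}, snd (f (i, \<one>))) \<in> iot G n g" unfolding eq[symmetric] unfolding iot_def using i by blast
    then obtain j where "({Lft (fst (f (i, \<one>))), Rgt i}, snd (f (i, \<one>))) = ({Lft (fst (g (j, \<one>))), Rgt j}, snd (g (j, \<one>)))"
      unfolding iot_def by blast
    hence "j = i" "fst (f (i, \<one>)) = fst (g (j, \<one>))" "snd (f (i, \<one>)) = snd (g (j, \<one>))" by (auto simp: doubleton_eq_iff)
    thus "f (i, \<one>) = g (i, \<one>)" by (simp add: prod_eq_iff)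
  qed
qed

text \<open>This is transitivity on words of full length: a word that lists all indices prescribes
  the values at all \<open>(i, \<one>)\<close>.\<close>

lemma wp_exists:
  assumes s: "inj_on s {1..n}" "!!i. i \<in> {1..n} ==> s i \<in> {1..n}" "!!i. i \<in> {1..n} ==> a i \<in> carrier G"
  obtains f where "f \<in> wp G {1..n}" "!!i. i \<in> {1..n} ==> f (i, \<one>) = (s i, a i)"
proof -
  let ?l = "[1..<Suc n]"
  have sl: "set ?l = {1..n}" by auto
  have "map (\<lambda>i. (i, \<one>)) ?l \<in> words {1..n} (carrier G) n" by (auto simp: words_def comp_def)
  moreover have "map (\<lambda>i. (s i, a i)) ?l \<in> words {1..n} (carrier G) n"
  proof -
    have "map fst (map (\<lambda>i. (s i, a i)) ?l) = map s ?l" by simp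
    moreover have "distinct (map s ?l)" unfolding distinct_map sl using s(1) by simp
    ultimately show ?thesis using s(2,3) sl unfolding words_def by (auto simp: comp_def simp del: upt_Suc)
  qed
  ultimately obtain f where f: "f \<in> wp G {1..n}" "map f (map (\<lambda>i. (i, \<one>)) ?l) = map (\<lambda>i. (s i, a i)) ?l" using wp_transitive by blast
  have "f (i, \<one>) = (s i, a i)" if "i \<in> {1..n}" for i using f(2) that sl unfolding map_map by (auto simp: map_eq_conv simp del: upt_Suc)
  thus ?thesis using that f(1) by blast
qed

lemma iot_surj:
  assumes x: "x \<in> perm_diagrams G n" shows "x \<in> iot G n ` wp G {1..n}"
proof -
  have "\<exists>p j. p \<in> x \<and> j \<in> {1..n} \<and> fst p = {Lft j, Rgt i}" if "i \<in> {1..n}" for i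
  proof -
    have "Rgt i \<in> nodes n" using that by (auto simp: nodes_def)
    then obtain p where p: "p \<in> x" "Rgt i \<in> fst p" using permD(2)[OF x] by blast
    thus ?thesis using perm_edge_at(2)[OF x p] by blast
  qed
  then obtain P s where P: "!!i. i \<in> {1..n} ==> P i \<in> x \<and> s i \<in> {1..n} \<and> fst (P i) = {Lft (s i), Rgt i}" by metis
  note D = permD(1)[OF x]
  have i: "inj_on s {1..n}"
  proof (rule inj_onI)
    fix i j assume ij: "i \<in> {1..n}" "j \<in> {1..n}" "s i = s j"
    hence "P i = P j" using diagramD(4)[OF D, of "P i" "P j" "Lft (s i)"] P by auto
    hence "{Lft (s i), Rgt i} = {Lft (s j), Rgt j}" using P[OF ij(1)] P[OF ij(2)] by metis
    thus "i = j" by (auto simp: doubleton_eq_iff)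
  qed
  obtain f where f: "f \<in> wp G {1..n}" "!!i. i \<in> {1..n} ==> f (i, \<one>) = (s i, snd (P i))"
    using wp_exists[OF i, of "\<lambda>i. snd (P i)"] P diagramD(3)[OF D] by blast
  have "iot G n f = P ` {1..n}" unfolding iot_def by (rule image_cong) (use f(2) P in \<open>auto simp: prod_eq_iff\<close>)
  moreover have "P ` {1..n} \<subseteq> x" by (rule image_subsetI) (use P in simp)
  ultimately have sub: "iot G n f \<subseteq> x" by simp
  have "iot G n f = x"
  proof (rule diagram_eqI[OF permD(1)[OF iot_perm[OF f(1)]] D sub])
    fix v assume "v \<in> nodes n" "\<forall>p\<in>iot G n f. v \<notin> fst p"
    with permD(2)[OF iot_perm[OF f(1)], of v] show "\<forall>p\<in>x. v \<notin> fst p" by simp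
  qed
  thus ?thesis using f(1) by blast
qed

lemma iot_bij: "bij_betw (iot G n) (wp G {1..n}) (perm_diagrams G n)" unfolding bij_betw_def using iot_inj iot_surj iot_perm by blast

lemma iot_id: "iot G n id = id_diagram G n" by (auto simp: iot_def id_diagram_def)

text \<open>The right column is the source of a permutation: the edge ending at \<open>i\<close>
  starts at the image of \<open>(i, \<one>)\<close>. Hence gluing and composition have the same
  order.\<close>

lemma iot_comp:
  assumes v: "v \<in> wp G {1..n}" and w: "w \<in> wp G {1..n}" shows "iot G n (v \<circ> w) = cc G n (iot G n v) (iot G n w)"
proof -
  note x = permD(1)[OF iot_perm[OF v]] and y = permD(1)[OF iot_perm[OF w]]
  have vw: "v \<circ> w \<in> wp G {1..n}" by (rule wp_comp[OF v w])
  show ?thesis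
  proof (rule diagram_eqI[OF permD(1)[OF iot_perm[OF vw]] concat_closed[OF x y]])
    show "iot G n (v \<circ> w) \<subseteq> cc G n (iot G n v) (iot G n w)"
    proof
      fix r assume "r \<in> iot G n (v \<circ> w)"
      then obtain i where i: "i \<in> {1..n}" "r = ({Lft (fst (v (w (i, \<one>)))), Rgt i}, snd (v (w (i, \<one>))))" unfolding iot_def by auto
      define j b where "j = fst (w (i, \<one>))" and "b = snd (w (i, \<one>))"
      define l a where "l = fst (v (j, \<one>))" and "a = snd (v (j, \<one>))"
      have j: "j \<in> {1..n}" "b \<in> carrier G" using wp_one(1,2)[OF w i(1)] by (simp_all add: j_def b_def)
      have l: "l \<in> {1..n}" "a \<in> carrier G" using wp_one(1,2)[OF v j(1)] by (simp_all add: l_def a_def)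
      have "v (j, b) = (l, a \<otimes> b)" unfolding l_def a_def by (rule wp_one(3)[OF v j])
      hence "v (w (i, \<one>)) = (l, a \<otimes> b)" by (simp add: j_def b_def)
      hence r: "r = ({Lft l, Rgt i}, a \<otimes> b)" using i by simp
      define p q where "p = ({Lft l, Rgt j}, a)" and "q = ({Lft j, Rgt i}, b)"
      have p: "p \<in> iot G n v" unfolding iot_def p_def using j(1) by (simp add: l_def a_def)
      have q: "q \<in> iot G n w" unfolding iot_def q_def using i(1) by (simp add: j_def b_def)
      let ?C = "{Mid j, Outer (Lft l), Outer (Rgt i)}" and ?F = "{xe p, ye q}"
      have 1: "?C \<subseteq> gnodes n" using i(1) j l by (auto simp: gnodes_def nodes_def)
      have 3: "?F \<subseteq> TT (iot G n v) (iot G n w)"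
      proof -
        have "xe p \<in> TT (iot G n v) (iot G n w)" unfolding TT_iff using p by blast
        moreover have "ye q \<in> TT (iot G n v) (iot G n w)" unfolding TT_iff using q by blast
        ultimately show ?thesis by (simp only: insert_subset empty_subsetI simp_thms)
      qed
      have pe: "ends (xe p) = {Mid j, Outer (Lft l)}" "ends (ye q) = {Mid j, Outer (Rgt i)}" by (auto simp: p_def q_def)
      have 4: "ends e \<subseteq> ?C" if "e \<in> ?F" for e
      proof -
        have "e = xe p \<or> e = ye q" using that by (simp only: insert_iff empty_iff simp_thms)
        thus ?thesis using pe by (elim disjE) (simp_all only:, auto)
      qed
      have 5: "?C \<subseteq> cpt ?F (Mid j)" using cpt_edge[of "xe p" ?F, OF _ pe(1) comp_refl] cpt_edge[of "ye q" ?F, OF _ pe(2) comp_refl]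
        by (simp only: insert_subset insert_iff comp_refl empty_subsetI simp_thms)
      have 6: "xe p' \<in> ?F" if p': "p' \<in> iot G n v" "u \<in> glue_fst ` fst p'" "u \<in> ?C" for p' u
      proof -
        have "Rgt j \<in> fst p' \<or> Lft l \<in> fst p'" using p'(2,3) by (metis glue_mem(1-3) insertE singletonD)
        hence "p' = p" using diagramD(4)[OF x p'(1) p] by (auto simp: p_def)
        thus ?thesis by simp
      qed
      have 7: "ye q' \<in> ?F" if q': "q' \<in> iot G n w" "u \<in> glue_snd ` fst q'" "u \<in> ?C" for q' u
      proof -
        have "Lft j \<in> fst q' \<or> Rgt i \<in> fst q'" using q'(2,3) by (metis glue_mem(4-6) insertE singletonD)
        hence "q' = q" using diagramD(4)[OF y q'(1) q] by (auto simp: q_def)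
        thus ?thesis by simp
      qed
      note B = block(2,3)[OF x y 1 _ 3 4 5 6 7]
      have o: "{v. Outer v \<in> ?C} = {Lft l, Rgt i}" by auto
      have "finprod G lab ?F = a \<otimes> b" using j(2) l(2) by (subst finprod_insert) (auto simp: p_def q_def)
      thus "r \<in> cc G n (iot G n v) (iot G n w)" using concatI[OF B(1)] B(2) unfolding o r by simp
    qed
  next
    fix u assume "u \<in> nodes n" "\<forall>p\<in>iot G n (v \<circ> w). u \<notin> fst p"
    with permD(2)[OF iot_perm[OF vw], of u] show "\<forall>p\<in>cc G n (iot G n v) (iot G n w). u \<notin> fst p" by simp
  qed
qed

end

section \<open>The diagram algebra satisfies the hypotheses of the comparison\<close>

locale rook_units = rook G k act \<delta> \<epsilon> for G (structure) and k :: "('k, 'y) ring_scheme" and act \<delta> \<epsilon> +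
  assumes act_unit: "act \<one> \<delta> \<in> Units k" and eps_unit: "\<epsilon> \<in> Units k"
begin

lemma grb_basis_algebra: "basis_algebra k (diagrams G n) (perm_diagrams G n) (cc G n) (mf n) (id_diagram G n) (wp G {1..n}) (iot G n)"
proof unfold_locales
  show "id_diagram G n \<in> perm_diagrams G n" using iot_perm[OF wp_id] by (simp add: iot_id)
  show "perm_diagrams G n \<subseteq> diagrams G n" using permD(1) by blast
  show "cc G n x y \<in> perm_diagrams G n \<longleftrightarrow> x \<in> perm_diagrams G n \<and> y \<in> perm_diagrams G n"
    if "x \<in> diagrams G n" "y \<in> diagrams G n" for x y
  proof
    assume "x \<in> perm_diagrams G n \<and> y \<in> perm_diagrams G n"
    then obtain v w where vw: "v \<in> wp G {1..n}" "w \<in> wp G {1..n}" "x = iot G n v" "y = iot G n w" using iot_surj by blast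
    thus "cc G n x y \<in> perm_diagrams G n" using iot_comp[OF vw(1,2)] iot_perm[OF wp_comp[OF vw(1,2)]] by simp
  qed (use perm_concat_left[OF that] perm_concat_right[OF that] in blast)
qed (auto simp: concat_closed concat_assoc mf_closed middle_cocycle id_left id_right mf_perm permD(1)
    wp_bij wp_comp wp_inv wp_id iot_comp iot_id intro: iot_bij[simplified])

lemma finprod_Units: "(!!x. x \<in> A ==> f x \<in> Units k) ==> (\<Otimes>\<^bsub>k\<^esub>x\<in>A. f x) \<in> Units k"
proof (induction A rule: infinite_finite_induct)
  case (insert x F)
  hence "(\<Otimes>\<^bsub>k\<^esub>x\<in>insert x F. f x) = f x \<otimes>\<^bsub>k\<^esub> (\<Otimes>\<^bsub>k\<^esub>x\<in>F. f x)"
    by (intro k.finprod_insert) (auto intro: k.Units_closed)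
  thus ?case using insert by simp
qed (auto simp: k.finprod_infinite)

lemma idem_lfam:
  assumes L: "lset n S M" and d: "d \<in> lfam G n S M" and y: "y \<in> diagrams G n" shows "cc G n (idem G n S M) y \<in> lfam G n S M"
proof -
  note e = idem_in[OF L d]
  have "M \<subseteq> cc G n (idem G n S M) y"
  proof
    fix p assume "p \<in> M"
    thus "p \<in> cc G n (idem G n S M) y" using L by (intro left_edge[OF e y]) (auto simp: idem_def lset_def)
  qed
  moreover have "Lft i \<notin> fst p" if "p \<in> cc G n (idem G n S M) y" "i \<in> S" for p i
  proof (rule left_isolated[OF e y _ _ that(1)])
    show "i \<in> {1..n}" using L that(2) by (auto simp: lset_def)
    show "Lft i \<notin> fst q" if "q \<in> idem G n S M" for q
      using idem_left[OF L d that, of i] Mp(6)[OF L d, of q i] \<open>i \<in> S\<close> unfolding Ai_def[OF L d] by blast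
  qed
  ultimately show ?thesis using concat_closed[OF e y] by (auto simp: lfam_def)
qed

lemma grb_resolution: "basis_algebra_res k (diagrams G n) (perm_diagrams G n) (cc G n) (mf n) (id_diagram G n) (wp G {1..n}) (iot G n)"
proof -
  interpret A: basis_algebra k "diagrams G n" "perm_diagrams G n" "cc G n" "mf n" "id_diagram G n" "wp G {1..n}" "iot G n" by (rule grb_basis_algebra)
  \<comment> \<open>A diagram that is not a permutation has a left node that is isolated or lies on
    a left-to-left edge, so it belongs to a member given by a single node or a single edge.\<close>
  let ?P = "{lfam G n S M | S M. lset n S M \<and> (S \<noteq> {} \<or> M \<noteq> {})}"
  show ?thesis
  proof (unfold_locales, rule A.acyc_from_idempotents[of ?P])
    fix d assume d: "d \<in> diagrams G n - perm_diagrams G n"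
    then obtain i where i: "i \<in> {1..n}" "\<not> (\<exists>p\<in>d. Lft i \<in> fst p \<and> \<not> fst p \<subseteq> range Lft)"
      using permI_left[of d G n] by blast
    show "\<exists>P\<in>?P. d \<in> P"
    proof (cases "\<exists>p\<in>d. Lft i \<in> fst p")
      case True
      then obtain p where p: "p \<in> d" "fst p \<subseteq> range Lft" using i(2) by blast
      hence "d \<in> lfam G n {} {p}" "lset n {} {p}" using d by (auto simp: lfam_def lset_def)
      thus ?thesis by blast
    next
      case False
      hence "d \<in> lfam G n {i} {}" "lset n {i} {}" using d i(1) by (auto simp: lfam_def lset_def)
      thus ?thesis by blast
    qed
  next
    fix P assume "P \<in> ?P"
    then obtain S M where P: "P = lfam G n S M" "lset n S M" "S \<noteq> {} \<or> M \<noteq> {}" by blast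
    show "P \<subseteq> diagrams G n - perm_diagrams G n"
    proof
      fix d assume d: "d \<in> P"
      hence D: "d \<in> diagrams G n" "M \<subseteq> d" "!!p i. p \<in> d ==> i \<in> S ==> Lft i \<notin> fst p" by (auto simp: P(1) lfam_def)
      have "d \<notin> perm_diagrams G n"
      proof
        assume t: "d \<in> perm_diagrams G n"
        have "S = {}"
        proof (rule ccontr)
          assume "S \<noteq> {}"
          then obtain i where i: "i \<in> S" by blast
          hence "Lft i \<in> nodes n" using P(2) by (auto simp: nodes_def lset_def)
          thus False using permD(2)[OF t] D(3) i by blast
        qed
        then obtain p where "p \<in> M" using P(3) by blast
        thus False using permD(3)[OF t, of p] D(2) P(2) unfolding lset_def by blast
      qed
      thus "d \<in> diagrams G n - perm_diagrams G n" using D(1) by blast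
    qed
  next
    fix P Q assume "P \<in> ?P" "Q \<in> ?P"
    then obtain S M S' M' where *: "P = lfam G n S M" "lset n S M" "S \<noteq> {} \<or> M \<noteq> {}" "Q = lfam G n S' M'" "lset n S' M'" by blast
    hence "P \<inter> Q = lfam G n (S \<union> S') (M \<union> M')" "lset n (S \<union> S') (M \<union> M')" by (auto simp: lfam_inter lset_def)
    thus "P \<inter> Q \<in> ?P" using *(3) by blast
  next
    fix P assume "P \<in> ?P" "P \<noteq> {}"
    \<comment> \<open>A member \<open>d\<close> of \<open>P\<close> certifies that the edges of
      \<open>M\<close> are disjoint and avoid \<open>S\<close>, so that \<open>idem\<close> is a
      diagram.\<close>
    then obtain S M d where P: "P = lfam G n S M" "lset n S M" "d \<in> lfam G n S M" by blast
    have u: "uu S M \<in> Units k" unfolding uu_def by (rule finprod_Units) (use act_unit eps_unit in auto)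
    have "emb k (inv\<^bsub>k\<^esub> uu S M) * emb k (uu S M) = eta k"
      using k.emb_mult[OF k.Units_inv_closed[OF u] k.Units_closed[OF u]] k.Units_l_inv[OF u] by simp
    thus "\<exists>e\<in>diagrams G n. \<exists>u v. v * u = eta k \<and> (\<forall>d\<in>P. cc G n e d = d \<and> A.cu e d = u) \<and>
        (\<forall>y\<in>diagrams G n. cc G n e y \<in> P)"
      using idem_in[OF P(2,3)] idem_concat[OF P(2)] idem_mf[OF P(2)] idem_lfam[OF P(2,3)] unfolding P(1) A.cu_def
      by (intro bexI[of _ "idem G n S M"] exI[of _ "emb k (uu S M)"] exI[of _ "emb k (inv\<^bsub>k\<^esub> uu S M)"]) auto
  qed
qed

end

subsection \<open>The group algebra of the wreath product\<close>

definition sg1 :: "('g, 'x) monoid_scheme => nat => (nat \<times> 'g => nat \<times> 'g) => nat => nat" where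
  "sg1 G n f i = (if i \<in> {1..n} then fst (f (i, \<one>\<^bsub>G\<^esub>)) else i)"

text \<open>The semidirect product indexes labels by the target of a strand, whereas the value at
  \<open>(i, \<one>)\<close> belongs to its source; \<open>perm_factors\<close> translates between
  the two.\<close>

definition ios :: "('g, 'x) monoid_scheme => nat => (nat \<times> 'g => nat \<times> 'g) => (nat => 'g) \<times> (nat => nat)" where
  "ios G n f = (perm_factors n (sg1 G n f) (\<lambda>i. snd (f (i, \<one>\<^bsub>G\<^esub>))), sg1 G n f)"

lemma wreath_simps: "carrier (power_semidirect_sym G n) = ({1..n} \<rightarrow>\<^sub>E carrier G) \<times> {p. p permutes {1..n}}"
  "\<one>\<^bsub>power_semidirect_sym G n\<^esub> = (\<lambda>i\<in>{1..n}. \<one>\<^bsub>G\<^esub>, id)"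
  "(a, s) \<otimes>\<^bsub>power_semidirect_sym G n\<^esub> (b, t) = ((\<lambda>i\<in>{1..n}. a i \<otimes>\<^bsub>G\<^esub> perm_factors n s b i), s \<circ> t)"
  by (simp_all add: power_semidirect_sym_def semidirect_def sym_group_def)

context comm_group
begin

lemma sg1_permutes:
  assumes f: "f \<in> wp G {1..n}" shows "sg1 G n f permutes {1..n}"
proof (rule bij_imp_permutes)
  have "inj_on (sg1 G n f) {1..n}" using wp_bij_fst(1)[OF f] by (rule inj_on_cong[THEN iffD1, rotated]) (simp add: sg1_def)
  moreover have "sg1 G n f ` {1..n} = {1..n}"
    using wp_bij_fst(2)[OF f] by (subst image_cong[OF refl, of _ _ "\<lambda>i. fst (f (i, \<one>))"]) (simp_all add: sg1_def)
  ultimately show "bij_betw (sg1 G n f) {1..n} {1..n}" by (simp add: bij_betw_def)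
qed (auto simp: sg1_def)

lemma finv_perm: "s permutes A ==> finv s (s i) = i" "s permutes A ==> s (finv s i) = i" "s permutes A ==> finv s i \<in> A \<longleftrightarrow> i \<in> A"
  using permutes_inverses[of s A] permutes_in_image[OF permutes_inv[of s A]] by blast+

lemma ios_in:
  assumes f: "f \<in> wp G {1..n}" shows "ios G n f \<in> carrier (power_semidirect_sym G n)" unfolding ios_def wreath_simps perm_factors_def
  using sg1_permutes[OF f] wp_one(2)[OF f] finv_perm(3)[OF sg1_permutes[OF f]] by auto

lemma ios_at: "f \<in> wp G {1..n} ==> i \<in> {1..n} ==> f (i, \<one>) = (snd (ios G n f) i, fst (ios G n f) (snd (ios G n f) i))"
proof -
  assume f: "f \<in> wp G {1..n}" and i: "i \<in> {1..n}"
  note p = sg1_permutes[OF f]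
  have "sg1 G n f i \<in> {1..n}" using permutes_in_image[OF p] i by blast
  hence "perm_factors n (sg1 G n f) (\<lambda>i. snd (f (i, \<one>))) (sg1 G n f i) = snd (f (i, \<one>))"
    unfolding perm_factors_def by (simp add: finv_perm(1)[OF p])
  thus ?thesis using i by (simp add: ios_def sg1_def prod_eq_iff)
qed

lemma ios_bij: "bij_betw (ios G n) (wp G {1..n}) (carrier (power_semidirect_sym G n))"
proof -
  have "inj_on (ios G n) (wp G {1..n})"
  proof (rule inj_onI)
    fix f g assume "f \<in> wp G {1..n}" "g \<in> wp G {1..n}" "ios G n f = ios G n g"
    thus "f = g" using ios_at[of f n] ios_at[of g n] by (intro wp_eqI[of f "{1..n}" g]) simp_all
  qed
  moreover have "x \<in> ios G n ` wp G {1..n}" if x: "x \<in> carrier (power_semidirect_sym G n)" for x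
  proof -
    obtain a s where as: "x = (a, s)" "a \<in> {1..n} \<rightarrow>\<^sub>E carrier G" "s permutes {1..n}" using x unfolding wreath_simps by auto
    have s: "s i \<in> {1..n} \<longleftrightarrow> i \<in> {1..n}" for i by (rule permutes_in_image[OF as(3)])
    obtain f where f: "f \<in> wp G {1..n}" "!!i. i \<in> {1..n} ==> f (i, \<one>) = (s i, a (s i))"
    proof (rule wp_exists[of s n "\<lambda>i. a (s i)"])
      show "inj_on s {1..n}" using permutes_inj_on[OF as(3)] .
      show "s i \<in> {1..n}" if "i \<in> {1..n}" for i using s that by blast
      show "a (s i) \<in> carrier G" if "i \<in> {1..n}" for i using s[of i] that as(2) by blast
    qed blast
    have "sg1 G n f = s" using f(2) permutes_not_in[OF as(3)] by (auto simp: sg1_def fun_eq_iff)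
    moreover have "perm_factors n s (\<lambda>i. snd (f (i, \<one>))) = a"
    proof
      fix i
      show "perm_factors n s (\<lambda>i. snd (f (i, \<one>))) i = a i"
      proof (cases "i \<in> {1..n}")
        case True
        hence "finv s i \<in> {1..n}" using finv_perm(3)[OF as(3)] by blast
        thus ?thesis using f(2)[of "finv s i"] True finv_perm(2)[OF as(3)] unfolding perm_factors_def by simp
      next
        case False
        thus ?thesis using as(2) unfolding perm_factors_def by (simp add: PiE_def extensional_def del: atLeastAtMost_iff)
      qed
    qed
    ultimately have "ios G n f = x" using as(1) by (simp add: ios_def)
    thus ?thesis using f(1) by blast
  qed
  ultimately show ?thesis using ios_in unfolding bij_betw_def by blast
qed

lemma ios_comp:
  assumes v: "v \<in> wp G {1..n}" and w: "w \<in> wp G {1..n}" shows "ios G n (v \<circ> w) = ios G n v \<otimes>\<^bsub>power_semidirect_sym G n\<^esub> ios G n w"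
proof -
  let ?s = "sg1 G n v" and ?t = "sg1 G n w"
  note ps = sg1_permutes[OF v] and pt = sg1_permutes[OF w]
  have wi: "fst (w (i, \<one>)) \<in> {1..n}" "snd (w (i, \<one>)) \<in> carrier G" if "i \<in> {1..n}" for i using wp_one(1,2)[OF w that] .
  have vw: "v (w (i, \<one>)) = (?s (?t i), snd (v (?t i, \<one>)) \<otimes> snd (w (i, \<one>)))" if "i \<in> {1..n}" for i
  proof -
    have "v (fst (w (i, \<one>)), snd (w (i, \<one>))) = (fst (v (fst (w (i, \<one>)), \<one>)), snd (v (fst (w (i, \<one>)), \<one>)) \<otimes> snd (w (i, \<one>)))"
      by (rule wp_one(3)[OF v wi[OF that]])
    thus ?thesis using that wi(1)[OF that] by (simp add: sg1_def)
  qed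
  have st: "sg1 G n (v \<circ> w) = ?s \<circ> ?t"
  proof
    fix i
    show "sg1 G n (v \<circ> w) i = (?s \<circ> ?t) i"
    proof (cases "i \<in> {1..n}")
      case True
      thus ?thesis using vw[OF True] by (simp add: sg1_def[of G n "v \<circ> w"])
    next
      case False
      thus ?thesis by (simp add: sg1_def del: atLeastAtMost_iff)
    qed
  qed
  have "perm_factors n (?s \<circ> ?t) (\<lambda>i. snd ((v \<circ> w) (i, \<one>))) l =
     (\<lambda>i\<in>{1..n}. perm_factors n ?s (\<lambda>i. snd (v (i, \<one>))) i \<otimes> perm_factors n ?s (perm_factors n ?t (\<lambda>i. snd (w (i, \<one>)))) i) l" for l
  proof (cases "l \<in> {1..n}")
    case True
    define j i where "j = finv ?s l" and "i = finv ?t j"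
    have j: "j \<in> {1..n}" using finv_perm(3)[OF ps] True by (simp only: j_def)
    have i: "i \<in> {1..n}" using finv_perm(3)[OF pt] j by (simp only: i_def)
    have "finv (?s \<circ> ?t) l = i" using o_inv_distrib[OF permutes_bij[OF ps] permutes_bij[OF pt]] by (simp add: i_def j_def)
    moreover have "?t i = j" unfolding i_def by (rule finv_perm(2)[OF pt])
    ultimately show ?thesis using True j vw[OF i] unfolding perm_factors_def by (simp add: j_def[symmetric] i_def[symmetric] del: atLeastAtMost_iff)
  next
    case False
    thus ?thesis unfolding perm_factors_def by (simp del: atLeastAtMost_iff)
  qed
  thus ?thesis unfolding ios_def wreath_simps st by (simp add: fun_eq_iff del: atLeastAtMost_iff)
qed

lemma ios_id: "ios G n id = \<one>\<^bsub>power_semidirect_sym G n\<^esub>" by (auto simp: ios_def wreath_simps sg1_def perm_factors_def fun_eq_iff restrict_def)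

text \<open>With \<open>D = T\<close> the ideal is zero, so its acyclicity is trivial.\<close>

lemma wreath_algebra:
  fixes n :: nat
  assumes "cring k"
  defines "C \<equiv> carrier (power_semidirect_sym G n)"
  shows "basis_algebra_res k C C (monoid.mult (power_semidirect_sym G n)) (\<lambda>_ _. \<one>\<^bsub>k\<^esub>) \<one>\<^bsub>power_semidirect_sym G n\<^esub> (wp G {1..n}) (ios G n)"
proof -
  interpret k: cring k by fact
  have ex: "\<exists>v\<in>wp G {1..n}. x = ios G n v" if "x \<in> C" for x using that bij_betw_imp_surj_on[OF ios_bij, of n] unfolding C_def by blast
  have in_C: "ios G n v \<in> C" if "v \<in> wp G {1..n}" for v using ios_in[OF that] by (simp add: C_def)
  let ?m = "monoid.mult (power_semidirect_sym G n)"
  have m: "?m (ios G n v) (ios G n w) = ios G n (v \<circ> w)" if "v \<in> wp G {1..n}" "w \<in> wp G {1..n}" for v w using ios_comp[OF that] by simp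
  have ba: "basis_algebra k C C ?m (\<lambda>_ _. \<one>\<^bsub>k\<^esub>) \<one>\<^bsub>power_semidirect_sym G n\<^esub> (wp G {1..n}) (ios G n)"
  proof unfold_locales
    fix x y z assume x: "x \<in> C" "y \<in> C"
    then obtain u v where uv: "u \<in> wp G {1..n}" "v \<in> wp G {1..n}" "x = ios G n u" "y = ios G n v" using ex by blast
    show "?m x y \<in> C" using uv m in_C wp_comp by metis
    thus "?m x y \<in> C \<longleftrightarrow> x \<in> C \<and> y \<in> C" using x by simp
    assume "z \<in> C"
    then obtain w where w: "w \<in> wp G {1..n}" "z = ios G n w" using ex by blast
    show "?m (?m x y) z = ?m x (?m y z)" using uv w by (simp add: m wp_comp comp_assoc)
  next
    fix x assume "x \<in> C"
    then obtain u where u: "u \<in> wp G {1..n}" "x = ios G n u" using ex by blast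
    show "?m \<one>\<^bsub>power_semidirect_sym G n\<^esub> x = x" "?m x \<one>\<^bsub>power_semidirect_sym G n\<^esub> = x"
      using m[OF wp_id u(1)] m[OF u(1) wp_id] u(2) by (simp_all add: ios_id)
  next
    show "\<one>\<^bsub>power_semidirect_sym G n\<^esub> \<in> C" using in_C[OF wp_id] by (simp add: ios_id)
    show "bij_betw (ios G n) (wp G {1..n}) C" unfolding C_def by (rule ios_bij)
  qed (simp_all add: wp_bij wp_comp wp_inv wp_id ios_comp ios_id)
  interpret B: basis_algebra k C C ?m "\<lambda>_ _. \<one>\<^bsub>k\<^esub>" "\<one>\<^bsub>power_semidirect_sym G n\<^esub>" "wp G {1..n}" "ios G n" by (rule ba)
  show ?thesis
  proof
    fix f q assume "f \<in> ech (eta k) ((C - C) \<times> B.Sc q)"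
    hence "f = 0" by (simp add: ech_def fspan_def)
    thus "\<exists>g\<in>ech (eta k) ((C - C) \<times> B.Sc (Suc q)). lin B.dd g = f" by (intro bexI[of _ 0]) simp_all
  qed
qed

end

subsection \<open>Adding a strand\<close>

context rook
begin

context
  fixes m :: nat and x :: "'a diagram"
  assumes x: "x \<in> diagrams G m"
begin

lemma add_in: "add_strand G (Suc m) x \<in> diagrams G (Suc m)"
proof -
  have sub: "fst p \<subseteq> nodes (Suc m)" "Lft (Suc m) \<notin> fst p" "Rgt (Suc m) \<notin> fst p" if "p \<in> x" for p
    using diagramD(1)[OF x that] by (auto simp: nodes_def)
  show ?thesis unfolding diagrams_def
  proof (intro CollectI conjI ballI impI)
    fix p assume p: "p \<in> add_strand G (Suc m) x"
    then consider "p = ({Lft (Suc m), Rgt (Suc m)}, \<one>)" | "p \<in> x" unfolding add_strand_def by blast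
    hence "fst p \<subseteq> nodes (Suc m) \<and> card (fst p) = 2 \<and> snd p \<in> carrier G"
    proof cases
      case 1
      thus ?thesis by (simp add: nodes_def)
    next
      case 2
      thus ?thesis using diagramD(2,3)[OF x 2] sub(1)[OF 2] by blast
    qed
    thus "fst p \<subseteq> nodes (Suc m)" "card (fst p) = 2" "snd p \<in> carrier G" by blast+
    fix p' assume p': "p' \<in> add_strand G (Suc m) x" "p \<noteq> p'"
    show "fst p \<inter> fst p' = {}"
    proof (cases "p \<in> x \<and> p' \<in> x")
      case True
      thus ?thesis using diagramD(4)[OF x, of p p'] p'(2) by blast
    next
      case False
      then consider "p = ({Lft (Suc m), Rgt (Suc m)}, \<one>)" "p' \<in> x" | "p' = ({Lft (Suc m), Rgt (Suc m)}, \<one>)" "p \<in> x"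
        using p p' unfolding add_strand_def by blast
      thus ?thesis using sub by cases auto
    qed
  qed
qed

end

context
  fixes m :: nat and x y :: "'a diagram"
  assumes x: "x \<in> diagrams G m" and y: "y \<in> diagrams G m"
begin

private abbreviation "N \<equiv> Suc m"
private abbreviation "x' \<equiv> add_strand G N x"
private abbreviation "y' \<equiv> add_strand G N y"
private abbreviation "st \<equiv> ({Lft N, Rgt N}, \<one>)"
private abbreviation "C0 \<equiv> {Mid N, Outer (Lft N), Outer (Rgt N)}"

private lemma gnodes_N: "gnodes N = gnodes m \<union> C0" "gnodes m \<inter> C0 = {}" by (auto simp: gnodes_def nodes_def atLeastAtMostSuc_conv)

private lemma TT_N: "TT x' y' = insert (xe st) (insert (ye st) (TT x y))" by (auto simp: TT_def pd_def add_strand_def)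

private lemma st_ends: "ends (xe st) = {Mid N, Outer (Lft N)}" "ends (ye st) = {Mid N, Outer (Rgt N)}" by auto

private lemma cpt_N: "w \<in> gnodes m ==> cpt (TT x' y') w = cpt (TT x y) w"
proof
  assume w: "w \<in> gnodes m"
  show "cpt (TT x y) w \<subseteq> cpt (TT x' y') w" by (rule comp_mono) (auto simp: TT_N)
  show "cpt (TT x' y') w \<subseteq> cpt (TT x y) w"
  proof (rule comp_least)
    fix a b assume a: "a \<in> cpt (TT x y) w" and "(a, b) \<in> adj (TT x' y')"
    then obtain e where e: "e \<in> TT x' y'" "{a, b} = ends e" by (auto simp: adj_def)
    have "a \<notin> C0" using comp_sub[OF TT_gr[OF x y] w] a gnodes_N(2) by blast
    hence "e \<noteq> xe st" "e \<noteq> ye st" using e(2) st_ends by (metis insertCI insertE insert_absorb2 singletonD)+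
    hence "(a, b) \<in> adj (TT x y)" using e unfolding TT_N by (auto simp: adj_def)
    thus "b \<in> cpt (TT x y) w" using comp_step[OF a] by blast
  qed simp
qed

private lemma C0: "cpt (TT x' y') (Mid N) = C0" "comp_label G x' y' C0 = \<one>"
proof -
  let ?F = "{xe st, ye st}"
  have st: "st \<in> x'" "st \<in> y'" unfolding add_strand_def by blast+
  have xN: "q = st" if "q \<in> x'" "Lft N \<in> fst q \<or> Rgt N \<in> fst q" for q using that(2) diagramD(4)[OF add_in[OF x] that(1) st(1)] by auto
  have yN: "q = st" if "q \<in> y'" "Lft N \<in> fst q \<or> Rgt N \<in> fst q" for q using that(2) diagramD(4)[OF add_in[OF y] that(1) st(2)] by auto
  have 1: "C0 \<subseteq> gnodes N" unfolding gnodes_N by blast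
  have 3: "?F \<subseteq> TT x' y'" unfolding TT_N by blast
  have 4: "ends e \<subseteq> C0" if "e \<in> ?F" for e
  proof -
    have "e = xe st \<or> e = ye st" using that by (simp only: insert_iff empty_iff simp_thms)
    thus ?thesis using st_ends by (elim disjE) (simp_all only:, auto)
  qed
  have 5: "C0 \<subseteq> cpt ?F (Mid N)" using cpt_edge[of "xe st" ?F, OF _ st_ends(1) comp_refl] cpt_edge[of "ye st" ?F, OF _ st_ends(2) comp_refl]
    by (simp only: insert_subset insert_iff comp_refl empty_subsetI simp_thms)
  have 6: "xe q \<in> ?F" if q: "q \<in> x'" "u \<in> glue_fst ` fst q" "u \<in> C0" for q u
  proof -
    have "Lft N \<in> fst q \<or> Rgt N \<in> fst q" using q(2,3) by (metis glue_mem(1-3) insertE singletonD)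
    from xN[OF q(1) this] show ?thesis by blast
  qed
  have 7: "ye q \<in> ?F" if q: "q \<in> y'" "u \<in> glue_snd ` fst q" "u \<in> C0" for q u
  proof -
    have "Lft N \<in> fst q \<or> Rgt N \<in> fst q" using q(2,3) by (metis glue_mem(4-6) insertE singletonD)
    from yN[OF q(1) this] show ?thesis by blast
  qed
  note b = block(1,3)[OF add_in[OF x] add_in[OF y] 1 _ 3 4 5 6 7]
  show "cpt (TT x' y') (Mid N) = C0" by (rule b(1)) simp_all
  have "finprod G lab ?F = \<one>" by (rule finprod_one_eqI) auto
  thus "comp_label G x' y' C0 = \<one>" using b(2) by simp
qed

text \<open>The new strands form one additional path from the left to the right column through the
  new middle node. It is not a middle component, and all old components are unchanged.\<close>

private lemma components_N: "components N x' y' = insert C0 (components m x y)"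
proof -
  have 1: "cpt (TT x' y') ` C0 = {C0}"
  proof -
    have "cpt (TT x' y') u = C0" if "u \<in> C0" for u using comp_eq[of u "TT x' y'" "Mid N"] C0(1) that by metis
    thus ?thesis by blast
  qed
  have 2: "cpt (TT x' y') ` gnodes m = cpt (TT x y) ` gnodes m" by (rule image_cong[OF refl cpt_N])
  have "components N x' y' = cpt (TT x' y') ` gnodes m \<union> cpt (TT x' y') ` C0" by (simp only: components_eq comps_eq gnodes_N(1) image_Un)
  thus ?thesis by (simp only: 1 2 components_eq comps_eq Un_insert_right Un_empty_right)
qed

private lemma old_comp:
  assumes C: "C \<in> components m x y" shows "comp_label G x' y' C = comp_label G x y C" "is_loop x' y' C \<longleftrightarrow> is_loop x y C"
proof -
  have C0: "u \<notin> C0" if "u \<in> C" for u using TT_comp_sub[OF x y C] gnodes_N(2) that by blast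
  have "\<not> glue_fst ` {Lft N, Rgt N} \<subseteq> C" "\<not> glue_snd ` {Lft N, Rgt N} \<subseteq> C" using C0 by auto
  hence "{p \<in> x'. glue_fst ` fst p \<subseteq> C} = {p \<in> x. glue_fst ` fst p \<subseteq> C}"
      "{p \<in> y'. glue_snd ` fst p \<subseteq> C} = {p \<in> y. glue_snd ` fst p \<subseteq> C}" unfolding add_strand_def by force+
  thus "comp_label G x' y' C = comp_label G x y C" by (simp add: comp_label_def)
  have "u \<notin> glue_fst ` {Lft N, Rgt N}" "u \<notin> glue_snd ` {Lft N, Rgt N}" if "u \<in> C" for u using C0[OF that] by auto
  thus "is_loop x' y' C \<longleftrightarrow> is_loop x y C" by (simp add: is_loop_def add_strand_def)
qed

lemma add_concat: "add_strand G (Suc m) (cc G m x y) = cc G (Suc m) (add_strand G (Suc m) x) (add_strand G (Suc m) y)"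
proof -
  have e: "{(h C, l C) |C. C \<in> K \<and> P C} = (\<lambda>C. (h C, l C)) ` {C \<in> K. P C}" for h :: "gnode set => node set" and l :: "gnode set => 'a" and K P by auto
  have o: "{v. Outer v \<in> C0} = {Lft N, Rgt N}" by auto
  have "{C \<in> components N x' y'. card {v. Outer v \<in> C} = 2} = insert C0 {C \<in> components m x y. card {v. Outer v \<in> C} = 2}"
  proof -
    have "card {v. Outer v \<in> C0} = 2" unfolding o by simp
    thus ?thesis unfolding components_N by blast
  qed
  hence "cc G N x' y' = insert ({Lft N, Rgt N}, \<one>) ((\<lambda>C. ({v. Outer v \<in> C}, comp_label G x' y' C)) ` {C \<in> components m x y. card {v. Outer v \<in> C} = 2})"
    unfolding concat_diagram_def e using o C0(2) by simp
  also have "(\<lambda>C. ({v. Outer v \<in> C}, comp_label G x' y' C)) ` {C \<in> components m x y. card {v. Outer v \<in> C} = 2} = cc G m x y"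
    unfolding concat_diagram_def e by (rule image_cong[OF refl]) (simp add: old_comp)
  finally show ?thesis by (simp add: add_strand_def)
qed

lemma add_mf: "mf (Suc m) (add_strand G (Suc m) x) (add_strand G (Suc m) y) = mf m x y"
proof -
  have "\<not> C0 \<subseteq> range Mid" by auto
  hence "{C \<in> components N x' y'. C \<subseteq> range Mid} = {C \<in> components m x y. C \<subseteq> range Mid}" unfolding components_N by blast
  thus ?thesis unfolding middle_factor_def
    by (intro k.finprod_cong') (auto simp: old_comp comp_label_eq[OF x y] eps intro!: act_closed glab_closed[OF TT_gr[OF x y]])
qed

end

lemma add_perm:
  assumes x: "x \<in> diagrams G m" shows "add_strand G (Suc m) x \<in> perm_diagrams G (Suc m) \<longleftrightarrow> x \<in> perm_diagrams G m"
proof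
  assume t: "add_strand G (Suc m) x \<in> perm_diagrams G (Suc m)"
  show "x \<in> perm_diagrams G m"
  proof (rule permI_left[OF x])
    fix i assume i: "i \<in> {1..m}"
    hence "Lft i \<in> nodes (Suc m)" by (auto simp: nodes_def)
    then obtain p where p: "p \<in> add_strand G (Suc m) x" "Lft i \<in> fst p" using permD(2)[OF t] by blast
    hence "p \<in> x" using i by (auto simp: add_strand_def)
    thus "\<exists>p\<in>x. Lft i \<in> fst p \<and> \<not> fst p \<subseteq> range Lft" using p permD(3)[OF t p(1)] by blast
  qed
next
  assume t: "x \<in> perm_diagrams G m"
  show "add_strand G (Suc m) x \<in> perm_diagrams G (Suc m)"
  proof (rule permI_left[OF add_in[OF x]])
    fix i assume i: "i \<in> {1..Suc m}"
    show "\<exists>p\<in>add_strand G (Suc m) x. Lft i \<in> fst p \<and> \<not> fst p \<subseteq> range Lft"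
    proof (cases "i = Suc m")
      case True
      thus ?thesis unfolding add_strand_def by (intro bexI[of _ "({Lft (Suc m), Rgt (Suc m)}, \<one>)"]) auto
    next
      case False
      hence "Lft i \<in> nodes m" using i by (auto simp: nodes_def)
      then obtain p where "p \<in> x" "Lft i \<in> fst p" using permD(2)[OF t] by blast
      thus ?thesis using permD(3)[OF t] unfolding add_strand_def by blast
    qed
  qed
qed

text \<open>An element of \<open>wp G {1..m}\<close> is the identity over the new index, so its
  diagram gains precisely the added strand.\<close>

lemma add_iot:
  assumes w: "w \<in> wp G {1..m}" shows "iot G (Suc m) w = add_strand G (Suc m) (iot G m w)"
proof -
  have "{1..Suc m} = insert (Suc m) {1..m}" by auto
  moreover have "w (Suc m, \<one>) = (Suc m, \<one>)" by (rule wp_out[OF w]) simp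
  ultimately show ?thesis unfolding iot_def add_strand_def by simp
qed

end

context rook_units
begin

lemma grb_hom: "basis_algebra_hom k (diagrams G m) (perm_diagrams G m) (cc G m) (mf m) (id_diagram G m) (wp G {1..m}) (iot G m)
    (diagrams G (Suc m)) (perm_diagrams G (Suc m)) (cc G (Suc m)) (mf (Suc m)) (id_diagram G (Suc m)) (wp G {1..Suc m}) (iot G (Suc m))
    (add_strand G (Suc m))"
proof (rule basis_algebra_hom.intro[OF grb_basis_algebra grb_basis_algebra], unfold_locales)
  show "wp G {1..m} \<subseteq> wp G {1..Suc m}" by (rule wp_mono) auto
qed (simp_all add: add_in add_concat add_mf add_perm add_iot)

end

section \<open>The isomorphisms of Tor\<close>

lemma mod_iso_quotients:
  assumes M: "carrier M = \<alpha> ` Z" and N: "carrier N = \<beta> ` Z" and eq: "!!z z'. z \<in> Z ==> z' \<in> Z ==> \<alpha> z = \<alpha> z' \<longleftrightarrow> \<beta> z = \<beta> z'"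
    and f: "!!z. z \<in> Z ==> f (\<alpha> z) = \<beta> z"
    and cl: "!!z z'. z \<in> Z ==> z' \<in> Z ==> z + z' \<in> Z" "!!r z. r \<in> carrier k ==> z \<in> Z ==> sc r z \<in> Z"
    and \<alpha>: "!!z z'. z \<in> Z ==> z' \<in> Z ==> \<alpha> (z + z') = \<alpha> z \<oplus>\<^bsub>M\<^esub> \<alpha> z'" "!!r z. r \<in> carrier k ==> z \<in> Z ==> \<alpha> (sc r z) = r \<odot>\<^bsub>M\<^esub> \<alpha> z"
    and \<beta>: "!!z z'. z \<in> Z ==> z' \<in> Z ==> \<beta> (z + z') = \<beta> z \<oplus>\<^bsub>N\<^esub> \<beta> z'" "!!r z. r \<in> carrier k ==> z \<in> Z ==> \<beta> (sc r z) = r \<odot>\<^bsub>N\<^esub> \<beta> z"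
  shows "f \<in> mod_iso k M N" unfolding mod_iso_def
proof (intro CollectI conjI ballI)
  have "f ` carrier M = carrier N" unfolding M N image_image using f by simp
  moreover have "inj_on f (carrier M)" unfolding M by (intro inj_onI) (auto simp: f eq)
  ultimately show "bij_betw f (carrier M) (carrier N)" by (simp add: bij_betw_def)
  fix x assume "x \<in> carrier M"
  then obtain z where z: "z \<in> Z" "x = \<alpha> z" unfolding M by blast
  show "f (r \<odot>\<^bsub>M\<^esub> x) = r \<odot>\<^bsub>N\<^esub> f x" if r: "r \<in> carrier k" for r
    using f[OF cl(2)[OF r z(1)]] \<alpha>(2)[OF r z(1)] \<beta>(2)[OF r z(1)] f[OF z(1)] z(2) by simp
  fix y assume "y \<in> carrier M"
  then obtain z' where z': "z' \<in> Z" "y = \<alpha> z'" unfolding M by blast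
  show "f (x \<oplus>\<^bsub>M\<^esub> y) = f x \<oplus>\<^bsub>N\<^esub> f y"
    using f[OF cl(1)[OF z(1) z'(1)]] \<alpha>(1)[OF z(1) z'(1)] \<beta>(1)[OF z(1) z'(1)] f[OF z(1)] f[OF z'(1)] z(2) z'(2) by simp
qed

context basis_algebra
begin

lemma BZ_closed: "z \<in> BZ q ==> z' \<in> BZ q ==> z + z' \<in> BZ q" "z \<in> BZ q ==> scale c z \<in> BZ q"
  by (auto simp: BZ_def lin_add lin_scale)

end

text \<open>The two algebras have the same \<open>W\<close>, so both Tor modules are quotients of
  the same bar cycles by the same relation. The isomorphism evaluates on one side at a bar cycle
  chosen to represent the class on the other.\<close>

lemma Tor_iso:
  assumes "basis_algebra_res k D T prd cf e0 W \<iota>" "basis_algebra_res k D' T' prd' cf' e0' W \<iota>'"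
  shows "\<exists>f. f \<in> mod_iso k (Tor k (basis_alg k D prd cf e0) (triv_mod k T) (triv_mod k T) q)
     (Tor k (basis_alg k D' prd' cf' e0') (triv_mod k T') (triv_mod k T') q)"
proof -
  interpret A: basis_algebra_res k D T prd cf e0 W \<iota> by fact
  interpret B: basis_algebra_res k D' T' prd' cf' e0' W \<iota>' by fact
  define f where "f m = B.\<alpha> q (SOME z. z \<in> A.BZ q \<and> A.\<alpha> q z = m)" for m
  have eq: "A.\<alpha> q z = A.\<alpha> q z' \<longleftrightarrow> B.\<alpha> q z = B.\<alpha> q z'" if "z \<in> A.BZ q" "z' \<in> A.BZ q" for z z'
    using A.\<alpha>_eq[OF that] B.\<alpha>_eq[OF that] by simp
  have f: "f (A.\<alpha> q z) = B.\<alpha> q z" if z: "z \<in> A.BZ q" for z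
  proof -
    have "\<exists>y. y \<in> A.BZ q \<and> A.\<alpha> q y = A.\<alpha> q z" using z by blast
    from someI_ex[OF this] show ?thesis unfolding f_def using eq[OF _ z] by blast
  qed
  have "f \<in> mod_iso k (Tor k A.Al A.Nt A.Nt q) (Tor k B.Al B.Nt B.Nt q)"
    by (rule mod_iso_quotients[where \<alpha>="A.\<alpha> q" and \<beta>="B.\<alpha> q" and sc="\<lambda>r. scale (emb k r)", OF A.carrier_Tor B.carrier_Tor eq f])
      (use A.BZ_closed A.\<alpha>_add A.\<alpha>_smult B.\<alpha>_add B.\<alpha>_smult in auto)
  thus ?thesis unfolding A.Al_def B.Al_def A.Nt_def B.Nt_def by blast
qed

context rook_units
begin

lemma GRB_simps: "GRB G k act \<delta> \<epsilon> n = basis_alg k (diagrams G n) (cc G n) (mf n) (id_diagram G n)" "GRB_triv G k n = triv_mod k (perm_diagrams G n)"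
  by (simp_all add: GRB_def GRB_triv_def)

lemma Tor_wreath: "\<exists>f. f \<in> mod_iso k (GRB_Tor G k act \<delta> \<epsilon> n q) (group_homology k (power_semidirect_sym G n) q)"
  unfolding GRB_Tor_def GRB_simps group_homology_def group_alg_def by (rule Tor_iso[OF grb_resolution wreath_algebra[OF k.is_cring]])

text \<open>On bar cycles the induced map is the inclusion for \<open>wp G {1..m}\<close> in
  \<open>wp G {1..Suc m}\<close>, to which \<open>wreath_stability\<close> applies with
  \<open>Suc m\<close> as the removed index.\<close>

lemma Tor_stable:
  assumes q: "2 * q + 2 \<le> Suc m"
  shows "GRB_Tor_incl G k act \<delta> \<epsilon> (Suc m) q \<in> mod_iso k (GRB_Tor G k act \<delta> \<epsilon> m q) (GRB_Tor G k act \<delta> \<epsilon> (Suc m) q)"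
proof -
  interpret A: basis_algebra_res k "diagrams G m" "perm_diagrams G m" "cc G m" "mf m" "id_diagram G m" "wp G {1..m}" "iot G m" by (rule grb_resolution)
  interpret B: basis_algebra_res k "diagrams G (Suc m)" "perm_diagrams G (Suc m)" "cc G (Suc m)" "mf (Suc m)" "id_diagram G (Suc m)" "wp G {1..Suc m}" "iot G (Suc m)"
    by (rule grb_resolution)
  interpret H: basis_algebra_hom k "diagrams G m" "perm_diagrams G m" "cc G m" "mf m" "id_diagram G m" "wp G {1..m}" "iot G m"
    "diagrams G (Suc m)" "perm_diagrams G (Suc m)" "cc G (Suc m)" "mf (Suc m)" "id_diagram G (Suc m)" "wp G {1..Suc m}" "iot G (Suc m)" "add_strand G (Suc m)"
    by (rule grb_hom)
  let ?F = "Tor_map k A.Al B.Al B.Nt B.Nt H.Ph id id q"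
  have W: "words I K 0 = {[]}" for I and K :: "'a set" by (auto simp: words_def)
  have I: "{1..Suc m} - {Suc m} = {1..m}" by auto
  have XA: "XX G ({1..Suc m} - {Suc m}) 0 p = (fspan (A.BX p) :: (_, 'k coef) chain set)" for p unfolding XX_def W I A.BX_def A.LW_def wl_def ..
  have XB: "XX G {1..Suc m} 0 p = (fspan (B.BX p) :: (_, 'k coef) chain set)" for p unfolding XX_def W B.BX_def B.LW_def wl_def ..
  have st: "stab_inj TYPE('k coef) {1..Suc m} (Suc m) q" "stab_surj TYPE('k coef) {1..Suc m} (Suc m) q"
    using wreath_stability[where 'u="'k coef", of "{1..Suc m}" "Suc m" q] q by auto
  have BXs: "f \<in> fspan (A.BX p) ==> f \<in> fspan (B.BX p)" for f :: "(_, 'k coef) chain" and p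
    unfolding A.BX_def B.BX_def by (erule fspan_mono) (use H.LW_sub in blast)
  have BZs: "z \<in> A.BZ q ==> z \<in> B.BZ q" for z unfolding A.BZ_def B.BZ_def ech_def using BXs by blast
  have F: "?F (A.\<alpha> q z) = B.\<alpha> q z" if "z \<in> A.BZ q" for z by (rule H.Tor_map_\<alpha>[OF that])
  have eq: "A.\<alpha> q z = A.\<alpha> q z' \<longleftrightarrow> B.\<alpha> q z = B.\<alpha> q z'" if z: "z \<in> A.BZ q" "z' \<in> A.BZ q" for z z'
  proof
    show "A.\<alpha> q z = A.\<alpha> q z' ==> B.\<alpha> q z = B.\<alpha> q z'" using F[OF z(1)] F[OF z(2)] by simp
    assume "B.\<alpha> q z = B.\<alpha> q z'"
    then obtain y where y: "y \<in> ech (eta k) (B.BX (Suc q))" "z - z' = lin tv y" using B.\<alpha>_eq[OF BZs[OF z(1)] BZs[OF z(2)]] by blast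
    have zz: "z - z' \<in> ech (eta k) (A.BX q)" by (rule A.ech_closed(3)) (use z in \<open>unfold A.BZ_def, blast+\<close>)
    obtain b where b: "b \<in> fspan (A.BX (Suc q))" "z - z' = lin tv b" using st(1) ech_fspan[OF zz] ech_fspan[OF y(1)] y(2) unfolding stab_inj_def XA XB by metis
    \<comment> \<open>Stability gives a filling with coefficients anywhere in \<open>coef\<close>;
      multiplying by the idempotent brings it back to \<open>k\<close>.\<close>
    have "z - z' = lin tv (scale (eta k) b)" using ech_eta[OF zz] b(2) by (simp add: lin_scale)
    thus "A.\<alpha> q z = A.\<alpha> q z'" using A.\<alpha>_eq[OF z] b(1) by blast
  qed
  have "B.\<alpha> q ` B.BZ q = B.\<alpha> q ` A.BZ q"
  proof
    show "B.\<alpha> q ` B.BZ q \<subseteq> B.\<alpha> q ` A.BZ q"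
    proof (rule image_subsetI)
      fix z assume z: "z \<in> B.BZ q"
      hence ze: "z \<in> ech (eta k) (B.BX q)" "lin tv z = 0" unfolding B.BZ_def by blast+
      obtain c b where c: "c \<in> fspan (A.BX q)" "lin tv c = 0" "b \<in> fspan (B.BX (Suc q))" "z = c + lin tv b"
        using st(2) ech_fspan[OF ze(1)] ze(2) unfolding stab_surj_def XA XB by metis
      have ec: "scale (eta k) c \<in> A.BZ q" unfolding A.BZ_def using A.ech_closed(4)[OF c(1)] c(2) by (simp add: lin_scale)
      have "z - scale (eta k) c = lin tv (scale (eta k) b)" using ech_eta[OF ze(1)] c(4) by (metis add_diff_cancel_left' lin_scale scale_distrib(1))
      hence "B.\<alpha> q z = B.\<alpha> q (scale (eta k) c)" using B.\<alpha>_eq[OF z BZs[OF ec]] c(3) by blast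
      thus "B.\<alpha> q z \<in> B.\<alpha> q ` A.BZ q" using ec by blast
    qed
  qed (use BZs in blast)
  hence N: "carrier (Tor k B.Al B.Nt B.Nt q) = B.\<alpha> q ` A.BZ q" using B.carrier_Tor by simp
  have "?F \<in> mod_iso k (Tor k A.Al A.Nt A.Nt q) (Tor k B.Al B.Nt B.Nt q)"
    by (rule mod_iso_quotients[where \<alpha>="A.\<alpha> q" and \<beta>="B.\<alpha> q" and sc="\<lambda>r. scale (emb k r)", OF A.carrier_Tor N eq F])
      (use A.BZ_closed A.\<alpha>_add A.\<alpha>_smult B.\<alpha>_add B.\<alpha>_smult BZs in auto)
  moreover have "A.Al = GRB G k act \<delta> \<epsilon> m" "B.Al = GRB G k act \<delta> \<epsilon> (Suc m)" "A.Nt = GRB_triv G k m" "B.Nt = GRB_triv G k (Suc m)"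
    "H.Ph = GRB_incl G k (Suc m)" by (simp_all add: GRB_simps A.Al_def B.Al_def A.Nt_def B.Nt_def H.Ph_def GRB_incl_def)
  ultimately show ?thesis by (simp only: GRB_Tor_def GRB_Tor_incl_def diff_Suc_1)
qed

end

lemma ring_iso_Units:
  assumes "cring k" "h \<in> ring_iso k k" "x \<in> Units k" shows "h x \<in> Units k"
proof -
  interpret k: cring k by fact
  have h: "h \<in> ring_hom k k" using assms(2) by (simp add: ring_iso_def)
  have x: "x \<in> carrier k" "inv\<^bsub>k\<^esub> x \<in> carrier k" using assms(3) by auto
  have "h x \<otimes>\<^bsub>k\<^esub> h (inv\<^bsub>k\<^esub> x) = \<one>\<^bsub>k\<^esub>"
    using ring_hom_mult[OF h x] ring_hom_one[OF h] k.Units_r_inv[OF assms(3)] by simp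
  thus ?thesis using ring_hom_closed[OF h x(1)] ring_hom_closed[OF h x(2)] k.m_comm unfolding Units_def by fastforce
qed

theorem corollary9p4:
  fixes G :: "('g, 'x) monoid_scheme"
    and k :: "('k, 'y) ring_scheme"
    and act :: "'g \<Rightarrow> 'k \<Rightarrow> 'k"
    and \<delta> \<epsilon> :: 'k
    and n :: nat
  assumes "comm_group G"
    and "comm_G_ring G k act"
    and "\<delta> \<in> Units k"
    and "\<epsilon> \<in> Units k"
  shows "(\<exists>\<Phi>. \<forall>q. \<Phi> q \<in> mod_iso k (GRB_Tor G k act \<delta> \<epsilon> n q)
                              (group_homology k (power_semidirect_sym G n) q)) \<and>
         (\<forall>q. n \<ge> 2 * q + 2 \<longrightarrow>
            GRB_Tor_incl G k act \<delta> \<epsilon> n q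
              \<in> mod_iso k (GRB_Tor G k act \<delta> \<epsilon> (n - 1) q) (GRB_Tor G k act \<delta> \<epsilon> n q))"
proof -
  have k: "cring k" and act: "!!g. g \<in> carrier G ==> act g \<in> ring_iso k k" using assms(2) by (simp_all add: comm_G_ring_def)
  interpret comm_group G by fact
  interpret k: cring k by fact
  \<comment> \<open>The neutral element of \<open>G\<close> acts by a ring automorphism, so
    \<open>act \<one> \<delta>\<close> is a unit because \<delta> is one.\<close>
  interpret rook_units G k act \<delta> \<epsilon> by unfold_locales (use assms ring_iso_Units[OF k act assms(3)] in auto)
  have "GRB_Tor_incl G k act \<delta> \<epsilon> n q \<in> mod_iso k (GRB_Tor G k act \<delta> \<epsilon> (n - 1) q) (GRB_Tor G k act \<delta> \<epsilon> n q)"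
    if "2 * q + 2 \<le> n" for q using Tor_stable[of q "n - 1"] that by simp
  thus ?thesis using Tor_wreath by metis
qed

end
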